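(* For $1\le r\le 2n$, $$\mathbb{P}_r=\sum_{w\in\mathcal{Z}_r}2^{c(w)-1}A_w .$$
   Context: Weyl group. Let $n\ge2$. $\tilde C_n$ is the Coxeter group generated by $s_0,\dots,s_n$ with relations $s_i^2=1$; $s_is_j=s_js_i$ if $|i-j|>1$; $s_is_{i+1}s_i=s_{i+1}s_is_{i+1}$ for $1\le i\le n-2$; $s_0s_1s_0s_1=s_1s_0s_1s_0$; $s_{n-1}s_ns_{n-1}s_n=s_ns_{n-1}s_ns_{n-1}$. $\ell$ is the length function; reduced words are words in $\{0,\dots,n\}$. $\tilde C_n^0$ is the set of minimal length representatives of the cosets $\tilde C_n/C_n$, $C_n=\langle s_1,\dots,s_n\rangle$. Put $\rho_i=s_{i-1}\cdots s_1s_0$ for $1\le i\le n$ and $\rho_i=s_{2n+1-i}s_{2n+2-i}\cdots s_{n-1}s_ns_{n-1}\cdots s_1s_0$ for $n+1\le i\le2n$. $\mathcal{Z}\subset\tilde C_n$ is the set of $w$ having a reduced word that is a (not necessarily contiguous) subword of some cyclic rotation of the word $1\,2\cdots(n-1)\,n\,(n-1)\cdots2\,1\,0$; $\mathcal{Z}_r=\{w\in\mathcal{Z}\mid\ell(w)=r\}$. $\mathrm{Supp}(w)$ is the set of letters in any reduced word of $w$, and $c(w)$ is the number of maximal nonempty intervals of consecutive integers in $\mathrm{Supp}(w)$. NilCoxeter and nilHecke algebras. $\mathbb{A}_0$ is the $\mathbb{Z}$-algebra generated by $A_0,\dots,A_n$ with $A_i^2=0$ and the same braid relations as the $s_i$;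 it has $\mathbb{Z}$-basis $A_w=A_{i_1}\cdots A_{i_l}$ ($w\in\tilde C_n$, $i_1\cdots i_l$ any reduced word). Affine Cartan matrix: $a_{ii}=2$, $a_{i,i+1}=a_{i+1,i}=-1$ for $1\le i\le n-2$, $a_{01}=-1$, $a_{10}=-2$, $a_{n-1,n}=-2$, $a_{n,n-1}=-1$, other entries $0$. $P=\bigoplus_{i=1}^n\mathbb{Z}\omega_i$, with $\langle\alpha_i^\vee,\omega_j\rangle=\delta_{ij}$ for $1\le i,j\le n$ and $\langle\alpha_0^\vee,\lambda\rangle=-\sum_{i=1}^n\langle\alpha_i^\vee,\lambda\rangle$; $\alpha_j\in P$ ($0\le j\le n$) is determined by $\langle\alpha_i^\vee,\alpha_j\rangle=a_{ij}$ for $1\le i\le n$; and $s_i\cdot\lambda=\lambda-\langle\alpha_i^\vee,\lambda\rangle\alpha_i$ for $0\le i\le n$. Let $S=\mathrm{Sym}(P)$. The nilHecke algebra $\mathbb{A}$ is generated by $S$ and $\mathbb{A}_0$ with relations $A_i\lambda=(s_i\cdot\lambda)A_i+\langle\alpha_i^\vee,\lambda\rangle1$ ($\lambda\in P$); it is a free left $S$-module with basis $\{A_w\}$. $\phi_0:S\to\mathbb{Z}$ is evaluation at $0$, and $\phi_0:\mathbb{A}\to\mathbb{A}_0$ is $\phi_0(\sum s_wA_w)=\sum\phi_0(s_w)A_w$. The affine Fomin–Stanley subalgebra is $\mathbb{B}=\{a\in\mathbb{A}_0\mid\phi_0(as)=\phi_0(s)a\text{ for all }s\in S\}$. For $w\in\tilde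 C_n^0$, $\mathbb{P}_w$ is the image of the homology Schubert class $\xi_w\in H_*(\mathrm{Gr}_{Sp_{2n}(\mathbb{C})})$ under the known isomorphism $j_0:H_*(\mathrm{Gr}_{Sp_{2n}(\mathbb{C})})\cong\mathbb{B}$; by a known theorem (Peterson, Lam), $\mathbb{P}_w$ is characterized as the unique element of $\mathbb{B}\cap\bigl(A_w+\sum_{u\in\tilde C_n\setminus\tilde C_n^0}\mathbb{Z}A_u\bigr)$. For $1\le r\le2n$, $\mathbb{P}_r:=\mathbb{P}_{\rho_r}$. *)

theory Defs
  imports
    "HOL-Algebra.QuotRing"
    "HOL-Algebra.Generated_Groups"
    "HOL-Library.Poly_Mapping"
    "HOL-Library.Sublist"
begin

section \<open>The Coxeter group\<close>

text \<open>Words are lists of indices in \<open>{0..n}\<close>. The braid relations, as pairs of words, are shared by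
  the Coxeter group and by the nilCoxeter algebra.\<close>

definition braid_rels :: "nat \<Rightarrow> (nat list \<times> nat list) set" where
  "braid_rels n =
     {([i, j], [j, i]) | i j. i \<le> n \<and> j \<le> n \<and> (i + 1 < j \<or> j + 1 < i)}
   \<union> {([i, i + 1, i], [i + 1, i, i + 1]) | i. 1 \<le> i \<and> i + 2 \<le> n}
   \<union> {([0, 1, 0, 1], [1, 0, 1, 0])}
   \<union> {([n - 1, n, n - 1, n], [n, n - 1, n, n - 1])}"

definition coxeter_rels :: "nat \<Rightarrow> (nat list \<times> nat list) set" where
  "coxeter_rels n = braid_rels n \<union> {([i, i], []) | i. i \<le> n}"

text \<open>The congruence on the free monoid on \<open>{0..n}\<close> generated by the relations. As all the
  generators are involutions, the quotient monoid is the group with this presentation.\<close>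

inductive_set coxeter_cong :: "nat \<Rightarrow> (nat list \<times> nat list) set" for n :: nat where
  refl: "u \<in> lists {0..n} \<Longrightarrow> (u, u) \<in> coxeter_cong n"
| sym: "(u, v) \<in> coxeter_cong n \<Longrightarrow> (v, u) \<in> coxeter_cong n"
| trans: "(u, v) \<in> coxeter_cong n \<Longrightarrow> (v, w) \<in> coxeter_cong n \<Longrightarrow> (u, w) \<in> coxeter_cong n"
| rel: "(u, v) \<in> coxeter_rels n \<Longrightarrow> x \<in> lists {0..n} \<Longrightarrow> y \<in> lists {0..n} \<Longrightarrow>
    (x @ u @ y, x @ v @ y) \<in> coxeter_cong n"

definition word_class :: "nat \<Rightarrow> nat list \<Rightarrow> nat list set" where
  "word_class n u = coxeter_cong n `` {u}"

text \<open>An element of the group is the set of all the words that represent it.\<close>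

definition coxeter_group :: "nat \<Rightarrow> nat list set monoid" where
  "coxeter_group n =
     \<lparr>carrier = lists {0..n} // coxeter_cong n,
      mult = (\<lambda>v w. \<Union>x\<in>v. \<Union>y\<in>w. word_class n (x @ y)),
      one = word_class n []\<rparr>"

definition len :: "nat list set \<Rightarrow> nat" where
  "len w = (LEAST k. \<exists>u\<in>w. length u = k)"

definition reduced_words :: "nat list set \<Rightarrow> nat list set" where
  "reduced_words w = {u \<in> w. length u = len w}"

definition finite_parabolic :: "nat \<Rightarrow> nat list set set" where
  "finite_parabolic n = generate (coxeter_group n) {word_class n [i] | i. 1 \<le> i \<and> i \<le> n}"

definition grassmannian :: "nat \<Rightarrow> nat list set set" where
  "grassmannian n = {w \<in> carrier (coxeter_group n).
     \<forall>v \<in> w <#\<^bsub>coxeter_group n\<^esub> finite_parabolic n. len w \<le> len v}"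

definition rho :: "nat \<Rightarrow> nat \<Rightarrow> nat list set" where
  "rho n i = word_class n
     (if i \<le> n then rev [0..<i] else [2 * n + 1 - i..<n + 1] @ rev [0..<n])"

definition Z_set :: "nat \<Rightarrow> nat list set set" where
  "Z_set n = {w \<in> carrier (coxeter_group n).
     \<exists>u \<in> reduced_words w. \<exists>k. subseq u (rotate k ([1..<n + 1] @ rev [0..<n]))}"

definition Z_len :: "nat \<Rightarrow> nat \<Rightarrow> nat list set set" where
  "Z_len n r = {w \<in> Z_set n. len w = r}"

text \<open>All the reduced words of \<open>w\<close> have the same letters, so that the union is that common set.\<close>

definition Supp :: "nat list set \<Rightarrow> nat set" where
  "Supp w = (\<Union>u\<in>reduced_words w. set u)"

definition intervals_in :: "nat set \<Rightarrow> nat set set" where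
  "intervals_in T = {I. I \<noteq> {} \<and> I \<subseteq> T \<and> (\<exists>a b. I = {a..b})}"

definition num_components :: "nat list set \<Rightarrow> nat" where
  "num_components w =
     card {I \<in> intervals_in (Supp w). \<forall>J \<in> intervals_in (Supp w). I \<subseteq> J \<longrightarrow> J = I}"

section \<open>The weight lattice and its symmetric algebra\<close>

text \<open>Meant for \<open>i, j \<le> n\<close> and \<open>n \<ge> 2\<close> only.\<close>

definition cartan :: "nat \<Rightarrow> nat \<Rightarrow> nat \<Rightarrow> int" where
  "cartan n i j =
     (if i = j then 2
      else if (i, j) = (1, 0) \<or> (i, j) = (n - 1, n) then -2
      else if j = i + 1 \<or> i = j + 1 then -1
      else 0)"

text \<open>A weight is the function of its coordinates in the basis of the fundamental weights.\<close>

definition weights :: "nat \<Rightarrow> (nat \<Rightarrow> int) set" where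
  "weights n = {l. \<forall>i. i \<notin> {1..n} \<longrightarrow> l i = 0}"

definition pairing :: "nat \<Rightarrow> nat \<Rightarrow> (nat \<Rightarrow> int) \<Rightarrow> int" where
  "pairing n i l = (if i = 0 then - (\<Sum>j = 1..n. l j) else l i)"

definition simple_root :: "nat \<Rightarrow> nat \<Rightarrow> (nat \<Rightarrow> int)" where
  "simple_root n j = (\<lambda>i. if i \<in> {1..n} then cartan n i j else 0)"

definition reflect :: "nat \<Rightarrow> nat \<Rightarrow> (nat \<Rightarrow> int) \<Rightarrow> (nat \<Rightarrow> int)" where
  "reflect n i l = (\<lambda>k. l k - pairing n i l * simple_root n i k)"

text \<open>\<open>Sym(P)\<close> is the ring of the polynomials over the integers in the fundamental weights; the
  type has one variable for each natural number, and those in \<open>{1..n}\<close> are used.\<close>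

type_synonym spoly = "(nat \<Rightarrow>\<^sub>0 nat) \<Rightarrow>\<^sub>0 int"

definition sym_alg :: "nat \<Rightarrow> spoly set" where
  "sym_alg n = {p. \<forall>m \<in> Poly_Mapping.keys p. Poly_Mapping.keys m \<subseteq> {1..n}}"

definition linear_poly :: "nat \<Rightarrow> (nat \<Rightarrow> int) \<Rightarrow> spoly" where
  "linear_poly n l = (\<Sum>i = 1..n. Poly_Mapping.single (Poly_Mapping.single i 1) (l i))"

definition eval0 :: "spoly \<Rightarrow> int" where
  "eval0 p = Poly_Mapping.lookup p 0"

section \<open>Free associative rings\<close>

text \<open>The monoid ring of the free monoid of words (written additively, as the monoid rings of the
  library require) is the free associative ring.\<close>

datatype 'g word = Word (letters: "'g list")

instantiation word :: (type) monoid_add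
begin

definition zero_word :: "'a word" where
  "zero_word = Word []"

definition plus_word :: "'a word \<Rightarrow> 'a word \<Rightarrow> 'a word" where
  "plus_word u v = Word (letters u @ letters v)"

instance
  by standard (simp_all add: zero_word_def plus_word_def)

end

definition word_monom :: "'g list \<Rightarrow> 'g word \<Rightarrow>\<^sub>0 int" where
  "word_monom gs = Poly_Mapping.single (Word gs) 1"

definition free_ring :: "'g set \<Rightarrow> ('g word \<Rightarrow>\<^sub>0 int) ring" where
  "free_ring G =
     \<lparr>carrier = {p. \<forall>u \<in> Poly_Mapping.keys p. set (letters u) \<subseteq> G},
      mult = (*), one = 1, zero = 0, add = (+)\<rparr>"

section \<open>The nilCoxeter and nilHecke algebras\<close>

text \<open>The generators \<open>A\<^sub>i\<close>, and a generator for each element of \<open>Sym(P)\<close>.\<close>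

datatype gen = GA nat | GS spoly

definition nilCoxeter_rels :: "nat \<Rightarrow> (gen word \<Rightarrow>\<^sub>0 int) set" where
  "nilCoxeter_rels n =
     {word_monom [GA i, GA i] | i. i \<le> n}
   \<union> {word_monom (map GA u) - word_monom (map GA v) | u v. (u, v) \<in> braid_rels n}"

definition nilCoxeter_free :: "nat \<Rightarrow> (gen word \<Rightarrow>\<^sub>0 int) ring" where
  "nilCoxeter_free n = free_ring {GA i | i. i \<le> n}"

definition nilCoxeter_ideal :: "nat \<Rightarrow> (gen word \<Rightarrow>\<^sub>0 int) set" where
  "nilCoxeter_ideal n = Idl\<^bsub>nilCoxeter_free n\<^esub> (nilCoxeter_rels n)"

definition nilCoxeter :: "nat \<Rightarrow> (gen word \<Rightarrow>\<^sub>0 int) set ring" where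
  "nilCoxeter n = nilCoxeter_free n Quot nilCoxeter_ideal n"

text \<open>The relations among the \<open>A\<^sub>i\<close>, those that make \<open>GS\<close> a ring homomorphism on \<open>Sym(P)\<close>, and the
  commutation relations.\<close>

definition nilHecke_rels :: "nat \<Rightarrow> (gen word \<Rightarrow>\<^sub>0 int) set" where
  "nilHecke_rels n =
     nilCoxeter_rels n
   \<union> {word_monom [GS p] + word_monom [GS q] - word_monom [GS (p + q)] | p q. p \<in> sym_alg n \<and> q \<in> sym_alg n}
   \<union> {word_monom [GS p, GS q] - word_monom [GS (p * q)] | p q. p \<in> sym_alg n \<and> q \<in> sym_alg n}
   \<union> {word_monom [GS 1] - 1}
   \<union> {word_monom [GA i, GS (linear_poly n l)]
        - (word_monom [GS (linear_poly n (reflect n i l)), GA i] + of_int (pairing n i l))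
        | i l. i \<le> n \<and> l \<in> weights n}"

definition nilHecke_free :: "nat \<Rightarrow> (gen word \<Rightarrow>\<^sub>0 int) ring" where
  "nilHecke_free n = free_ring ({GA i | i. i \<le> n} \<union> {GS p | p. p \<in> sym_alg n})"

definition nilHecke_ideal :: "nat \<Rightarrow> (gen word \<Rightarrow>\<^sub>0 int) set" where
  "nilHecke_ideal n = Idl\<^bsub>nilHecke_free n\<^esub> (nilHecke_rels n)"

definition nilHecke :: "nat \<Rightarrow> (gen word \<Rightarrow>\<^sub>0 int) set ring" where
  "nilHecke n = nilHecke_free n Quot nilHecke_ideal n"

definition scalar :: "nat \<Rightarrow> spoly \<Rightarrow> (gen word \<Rightarrow>\<^sub>0 int) set" where
  "scalar n p = nilHecke_ideal n +>\<^bsub>nilHecke_free n\<^esub> word_monom [GS p]"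

text \<open>The canonical map from the nilCoxeter algebra to the nilHecke algebra. An element of the
  source is a coset; its representatives lie in one coset of the larger ideal.\<close>

definition incl :: "nat \<Rightarrow> (gen word \<Rightarrow>\<^sub>0 int) set \<Rightarrow> (gen word \<Rightarrow>\<^sub>0 int) set" where
  "incl n a = (\<Union>x\<in>a. nilHecke_ideal n +>\<^bsub>nilHecke_free n\<^esub> x)"

text \<open>By the braid relations, \<open>A\<^sub>w\<close> does not depend on the reduced word that is chosen.\<close>

definition nilA :: "nat \<Rightarrow> nat list set \<Rightarrow> (gen word \<Rightarrow>\<^sub>0 int) set" where
  "nilA n w = nilCoxeter_ideal n +>\<^bsub>nilCoxeter_free n\<^esub>
     word_monom (map GA (SOME u. u \<in> reduced_words w))"

section \<open>The affine Fomin-Stanley subalgebra\<close>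

text \<open>The coordinates of an element of the nilHecke algebra in its left \<open>Sym(P)\<close>-basis of the \<open>A\<^sub>w\<close>.\<close>

definition coords :: "nat \<Rightarrow> (gen word \<Rightarrow>\<^sub>0 int) set \<Rightarrow> (nat list set \<Rightarrow> spoly)" where
  "coords n x = (THE f. range f \<subseteq> sym_alg n \<and> finite {w. f w \<noteq> 0}
     \<and> {w. f w \<noteq> 0} \<subseteq> carrier (coxeter_group n)
     \<and> x = (\<Oplus>\<^bsub>nilHecke n\<^esub> w \<in> {w. f w \<noteq> 0}. scalar n (f w) \<otimes>\<^bsub>nilHecke n\<^esub> incl n (nilA n w)))"

definition phi0 :: "nat \<Rightarrow> (gen word \<Rightarrow>\<^sub>0 int) set \<Rightarrow> (gen word \<Rightarrow>\<^sub>0 int) set" where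
  "phi0 n x = (\<Oplus>\<^bsub>nilCoxeter n\<^esub> w \<in> {w. coords n x w \<noteq> 0}.
     [eval0 (coords n x w)] \<cdot>\<^bsub>nilCoxeter n\<^esub> nilA n w)"

definition fomin_stanley :: "nat \<Rightarrow> (gen word \<Rightarrow>\<^sub>0 int) set set" where
  "fomin_stanley n = {a \<in> carrier (nilCoxeter n). \<forall>s \<in> sym_alg n.
     phi0 n (incl n a \<otimes>\<^bsub>nilHecke n\<^esub> scalar n s) = [eval0 s] \<cdot>\<^bsub>nilCoxeter n\<^esub> a}"

definition non_grassmannian_span :: "nat \<Rightarrow> (gen word \<Rightarrow>\<^sub>0 int) set set" where
  "non_grassmannian_span n =
     {\<Oplus>\<^bsub>nilCoxeter n\<^esub> u \<in> U. [k u] \<cdot>\<^bsub>nilCoxeter n\<^esub> nilA n u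
       | U (k :: nat list set \<Rightarrow> int). finite U \<and> U \<subseteq> carrier (coxeter_group n) - grassmannian n}"

text \<open>The image of the homology Schubert class of \<open>w\<close>, through its characterization by Peterson and
  Lam.\<close>

definition schubert :: "nat \<Rightarrow> nat list set \<Rightarrow> (gen word \<Rightarrow>\<^sub>0 int) set" where
  "schubert n w = (THE a. a \<in> fomin_stanley n
     \<and> (\<exists>b \<in> non_grassmannian_span n. a = nilA n w \<oplus>\<^bsub>nilCoxeter n\<^esub> b))"

definition schubert_row :: "nat \<Rightarrow> nat \<Rightarrow> (gen word \<Rightarrow>\<^sub>0 int) set" where
  "schubert_row n r = schubert n (rho n r)"

end

theory Submission
  imports Defs
begin

text \<open>The group acts by affine signed permutations of the integers, and the nilHecke algebra acts
  faithfully on the free \<open>Sym(P)\<close>-module over the group, so that \<open>a \<in> \<bbbA>\<^sub>0\<close> belongs to the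
  Fomin-Stanley algebra \<open>\<B>\<close> as soon as \<open>\<phi>\<^sub>0(a \<epsilon>\<^sub>j) = 0\<close> for the coordinates \<open>\<epsilon>\<^sub>1, \<dots>, \<epsilon>\<^sub>n\<close> of the weights.

  Put \<open>L\<^sub>m = (1 + A\<^bsub>m-1\<^esub>) \<cdots> (1 + A\<^sub>1) (1 + 2 A\<^sub>0) (1 + A\<^sub>1) \<cdots> (1 + A\<^bsub>m-1\<^esub>)\<close> and
  \<open>h\<^sub>m = A\<^sub>m \<cdots> A\<^bsub>n-1\<^esub> A\<^sub>n A\<^bsub>n-1\<^esub> \<cdots> A\<^sub>m\<close>. Then \<open>M = L\<^sub>n + \<Sum>\<^sub>m (h\<^sub>m L\<^sub>m + L\<^sub>m h\<^sub>m)\<close> is the sum of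
  \<open>2\<^bsup>c(w)\<^esup> A\<^sub>w\<close> over \<open>w \<in> \<Z>\<close>: the terms of the products are normal forms for the elements of \<open>\<Z>\<close>, and
  a letter that has no neighbour among the smaller letters commutes with them, so that it occurs
  both on the left and on the right. A telescoping sum over \<open>m\<close> shows that \<open>\<phi>\<^sub>0(M \<epsilon>\<^sub>j) = 0\<close>.
  The halves of the homogeneous parts of \<open>M\<close> thus lie in \<open>\<B>\<close>, and all the normal forms of
  length \<open>r\<close> other than \<open>\<rho>\<^sub>r\<close> have a reduced word that ends in a positive letter.

  An element of \<open>\<B>\<close> without Grassmannian terms is zero: among its terms \<open>A\<^bsub>ux\<^esub>\<close> with \<open>u\<close> Grassmannian
  and \<open>x\<close> in \<open>C\<^sub>n\<close>, take those with \<open>u\<close> of maximal length, then the least \<open>j\<close> moved by one of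
  the \<open>x\<close>, and then \<open>x = s\<^sub>i y\<close> with the greatest image of \<open>j\<close>. No other term contributes to the
  coefficient of \<open>A\<^bsub>uy\<^esub>\<close> in \<open>\<phi>\<^sub>0(a \<epsilon>\<^sub>j)\<close>, and the contribution of this one does not vanish.\<close>

section \<open>Evaluation of monoid rings\<close>

text \<open>Group and algebras are given by presentations, while \<open>coords\<close> and
  \<open>schubert\<close> are definite descriptions. Before any coefficient can be read off, the
  permutation action must be shown faithful and the \<open>A_w\<close> must be shown to form a
  basis: the operators on the free module give independence, rewriting with the relations gives
  spanning. Moving \<open>\<epsilon>_j\<close> to the left through a word leaves multiples of
  coordinates, which \<open>\<phi>_0\<close> kills, and words with one letter deleted. Operators of
  the form \<open>\<Sum> \<epsilon>_i X_i\<close> form a right ideal that is not stable under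
  \<open>A_m\<close> on the left, because \<open>A_m \<epsilon>_m\<close> has a new constant term.
  Hence the coefficient of \<open>\<epsilon>_m\<close> in \<open>L_m \<epsilon>_j\<close> has to be
  recorded beside the constant part. The factor 2 at \<open>A_0\<close> is put in by hand for the
  component that contains 0. Any other component gets its factor from its least letter, which can
  stand on either side. The weight of the identity is 1 and cannot be halved, so the division by 2
  waits for the parts of positive degree.\<close>

definition pm_ev :: "('k::monoid_add \<Rightarrow> 'r::ring_1) \<Rightarrow> ('k \<Rightarrow>\<^sub>0 int) \<Rightarrow> 'r" where
  "pm_ev \<phi> p = (\<Sum>k\<in>Poly_Mapping.keys p. of_int (Poly_Mapping.lookup p k) * \<phi> k)"

lemma pm_ev_superset:
  assumes "finite K" "Poly_Mapping.keys p \<subseteq> K"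
  shows "pm_ev \<phi> p = (\<Sum>k\<in>K. of_int (Poly_Mapping.lookup p k) * \<phi> k)"
  unfolding pm_ev_def
  by (rule sum.mono_neutral_left) (use assms in \<open>auto simp: in_keys_iff\<close>)

lemma pm_ev_zero [simp]: "pm_ev \<phi> 0 = 0"
  by (simp add: pm_ev_def)

lemma pm_ev_add: "pm_ev \<phi> (p + q) = pm_ev \<phi> p + pm_ev \<phi> q"
proof -
  let ?K = "Poly_Mapping.keys p \<union> Poly_Mapping.keys q"
  have "pm_ev \<phi> (p + q) = (\<Sum>k\<in>?K. of_int (Poly_Mapping.lookup (p + q) k) * \<phi> k)"
    by (rule pm_ev_superset) (auto dest: set_mp[OF keys_add])
  also have "\<dots> = (\<Sum>k\<in>?K. of_int (Poly_Mapping.lookup p k) * \<phi> k)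
      + (\<Sum>k\<in>?K. of_int (Poly_Mapping.lookup q k) * \<phi> k)"
    by (simp add: lookup_add distrib_right sum.distrib)
  also have "\<dots> = pm_ev \<phi> p + pm_ev \<phi> q"
    by (simp add: pm_ev_superset[of ?K])
  finally show ?thesis .
qed

lemma pm_ev_uminus: "pm_ev \<phi> (- p) = - pm_ev \<phi> p"
  using pm_ev_add[of \<phi> p "- p"] by (simp add: eq_neg_iff_add_eq_0 add.commute)

lemma pm_ev_diff: "pm_ev \<phi> (p - q) = pm_ev \<phi> p - pm_ev \<phi> q"
  using pm_ev_add[of \<phi> p "- q"] by (simp add: pm_ev_uminus)

lemma pm_ev_sum: "pm_ev \<phi> (\<Sum>i\<in>I. f i) = (\<Sum>i\<in>I. pm_ev \<phi> (f i))"
  by (induction I rule: infinite_finite_induct) (auto simp: pm_ev_add)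

lemma pm_ev_single [simp]: "pm_ev \<phi> (Poly_Mapping.single k c) = of_int c * \<phi> k"
  by (cases "c = 0") (auto simp: pm_ev_def)

lemma poly_mapping_decomp:
  fixes p :: "'k \<Rightarrow>\<^sub>0 'b::comm_monoid_add"
  shows "p = (\<Sum>k\<in>Poly_Mapping.keys p. Poly_Mapping.single k (Poly_Mapping.lookup p k))"
proof (rule poly_mapping_eqI)
  fix x
  have "(\<Sum>k\<in>Poly_Mapping.keys p. Poly_Mapping.lookup (Poly_Mapping.single k (Poly_Mapping.lookup p k)) x)
      = (\<Sum>k\<in>Poly_Mapping.keys p. if x = k then Poly_Mapping.lookup p x else 0)"
    by (rule sum.cong) (auto simp: lookup_single when_def)
  then show "Poly_Mapping.lookup p x = Poly_Mapping.lookup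
      (\<Sum>k\<in>Poly_Mapping.keys p. Poly_Mapping.single k (Poly_Mapping.lookup p k)) x"
    by (simp add: lookup_sum in_keys_iff)
qed

lemma poly_mapping_single_induct [case_names zero add single]:
  fixes p :: "'k \<Rightarrow>\<^sub>0 'b::comm_monoid_add"
  assumes "P 0" and "\<And>p q. P p \<Longrightarrow> P q \<Longrightarrow> P (p + q)"
    and "\<And>k c. P (Poly_Mapping.single k c)"
  shows "P p"
proof -
  have "P (\<Sum>k\<in>K. Poly_Mapping.single k (Poly_Mapping.lookup p k))" if "finite K" for K
    using that by (induction K) (auto intro: assms)
  then show ?thesis using poly_mapping_decomp[of p] by (metis finite_keys)
qed

text \<open>Integer scalars are central, so multiplicativity on monomials suffices even when the
  target ring, such as \<open>endo\<close>, is not commutative.\<close>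

lemma pm_ev_mult:
  assumes "\<And>j k. \<phi> (j + k) = \<phi> j * \<phi> k"
  shows "pm_ev \<phi> (p * q) = pm_ev \<phi> p * pm_ev \<phi> q"
proof (induction p rule: poly_mapping_single_induct)
  case (single k c)
  show ?case
  proof (induction q rule: poly_mapping_single_induct)
    case (single j d)
    have "of_int (c * d) * (\<phi> k * \<phi> j) = of_int c * \<phi> k * (of_int d * \<phi> j)"
      by (metis (no_types, lifting) mult.assoc mult_of_int_commute of_int_mult)
    then show ?case by (simp add: mult_single assms)
  qed (simp_all add: pm_ev_add distrib_left)
qed (simp_all add: pm_ev_add distrib_right)

lemma pm_ev_of_int: "\<phi> 0 = 1 \<Longrightarrow> pm_ev \<phi> (of_int c) = of_int c"
  by (simp flip: single_of_int)

section \<open>The polynomial ring\<close>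

definition xvar :: "nat \<Rightarrow> spoly" where
  "xvar j = Poly_Mapping.single (Poly_Mapping.single j 1) 1"

text \<open>Building polynomials one variable at a time gives the induction principle behind the
  identities for \<open>srefl\<close>, \<open>ddiff\<close> and the commutation with
  \<open>A_i\<close>; \<open>polys_in_iff\<close> translates the set into a condition on
  keys.\<close>

inductive_set polys_in :: "nat set \<Rightarrow> spoly set" for V where
  const: "of_int c \<in> polys_in V"
| add: "p \<in> polys_in V \<Longrightarrow> q \<in> polys_in V \<Longrightarrow> p + q \<in> polys_in V"
| var: "p \<in> polys_in V \<Longrightarrow> j \<in> V \<Longrightarrow> xvar j * p \<in> polys_in V"

lemma polys_in_single:
  assumes "Poly_Mapping.keys m \<subseteq> V"
  shows "Poly_Mapping.single m c \<in> polys_in V"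
proof -
  have *: "Poly_Mapping.single (\<Sum>k\<in>K. Poly_Mapping.single k (e k)) c \<in> polys_in V"
    if "finite K" "K \<subseteq> V" for K and e :: "nat \<Rightarrow> nat"
    using that
  proof (induction K)
    case empty
    then show ?case using polys_in.const[of c V] by (simp flip: single_of_int)
  next
    case (insert k K)
    let ?s = "\<Sum>k\<in>K. Poly_Mapping.single k (e k)"
    have "Poly_Mapping.single (Poly_Mapping.single k d + ?s) c \<in> polys_in V" for d :: nat
    proof (induction d)
      case (Suc d)
      have "Poly_Mapping.single (Poly_Mapping.single k (Suc d) + ?s) c
          = xvar k * Poly_Mapping.single (Poly_Mapping.single k d + ?s) c"
        by (simp add: xvar_def mult_single add.assoc[symmetric] flip: single_add)
      then show ?case using Suc insert by (auto intro: polys_in.var)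
    qed (use insert in auto)
    then show ?case using insert by simp
  qed
  show ?thesis
    by (subst poly_mapping_decomp[of m]) (rule *, use assms in auto)
qed

lemma polys_in_iff: "p \<in> polys_in V \<longleftrightarrow> (\<forall>m\<in>Poly_Mapping.keys p. Poly_Mapping.keys m \<subseteq> V)"
proof
  assume "p \<in> polys_in V"
  then show "\<forall>m\<in>Poly_Mapping.keys p. Poly_Mapping.keys m \<subseteq> V"
  proof induction
    case (const c)
    then show ?case by (simp flip: single_of_int)
  next
    case (add p q)
    then show ?case using keys_add[of p q] by blast
  next
    case (var p j)
    show ?case
    proof
      fix m assume "m \<in> Poly_Mapping.keys (xvar j * p)"
      then obtain a b where "m = a + b" "a \<in> Poly_Mapping.keys (xvar j)" "b \<in> Poly_Mapping.keys p"
        using keys_mult[of "xvar j" p] by auto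
      then show "Poly_Mapping.keys m \<subseteq> V"
        using var keys_add[of a b] by (auto simp: xvar_def)
    qed
  qed
next
  assume *: "\<forall>m\<in>Poly_Mapping.keys p. Poly_Mapping.keys m \<subseteq> V"
  have "(\<Sum>m\<in>K. Poly_Mapping.single m (Poly_Mapping.lookup p m)) \<in> polys_in V"
    if "finite K" "K \<subseteq> Poly_Mapping.keys p" for K
    using that
  proof (induction K)
    case empty
    then show ?case using polys_in.const[of 0 V] by simp
  next
    case (insert m K)
    then show ?case using * by (auto intro!: polys_in.add polys_in_single)
  qed
  then show "p \<in> polys_in V" by (subst poly_mapping_decomp[of p]) simp
qed

lemma polys_in_UNIV: "p \<in> polys_in UNIV"
  by (simp add: polys_in_iff)

lemma sym_alg_eq: "sym_alg n = polys_in {1..n}"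
  unfolding sym_alg_def using polys_in_iff[of _ "{1..n}"] by blast

lemma polys_in_mult: "p \<in> polys_in V \<Longrightarrow> q \<in> polys_in V \<Longrightarrow> p * q \<in> polys_in V"
proof (induction p rule: polys_in.induct)
  case (const c)
  then have "\<forall>m\<in>Poly_Mapping.keys q. Poly_Mapping.keys m \<subseteq> V" by (simp add: polys_in_iff)
  moreover have "Poly_Mapping.keys (of_int c * q) \<subseteq> Poly_Mapping.keys q"
    using keys_mult[of "of_int c" q] by (auto simp flip: single_of_int split: if_splits)
  ultimately show ?case by (auto simp: polys_in_iff)
qed (auto simp: distrib_right mult.assoc intro: polys_in.intros)

lemma polys_in_uminus: "p \<in> polys_in V \<Longrightarrow> - p \<in> polys_in V"
  by (simp add: polys_in_iff)

lemma polys_in_diff: "p \<in> polys_in V \<Longrightarrow> q \<in> polys_in V \<Longrightarrow> p - q \<in> polys_in V"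
  using polys_in.add[of p V "- q"] by (simp add: polys_in_uminus)

lemma xvar_in: "j \<in> V \<Longrightarrow> xvar j \<in> polys_in V"
  using polys_in.var[OF polys_in.const[of 1]] by simp

text \<open>Exponents are natural numbers, so a product of monomials is constant only if both
  factors are. The indicator of the monomial 0 is therefore multiplicative, and evaluation at 0
  becomes an instance of \<open>pm_ev\<close>.\<close>

lemma eval0_pm_ev: "eval0 = pm_ev (\<lambda>m. if m = 0 then 1 else 0)"
proof
  fix p :: spoly
  have "pm_ev (\<lambda>m. if m = 0 then 1 else 0) p = (\<Sum>k\<in>Poly_Mapping.keys p. if k = 0 then Poly_Mapping.lookup p k else (0::int))"
    unfolding pm_ev_def by (rule sum.cong) auto
  then show "eval0 p = pm_ev (\<lambda>m. if m = 0 then 1 else 0) p"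
    by (auto simp: eval0_def in_keys_iff)
qed

lemma nat_pm_add_eq_0: "(a + b = (0 :: nat \<Rightarrow>\<^sub>0 nat)) \<longleftrightarrow> a = 0 \<and> b = 0"
  by (auto simp: poly_mapping_eq_iff fun_eq_iff lookup_add)

lemma eval0_mult: "eval0 (p * q) = eval0 p * eval0 q"
  unfolding eval0_pm_ev by (rule pm_ev_mult) (auto simp: nat_pm_add_eq_0)

lemma eval0_add: "eval0 (p + q) = eval0 p + eval0 q"
  by (simp add: eval0_pm_ev pm_ev_add)

lemma eval0_zero [simp]: "eval0 0 = 0" by (simp add: eval0_pm_ev)

lemma eval0_sum: "eval0 (\<Sum>i\<in>I. f i) = (\<Sum>i\<in>I. eval0 (f i))"
  by (simp add: eval0_pm_ev pm_ev_sum)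

lemma eval0_of_int [simp]: "eval0 (of_int c) = c"
  by (simp add: eval0_pm_ev pm_ev_of_int)

lemma eval0_xvar [simp]: "eval0 (xvar j) = 0"
  by (auto simp: eval0_pm_ev xvar_def poly_mapping_eq_iff fun_eq_iff lookup_single when_def)

lemma eval0_uminus: "eval0 (- p) = - eval0 p" by (simp add: eval0_pm_ev pm_ev_uminus)

section \<open>Reflections and divided differences\<close>

definition subst_mon :: "(nat \<Rightarrow> spoly) \<Rightarrow> (nat \<Rightarrow>\<^sub>0 nat) \<Rightarrow> spoly" where
  "subst_mon y m = (\<Prod>j\<in>Poly_Mapping.keys m. y j ^ Poly_Mapping.lookup m j)"

lemma subst_mon_superset:
  "finite K \<Longrightarrow> Poly_Mapping.keys m \<subseteq> K \<Longrightarrow> subst_mon y m = (\<Prod>j\<in>K. y j ^ Poly_Mapping.lookup m j)"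
  unfolding subst_mon_def
  by (rule prod.mono_neutral_left) (auto simp: in_keys_iff)

lemma subst_mon_add: "subst_mon y (a + b) = subst_mon y a * subst_mon y b"
proof -
  let ?K = "Poly_Mapping.keys a \<union> Poly_Mapping.keys b"
  have "subst_mon y (a + b) = (\<Prod>j\<in>?K. y j ^ Poly_Mapping.lookup (a + b) j)"
    by (rule subst_mon_superset) (auto dest: set_mp[OF keys_add])
  also have "\<dots> = (\<Prod>j\<in>?K. y j ^ Poly_Mapping.lookup a j) * (\<Prod>j\<in>?K. y j ^ Poly_Mapping.lookup b j)"
    by (simp add: lookup_add power_add prod.distrib)
  finally show ?thesis by (simp add: subst_mon_superset[of ?K])
qed

definition alpha :: "nat \<Rightarrow> nat \<Rightarrow> spoly" where
  "alpha n i = linear_poly n (simple_root n i)"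

text \<open>The value at the fundamental weight \<open>\<omega>\<^sub>j\<close> of the \<open>i\<close>-th simple coroot.\<close>

definition copair :: "nat \<Rightarrow> nat \<Rightarrow> nat \<Rightarrow> int" where
  "copair n i j = (if j \<in> {1..n} then if i = 0 then - 1 else if i = j then 1 else 0 else 0)"

text \<open>The reflection of the weights, extended to a ring endomorphism of all polynomials of the
  type; the variables outside \<open>{1..n}\<close> stay fixed.\<close>

definition srefl :: "nat \<Rightarrow> nat \<Rightarrow> spoly \<Rightarrow> spoly" where
  "srefl n i = pm_ev (subst_mon (\<lambda>j. xvar j - of_int (copair n i j) * alpha n i))"

lemma srefl_add: "srefl n i (p + q) = srefl n i p + srefl n i q"
  by (simp add: srefl_def pm_ev_add)
lemma srefl_mult: "srefl n i (p * q) = srefl n i p * srefl n i q"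
  unfolding srefl_def by (rule pm_ev_mult) (rule subst_mon_add)
lemma srefl_zero [simp]: "srefl n i 0 = 0" by (simp add: srefl_def)
lemma srefl_of_int [simp]: "srefl n i (of_int c) = of_int c"
  by (simp add: srefl_def pm_ev_of_int subst_mon_def)
lemma srefl_sum: "srefl n i (\<Sum>k\<in>I. f k) = (\<Sum>k\<in>I. srefl n i (f k))"
  by (simp add: srefl_def pm_ev_sum)
lemma srefl_uminus: "srefl n i (- p) = - srefl n i p" by (simp add: srefl_def pm_ev_uminus)
lemma srefl_diff: "srefl n i (p - q) = srefl n i p - srefl n i q" by (simp add: srefl_def pm_ev_diff)
lemma srefl_xvar: "srefl n i (xvar j) = xvar j - of_int (copair n i j) * alpha n i"
  by (simp add: srefl_def xvar_def subst_mon_def)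

lemma linear_poly_eq: "linear_poly n l = (\<Sum>j=1..n. of_int (l j) * xvar j)"
  unfolding linear_poly_def
  by (rule sum.cong) (auto simp: xvar_def mult_single simp flip: single_of_int)

lemma pairing_copair:
  assumes "i \<le> n"
  shows "pairing n i l = (\<Sum>j=1..n. l j * copair n i j)"
proof (cases "i = 0")
  case True
  then show ?thesis by (simp add: pairing_def copair_def sum_negf)
next
  case False
  have "(\<Sum>j=1..n. l j * copair n i j) = (\<Sum>j=1..n. if i = j then l j else 0)"
    by (rule sum.cong) (use False in \<open>auto simp: copair_def\<close>)
  then show ?thesis using False assms by (simp add: pairing_def)
qed

lemma linear_poly_reflect: 
  assumes "i \<le> n"
  shows "linear_poly n (reflect n i l) = srefl n i (linear_poly n l)"
    "srefl n i (linear_poly n l) = linear_poly n l - of_int (pairing n i l) * alpha n i"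
proof -
  show "srefl n i (linear_poly n l) = linear_poly n l - of_int (pairing n i l) * alpha n i"
    by (simp add: linear_poly_eq srefl_sum srefl_mult srefl_xvar right_diff_distrib sum_subtractf
        pairing_copair[OF assms] sum_distrib_right mult.assoc)
  moreover have "linear_poly n (reflect n i l) = linear_poly n l - of_int (pairing n i l) * alpha n i"
    by (simp add: linear_poly_eq reflect_def alpha_def left_diff_distrib sum_subtractf sum_distrib_left mult.assoc)
  ultimately show "linear_poly n (reflect n i l) = srefl n i (linear_poly n l)" by simp
qed

text \<open>Induction through the twisted Leibniz identity
  \<open>x p - s(x) s(p) = x (p - s(p)) + (x - s(x)) s(p)\<close>, where \<open>x - s(x)\<close> is
  an integer multiple of the root for a variable \<open>x\<close>.\<close>

lemma alpha_dvd: "alpha n i dvd p - srefl n i p"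
proof -
  have "p \<in> polys_in UNIV" by (rule polys_in_UNIV)
  then show ?thesis
  proof induction
    case (add p q)
    have "p + q - srefl n i (p + q) = (p - srefl n i p) + (q - srefl n i q)"
      by (simp add: srefl_add)
    then show ?case using add by (metis dvd_add)
  next
    case (var p j)
    have "xvar j * p - srefl n i (xvar j * p) = xvar j * (p - srefl n i p) + (of_int (copair n i j) * srefl n i p) * alpha n i"
      by (simp add: srefl_mult srefl_xvar algebra_simps)
    then show ?case using var by (metis dvd_add dvd_mult dvd_triv_right)
  qed auto
qed

text \<open>The divided difference. The quotient is chosen, and for \<open>i \<le> n\<close> it is
  unique, since the root is a nonzero element of an integral domain
  (\<open>ddiff_unique\<close>).\<close>

definition ddiff :: "nat \<Rightarrow> nat \<Rightarrow> spoly \<Rightarrow> spoly" where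
  "ddiff n i p = (SOME q. alpha n i * q = p - srefl n i p)"

lemma ddiff: "alpha n i * ddiff n i p = p - srefl n i p"
  unfolding ddiff_def using alpha_dvd[of n i p] by (metis (mono_tags, lifting) dvdE someI)

section \<open>The Coxeter group as a group of permutations\<close>

type_synonym state = "int \<times> int"

text \<open>For pairs \<open>(q, r)\<close> with \<open>r\<close> in \<open>{1..2n}\<close> this is
  the order of the integers \<open>2nq + r\<close>.\<close>

definition slt :: "state \<Rightarrow> state \<Rightarrow> bool" (infix "\<prec>" 50) where
  "s \<prec> t \<longleftrightarrow> fst s < fst t \<or> fst s = fst t \<and> snd s < snd t"

lemma slt_linear: "s \<prec> t \<or> s = t \<or> t \<prec> s"
  by (auto simp: slt_def prod_eq_iff)

lemma slt_irrefl [simp]: "\<not> s \<prec> s" by (auto simp: slt_def)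

lemma slt_trans: "s \<prec> t \<Longrightarrow> t \<prec> u \<Longrightarrow> s \<prec> u" by (auto simp: slt_def)

lemma slt_asym: "s \<prec> t \<Longrightarrow> \<not> t \<prec> s" by (auto simp: slt_def)

definition sh :: "int \<Rightarrow> state \<Rightarrow> state" where "sh k s = (fst s + k, snd s)"

locale affine_C =
  fixes n :: nat
  assumes n_ge_2: "2 \<le> n"
begin

text \<open>The state \<open>(q, r)\<close> with \<open>r \<in> {1..2n}\<close> stands for the integer \<open>2nq + r\<close>. A generator \<open>s\<^sub>i\<close>
  exchanges the neighbours \<open>x\<close>, \<open>x + 1\<close> whenever \<open>x\<close> is congruent to \<open>i\<close> or \<open>-i\<close> modulo \<open>2n\<close>.\<close>

definition actr :: "nat \<Rightarrow> int \<Rightarrow> int" where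
  "actr i r = (if i = 0 then if r = 2 * int n then 1 else if r = 1 then 2 * int n else r
     else if r = int i \<or> r = 2 * int n - int i then r + 1
     else if r = int i + 1 \<or> r = 2 * int n - int i + 1 then r - 1 else r)"

definition act :: "nat \<Rightarrow> state \<Rightarrow> state" where
  "act i s = (fst s + (if i = 0 \<and> snd s = 2 * int n then 1 else if i = 0 \<and> snd s = 1 then - 1 else 0),
     actr i (snd s))"

definition valid :: "state \<Rightarrow> bool" where "valid s \<longleftrightarrow> 1 \<le> snd s \<and> snd s \<le> 2 * int n"

text \<open>On the integers this is the point reflection \<open>x \<mapsto> 2n + 1 - x\<close>.
  Together with the translations \<open>sh\<close> by multiples of \<open>2n\<close> it commutes
  with the generators, and this is what singles out affine signed permutations.\<close>

definition rv :: "state \<Rightarrow> state" where "rv s = (- fst s, 2 * int n + 1 - snd s)"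

text \<open>The neighbours \<open>i\<close> and \<open>i + 1\<close>; for \<open>i = 0\<close> they
  are the integers 0 and 1, which lie in different blocks of length \<open>2n\<close>.\<close>

definition xe :: "nat \<Rightarrow> state" where "xe i = (if i = 0 then (- 1, 2 * int n) else (0, int i))"
definition ye :: "nat \<Rightarrow> state" where "ye i = (if i = 0 then (0, 1) else (0, int i + 1))"

lemmas act_defs = act_def actr_def

lemma n_int: "2 \<le> int n" using n_ge_2 by simp

lemma act_act [simp]: "i \<le> n \<Longrightarrow> act i (act i s) = s"
  using n_int by (cases s) (auto simp: act_defs split: if_splits; presburger)

lemma act_act_comp: "i \<le> n \<Longrightarrow> act i \<circ> act i = id"
  by (simp add: fun_eq_iff)

lemma act_valid [simp]: "i \<le> n \<Longrightarrow> valid (act i s) = valid s"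
  using n_int by (cases s) (auto simp: act_defs valid_def split: if_splits)

lemma act_sh: "act i (sh k s) = sh k (act i s)"
  by (auto simp: act_defs sh_def)

lemma act_rv: "i \<le> n \<Longrightarrow> act i (rv s) = rv (act i s)"
  using n_int by (cases s) (auto simp: act_defs rv_def split: if_splits; presburger)

lemma act_xe [simp]: "i \<le> n \<Longrightarrow> act i (xe i) = ye i"
  and act_ye [simp]: "i \<le> n \<Longrightarrow> act i (ye i) = xe i"
  using n_int by (auto simp: act_defs xe_def ye_def split: if_splits; presburger)+

lemma valid_xe [simp]: "i \<le> n \<Longrightarrow> valid (xe i)" and valid_ye [simp]: "i \<le> n \<Longrightarrow> valid (ye i)"
  using n_int by (auto simp: valid_def xe_def ye_def)

lemma xe_slt_ye: "xe i \<prec> ye i" by (auto simp: xe_def ye_def slt_def)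

lemma rv_rv [simp]: "rv (rv s) = s" by (simp add: rv_def)
lemma rv_sh: "rv (sh k s) = sh (- k) (rv s)" by (simp add: rv_def sh_def)
lemma sh_sh: "sh k (sh l s) = sh (k + l) s" by (simp add: sh_def)
lemma sh_0 [simp]: "sh 0 s = s" by (simp add: sh_def)
lemma slt_rv [simp]: "rv s \<prec> rv t \<longleftrightarrow> t \<prec> s" by (auto simp: slt_def rv_def)
lemma slt_sh [simp]: "sh k s \<prec> sh k t \<longleftrightarrow> s \<prec> t" by (auto simp: slt_def sh_def)

text \<open>The neighbouring pairs exchanged by a generator are pairwise disjoint, so the only pairs
  that it can invert are those that it exchanges.\<close>

lemma act_flip:
  assumes "i \<le> n" "valid s" "valid t" "s \<prec> t" "\<not> act i s \<prec> act i t"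
  shows "t = act i s"
proof (cases "i = 0")
  case True
  consider "snd s = 2 * int n" | "snd s = 1" | "snd s \<noteq> 2 * int n" "snd s \<noteq> 1" by blast
  note s = this
  consider "snd t = 2 * int n" | "snd t = 1" | "snd t \<noteq> 2 * int n" "snd t \<noteq> 1" by blast
  note t = this
  show ?thesis
    using assms n_int True
    by (cases rule: s; cases rule: t) (simp_all add: act_defs valid_def slt_def prod_eq_iff; linarith?)+
next
  case False
  define U where "U r \<longleftrightarrow> r = int i \<or> r = 2 * int n - int i" for r
  \<comment> \<open>\<open>U\<close> marks the left ends of the exchanged pairs. Two adjacent left
    ends would make an odd number equal to an even one.\<close>
  have U: "\<not> (U (r + 1) \<and> U r)" for r using False assms(1) unfolding U_def by presburger
  have a: "act i x = (fst x, if U (snd x) then snd x + 1 else if U (snd x - 1) then snd x - 1 else snd x)" for x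
    using False unfolding act_defs U_def by (simp add: prod_eq_iff)
  have f: "fst s = fst t" "snd s < snd t" using assms(4,5) by (auto simp: slt_def a split: if_splits)
  then have g: "\<not> (if U (snd s) then snd s + 1 else if U (snd s - 1) then snd s - 1 else snd s)
      < (if U (snd t) then snd t + 1 else if U (snd t - 1) then snd t - 1 else snd t)"
    using assms(5) by (simp add: slt_def a)
  have *: "U (snd s) \<and> snd t = snd s + 1"
  proof (cases "U (snd s)")
    case True
    then have "snd t \<le> snd s + 2" "snd t \<noteq> snd s + 2"
      using g f U[of "snd s"] by (auto split: if_splits simp: algebra_simps)
    then show ?thesis using f True by simp
  next
    case ns: False
    then have "snd t \<le> snd s + 1" using g f by (auto split: if_splits)
    then have "snd t - 1 = snd s" using f by simp
    then show ?thesis using g f ns by (auto split: if_splits)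
  qed
  then show ?thesis using f by (simp add: a prod_eq_iff)
qed

lemma act_commute: "i \<le> n \<Longrightarrow> j \<le> n \<Longrightarrow> i + 1 < j \<Longrightarrow> act i (act j s) = act j (act i s)"
proof -
  assume ij: "i \<le> n" "j \<le> n" "i + 1 < j"
  consider "snd s = 2 * int n \<and> i = 0" | "snd s = 1 \<and> i = 0"
    | "snd s = int i" | "snd s = int i + 1" | "snd s = 2 * int n - int i" | "snd s = 2 * int n - int i + 1"
    | "snd s = int j" | "snd s = int j + 1" | "snd s = 2 * int n - int j" | "snd s = 2 * int n - int j + 1"
    | "snd s \<notin> {int i, int i + 1, 2 * int n - int i, 2 * int n - int i + 1}"
      "snd s \<notin> {int j, int j + 1, 2 * int n - int j, 2 * int n - int j + 1}" "i = 0 \<longrightarrow> snd s \<notin> {1, 2 * int n}"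
    by blast
  then show ?thesis
    using n_int ij by cases (simp_all add: act_defs)
qed

lemma act_braid3: "1 \<le> i \<Longrightarrow> i + 2 \<le> n \<Longrightarrow> act i (act (i+1) (act i s)) = act (i+1) (act i (act (i+1) s))"
proof -
  assume i: "1 \<le> i" "i + 2 \<le> n"
  consider "snd s = int i" | "snd s = int i + 1" | "snd s = int i + 2" | "snd s = 2 * int n - int i - 1"
    | "snd s = 2 * int n - int i" | "snd s = 2 * int n - int i + 1" 
    | "snd s \<notin> {int i, int i + 1, int i + 2, 2 * int n - int i - 1, 2 * int n - int i, 2 * int n - int i + 1}"
    by blast
  then show ?thesis
    using i by cases (simp_all add: act_defs)
qed

lemma act_braid4: "act 0 (act 1 (act 0 (act 1 s))) = act 1 (act 0 (act 1 (act 0 s)))"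
proof -
  consider "snd s = 1" | "snd s = 2" | "snd s = 2 * int n" | "snd s = 2 * int n - 1"
    | "snd s \<notin> {1, 2, 2 * int n, 2 * int n - 1}"
    by blast
  then show ?thesis
    using n_int by cases (simp_all add: act_defs)
qed

lemma act_braid4': "act (n-1) (act n (act (n-1) (act n s))) = act n (act (n-1) (act n (act (n-1) s)))"
proof -
  have 1: "act n t = (fst t, if snd t = int n then int n + 1 else if snd t = int n + 1 then int n else snd t)" for t
    using n_ge_2 by (simp add: act_defs)
  have 2: "act (n-1) t = (fst t, if snd t = int n - 1 then int n else if snd t = int n + 1 then int n + 2
      else if snd t = int n then int n - 1 else if snd t = int n + 2 then int n + 1 else snd t)" for t
    using n_ge_2 by (simp add: act_defs of_nat_diff)
  consider "snd s = int n - 1" | "snd s = int n" | "snd s = int n + 1" | "snd s = int n + 2"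
    | "snd s \<notin> {int n - 1, int n, int n + 1, int n + 2}"
    by blast
  then show ?thesis
    unfolding 1 2 by cases simp_all
qed

primrec pa :: "nat list \<Rightarrow> state \<Rightarrow> state" where
  "pa [] = id"
| "pa (i # u) = act i \<circ> pa u"

abbreviation Wd :: "nat list set" where "Wd \<equiv> lists {0..n}"

lemma pa_append: "pa (u @ v) = pa u \<circ> pa v"
  by (induction u) auto

lemma pa_rev_l: "u \<in> Wd \<Longrightarrow> pa (rev u) (pa u s) = s"
  by (induction u arbitrary: s) (auto simp: pa_append)

lemma pa_rev_r: "u \<in> Wd \<Longrightarrow> pa u (pa (rev u) s) = s"
proof -
  assume "u \<in> Wd"
  then have "rev u \<in> Wd" by auto
  from pa_rev_l[OF this, of s] show ?thesis by simp
qed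

lemma rev_Wd [simp]: "rev u \<in> Wd \<longleftrightarrow> u \<in> Wd" by auto

lemma pa_inj: "u \<in> Wd \<Longrightarrow> pa u s = pa u t \<longleftrightarrow> s = t"
  by (metis pa_rev_l)

lemma pa_valid [simp]: "u \<in> Wd \<Longrightarrow> valid (pa u s) = valid s"
  by (induction u) auto

lemma pa_sh: "pa u (sh k s) = sh k (pa u s)"
  by (induction u) (auto simp: act_sh)

lemma pa_rv: "u \<in> Wd \<Longrightarrow> pa u (rv s) = rv (pa u s)"
  by (induction u) (auto simp: act_rv)

lemma pa_rev_eq: "u \<in> Wd \<Longrightarrow> v \<in> Wd \<Longrightarrow> pa (rev u) = pa (rev v) \<longleftrightarrow> pa u = pa v"
  by (metis ext pa_rev_l pa_rev_r rev_Wd rev_rev_ident)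

text \<open>Orbits of the symmetries that commute with the group: one value of an element determines
  its values on the whole orbit.\<close>

definition orb :: "state \<Rightarrow> state \<Rightarrow> bool" where
  "orb s t \<longleftrightarrow> (\<exists>q. t = sh q s \<or> t = sh q (rv s))"

lemma orb_sym: "orb s t \<Longrightarrow> orb t s"
  unfolding orb_def by (metis add.right_inverse rv_rv rv_sh sh_0 sh_sh add.left_inverse)

lemma orb_trans: "orb s t \<Longrightarrow> orb t u \<Longrightarrow> orb s u"
  unfolding orb_def by (metis rv_rv rv_sh sh_sh)

lemma act_moved:
  assumes "i \<le> n" "act i s \<noteq> s"
  shows "orb (xe i) s \<or> orb (ye i) s"
proof (cases "i = 0")
  case True
  then consider "snd s = 2 * int n" | "snd s = 1"
    using assms by (auto simp: act_defs prod_eq_iff split: if_splits)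
  then show ?thesis
  proof cases
    case 1
    then have "s = sh (fst s + 1) (xe i)" using True by (simp add: xe_def sh_def prod_eq_iff)
    then show ?thesis by (auto simp: orb_def)
  next
    case 2
    then have "s = sh (fst s) (ye i)" using True by (simp add: ye_def sh_def prod_eq_iff)
    then show ?thesis by (auto simp: orb_def)
  qed
next
  case False
  then consider "snd s = int i" | "snd s = int i + 1" | "snd s = 2 * int n - int i" | "snd s = 2 * int n - int i + 1"
    using assms by (auto simp: act_defs prod_eq_iff split: if_splits)
  then show ?thesis
  proof cases
    case 1
    then have "s = sh (fst s) (xe i)" using False by (simp add: xe_def sh_def prod_eq_iff)
    then show ?thesis by (auto simp: orb_def)
  next
    case 2
    then have "s = sh (fst s) (ye i)" using False by (simp add: ye_def sh_def prod_eq_iff)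
    then show ?thesis by (auto simp: orb_def)
  next
    case 3
    then have "s = sh (fst s) (rv (ye i))" using False by (simp add: ye_def sh_def rv_def prod_eq_iff)
    then show ?thesis by (auto simp: orb_def)
  next
    case 4
    then have "s = sh (fst s) (rv (xe i))" using False by (simp add: xe_def sh_def rv_def prod_eq_iff)
    then show ?thesis by (auto simp: orb_def)
  qed
qed

lemma act_moved_orb:
  assumes "i \<le> n" "act i s \<noteq> s" "act i t \<noteq> t"
  shows "orb s t \<or> orb (act i s) t"
proof -
  have *: "orb (act i a) (act i b)" if "orb a b" for a b
    using that assms(1) by (auto simp: orb_def act_sh act_rv)
  have "orb s t \<or> orb (act i s) t" if "orb (xe i) s \<or> orb (ye i) s" "orb (xe i) t \<or> orb (ye i) t"
    using that *[of "xe i" s] *[of "ye i" s] assms(1) by (auto intro: orb_trans dest: orb_sym)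
  then show ?thesis using assms act_moved by blast
qed

text \<open>The states moved by a generator lie in two orbits that it exchanges
  (\<open>act_moved_orb\<close>). Hence the conjugate of \<open>s_i\<close> by \<open>u\<close>
  equals \<open>s_k\<close> as soon as the two agree at one moved state.\<close>

lemma reflection_unique:
  assumes p: "u \<in> Wd" and i: "i \<le> n" and k: "k \<le> n"
    and s: "act i s \<noteq> s" "pa u (act i s) = act k (pa u s)"
  shows "act k (pa u t) = pa u (act i t)"
proof -
  have Ps: "act k (pa u s) = pa u (act i s)" "act k (pa u (act i s)) = pa u (act i (act i s))"
    using s i k by (simp_all)
  have Prv: "act k (pa u (rv t)) = pa u (act i (rv t))" if "act k (pa u t) = pa u (act i t)" for t
    using that by (simp add: act_rv[OF i] act_rv[OF k] pa_rv[OF p])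
  have Psh: "act k (pa u (sh q t)) = pa u (act i (sh q t))" if "act k (pa u t) = pa u (act i t)" for t q
    using that by (simp add: act_sh pa_sh)
  have P: "act k (pa u t) = pa u (act i t)" if "orb s t \<or> orb (act i s) t" for t
    using that Ps Prv Psh unfolding orb_def by blast
  show ?thesis
  proof (cases "act i t = t")
    case False
    then show ?thesis using P act_moved_orb[OF i s(1)] by blast
  next
    case True
    \<comment> \<open>If a state fixed by \<open>s_i\<close> were sent to one moved by
      \<open>s_k\<close>, it would share an orbit with \<open>s\<close> or with
      \<open>act i s\<close>, and \<open>s_i\<close> moves all of these.\<close>
    have "act k (pa u t) = pa u t"
    proof (rule ccontr)
      assume "act k (pa u t) \<noteq> pa u t"
      moreover have "act k (pa u s) \<noteq> pa u s" using s p pa_inj by metis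
      ultimately have "orb (pa u s) (pa u t) \<or> orb (pa u (act i s)) (pa u t)"
        using act_moved_orb[OF k] s(2) by metis
      moreover have "orb a b" if "orb (pa u a) (pa u b)" for a b
        using that p unfolding orb_def by (metis pa_inj pa_sh pa_rv)
      ultimately have "orb s t \<or> orb (act i s) t" by blast
      then have "act i t \<noteq> t"
        using s(1) i unfolding orb_def by (auto simp: act_sh act_rv; metis act_act rv_rv sh_sh sh_0 add.left_inverse)
      then show False using True by simp
    qed
    then show ?thesis using True by simp
  qed
qed

section \<open>Descents, the exchange condition and reduced words\<close>

definition desc :: "(state \<Rightarrow> state) \<Rightarrow> nat \<Rightarrow> bool" where
  "desc h i \<longleftrightarrow> h (ye i) \<prec> h (xe i)"

text \<open>The word \<open>w\<close> collects the letters of \<open>u\<close> already passed, in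
  reverse order. At the letter that inverts the tracked pair, \<open>act_flip\<close> shows that it
  exchanges this pair, so by \<open>reflection_unique\<close> it equals the reflection
  \<open>w s_i w^-1\<close> and cancels against it.\<close>

lemma exchange_aux:
  assumes "u \<in> Wd" "w \<in> Wd" "i \<le> n" "pa w (xe i) \<prec> pa w (ye i)"
    "pa (rev u) (pa w (ye i)) \<prec> pa (rev u) (pa w (xe i))"
  shows "\<exists>j<length u. pa (w @ [i] @ rev w @ u) = pa (take j u @ drop (Suc j) u)"
  using assms
proof (induction u arbitrary: w rule: list.induct)
  case Nil
  then show ?case using slt_asym by auto
next
  case (Cons k u)
  then have k: "k \<le> n" and u: "u \<in> Wd" by auto
  show ?case
  proof (cases "act k (pa w (xe i)) \<prec> act k (pa w (ye i))")
    case True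
    have "\<exists>j<length u. pa ((k # w) @ [i] @ rev (k # w) @ u) = pa (take j u @ drop (Suc j) u)"
      using Cons.prems True k u by (intro Cons.IH) (auto simp: pa_append)
    then obtain j where j: "j < length u"
      "pa ((k # w) @ [i] @ rev (k # w) @ u) = pa (take j u @ drop (Suc j) u)" by blast
    have "pa (w @ [i] @ rev w @ k # u) = act k \<circ> pa ((k # w) @ [i] @ rev (k # w) @ u)"
      using k by (simp add: pa_append fun_eq_iff)
    also have "\<dots> = pa (take (Suc j) (k # u) @ drop (Suc (Suc j)) (k # u))"
      unfolding j(2) by simp
    finally show ?thesis using j(1) by (metis Suc_less_eq length_Cons)
  next
    case False
    have e: "pa w (act i (xe i)) = act k (pa w (xe i))"
      using act_flip[OF k _ _ Cons.prems(4) False] Cons.prems by simp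
    have "act i (xe i) \<noteq> xe i" using xe_slt_ye[of i] Cons.prems(3) by auto
    then have "act k (pa w t) = pa w (act i t)" for t
      using reflection_unique[OF Cons.prems(2,3) k _ e] by blast
    then have "pa w (act i (pa (rev w) (act k (pa u t)))) = pa u t" for t
      using Cons.prems(2) k by (metis act_act pa_rev_r)
    then have "pa (w @ [i] @ rev w @ k # u) = pa (take 0 (k # u) @ drop (Suc 0) (k # u))"
      by (simp add: pa_append fun_eq_iff)
    then show ?thesis by blast
  qed
qed

lemma exchange:
  assumes "u \<in> Wd" "i \<le> n" "desc (pa (rev u)) i"
  obtains j where "j < length u" "pa (i # u) = pa (take j u @ drop (Suc j) u)"
  using exchange_aux[of u "[]" i] assms xe_slt_ye that by (auto simp: desc_def pa_append)

text \<open>Minimality among the words with the same permutation. That this is minimality in the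
  presented group is known only after \<open>coxeter_cong_iff\<close>.\<close>

definition red :: "nat list \<Rightarrow> bool" where
  "red u \<longleftrightarrow> u \<in> Wd \<and> (\<forall>v\<in>Wd. pa v = pa u \<longrightarrow> length u \<le> length v)"

lemma red_Wd: "red u \<Longrightarrow> u \<in> Wd" by (simp add: red_def)

lemma red_Nil [simp]: "red []" by (simp add: red_def)

lemma red_rev: "red (rev u) \<longleftrightarrow> red u"
proof -
  have "red (rev u)" if "red u" for u
    using that unfolding red_def by (metis length_rev pa_rev_eq rev_Wd rev_rev_ident)
  then show ?thesis by (metis rev_rev_ident)
qed

lemma red_append:
  assumes "red (u @ v)"
  shows "red v"
  unfolding red_def
proof (intro conjI ballI impI)
  show "v \<in> Wd" using assms by (auto simp: red_def)
  fix w assume w: "w \<in> Wd" "pa w = pa v"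
  then have "u @ w \<in> Wd" "pa (u @ w) = pa (u @ v)" using assms by (auto simp: pa_append red_def)
  then have "length (u @ v) \<le> length (u @ w)" using assms unfolding red_def by blast
  then show "length v \<le> length w" by simp
qed

lemma red_append2: "red (u @ v) \<Longrightarrow> red u"
  using red_append[of "rev v" "rev u"] red_rev by (metis rev_append)

lemma red_Cons: "red (i # u) \<Longrightarrow> red u" using red_append[of "[i]"] by simp

lemma red_pa_eq: "red u \<Longrightarrow> v \<in> Wd \<Longrightarrow> pa v = pa u \<Longrightarrow> length v = length u \<Longrightarrow> red v"
  by (auto simp: red_def)

lemma red_length_eq: "red u \<Longrightarrow> red v \<Longrightarrow> pa u = pa v \<Longrightarrow> length u = length v"
  unfolding red_def by (metis le_antisym)

lemma ex_red: "u \<in> Wd \<Longrightarrow> \<exists>v. red v \<and> pa v = pa u"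
  using ex_has_least_nat[of "\<lambda>v. v \<in> Wd \<and> pa v = pa u" u length] unfolding red_def by metis

lemma desc_act: "u \<in> Wd \<Longrightarrow> i \<le> n \<Longrightarrow> desc (pa u \<circ> act i) i \<longleftrightarrow> \<not> desc (pa u) i"
  using slt_linear[of "pa u (xe i)" "pa u (ye i)"] pa_inj[of u "xe i" "ye i"] xe_slt_ye[of i]
  by (auto simp: desc_def dest: slt_asym)

lemma pa_rev_Cons: "pa (rev (i # u)) = pa (rev u) \<circ> act i" by (simp add: pa_append)

text \<open>A left descent of \<open>u\<close> allows a deletion in \<open>u\<close>. Without it, a
  reduced word \<open>v\<close> of \<open>s_i u\<close> has the left descent \<open>i\<close>, so
  that deleting a letter of \<open>v\<close> gives a word for \<open>u\<close>, and \<open>v\<close>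
  is longer than \<open>u\<close>.\<close>

lemma red_Cons_iff:
  assumes "red u" "i \<le> n"
  shows "red (i # u) \<longleftrightarrow> \<not> desc (pa (rev u)) i"
proof
  assume r: "red (i # u)"
  show "\<not> desc (pa (rev u)) i"
  proof
    assume "desc (pa (rev u)) i"
    then obtain j where j: "j < length u" "pa (i # u) = pa (take j u @ drop (Suc j) u)"
      using exchange assms red_Wd by blast
    have "take j u @ drop (Suc j) u \<in> Wd" using red_Wd[OF assms(1)] by (auto dest: in_set_takeD in_set_dropD)
    then show False using r j unfolding red_def by fastforce
  qed
next
  assume d: "\<not> desc (pa (rev u)) i"
  obtain v where v: "red v" "pa v = pa (i # u)" using ex_red[of "i # u"] assms red_Wd by auto
  have "pa (rev v) = pa (rev (i # u))"
    by (rule iffD2[OF pa_rev_eq]) (use v assms red_Wd in auto)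
  then have "desc (pa (rev v)) i"
    using desc_act[of "rev u" i] d assms red_Wd[OF assms(1)] by (simp add: pa_append)
  then obtain j where j: "j < length v" "pa (i # v) = pa (take j v @ drop (Suc j) v)"
    using exchange assms red_Wd v(1) by blast
  have "pa (i # v) = pa u" using v assms(2) by (simp add: fun_eq_iff)
  moreover have "take j v @ drop (Suc j) v \<in> Wd" using red_Wd[OF v(1)] by (auto dest: in_set_takeD in_set_dropD)
  ultimately have "length u \<le> length v - 1" using j assms(1) unfolding red_def by fastforce
  then have "length (i # u) \<le> length v" using j(1) by simp
  moreover have "i # u \<in> Wd" using assms red_Wd by auto
  then have "length v \<le> length (i # u)" using v unfolding red_def by metis
  ultimately show "red (i # u)"
    using red_pa_eq[OF v(1), of "i # u"] v assms red_Wd[OF assms(1)] by auto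
qed

lemma desc_exchange:
  assumes "red u" "i \<le> n" "desc (pa (rev u)) i"
  obtains v where "red (i # v)" "pa (i # v) = pa u" "length u = Suc (length v)"
proof -
  obtain j where j: "j < length u" "pa (i # u) = pa (take j u @ drop (Suc j) u)"
    using exchange assms red_Wd by blast
  define v where "v = take j u @ drop (Suc j) u"
  have "v \<in> Wd" using red_Wd[OF assms(1)] by (auto simp: v_def dest: in_set_takeD in_set_dropD)
  then have v1: "i # v \<in> Wd" using assms(2) by auto
  have "act i (pa v s) = pa u s" for s
    using assms(2) fun_cong[OF j(2), of s] by (simp add: v_def) (metis act_act)
  then have v2: "pa (i # v) = pa u" by (simp add: fun_eq_iff)
  have v3: "length u = Suc (length v)" using j by (simp add: v_def)
  show ?thesis by (rule that[OF red_pa_eq[OF assms(1) v1 v2] v2 v3]) (simp add: v3)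
qed

lemma red_Cons_desc: "red (i # u) \<Longrightarrow> desc (pa (rev (i # u))) i"
  using red_Cons_iff[of u i] desc_act[of "rev u" i] red_Cons[of i u] red_Wd[of "i # u"] by (auto simp: pa_append)

lemma pa_rev_red: "red u \<Longrightarrow> red v \<Longrightarrow> pa u = pa v \<Longrightarrow> pa (rev u) = pa (rev v)"
  using pa_rev_eq red_Wd by blast

section \<open>Braid equivalence and faithfulness of the permutation action\<close>

lemma braid_rels_Wd: "(u, v) \<in> braid_rels n \<Longrightarrow> u \<in> Wd \<and> v \<in> Wd \<and> length u = length v \<and> set u = set v"
  using n_ge_2 by (auto simp: braid_rels_def)

lemma braid_rels_pa: "(u, v) \<in> braid_rels n \<Longrightarrow> pa u = pa v"
  using act_commute act_braid3 act_braid4 act_braid4' by (auto simp: braid_rels_def fun_eq_iff)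

lemma coxeter_rels_pa: "(u, v) \<in> coxeter_rels n \<Longrightarrow> u \<in> Wd \<and> v \<in> Wd \<and> pa u = pa v"
  using braid_rels_pa[of u v] braid_rels_Wd[of u v] by (auto simp: coxeter_rels_def fun_eq_iff)

lemma coxeter_cong_pa: "(u, v) \<in> coxeter_cong n \<Longrightarrow> u \<in> Wd \<and> v \<in> Wd \<and> pa u = pa v"
proof (induction rule: coxeter_cong.induct)
  case (rel u v x y)
  then show ?case using coxeter_rels_pa[of u v] by (auto simp: pa_append)
qed auto

text \<open>Braid moves alone, without cancellation of squares. In this form the equivalence carries
  over to the nilCoxeter algebra, where squares vanish instead.\<close>

inductive beq :: "nat list \<Rightarrow> nat list \<Rightarrow> bool" where
  refl: "u \<in> Wd \<Longrightarrow> beq u u"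
| sym: "beq u v \<Longrightarrow> beq v u"
| trans: "beq u v \<Longrightarrow> beq v w \<Longrightarrow> beq u w"
| rel: "(u, v) \<in> braid_rels n \<Longrightarrow> x \<in> Wd \<Longrightarrow> y \<in> Wd \<Longrightarrow> beq (x @ u @ y) (x @ v @ y)"

lemma beq_coxeter: "beq u v \<Longrightarrow> (u, v) \<in> coxeter_cong n"
  by (induction rule: beq.induct) (auto intro: coxeter_cong.intros simp: coxeter_rels_def)

lemma beq_props: "beq u v \<Longrightarrow> length u = length v \<and> set u = set v"
proof (induction rule: beq.induct)
  case (rel u v x y)
  then show ?case using braid_rels_Wd[of u v] by simp
qed auto

lemma beq_Wd: "beq u v \<Longrightarrow> u \<in> Wd \<and> v \<in> Wd"
  using beq_coxeter coxeter_cong_pa by blast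

lemma beq_append: "beq u v \<Longrightarrow> x \<in> Wd \<Longrightarrow> y \<in> Wd \<Longrightarrow> beq (x @ u @ y) (x @ v @ y)"
proof (induction rule: beq.induct)
  case (refl u)
  then show ?case by (intro beq.refl) auto
next
  case (rel u v x' y')
  then show ?case using beq.rel[of u v "x @ x'" "y' @ y"] by auto
qed (blast intro: beq.intros)+

lemma beq_pa: "beq u v \<Longrightarrow> pa u = pa v"
  using beq_coxeter coxeter_cong_pa by blast

text \<open>With \<open>h\<close> the permutation of the inverse of a word, this says that the
  letters of \<open>p\<close> can be split off on the left, one descent after the other.\<close>

primrec dl :: "(state \<Rightarrow> state) \<Rightarrow> nat list \<Rightarrow> bool" where
  "dl h [] = True"
| "dl h (a # p) = (desc h a \<and> dl (h \<circ> act a) p)"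

lemma dl_exchange:
  assumes "red u" "p \<in> Wd" "dl (pa (rev u)) p"
  shows "\<exists>x. red (p @ x) \<and> pa (p @ x) = pa u"
  using assms
proof (induction p arbitrary: u rule: list.induct)
  case (Cons a p)
  then obtain v where v: "red (a # v)" "pa (a # v) = pa u" 
    using desc_exchange[of u a] by (metis Cons_in_lists_iff atLeastAtMost_iff dl.simps(2))
  have a: "a \<le> n" using Cons by auto
  have "pa (rev u) = pa (rev (a # v))"
    using pa_rev_red v Cons.prems(1) by metis
  then have "pa (rev u) (act a s) = pa (rev v) s" for s
    using a by (simp only: pa_rev_Cons comp_apply act_act)
  then have "pa (rev v) = pa (rev u) \<circ> act a"
    by (simp only: fun_eq_iff comp_apply simp_thms)
  then have "dl (pa (rev v)) p" using Cons.prems(3) by (simp only: dl.simps)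
  then obtain x where x: "red (p @ x)" "pa (p @ x) = pa v"
    using Cons.IH[of v] Cons.prems(2) red_Cons[OF v(1)] by auto
  have "pa (a # p @ x) = pa (a # v)" using x by simp
  moreover have "length (a # p @ x) = length (a # v)" 
    using red_length_eq[OF x(1) red_Cons[OF v(1)] x(2)] by simp
  moreover have "a # p @ x \<in> Wd" using red_Wd[OF x(1)] a by auto
  ultimately have "red (a # p @ x)" "pa (a # p @ x) = pa u"
    using red_pa_eq[OF v(1)] v(2) by metis+
  then show ?case by (metis append_Cons)
qed auto

text \<open>For neighbouring letters the two descents put the three or four consecutive integers
  moved by both generators into decreasing order, so either side of the braid relation splits off.
  In the cases of order 4 one of the inequalities comes from the symmetry \<open>rv\<close>.\<close>

lemma desc_two:
  assumes u: "u \<in> Wd" and ab: "a < b" "b \<le> n" and d: "desc (pa u) a" "desc (pa u) b"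
  shows "\<exists>p q. ((a # p, b # q) \<in> braid_rels n \<or> (b # q, a # p) \<in> braid_rels n)
    \<and> dl (pa u) (a # p) \<and> dl (pa u) (b # q)"
proof -
  let ?h = "pa u"
  consider "a + 1 < b" | "b = a + 1" "1 \<le> a" "a + 2 \<le> n" | "b = 1" "a = 0" | "b = n" "a = n - 1"
    using ab by linarith
  then show ?thesis
  proof cases
    case 1
    have "([a, b], [b, a]) \<in> braid_rels n" using 1 ab by (auto simp: braid_rels_def)
    moreover have "act a (xe b) = xe b" "act a (ye b) = ye b" "act b (xe a) = xe a" "act b (ye a) = ye a"
      using 1 ab n_int by (auto simp: act_defs xe_def ye_def)
    then have "dl ?h [a, b]" "dl ?h [b, a]" using d by (simp_all add: desc_def)
    ultimately show ?thesis by blast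
  next
    case 2
    have r: "([a, b, a], [b, a, b]) \<in> braid_rels n" using 2 by (auto simp: braid_rels_def)
    let ?p1 = "(0, int a) :: state" and ?p2 = "(0, int a + 1) :: state" and ?p3 = "(0, int a + 2) :: state"
    have a: "act a ?p1 = ?p2" "act a ?p2 = ?p1" "act a ?p3 = ?p3"
      "act b ?p1 = ?p1" "act b ?p2 = ?p3" "act b ?p3 = ?p2"
      using 2 by (auto simp: act_defs)
    have e: "xe a = ?p1" "ye a = ?p2" "xe b = ?p2" "ye b = ?p3"
      using 2 by (auto simp: xe_def ye_def)
    have "?h ?p3 \<prec> ?h ?p2" "?h ?p2 \<prec> ?h ?p1" using d by (auto simp: desc_def e)
    moreover have "?h ?p3 \<prec> ?h ?p1" using calculation slt_trans by blast
    ultimately have "dl ?h [a, b, a]" "dl ?h [b, a, b]"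
      by (simp_all add: desc_def e a)
    then show ?thesis using r by blast
  next
    case 3
    have r: "([a, b, a, b], [b, a, b, a]) \<in> braid_rels n" using 3 by (auto simp: braid_rels_def)
    \<comment> \<open>These are the integers -1, 0, 1, 2; up to a translation, \<open>rv\<close>
      exchanges the two outer pairs.\<close>
    let ?p1 = "(- 1, 2 * int n - 1) :: state" and ?p2 = "(- 1, 2 * int n) :: state"
      and ?p3 = "(0, 1) :: state" and ?p4 = "(0, 2) :: state"
    have a: "act a ?p1 = ?p1" "act a ?p2 = ?p3" "act a ?p3 = ?p2" "act a ?p4 = ?p4"
      "act b ?p1 = ?p2" "act b ?p2 = ?p1" "act b ?p3 = ?p4" "act b ?p4 = ?p3"
      using 3 n_int by (auto simp: act_defs)
    have e: "xe a = ?p2" "ye a = ?p3" "xe b = ?p3" "ye b = ?p4"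
      using 3 by (auto simp: xe_def ye_def)
    have "?p1 = sh (- 1) (rv ?p4)" "?p2 = sh (- 1) (rv ?p3)" by (auto simp: sh_def rv_def)
    then have "?h ?p2 \<prec> ?h ?p1 \<longleftrightarrow> ?h ?p4 \<prec> ?h ?p3" using u by (simp add: pa_sh pa_rv)
    then have "?h ?p4 \<prec> ?h ?p3" "?h ?p3 \<prec> ?h ?p2" "?h ?p2 \<prec> ?h ?p1"
      using d by (auto simp: desc_def e)
    moreover have "?h ?p4 \<prec> ?h ?p2" "?h ?p3 \<prec> ?h ?p1" "?h ?p4 \<prec> ?h ?p1"
      using calculation slt_trans by blast+
    ultimately have "dl ?h [a, b, a, b]" "dl ?h [b, a, b, a]"
      by (simp_all add: desc_def e a)
    then show ?thesis using r by blast
  next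
    case 4
    have r: "([a, b, a, b], [b, a, b, a]) \<in> braid_rels n" using 4 by (auto simp: braid_rels_def)
    let ?p1 = "(0, int n - 1) :: state" and ?p2 = "(0, int n) :: state"
      and ?p3 = "(0, int n + 1) :: state" and ?p4 = "(0, int n + 2) :: state"
    have a: "act a ?p1 = ?p2" "act a ?p2 = ?p1" "act a ?p3 = ?p4" "act a ?p4 = ?p3"
      "act b ?p1 = ?p1" "act b ?p2 = ?p3" "act b ?p3 = ?p2" "act b ?p4 = ?p4"
      using 4 n_ge_2 by (auto simp: act_defs of_nat_diff)
    have e: "xe a = ?p1" "ye a = ?p2" "xe b = ?p2" "ye b = ?p3"
      using 4 n_ge_2 by (auto simp: xe_def ye_def of_nat_diff)
    have "?p4 = rv ?p1" "?p3 = rv ?p2" by (auto simp: rv_def)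
    then have "?h ?p4 \<prec> ?h ?p3 \<longleftrightarrow> ?h ?p2 \<prec> ?h ?p1" using u by (simp add: pa_rv)
    then have "?h ?p4 \<prec> ?h ?p3" "?h ?p3 \<prec> ?h ?p2" "?h ?p2 \<prec> ?h ?p1"
      using d by (auto simp: desc_def e)
    moreover have "?h ?p4 \<prec> ?h ?p2" "?h ?p3 \<prec> ?h ?p1" "?h ?p4 \<prec> ?h ?p1"
      using calculation slt_trans by blast+
    ultimately have "dl ?h [a, b, a, b]" "dl ?h [b, a, b, a]"
      by (simp_all add: desc_def e a)
    then show ?thesis using r by blast
  qed
qed

lemma braid_exchange:
  assumes "red u" "a \<noteq> b" "a \<le> n" "b \<le> n" "desc (pa (rev u)) a" "desc (pa (rev u)) b"
  obtains p q x where "beq (a # p) (b # q)" "red (a # p @ x)" "pa (a # p @ x) = pa u"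
proof -
  have ru: "rev u \<in> Wd" using red_Wd[OF assms(1)] by auto
  have "\<exists>p q. ((a # p, b # q) \<in> braid_rels n \<or> (b # q, a # p) \<in> braid_rels n) \<and> dl (pa (rev u)) (a # p)"
    using desc_two[OF ru, of a b] desc_two[OF ru, of b a] assms by (meson linorder_neqE_nat)
  then obtain p q where pq: "(a # p, b # q) \<in> braid_rels n \<or> (b # q, a # p) \<in> braid_rels n"
    "dl (pa (rev u)) (a # p)" by blast
  have "beq (a # p) (b # q)"
    using pq(1) beq.rel[of "a # p" "b # q" "[]" "[]"] beq.rel[of "b # q" "a # p" "[]" "[]"] beq.sym by auto
  moreover have "a # p \<in> Wd" using calculation beq_Wd by blast
  ultimately show ?thesis using that dl_exchange[OF assms(1) _ pq(2)] by auto
qed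

text \<open>Matsumoto's theorem.\<close>

theorem red_beq: "red u \<Longrightarrow> red v \<Longrightarrow> pa u = pa v \<Longrightarrow> beq u v"
proof (induction "length u" arbitrary: u v rule: less_induct)
  case less
  have cons: "beq (c # s) (c # t)"
    if "red (c # s)" "red (c # t)" "pa (c # s) = pa (c # t)" "length (c # s) = length u" for c s t
  proof -
    have c: "c \<le> n" using red_Wd[OF that(1)] by auto
    have "pa s = pa t" using that(3) c by (auto simp: fun_eq_iff) (metis act_act)
    then have "beq s t" using less.hyps[of s t] that red_Cons by auto
    then show ?thesis using beq_append[of s t "[c]" "[]"] c by auto
  qed
  have len: "length v = length u" using red_length_eq less.prems by metis
  show ?case
  proof (cases u)
    case Nil
    then show ?thesis using len beq.refl[of "[]"] by simp
  next
    case u: (Cons a s)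
    then obtain b t where v: "v = b # t" using len by (cases v) auto
    have ab: "a \<le> n" "b \<le> n" using red_Wd[OF less.prems(1)] red_Wd[OF less.prems(2)] u v by auto
    show ?thesis
    proof (cases "a = b")
      case True
      then show ?thesis using cons less.prems u v by metis
    next
      case False
      have "pa (rev u) = pa (rev v)" 
        using pa_rev_red less.prems by blast
      then have "desc (pa (rev u)) a" "desc (pa (rev u)) b"
        using red_Cons_desc less.prems u v by metis+
      \<comment> \<open>The two words are linked through words for the same element that begin with
        the two sides of the braid relation of \<open>a\<close> and \<open>b\<close>. Each link
        joins words with the same first letter, whose shorter tails fall under the induction
        hypothesis.\<close>
      then obtain p q x where x: "beq (a # p) (b # q)" "red (a # p @ x)" "pa (a # p @ x) = pa u"
        using braid_exchange[OF less.prems(1) False ab] by metis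
      have xW: "x \<in> Wd" using red_Wd[OF x(2)] by auto
      have e: "beq (a # p @ x) (b # q @ x)" using beq_append[OF x(1), of "[]" x] xW by simp
      have l: "length (a # p @ x) = length u" using red_length_eq x less.prems by metis
      have "red (b # q @ x)"
        using red_pa_eq[OF x(2), of "b # q @ x"] beq_pa[OF e] beq_Wd[OF e] beq_props[OF e] by metis
      then have "beq (b # q @ x) v"
        using cons[of b "q @ x" t] less.prems v beq_pa[OF e] x(3) beq_props[OF e] l by simp
      moreover have "beq u (a # p @ x)"
        using cons[of a s "p @ x"] x less.prems u by simp
      ultimately show ?thesis using e beq.trans by blast
    qed
  qed
qed

text \<open>If \<open>i\<close> is a left descent of the reduced word found so far, Matsumoto's
  theorem brings \<open>i\<close> to its front inside the congruence, and the square
  cancels.\<close>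

lemma ex_red_cong: "u \<in> Wd \<Longrightarrow> \<exists>v. red v \<and> (u, v) \<in> coxeter_cong n"
proof (induction u rule: list.induct)
  case Nil
  show ?case by (intro exI[of _ "[]"] conjI red_Nil coxeter_cong.refl) simp
next
  case (Cons i u)
  then obtain v where v: "red v" "(u, v) \<in> coxeter_cong n" by auto
  have i: "i \<le> n" using Cons by auto
  have cg: "(i # s, i # t) \<in> coxeter_cong n" if "(s, t) \<in> coxeter_cong n" for s t
    using that
  proof induction
    case (rel u v x y)
    then show ?case using coxeter_cong.rel[of u v n "i # x" y] i by auto
  next
    case (refl u)
    then show ?case using i by (intro coxeter_cong.refl) auto
  qed (blast intro: coxeter_cong.intros)+
  show ?case
  proof (cases "desc (pa (rev v)) i")
    case False
    then have "red (i # v)" using red_Cons_iff v i by blast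
    then show ?thesis using cg v by blast
  next
    case True
    then obtain w where w: "red (i # w)" "pa (i # w) = pa v" using desc_exchange[OF v(1) i] by metis
    then have "(v, i # w) \<in> coxeter_cong n"
      using red_beq[OF v(1) w(1)] beq_coxeter by simp
    then have 1: "(i # u, i # i # w) \<in> coxeter_cong n"
      by (rule cg[OF coxeter_cong.trans[OF v(2)]])
    have 2: "(i # i # w, w) \<in> coxeter_cong n"
      using coxeter_cong.rel[of "[i, i]" "[]" n "[]" w] i red_Wd[OF w(1)] by (auto simp: coxeter_rels_def)
    show ?thesis using red_Cons[OF w(1)] coxeter_cong.trans[OF 1 2] by blast
  qed
qed

text \<open>Reduced words with the same permutation are braid equivalent, and every word is
  congruent to a reduced one. From here on \<open>pa\<close> decides equality in the presented
  group.\<close>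

theorem coxeter_cong_iff: "(u, v) \<in> coxeter_cong n \<longleftrightarrow> u \<in> Wd \<and> v \<in> Wd \<and> pa u = pa v"
proof
  assume *: "u \<in> Wd \<and> v \<in> Wd \<and> pa u = pa v"
  then obtain u' v' where r: "red u'" "(u, u') \<in> coxeter_cong n" "red v'" "(v, v') \<in> coxeter_cong n"
    using ex_red_cong by meson
  have "pa u' = pa v'" using coxeter_cong_pa[OF r(2)] coxeter_cong_pa[OF r(4)] * by simp
  then have "(u', v') \<in> coxeter_cong n" using r beq_coxeter red_beq by blast
  then show "(u, v) \<in> coxeter_cong n"
    using coxeter_cong.trans[OF r(2)] coxeter_cong.trans[OF _ coxeter_cong.sym[OF r(4)]] by blast
qed (rule coxeter_cong_pa)

section \<open>Lengths, supports and cosets in the presented group\<close>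

abbreviation cls :: "nat list \<Rightarrow> nat list set" where "cls \<equiv> word_class n"
abbreviation CG :: "nat list set monoid" where "CG \<equiv> coxeter_group n"

lemma cls_eq: "u \<in> Wd \<Longrightarrow> cls u = {v \<in> Wd. pa v = pa u}"
  by (auto simp: word_class_def coxeter_cong_iff)

lemma cls_inject: "u \<in> Wd \<Longrightarrow> v \<in> Wd \<Longrightarrow> cls u = cls v \<longleftrightarrow> pa u = pa v"
  using cls_eq by auto

lemma carrier_CG: "carrier CG = cls ` Wd"
  by (auto simp: coxeter_group_def quotient_def word_class_def)

lemma ex_red_cls: "w \<in> carrier CG \<Longrightarrow> \<exists>u. red u \<and> w = cls u"
proof -
  assume "w \<in> carrier CG"
  then obtain u where u: "u \<in> Wd" "w = cls u" unfolding carrier_CG by blast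
  obtain v where v: "red v" "pa v = pa u" using ex_red[OF u(1)] by blast
  then have "w = cls v" using cls_inject[OF red_Wd[OF v(1)] u(1)] u(2) by simp
  then show ?thesis using v(1) by blast
qed

lemma mult_CG: "u \<in> Wd \<Longrightarrow> v \<in> Wd \<Longrightarrow> cls u \<otimes>\<^bsub>CG\<^esub> cls v = cls (u @ v)"
proof -
  assume uv: "u \<in> Wd" "v \<in> Wd"
  have *: "cls (x @ y) = cls (u @ v)" if "x \<in> cls u" "y \<in> cls v" for x y
    using that uv cls_eq cls_inject[of "x @ y" "u @ v"] by (auto simp: pa_append)
  have ne: "cls u \<noteq> {}" "cls v \<noteq> {}" using uv cls_eq by auto
  have "(\<Union>x\<in>cls u. \<Union>y\<in>cls v. cls (x @ y)) = (\<Union>x\<in>cls u. \<Union>y\<in>cls v. cls (u @ v))"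
    by (intro SUP_cong HOL.refl *)
  also have "\<dots> = cls (u @ v)" using ne by simp
  finally show ?thesis by (simp add: coxeter_group_def)
qed

lemma one_CG: "\<one>\<^bsub>CG\<^esub> = cls []" by (simp add: coxeter_group_def)

lemma carrier_E: "x \<in> carrier CG \<Longrightarrow> (\<And>u. u \<in> Wd \<Longrightarrow> x = cls u \<Longrightarrow> P) \<Longrightarrow> P"
  unfolding carrier_CG by blast

lemma cls_carrier: "u \<in> Wd \<Longrightarrow> cls u \<in> carrier CG"
  unfolding carrier_CG by blast

lemma group_CG: "group CG"
proof (rule groupI)
  show "\<one>\<^bsub>CG\<^esub> \<in> carrier CG" unfolding one_CG by (rule cls_carrier) simp
  fix x assume "x \<in> carrier CG"
  then obtain u where u: "u \<in> Wd" "x = cls u" by (rule carrier_E)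
  show "\<one>\<^bsub>CG\<^esub> \<otimes>\<^bsub>CG\<^esub> x = x"
    unfolding u(2) one_CG by (subst mult_CG) (use u in simp_all)
  have r: "rev u \<in> Wd" using u by auto
  have "cls (rev u @ u) = cls []"
    by (rule iffD2[OF cls_inject]) (use u in \<open>auto simp: pa_append fun_eq_iff pa_rev_l\<close>)
  then have "cls (rev u) \<otimes>\<^bsub>CG\<^esub> x = \<one>\<^bsub>CG\<^esub>" unfolding u(2) one_CG by (subst mult_CG[OF r u(1)])
  then show "\<exists>y\<in>carrier CG. y \<otimes>\<^bsub>CG\<^esub> x = \<one>\<^bsub>CG\<^esub>" using cls_carrier[OF r] by blast
  fix y assume "y \<in> carrier CG"
  then obtain v where v: "v \<in> Wd" "y = cls v" by (rule carrier_E)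
  have uv: "u @ v \<in> Wd" using u v by auto
  then show "x \<otimes>\<^bsub>CG\<^esub> y \<in> carrier CG"
    unfolding u(2) v(2) mult_CG[OF u(1) v(1)] by (rule cls_carrier)
  fix z assume "z \<in> carrier CG"
  then obtain w where w: "w \<in> Wd" "z = cls w" by (rule carrier_E)
  have vw: "v @ w \<in> Wd" using w v by auto
  show "x \<otimes>\<^bsub>CG\<^esub> y \<otimes>\<^bsub>CG\<^esub> z = x \<otimes>\<^bsub>CG\<^esub> (y \<otimes>\<^bsub>CG\<^esub> z)"
    unfolding u(2) v(2) w(2) mult_CG[OF u(1) v(1)] mult_CG[OF v(1) w(1)] mult_CG[OF uv w(1)] mult_CG[OF u(1) vw]
    by simp
qed

lemma in_cls: "u \<in> Wd \<Longrightarrow> v \<in> cls u \<longleftrightarrow> v \<in> Wd \<and> pa v = pa u"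
  unfolding cls_eq by blast

lemma len_cls:
  assumes "red u"
  shows "len (cls u) = length u"
  unfolding len_def
proof (rule Least_equality)
  show "\<exists>v\<in>cls u. length v = length u" using in_cls[OF red_Wd[OF assms]] red_Wd[OF assms] by blast
  fix k assume "\<exists>v\<in>cls u. length v = k"
  then obtain v where "v \<in> Wd" "pa v = pa u" "length v = k" using in_cls[OF red_Wd[OF assms]] by blast
  then show "length u \<le> k" using assms unfolding red_def by blast
qed

lemma reduced_words_cls:
  assumes "red u"
  shows "reduced_words (cls u) = {v. red v \<and> pa v = pa u}"
proof -
  have "v \<in> reduced_words (cls u) \<longleftrightarrow> red v \<and> pa v = pa u" for v
    unfolding reduced_words_def mem_Collect_eq len_cls[OF assms] in_cls[OF red_Wd[OF assms]]
    using red_pa_eq[OF assms] red_length_eq[OF _ assms] red_Wd by metis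
  then show ?thesis by blast
qed

text \<open>All reduced words are braid equivalent, and both sides of a braid relation have the same
  letters.\<close>

lemma Supp_cls:
  assumes "red u"
  shows "Supp (cls u) = set u"
proof -
  have "set v = set u" if "red v" "pa v = pa u" for v
    using beq_props[OF red_beq[OF that(1) assms that(2)]] by blast
  then show ?thesis unfolding Supp_def reduced_words_cls[OF assms] using assms by blast
qed

lemma finite_parabolic_cls: "w \<in> finite_parabolic n \<longleftrightarrow> (\<exists>x \<in> lists {1..n}. w = cls x)"
proof
  assume "w \<in> finite_parabolic n"
  then show "\<exists>x \<in> lists {1..n}. w = cls x"
    unfolding finite_parabolic_def
  proof induction
    case one
    then show ?case using one_CG by (intro bexI[of _ "[]"]) auto
  next
    case (incl h)
    then obtain i where "h = cls [i]" "i \<in> {1..n}" by auto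
    then show ?case by (intro bexI[of _ "[i]"]) auto
  next
    case (inv h)
    then obtain i where i: "h = cls [i]" "i \<in> {1..n}" by auto
    have "cls ([i] @ [i]) = cls []" using i by (intro iffD2[OF cls_inject]) (auto simp: fun_eq_iff)
    then have "inv\<^bsub>CG\<^esub> h = cls [i]"
      unfolding i(1) using i(2)
      by (intro group.inv_equality[OF group_CG]) (auto simp: mult_CG one_CG intro!: cls_carrier)
    then show ?case using i by (intro bexI[of _ "[i]"]) auto
  next
    case (eng h1 h2)
    then obtain x y where xy: "x \<in> lists {1..n}" "h1 = cls x" "y \<in> lists {1..n}" "h2 = cls y" by blast
    then have "x \<in> Wd" "y \<in> Wd" by auto
    then show ?case using xy by (intro bexI[of _ "x @ y"]) (auto simp: mult_CG)
  qed
next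
  assume "\<exists>x \<in> lists {1..n}. w = cls x"
  then obtain x where x: "x \<in> lists {1..n}" "w = cls x" by blast
  have "cls x \<in> generate CG {cls [i] | i. 1 \<le> i \<and> i \<le> n}"
    using x(1)
  proof (induction x rule: list.induct)
    case Nil
    then show ?case using generate.one[of CG] by (simp add: one_CG)
  next
    case (Cons i x)
    have "cls [i] \<otimes>\<^bsub>CG\<^esub> cls x \<in> generate CG {cls [i] | i. 1 \<le> i \<and> i \<le> n}"
      by (rule generate.eng) (use Cons in \<open>auto intro!: generate.incl\<close>)
    moreover have "x \<in> Wd" "[i] \<in> Wd" using Cons by auto
    ultimately show ?case using mult_CG by simp
  qed
  then show "w \<in> finite_parabolic n" using x by (simp add: finite_parabolic_def)
qed

lemma grassmannian_cls:
  assumes "u \<in> Wd"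
  shows "cls u \<in> grassmannian n \<longleftrightarrow> (\<forall>x\<in>lists {1..n}. len (cls u) \<le> len (cls (u @ x)))"
proof -
  have W: "x \<in> Wd" if "x \<in> lists {1..n}" for x using that by auto
  have *: "v \<in> cls u <#\<^bsub>CG\<^esub> finite_parabolic n \<longleftrightarrow> (\<exists>x\<in>lists {1..n}. v = cls (u @ x))" for v
  proof -
    have "v \<in> cls u <#\<^bsub>CG\<^esub> finite_parabolic n \<longleftrightarrow> (\<exists>h\<in>finite_parabolic n. v = cls u \<otimes>\<^bsub>CG\<^esub> h)"
      unfolding l_coset_def by blast
    also have "\<dots> \<longleftrightarrow> (\<exists>x\<in>lists {1..n}. v = cls u \<otimes>\<^bsub>CG\<^esub> cls x)"
      unfolding Bex_def finite_parabolic_cls by metis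
    also have "\<dots> \<longleftrightarrow> (\<exists>x\<in>lists {1..n}. v = cls (u @ x))"
      by (rule bex_cong[OF HOL.refl]) (simp only: mult_CG[OF assms W])
    finally show ?thesis .
  qed
  have "cls u \<in> grassmannian n \<longleftrightarrow> (\<forall>v. v \<in> cls u <#\<^bsub>CG\<^esub> finite_parabolic n \<longrightarrow> len (cls u) \<le> len v)"
    unfolding grassmannian_def using cls_carrier[OF assms] by (simp add: Ball_def)
  then show ?thesis unfolding * by metis
qed

lemma not_grassmannian:
  assumes "red (u @ [i])" "1 \<le> i"
  shows "cls (u @ [i]) \<notin> grassmannian n"
proof -
  have W: "u @ [i] \<in> Wd" "u \<in> Wd" using red_Wd[OF assms(1)] by auto
  have "cls ((u @ [i]) @ [i]) = cls u"
    by (rule iffD2[OF cls_inject]) (use W in \<open>auto simp: pa_append fun_eq_iff\<close>)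
  then have "len (cls ((u @ [i]) @ [i])) < len (cls (u @ [i]))"
    using len_cls[OF assms(1)] len_cls[OF red_append2[OF assms(1)]] by simp
  moreover have "[i] \<in> lists {1..n}" using W assms(2) by auto
  ultimately show ?thesis using grassmannian_cls[OF W(1)] by (meson not_le)
qed

section \<open>Polynomials in the coordinates of the weights\<close>

lemma lookup_linear_poly:
  "j \<in> {1..n} \<Longrightarrow> Poly_Mapping.lookup (linear_poly n l) (Poly_Mapping.single j 1) = l j"
proof -
  assume j: "j \<in> {1..n}"
  have inj: "Poly_Mapping.single i (1::nat) = Poly_Mapping.single j 1 \<longleftrightarrow> i = j" for i
    by (metis keys_single singleton_inject zero_neq_one)
   have "Poly_Mapping.lookup (linear_poly n l) (Poly_Mapping.single j 1)
      = (\<Sum>i=1..n. if i = j then l i else 0)"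
    unfolding linear_poly_def lookup_sum by (rule sum.cong) (auto simp: lookup_single when_def inj inj[unfolded One_nat_def])
  then show ?thesis using j by simp
qed

lemma alpha_nonzero: "i \<le> n \<Longrightarrow> alpha n i \<noteq> 0"
proof
  assume i: "i \<le> n" "alpha n i = 0"
  define j where "j = (if i = 0 then 1 else i)"
  have "simple_root n i j = 0"
    using lookup_linear_poly[of j "simple_root n i"] i n_ge_2 by (auto simp: alpha_def j_def)
  then show False using i n_ge_2 by (auto simp: simple_root_def cartan_def j_def split: if_splits)
qed

lemma ddiff_unique: "i \<le> n \<Longrightarrow> alpha n i * q = p - srefl n i p \<Longrightarrow> ddiff n i p = q"
  using ddiff[of n i p] alpha_nonzero[of i] by (metis mult_cancel_left)

lemma ddiff_add: "i \<le> n \<Longrightarrow> ddiff n i (p + q) = ddiff n i p + ddiff n i q"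
  by (rule ddiff_unique) (simp_all add: distrib_left ddiff srefl_add)

lemma ddiff_of_int [simp]: "i \<le> n \<Longrightarrow> ddiff n i (of_int c) = 0"
  by (rule ddiff_unique) simp_all

lemma ddiff_mult: "i \<le> n \<Longrightarrow> ddiff n i (p * q) = ddiff n i p * q + srefl n i p * ddiff n i q"
proof (rule ddiff_unique, assumption)
  have "alpha n i * (ddiff n i p * q + srefl n i p * ddiff n i q)
      = (alpha n i * ddiff n i p) * q + srefl n i p * (alpha n i * ddiff n i q)"
    by (simp add: algebra_simps)
  also have "\<dots> = p * q - srefl n i (p * q)"
    unfolding ddiff srefl_mult by (simp add: algebra_simps)
  finally show "alpha n i * (ddiff n i p * q + srefl n i p * ddiff n i q) = p * q - srefl n i (p * q)" .
qed

lemma ddiff_xvar: "i \<le> n \<Longrightarrow> ddiff n i (xvar j) = of_int (copair n i j)"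
  by (rule ddiff_unique) (simp_all add: srefl_xvar)

lemma alpha_in: "alpha n i \<in> polys_in {1..n}"
proof -
  have "(\<Sum>j\<in>J. of_int (l j) * xvar j) \<in> polys_in {1..n}" if "finite J" "J \<subseteq> {1..n}" for J and l :: "nat \<Rightarrow> int"
    using that
  proof (induction J)
    case empty
    then show ?case using polys_in.const[of 0] by simp
  next
    case (insert j J)
    then show ?case using polys_in.var[OF polys_in.const[of "l j"], of j "{1..n}"]
      by (auto simp: mult.commute intro!: polys_in.add)
  qed
  then show ?thesis unfolding alpha_def linear_poly_eq by blast
qed

lemma srefl_in: "p \<in> polys_in {1..n} \<Longrightarrow> srefl n i p \<in> polys_in {1..n}"
proof (induction rule: polys_in.induct)
  case (var p j)
  then show ?case unfolding srefl_mult srefl_xvar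
    by (intro polys_in_mult polys_in_diff xvar_in alpha_in polys_in.const)
qed (auto simp: srefl_add intro: polys_in.intros)

lemma ddiff_in: "p \<in> polys_in {1..n} \<Longrightarrow> i \<le> n \<Longrightarrow> ddiff n i p \<in> polys_in {1..n}"
proof (induction rule: polys_in.induct)
  case (const c)
  then show ?case using polys_in.const[of 0] by simp
next
  case (var p j)
  then show ?case unfolding ddiff_mult[OF var.prems] srefl_xvar ddiff_xvar[OF var.prems]
    by (intro polys_in_mult polys_in_diff polys_in.add xvar_in alpha_in polys_in.const) auto
qed (auto simp: ddiff_add intro: polys_in.intros)

text \<open>The coordinates \<open>\<epsilon>\<^sub>r = \<omega>\<^sub>r - \<omega>\<^bsub>r-1\<^esub>\<close>, with \<open>\<epsilon>\<^bsub>2n+1-r\<^esub> = - \<epsilon>\<^sub>r\<close>.\<close>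

definition eps0 :: "nat \<Rightarrow> spoly" where "eps0 r = (if r \<le> 1 then xvar r else xvar r - xvar (r - 1))"

definition eps :: "int \<Rightarrow> spoly" where
  "eps r = (if r \<le> int n then eps0 (nat r) else - eps0 (nat (2 * int n + 1 - r)))"

text \<open>The value of the \<open>i\<close>-th simple coroot at \<open>\<epsilon>_r\<close>: it is
  1 where \<open>s_i\<close> moves the integer \<open>r\<close> up, -1 where it moves it down, and 0
  where it fixes it.\<close>

definition kap :: "nat \<Rightarrow> int \<Rightarrow> int" where
  "kap i r = (if i = 0 then if r = 2 * int n then 1 else if r = 1 then - 1 else 0
     else if r = int i \<or> r = 2 * int n - int i then 1
     else if r = int i + 1 \<or> r = 2 * int n - int i + 1 then - 1 else 0)"

lemma alpha_0: "alpha n 0 = - 2 * eps0 1"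
proof -
  have "alpha n 0 = (\<Sum>j=1..n. if j = 1 then - 2 * xvar 1 else 0)"
    unfolding alpha_def linear_poly_eq
    by (rule sum.cong) (use n_ge_2 in \<open>auto simp: simple_root_def cartan_def\<close>)
  then show ?thesis using n_ge_2 by (simp add: eps0_def)
qed

lemma alpha_n: "alpha n n = 2 * eps0 n"
proof -
  have "alpha n n = (\<Sum>j=1..n. (if j = n then 2 * xvar n else 0) + (if j = n - 1 then - 2 * xvar (n - 1) else 0))"
    unfolding alpha_def linear_poly_eq
    by (rule sum.cong) (use n_ge_2 in \<open>auto simp: simple_root_def cartan_def\<close>)
  also have "\<dots> = 2 * xvar n - 2 * xvar (n - 1)"
  proof -
    have "1 \<le> n - 1" using n_ge_2 by simp
    then show ?thesis using n_ge_2 by (simp add: sum.distrib)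
  qed
  finally show ?thesis using n_ge_2 by (simp add: eps0_def algebra_simps)
qed

lemma alpha_mid:
  assumes "1 \<le> i" "i < n"
  shows "alpha n i = eps0 i - eps0 (i + 1)"
proof -
  have "alpha n i = (\<Sum>j=1..n. ((if j = i then 2 * xvar i else 0) + (if j = i - 1 then - xvar (i - 1) else 0))
      + (if j = i + 1 then - xvar (i + 1) else 0))"
    unfolding alpha_def linear_poly_eq
    by (rule sum.cong) (use assms in \<open>auto simp: simple_root_def cartan_def\<close>)
  also have "\<dots> = 2 * xvar i + (if i = 1 then 0 else - xvar (i - 1)) - xvar (i + 1)"
    using assms by (auto simp: sum.distrib)
  finally show ?thesis using assms by (auto simp: eps0_def algebra_simps)
qed

lemma alpha_eps:
  assumes "i \<le> n"
  shows "alpha n i = (if i = 0 then eps (2 * int n) - eps 1 else eps (int i) - eps (int i + 1))"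
proof -
  consider "i = 0" | "i = n" "0 < i" | "1 \<le> i" "i < n" using assms by linarith
  then show ?thesis
  proof cases
    case 1
    then show ?thesis using alpha_0 n_ge_2 by (simp add: eps_def algebra_simps)
  next
    case 2
    then show ?thesis using alpha_n n_ge_2 by (simp add: eps_def algebra_simps)
  next
    case 3
    then have "nat (int i + 1) = i + 1" by simp
    then show ?thesis using alpha_mid[OF 3] 3 by (simp add: eps_def)
  qed
qed

lemma srefl_eps0:
  assumes "i \<le> n" "1 \<le> r" "r \<le> n"
  shows "srefl n i (eps0 r) = eps0 r - of_int (kap i (int r)) * alpha n i"
proof -
  have "srefl n i (eps0 r) = eps0 r - of_int (copair n i r - copair n i (r - 1)) * alpha n i"
    using assms by (auto simp: eps0_def srefl_xvar srefl_diff algebra_simps copair_def)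
  moreover have "copair n i r - copair n i (r - 1) = kap i (int r)"
    using assms n_ge_2 by (auto simp: copair_def kap_def)
  ultimately show ?thesis by (simp only:)
qed

lemma kap_rv: "i \<le> n \<Longrightarrow> kap i (2 * int n + 1 - r) = - kap i r"
  using n_ge_2 by (auto simp: kap_def; presburger)

lemma eps_rv: "1 \<le> r \<Longrightarrow> r \<le> 2 * int n \<Longrightarrow> eps (2 * int n + 1 - r) = - eps r"
  by (auto simp: eps_def)

lemma srefl_eps_kap:
  assumes "i \<le> n" "1 \<le> r" "r \<le> 2 * int n"
  shows "srefl n i (eps r) = eps r - of_int (kap i r) * alpha n i"
proof (cases "r \<le> int n")
  case True
  then show ?thesis using srefl_eps0[OF assms(1), of "nat r"] assms by (simp add: eps_def)
next
  case False
  then have "srefl n i (eps r) = - (eps0 (nat (2 * int n + 1 - r)) - of_int (kap i (2 * int n + 1 - r)) * alpha n i)"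
    using srefl_eps0[OF assms(1), of "nat (2 * int n + 1 - r)"] assms by (simp add: eps_def srefl_uminus)
  then show ?thesis using False kap_rv[OF assms(1)] by (simp add: eps_def)
qed

lemma ddiff_eps:
  assumes "i \<le> n" "1 \<le> r" "r \<le> 2 * int n"
  shows "ddiff n i (eps r) = of_int (kap i r)"
  by (rule ddiff_unique) (use srefl_eps_kap assms in \<open>simp_all add: algebra_simps\<close>)

text \<open>On weights of level zero the affine reflections act through residues modulo
  \<open>2n\<close>. This links the polynomial action with the permutations of states.\<close>

lemma srefl_eps:
  assumes "i \<le> n" "1 \<le> r" "r \<le> 2 * int n"
  shows "srefl n i (eps r) = eps (actr i r)"
proof (cases "i = 0")
  case True
  then show ?thesis using srefl_eps_kap[OF assms] alpha_eps[OF assms(1)] n_ge_2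
    by (auto simp: kap_def actr_def)
next
  case False
  then have i: "1 \<le> int i" "int i \<le> int n" using assms by auto
  have 1: "eps (2 * int n - int i) = - eps (int i + 1)" "eps (2 * int n - int i + 1) = - eps (int i)"
    using eps_rv[of "int i + 1"] eps_rv[of "int i"] i n_int by (auto simp: algebra_simps)
  have 2: "2 * int n - int i \<noteq> int i + 1" "2 * int n + 1 \<noteq> 2 * int i" by presburger+
  consider "r = int i" | "r = 2 * int n - int i" | "r = int i + 1" | "r = 2 * int n - int i + 1"
    | "r \<noteq> int i" "r \<noteq> 2 * int n - int i" "r \<noteq> int i + 1" "r \<noteq> 2 * int n - int i + 1" by blast
  then show ?thesis
    using srefl_eps_kap[OF assms] alpha_eps[OF assms(1)] False 1 2
    by cases (simp_all add: kap_def actr_def)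
qed

lemma eps_in: "1 \<le> r \<Longrightarrow> r \<le> 2 * int n \<Longrightarrow> eps r \<in> polys_in {1..n}"
  by (auto simp: eps_def eps0_def intro!: polys_in_uminus polys_in_diff xvar_in)

lemma xvar_eps: "1 \<le> j \<Longrightarrow> j \<le> n \<Longrightarrow> xvar j = (\<Sum>r=1..j. eps (int r))"
proof (induction j rule: nat_induct_at_least)
  case base
  then show ?case by (simp add: eps_def eps0_def)
next
  case (Suc j)
  then have "nat (int (Suc j)) = Suc j" by simp
  then have "eps (int (Suc j)) = xvar (Suc j) - xvar j" using Suc by (simp add: eps_def eps0_def)
  then show ?case using Suc by simp
qed

lemma srefl_xvar_out: "j \<notin> {1..n} \<Longrightarrow> srefl n i (xvar j) = xvar j"
  by (simp add: srefl_xvar copair_def)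

text \<open>On the coordinates this is the involutivity of the residue permutation, and the
  fundamental weights are sums of coordinates.\<close>

lemma srefl_srefl: "i \<le> n \<Longrightarrow> srefl n i (srefl n i p) = p"
proof -
  assume i: "i \<le> n"
  have x: "srefl n i (srefl n i (xvar j)) = xvar j" for j
  proof (cases "j \<in> {1..n}")
    case True
    have "srefl n i (srefl n i (eps (int r))) = eps (int r)" if "r \<in> {1..j}" for r
    proof -
      have r: "1 \<le> int r" "int r \<le> 2 * int n" using that True by auto
      have "valid (0, int r)" using r by (simp add: valid_def)
      then have "1 \<le> actr i (int r)" "actr i (int r) \<le> 2 * int n" "actr i (actr i (int r)) = int r"
        using act_valid[OF i, of "(0, int r)"] act_act[OF i, of "(0, int r)"]
        by (auto simp: valid_def act_def)
      then show ?thesis using srefl_eps[OF i] r by simp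
    qed
    then show ?thesis using True xvar_eps[of j] by (simp add: srefl_sum)
  next
    case False
    then show ?thesis by (simp add: srefl_xvar_out)
  qed
  have "p \<in> polys_in UNIV" by (rule polys_in_UNIV)
  then show ?thesis by induction (simp_all add: srefl_add srefl_mult x)
qed

lemma srefl_alpha: "i \<le> n \<Longrightarrow> srefl n i (alpha n i) = - alpha n i"
proof -
  assume i: "i \<le> n"
  define r where "r = (if i = 0 then 2 * int n else int i)"
  have r: "1 \<le> r" "r \<le> 2 * int n" "kap i r = 1" using i n_ge_2 by (auto simp: r_def kap_def)
  have A: "srefl n i (eps r) = eps r - alpha n i"
    using srefl_eps_kap[OF i r(1,2)] r(3) by simp
  have "eps r = srefl n i (eps r) - srefl n i (alpha n i)"
    using arg_cong[OF A, of "srefl n i"] unfolding srefl_diff srefl_srefl[OF i] .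
  then show ?thesis using A by (simp add: eq_neg_iff_add_eq_0 algebra_simps)
qed

lemma srefl_ddiff: "i \<le> n \<Longrightarrow> srefl n i (ddiff n i p) = ddiff n i p"
proof -
  assume i: "i \<le> n"
  have "srefl n i (alpha n i * ddiff n i p) = srefl n i (p - srefl n i p)" by (simp add: ddiff)
  then have "alpha n i * srefl n i (ddiff n i p) = p - srefl n i p"
    by (simp add: srefl_mult srefl_diff srefl_alpha srefl_srefl i algebra_simps)
  then show ?thesis using ddiff_unique[OF i] by metis
qed

lemma ddiff_ddiff: "i \<le> n \<Longrightarrow> ddiff n i (ddiff n i p) = 0"
  by (rule ddiff_unique) (simp_all add: srefl_ddiff)

lemma ddiff_srefl: "i \<le> n \<Longrightarrow> ddiff n i (srefl n i p) = - ddiff n i p"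
  by (rule ddiff_unique) (simp_all add: srefl_srefl ddiff)

end

section \<open>A faithful representation of the nilHecke algebra\<close>

text \<open>The free module over the polynomials with basis the permutations of the states. An element \<open>w\<close>
  of the group is represented by the permutation of \<open>w\<^sup>-\<^sup>1\<close>.\<close>

type_synonym modl = "(state \<Rightarrow> state) \<Rightarrow>\<^sub>0 spoly"

text \<open>Additive endomorphisms form a type, so that identities between operators can be computed
  in the class \<open>ring_1\<close>.\<close>

typedef endo = "{f :: modl \<Rightarrow> modl. \<forall>x y. f (x + y) = f x + f y}"
  morphisms app Endo
  by (rule exI[of _ id]) simp

setup_lifting type_definition_endo

instantiation endo :: ring_1
begin
lift_definition zero_endo :: endo is "\<lambda>x. 0" by simp
lift_definition one_endo :: endo is "\<lambda>x. x" by simp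
lift_definition plus_endo :: "endo \<Rightarrow> endo \<Rightarrow> endo" is "\<lambda>f g x. f x + g x" by (simp add: algebra_simps)
lift_definition minus_endo :: "endo \<Rightarrow> endo \<Rightarrow> endo" is "\<lambda>f g x. f x - g x" by (simp add: algebra_simps)
lift_definition uminus_endo :: "endo \<Rightarrow> endo" is "\<lambda>f x. - f x" by simp
lift_definition times_endo :: "endo \<Rightarrow> endo \<Rightarrow> endo" is "\<lambda>f g x. f (g x)" by simp
instance
proof
  show "(0::endo) \<noteq> 1"
  proof transfer
    have "(\<lambda>x. 0) (Poly_Mapping.single id 1) \<noteq> (Poly_Mapping.single id 1 :: modl)"
      by (metis lookup_single_eq lookup_zero zero_neq_one)
    then show "(\<lambda>x. 0) \<noteq> (\<lambda>x::modl. x)" by metis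
  qed
qed (transfer; simp add: algebra_simps fun_eq_iff)+
end

lemma app_add [simp]: "app X (x + y) = app X x + app X y" by transfer simp
lemma app_zero [simp]: "app X 0 = 0" using app_add[of X 0 0] by simp
lemma app_uminus [simp]: "app X (- x) = - app X x"
  using app_add[of X x "- x"] by (simp add: eq_neg_iff_add_eq_0 add.commute)
lemma app_sum: "app X (\<Sum>i\<in>I. f i) = (\<Sum>i\<in>I. app X (f i))"
  by (induction I rule: infinite_finite_induct) auto
lemma app_0 [simp]: "app 0 x = 0" by transfer simp
lemma app_1 [simp]: "app 1 x = x" by transfer simp
lemma app_plus: "app (X + Y) x = app X x + app Y x" by transfer simp
lemma app_minus: "app (X - Y) x = app X x - app Y x" by transfer simp
lemma app_times: "app (X * Y) x = app X (app Y x)" by transfer simp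
lemma app_sum_l: "app (\<Sum>i\<in>I. X i) x = (\<Sum>i\<in>I. app (X i) x)"
  by (induction I rule: infinite_finite_induct) (auto simp: app_plus)

lemma endo_eqI:
  assumes "\<And>h f. app X (Poly_Mapping.single h f) = app Y (Poly_Mapping.single h f)"
  shows "X = Y"
proof -
  have "app X x = app Y x" for x
    by (induction x rule: poly_mapping_single_induct) (simp_all add: assms)
  then show ?thesis by (metis app_inverse ext)
qed

text \<open>Extends values on the summands additively. Linearity over the polynomials would be too
  much to ask, as \<open>A_i\<close> twists the coefficients.\<close>

definition ext :: "((state \<Rightarrow> state) \<Rightarrow> spoly \<Rightarrow> modl) \<Rightarrow> endo" where
  "ext \<phi> = Endo (\<lambda>x. \<Sum>h\<in>Poly_Mapping.keys x. \<phi> h (Poly_Mapping.lookup x h))"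

lemma app_ext:
  assumes \<phi>: "\<And>h f g. \<phi> h (f + g) = \<phi> h f + \<phi> h g"
  shows "app (ext \<phi>) (Poly_Mapping.single h f) = \<phi> h f"
proof -
  have 0: "\<phi> h 0 = 0" for h by (metis add_cancel_right_right \<phi>)
  have *: "(\<Sum>h\<in>Poly_Mapping.keys z. \<phi> h (Poly_Mapping.lookup z h)) = (\<Sum>h\<in>K. \<phi> h (Poly_Mapping.lookup z h))"
    if "finite K" "Poly_Mapping.keys z \<subseteq> K" for z K
    by (rule sum.mono_neutral_left) (use that 0 in \<open>auto simp: in_keys_iff\<close>)
  have "(\<Sum>h\<in>Poly_Mapping.keys (x + y). \<phi> h (Poly_Mapping.lookup (x + y) h))
      = (\<Sum>h\<in>Poly_Mapping.keys x. \<phi> h (Poly_Mapping.lookup x h))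
      + (\<Sum>h\<in>Poly_Mapping.keys y. \<phi> h (Poly_Mapping.lookup y h))" for x y
  proof -
    let ?K = "Poly_Mapping.keys x \<union> Poly_Mapping.keys y"
    have "Poly_Mapping.keys (x + y) \<subseteq> ?K" by (rule keys_add)
    then show ?thesis
      using \<phi> *[of ?K x] *[of ?K y] *[of ?K "x + y"] by (simp add: lookup_add sum.distrib)
  qed
  then have "app (ext \<phi>) x = (\<Sum>h\<in>Poly_Mapping.keys x. \<phi> h (Poly_Mapping.lookup x h))" for x
    unfolding ext_def by (subst Endo_inverse) simp_all
  then show ?thesis by (cases "f = 0") (simp_all add: 0)
qed

definition opS :: "spoly \<Rightarrow> endo" where
  "opS p = ext (\<lambda>h f. Poly_Mapping.single h (p * f))"

lemma app_opS [simp]: "app (opS p) (Poly_Mapping.single h f) = Poly_Mapping.single h (p * f)"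
  unfolding opS_def by (rule app_ext) (simp add: distrib_left single_add)

lemma opS_add: "opS (p + q) = opS p + opS q"
  by (rule endo_eqI) (simp add: app_plus distrib_right single_add)
lemma opS_mult: "opS (p * q) = opS p * opS q"
  by (rule endo_eqI) (simp add: app_times mult.assoc)
lemma opS_1 [simp]: "opS 1 = 1" by (rule endo_eqI) simp
lemma opS_0 [simp]: "opS 0 = 0" by (rule endo_eqI) simp
lemma opS_uminus: "opS (- p) = - opS p"
  using opS_add[of p "- p"] by (simp add: eq_neg_iff_add_eq_0 add.commute)
lemma opS_sum: "opS (\<Sum>i\<in>I. f i) = (\<Sum>i\<in>I. opS (f i))"
  by (induction I rule: infinite_finite_induct) (auto simp: opS_add)
lemma opS_of_int [simp]: "opS (of_int c) = of_int c"
proof -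
  have "opS (of_nat k) = of_nat k" for k by (induction k) (auto simp: opS_add)
  then show ?thesis by (cases c) (auto simp: opS_uminus simp del: of_nat_Suc)
qed

lemma lookup_opS: "Poly_Mapping.lookup (app (opS p) x) h = p * Poly_Mapping.lookup x h"
  by (induction x rule: poly_mapping_single_induct)
    (simp_all add: lookup_add distrib_left lookup_single when_def)

lemma lookup_of_int_endo: "Poly_Mapping.lookup (app (of_int c) x) h = of_int c * Poly_Mapping.lookup x h"
  using lookup_opS[of "of_int c"] by simp

context affine_C begin

definition GG :: "(state \<Rightarrow> state) set" where "GG = pa ` Wd"

text \<open>By the commutation relation,
  \<open>A_i f A_w = s_i(f) A_i A_w + \<partial>_i(f) A_w\<close>. As \<open>h\<close> stands for
  the inverse of \<open>w\<close>, an ascent of \<open>h\<close> at \<open>i\<close> means that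
  \<open>s_i w\<close> is longer than \<open>w\<close>. Outside the group only the second term is
  kept, so that \<open>A_i\<close> kills the unit vectors there.\<close>

definition opA :: "nat \<Rightarrow> endo" where
  "opA i = ext (\<lambda>h f. Poly_Mapping.single h (ddiff n i f)
     + (if h \<in> GG \<and> h (xe i) \<prec> h (ye i) then Poly_Mapping.single (h \<circ> act i) (srefl n i f) else 0))"

lemma app_opA:
  "i \<le> n \<Longrightarrow> app (opA i) (Poly_Mapping.single h f) = Poly_Mapping.single h (ddiff n i f)
     + (if h \<in> GG \<and> h (xe i) \<prec> h (ye i) then Poly_Mapping.single (h \<circ> act i) (srefl n i f) else 0)"
  unfolding opA_def by (rule app_ext) (auto simp: ddiff_add srefl_add single_add)

lemma opA_opS: "i \<le> n \<Longrightarrow> opA i * opS f = opS (srefl n i f) * opA i + opS (ddiff n i f)"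
  by (rule endo_eqI) (auto simp: app_plus app_times app_opA ddiff_mult srefl_mult single_add)

lemma opA_sq: "i \<le> n \<Longrightarrow> opA i * opA i = 0"
proof (rule endo_eqI)
  fix h f assume i: "i \<le> n"
  show "app (opA i * opA i) (Poly_Mapping.single h f) = app 0 (Poly_Mapping.single h f)"
    using i slt_asym
    by (auto simp: app_times app_opA ddiff_ddiff srefl_ddiff ddiff_srefl srefl_srefl simp flip: single_add)
qed

lemma opA_sq_left: "i \<le> n \<Longrightarrow> opA i * (opA i * X) = 0"
  by (simp add: opA_sq flip: mult.assoc)

definition opW :: "nat list \<Rightarrow> endo" where "opW u = prod_list (map opA u)"

lemma opW_Nil [simp]: "opW [] = 1" by (simp add: opW_def)
lemma opW_Cons: "opW (i # u) = opA i * opW u" by (simp add: opW_def)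
lemma opW_append: "opW (u @ v) = opW u * opW v" by (simp add: opW_def)

definition bas :: "(state \<Rightarrow> state) \<Rightarrow> modl" where "bas h = Poly_Mapping.single h 1"

lemma asc_iff: "u \<in> Wd \<Longrightarrow> i \<le> n \<Longrightarrow> pa u (xe i) \<prec> pa u (ye i) \<longleftrightarrow> \<not> desc (pa u) i"
  using slt_linear[of "pa u (xe i)" "pa u (ye i)"] pa_inj[of u "xe i" "ye i"] xe_slt_ye[of i]
  by (auto simp: desc_def dest: slt_asym)

lemma opW_bas:
  assumes "red w" "u \<in> Wd"
  shows "app (opW u) (bas (pa (rev w))) = (if red (u @ w) then bas (pa (rev (u @ w))) else 0)"
  using assms(2)
proof (induction u rule: list.induct)
  case Nil
  then show ?case using assms(1) by simp
next
  case (Cons i u)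
  then have i: "i \<le> n" and u: "u \<in> Wd" by auto
  show ?case
  proof (cases "red (u @ w)")
    case False
    then have "\<not> red ((i # u) @ w)" using red_Cons by auto
    then show ?thesis using Cons.IH[OF u] False by (simp add: opW_Cons app_times)
  next
    case True
    have W: "rev (u @ w) \<in> Wd" using red_Wd[OF True] by auto
    then have "pa (rev (u @ w)) \<in> GG" by (auto simp: GG_def)
    moreover have "pa (rev (u @ w)) (xe i) \<prec> pa (rev (u @ w)) (ye i) \<longleftrightarrow> red (i # u @ w)"
      using asc_iff[OF W i] red_Cons_iff[OF True i] by simp
    ultimately have "app (opA i) (bas (pa (rev (u @ w)))) = (if red (i # u @ w) then bas (pa (rev (u @ w)) \<circ> act i) else 0)"
      unfolding bas_def app_opA[OF i] using ddiff_of_int[OF i, of 1] srefl_of_int[of n i 1] by simp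
    then show ?thesis using Cons.IH[OF u] True
      by (simp add: opW_Cons app_times pa_append o_def)
  qed
qed

lemma opW_bas_id: "u \<in> Wd \<Longrightarrow> app (opW u) (bas id) = (if red u then bas (pa (rev u)) else 0)"
  using opW_bas[of "[]" u] by simp

definition res :: "nat list \<Rightarrow> int \<Rightarrow> int" where "res u r = foldr actr u r"

lemma res_simps [simp]: "res [] r = r" "res (i # u) r = actr i (res u r)" by (simp_all add: res_def)

lemma snd_pa: "snd (pa u s) = res u (snd s)"
  by (induction u) (simp_all add: act_def)

lemma res_valid: "u \<in> Wd \<Longrightarrow> 1 \<le> r \<and> r \<le> 2 * int n \<Longrightarrow> 1 \<le> res u r \<and> res u r \<le> 2 * int n"
  using pa_valid[of u "(0, r)"] snd_pa[of u "(0, r)"] by (simp add: valid_def)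

lemma opA_eps:
  assumes "i \<le> n" "1 \<le> r \<and> r \<le> 2 * int n"
  shows "opA i * opS (eps r) = opS (eps (actr i r)) * opA i + of_int (kap i r)"
  using opA_opS[OF assms(1), of "eps r"] srefl_eps[OF assms(1)] ddiff_eps[OF assms(1)] assms(2) by simp

text \<open>The iterated twisted Leibniz rule: on its way to the left the coordinate either passes
  all the letters or is absorbed by the \<open>j\<close>-th one, which disappears. The factor is the
  coroot value at the residue reached by then.\<close>

lemma opW_eps:
  assumes "u \<in> Wd" "1 \<le> r \<and> r \<le> 2 * int n"
  shows "opW u * opS (eps r) = opS (eps (res u r)) * opW u
    + (\<Sum>j<length u. of_int (kap (u ! j) (res (drop (Suc j) u) r)) * opW (take j u @ drop (Suc j) u))"
  using assms(1)
proof (induction u rule: list.induct)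
  case (Cons i u)
  then have i: "i \<le> n" and u: "u \<in> Wd" by auto
  let ?s = "\<lambda>u j. of_int (kap (u ! j) (res (drop (Suc j) u) r)) * opW (take j u @ drop (Suc j) u)"
  have c: "X * of_int k = of_int k * X" for X :: endo and k by (rule mult_of_int_commute[symmetric])
  have "opW (i # u) * opS (eps r) = opA i * (opS (eps (res u r)) * opW u + (\<Sum>j<length u. ?s u j))"
    using Cons.IH[OF u] by (simp add: opW_Cons mult.assoc)
  also have "\<dots> = opA i * opS (eps (res u r)) * opW u + (\<Sum>j<length u. opA i * ?s u j)"
    by (simp add: distrib_left mult.assoc sum_distrib_left)
  also have "(\<Sum>j<length u. opA i * ?s u j) = (\<Sum>j<length u. ?s (i # u) (Suc j))"
  proof (rule sum.cong[OF HOL.refl])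
    fix j
    show "opA i * ?s u j = ?s (i # u) (Suc j)"
      by (simp add: opW_Cons) (metis (no_types) c mult.assoc)
  qed
  also have "opA i * opS (eps (res u r)) * opW u = opS (eps (res (i # u) r)) * opW (i # u) + ?s (i # u) 0"
    using opA_eps[OF i res_valid[OF u assms(2)]] by (simp add: opW_Cons distrib_right mult.assoc)
  finally have 1: "opW (i # u) * opS (eps r) = opS (eps (res (i # u) r)) * opW (i # u)
      + (?s (i # u) 0 + (\<Sum>j<length u. ?s (i # u) (Suc j)))"
    by (simp only: add.assoc)
  have 2: "(\<Sum>j<length (i # u). ?s (i # u) j) = ?s (i # u) 0 + (\<Sum>j<length u. ?s (i # u) (Suc j))"
    unfolding list.size add_Suc_right add_0_right by (rule sum.lessThan_Suc_shift)
  show ?case unfolding 2 by (rule 1)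
qed simp

lemma kap_commute: "i \<le> n \<Longrightarrow> j \<le> n \<Longrightarrow> i + 1 < j \<or> j + 1 < i \<Longrightarrow> kap i (actr j r) = kap i r"
  using n_int by (auto simp: kap_def actr_def)

text \<open>Deleting the middle letter of \<open>A_i A_{i+1} A_i\<close> leaves a square, which is
  0; these identities match the deletions of the outer letters on the two sides of the relation. In
  the relations of length 4 it is again only the outer deletions that survive.\<close>

lemma kap_braid3:
  assumes "1 \<le> i" "i + 2 \<le> n"
  shows "kap i (actr (i+1) (actr i r)) = kap (i+1) r" "kap (i+1) (actr i (actr (i+1) r)) = kap i r"
proof -
  consider "r = int i" | "r = int i + 1" | "r = int i + 2" | "r = 2 * int n - int i - 1"
    | "r = 2 * int n - int i" | "r = 2 * int n - int i + 1" 
    | "r \<notin> {int i, int i + 1, int i + 2, 2 * int n - int i - 1, 2 * int n - int i, 2 * int n - int i + 1}"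
    by blast
  then show "kap i (actr (i+1) (actr i r)) = kap (i+1) r" "kap (i+1) (actr i (actr (i+1) r)) = kap i r"
    using assms by (cases, simp_all add: kap_def actr_def)+
qed

lemma kap_braid4:
  "kap 0 (actr 1 (actr 0 (actr 1 r))) = kap 0 r" "kap 1 (actr 0 (actr 1 (actr 0 r))) = kap 1 r"
proof -
  consider "r = 1" | "r = 2" | "r = 2 * int n" | "r = 2 * int n - 1"
    | "r \<notin> {1, 2, 2 * int n, 2 * int n - 1}"
    by blast
  then show "kap 0 (actr 1 (actr 0 (actr 1 r))) = kap 0 r" "kap 1 (actr 0 (actr 1 (actr 0 r))) = kap 1 r"
    using n_int by (cases, simp_all add: kap_def actr_def)+
qed

lemma kap_braid4':
  "kap (n-1) (actr n (actr (n-1) (actr n r))) = kap (n-1) r" "kap n (actr (n-1) (actr n (actr (n-1) r))) = kap n r"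
proof -
  have 1: "actr n t = (if t = int n then int n + 1 else if t = int n + 1 then int n else t)" for t
    using n_ge_2 by (simp add: actr_def)
  have 2: "actr (n-1) t = (if t = int n - 1 then int n else if t = int n + 1 then int n + 2
      else if t = int n then int n - 1 else if t = int n + 2 then int n + 1 else t)" for t
    using n_ge_2 by (simp add: actr_def of_nat_diff)
  have 3: "kap n t = (if t = int n then 1 else if t = int n + 1 then - 1 else 0)" for t
    using n_ge_2 by (simp add: kap_def)
  have 4: "kap (n-1) t = (if t = int n - 1 \<or> t = int n + 1 then 1 else if t = int n \<or> t = int n + 2 then - 1 else 0)" for t
    using n_ge_2 by (simp add: kap_def of_nat_diff)
  consider "r = int n - 1" | "r = int n" | "r = int n + 1" | "r = int n + 2"
    | "r \<notin> {int n - 1, int n, int n + 1, int n + 2}"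
    by blast
  then show "kap (n-1) (actr n (actr (n-1) (actr n r))) = kap (n-1) r" "kap n (actr (n-1) (actr n (actr (n-1) r))) = kap n r"
    unfolding 1 2 3 4 by (cases, simp_all)+
qed

lemma opW_braid_aux:
  assumes "red w" and uv: "(u, v) \<in> braid_rels n"
  shows "app (opW u) (bas (pa (rev w))) = app (opW v) (bas (pa (rev w)))"
proof -
  note p = braid_rels_Wd[OF uv] braid_rels_pa[OF uv]
  have e: "pa (u @ w) = pa (v @ w)" "u @ w \<in> Wd" "v @ w \<in> Wd" "length (u @ w) = length (v @ w)"
    using p red_Wd[OF assms(1)] by (auto simp: pa_append)
  then have "red (u @ w) = red (v @ w)" using red_pa_eq by metis
  moreover have "pa (rev (u @ w)) = pa (rev (v @ w))" using pa_rev_eq e by blast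
  ultimately show ?thesis using opW_bas[OF assms(1)] p by simp
qed

lemma opW_braid_zero:
  assumes "h \<notin> GG" "u \<in> Wd" "u \<noteq> []"
  shows "app (opW u) (bas h) = 0"
proof -
  obtain x i where u: "u = x @ [i]" using assms(3) by (metis rev_exhaust)
  then have i: "i \<le> n" using assms(2) by auto
  have "app (opA i) (bas h) = 0"
    unfolding bas_def app_opA[OF i] using ddiff_of_int[OF i, of 1] assms(1) by simp
  then show ?thesis unfolding u opW_append app_times by (simp add: opW_Cons)
qed

lemma opW_braid_eps:
  assumes uv: "(u, v) \<in> braid_rels n" and r: "1 \<le> r \<and> r \<le> 2 * int n"
  shows "(opW u - opW v) * opS (eps r) = opS (eps (res u r)) * (opW u - opW v)"
proof -
  let ?s = "\<lambda>u. \<Sum>j<length u. of_int (kap (u ! j) (res (drop (Suc j) u) r)) * opW (take j u @ drop (Suc j) u)"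
  have W: "u \<in> Wd" "v \<in> Wd" using braid_rels_Wd[OF uv] by auto
  have "res u r = res v r"
    using snd_pa[of u "(0, r)"] snd_pa[of v "(0, r)"] braid_rels_pa[OF uv] by simp
  moreover have "?s u = ?s v"
  proof -
    consider i j where "u = [i, j]" "v = [j, i]" "i \<le> n" "j \<le> n" "i + 1 < j \<or> j + 1 < i"
      | i where "u = [i, i + 1, i]" "v = [i + 1, i, i + 1]" "1 \<le> i" "i + 2 \<le> n"
      | "u = [0, 1, 0, 1]" "v = [1, 0, 1, 0]"
      | "u = [n - 1, n, n - 1, n]" "v = [n, n - 1, n, n - 1]"
      using uv by (auto simp: braid_rels_def)
    then show ?thesis
    proof cases
      case 1
      then show ?thesis
        using kap_commute[of i j r] kap_commute[of j i r] by (auto simp: opW_Cons sum.lessThan_Suc_shift)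
    next
      case 2
      then show ?thesis
        using kap_braid3[of i r] opA_sq[of i] opA_sq[of "i+1"]
        by (simp add: opW_Cons sum.lessThan_Suc_shift)
    next
      case 3
      then show ?thesis
        using kap_braid4[of r] n_ge_2
        by (simp add: opW_Cons sum.lessThan_Suc_shift mult.assoc opA_sq opA_sq_left)
    next
      case 4
      then show ?thesis
        using kap_braid4'[of r] n_ge_2
        by (simp add: opW_Cons sum.lessThan_Suc_shift mult.assoc opA_sq opA_sq_left)
    qed
  qed
  ultimately show ?thesis
    using opW_eps[OF W(1) r] opW_eps[OF W(2) r] by (simp add: left_diff_distrib right_diff_distrib)
qed

lemma opW_xvar_out: "u \<in> Wd \<Longrightarrow> j \<notin> {1..n} \<Longrightarrow> opW u * opS (xvar j) = opS (xvar j) * opW u"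
proof (induction u rule: list.induct)
  case (Cons i u)
  then have i: "i \<le> n" by auto
  have "copair n i j = 0" using Cons.prems by (simp add: copair_def)
  then have "opA i * opS (xvar j) = opS (xvar j) * opA i"
    using opA_opS[OF i, of "xvar j"] ddiff_xvar[OF i, of j] srefl_xvar_out[OF Cons.prems(2)] by simp
  then show ?case using Cons by (simp add: opW_Cons) (metis mult.assoc)
qed simp

text \<open>The difference \<open>B\<close> of the two sides kills the basis vectors, because both
  words have the same effect on lengths. It passes each variable at the cost of a new factor on its
  left, hence it kills all polynomial multiples as well.\<close>

theorem opW_braid:
  assumes uv: "(u, v) \<in> braid_rels n"
  shows "opW u = opW v"
proof -
  define B where "B = opW u - opW v"
  have W: "u \<in> Wd" "v \<in> Wd" "u \<noteq> []" "v \<noteq> []" using braid_rels_Wd[OF uv] uv by (auto simp: braid_rels_def)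
  have b: "app B (bas h) = 0" for h
  proof (cases "h \<in> GG")
    case True
    then obtain x where x: "x \<in> Wd" "h = pa x" by (auto simp: GG_def)
    obtain w where w: "red w" "pa w = pa (rev x)" using ex_red[of "rev x"] x by auto
    have "pa (rev w) = h" using pa_rev_eq[of w "rev x"] w x red_Wd[OF w(1)] by auto
    then show ?thesis using opW_braid_aux[OF w(1) uv] by (simp add: B_def app_minus)
  next
    case False
    then show ?thesis using opW_braid_zero W by (simp add: B_def app_minus)
  qed
  have "app B (Poly_Mapping.single h f) = 0" for h f
  proof -
    have "f \<in> polys_in UNIV" by (rule polys_in_UNIV)
    then show ?thesis
    proof induction
      case (const c)
      have "app B (Poly_Mapping.single h (of_int c)) = app (B * of_int c) (bas h)"
        using app_opS[of "of_int c" h 1] by (simp add: app_times bas_def)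
      also have "\<dots> = app (of_int c * B) (bas h)" by (simp only: mult_of_int_commute)
      finally show ?case using b by (simp add: app_times)
    next
      case (add p q)
      then show ?case by (simp add: single_add)
    next
      case (var p j)
      have "\<exists>Y. B * opS (xvar j) = Y * B"
      proof (cases "j \<in> {1..n}")
        case True
        have "B * opS (xvar j) = (\<Sum>r=1..j. B * opS (eps (int r)))"
          using xvar_eps[of j] True by (simp add: opS_sum sum_distrib_left)
        also have "\<dots> = (\<Sum>r=1..j. opS (eps (res u (int r)))) * B"
          unfolding sum_distrib_right B_def by (rule sum.cong[OF HOL.refl], rule opW_braid_eps[OF uv]) (use True in auto)
        finally show ?thesis by blast
      next
        case False
        then have "B * opS (xvar j) = opS (xvar j) * B"
          using opW_xvar_out W by (simp add: B_def left_diff_distrib right_diff_distrib)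
        then show ?thesis by blast
      qed
      then obtain Y where "B * opS (xvar j) = Y * B" by blast
      then have "app B (app (opS (xvar j)) (Poly_Mapping.single h p)) = app Y (app B (Poly_Mapping.single h p))"
        by (metis app_times)
      then show ?case using var by simp
    qed
  qed
  then have "B = 0" by (intro endo_eqI) simp
  then show ?thesis by (simp add: B_def)
qed

end

section \<open>Quotients of free rings\<close>

definition FC :: "'g set \<Rightarrow> ('g word \<Rightarrow>\<^sub>0 int) set" where
  "FC G = {p. \<forall>u \<in> Poly_Mapping.keys p. set (letters u) \<subseteq> G}"

lemma free_ring_simps [simp]:
  "carrier (free_ring G) = FC G" "mult (free_ring G) = (*)" "one (free_ring G) = 1"
  "zero (free_ring G) = 0" "add (free_ring G) = (+)"
  by (simp_all add: free_ring_def FC_def)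

lemma FC_add: "p \<in> FC G \<Longrightarrow> q \<in> FC G \<Longrightarrow> p + q \<in> FC G"
  using keys_add[of p q] by (auto simp: FC_def)
lemma FC_uminus: "p \<in> FC G \<Longrightarrow> - p \<in> FC G" by (simp add: FC_def)
lemma FC_diff: "p \<in> FC G \<Longrightarrow> q \<in> FC G \<Longrightarrow> p - q \<in> FC G"
  using FC_add[of p G "- q"] FC_uminus[of q] by simp
lemma FC_zero [simp]: "0 \<in> FC G" by (simp add: FC_def)
lemma FC_one [simp]: "1 \<in> FC G" by (auto simp: FC_def zero_word_def simp flip: single_one)
lemma FC_of_int [simp]: "of_int c \<in> FC G" by (auto simp: FC_def zero_word_def simp flip: single_of_int)
lemma FC_mult: "p \<in> FC G \<Longrightarrow> q \<in> FC G \<Longrightarrow> p * q \<in> FC G"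
  using keys_mult[of p q] by (fastforce simp: FC_def plus_word_def)
lemma FC_sum: "(\<And>i. i \<in> A \<Longrightarrow> f i \<in> FC G) \<Longrightarrow> (\<Sum>i\<in>A. f i) \<in> FC G"
  by (induction A rule: infinite_finite_induct) (auto intro: FC_add)
lemma FC_word_monom [simp]: "word_monom gs \<in> FC G \<longleftrightarrow> set gs \<subseteq> G"
  by (auto simp: FC_def word_monom_def)
lemma FC_mono: "G \<subseteq> H \<Longrightarrow> p \<in> FC G \<Longrightarrow> p \<in> FC H" by (auto simp: FC_def)

lemma word_monom_append: "word_monom (u @ v) = word_monom u * word_monom v"
  by (simp add: word_monom_def mult_single plus_word_def)
lemma word_monom_Nil: "word_monom [] = 1"
  by (simp add: word_monom_def zero_word_def flip: single_one)

lemma FC_induct [consumes 1, case_names zero add monom]: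
  assumes "p \<in> FC G" and "P 0" and "\<And>p q. p \<in> FC G \<Longrightarrow> q \<in> FC G \<Longrightarrow> P p \<Longrightarrow> P q \<Longrightarrow> P (p + q)"
    and "\<And>gs c. set gs \<subseteq> G \<Longrightarrow> P (of_int c * word_monom gs)"
  shows "P p"
proof -
  have m: "Poly_Mapping.single u c = of_int c * word_monom (letters u)" for u :: "'a word" and c
    by (cases u) (simp add: word_monom_def mult_single flip: single_of_int)
  have "P (\<Sum>u\<in>K. Poly_Mapping.single u (Poly_Mapping.lookup p u)) \<and> (\<Sum>u\<in>K. Poly_Mapping.single u (Poly_Mapping.lookup p u)) \<in> FC G"
    if "finite K" "K \<subseteq> Poly_Mapping.keys p" for K
    using that
  proof (induction K)
    case (insert u K)
    then have "set (letters u) \<subseteq> G" using assms(1) by (auto simp: FC_def)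
    then have "P (Poly_Mapping.single u (Poly_Mapping.lookup p u))" "Poly_Mapping.single u (Poly_Mapping.lookup p u) \<in> FC G"
      unfolding m by (auto intro!: assms(4) FC_mult)
    then show ?case using insert by (auto intro: assms(3) FC_add)
  qed (use assms(2) in auto)
  then have "P (\<Sum>u\<in>Poly_Mapping.keys p. Poly_Mapping.single u (Poly_Mapping.lookup p u))" by simp
  then show ?thesis using poly_mapping_decomp[of p] by simp
qed

lemma ring_free_ring: "ring (free_ring G)"
proof (rule ringI)
  show "abelian_group (free_ring G)"
  proof (rule abelian_groupI)
    fix x assume "x \<in> carrier (free_ring G)"
    then show "\<exists>y\<in>carrier (free_ring G). y \<oplus>\<^bsub>free_ring G\<^esub> x = \<zero>\<^bsub>free_ring G\<^esub>"
      by (intro bexI[of _ "- x"]) (auto intro: FC_uminus)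
  qed (auto intro: FC_add simp: algebra_simps)
  show "monoid (free_ring G)" by (rule monoidI) (auto intro: FC_mult simp: mult.assoc)
qed (auto simp: algebra_simps)

lemma ideal_free_ringI:
  assumes "I \<subseteq> FC G" "0 \<in> I" "\<And>a b. a \<in> I \<Longrightarrow> b \<in> I \<Longrightarrow> a + b \<in> I" "\<And>a. a \<in> I \<Longrightarrow> - a \<in> I"
    "\<And>a x. a \<in> I \<Longrightarrow> x \<in> FC G \<Longrightarrow> x * a \<in> I" "\<And>a x. a \<in> I \<Longrightarrow> x \<in> FC G \<Longrightarrow> a * x \<in> I"
  shows "ideal I (free_ring G)"
proof (rule idealI[OF ring_free_ring])
  interpret ring "free_ring G" by (rule ring_free_ring)
  have inv: "inv\<^bsub>add_monoid (free_ring G)\<^esub> a = - a" if "a \<in> I" for a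
  proof -
    have "\<ominus>\<^bsub>free_ring G\<^esub> a = - a"
      by (rule minus_equality) (use that assms(1) in \<open>auto intro: FC_uminus\<close>)
    then show ?thesis by (simp add: a_inv_def)
  qed
  show "subgroup I (add_monoid (free_ring G))"
    by (rule subgroup.intro) (use assms inv in auto)
qed (use assms in auto)

text \<open>Common ground of the nilCoxeter and the nilHecke algebra, which differ in generators and
  relations only.\<close>

locale free_quot =
  fixes G :: "'g set" and S :: "('g word \<Rightarrow>\<^sub>0 int) set"
  assumes S: "S \<subseteq> FC G"
begin

abbreviation R :: "('g word \<Rightarrow>\<^sub>0 int) ring" where "R \<equiv> free_ring G"
definition J :: "('g word \<Rightarrow>\<^sub>0 int) set" where "J = Idl\<^bsub>R\<^esub> S"
abbreviation Q :: "('g word \<Rightarrow>\<^sub>0 int) set ring" where "Q \<equiv> R Quot J"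
definition cl :: "('g word \<Rightarrow>\<^sub>0 int) \<Rightarrow> ('g word \<Rightarrow>\<^sub>0 int) set" where "cl p = J +>\<^bsub>R\<^esub> p"

sublocale R: ring R by (rule ring_free_ring)
sublocale J: ideal J R unfolding J_def by (rule R.genideal_ideal) (use S in simp)
sublocale Q: ring Q by (rule J.quotient_is_ring)

lemma rel_in: "p \<in> S \<Longrightarrow> p \<in> J"
  unfolding J_def using R.genideal_self[of S] S by auto

lemma J_minimal: "ideal K R \<Longrightarrow> S \<subseteq> K \<Longrightarrow> J \<subseteq> K"
  unfolding J_def by (rule R.genideal_minimal)

lemma J_zero: "0 \<in> J" using J.zero_closed by simp
lemma J_add: "p \<in> J \<Longrightarrow> q \<in> J \<Longrightarrow> p + q \<in> J" using J.a_closed by simp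
lemma J_mult_l: "p \<in> J \<Longrightarrow> q \<in> FC G \<Longrightarrow> q * p \<in> J" using J.I_l_closed by simp
lemma J_mult_r: "p \<in> J \<Longrightarrow> q \<in> FC G \<Longrightarrow> p * q \<in> J" using J.I_r_closed by simp
lemma J_uminus: "p \<in> J \<Longrightarrow> - p \<in> J" using J_mult_l[of p "- 1"] FC_uminus[OF FC_one, of G] by simp

lemma cl_alt: "cl p = {x + p | x. x \<in> J}"
  by (auto simp: cl_def a_r_coset_def r_coset_def)

lemma cl_eq: "cl p = cl q \<longleftrightarrow> p - q \<in> J"
proof
  assume "cl p = cl q"
  moreover have "p \<in> cl p" using J_zero by (auto simp: cl_alt)
  ultimately show "p - q \<in> J" by (auto simp: cl_alt)
next
  assume *: "p - q \<in> J"
  show "cl p = cl q"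
  proof (rule equalityI; rule subsetI)
    fix y assume "y \<in> cl p"
    then obtain x where "x \<in> J" "y = x + p" by (auto simp: cl_alt)
    then show "y \<in> cl q" using J_add[OF _ *, of x] by (auto simp: cl_alt intro!: exI[of _ "x + (p - q)"])
  next
    fix y assume "y \<in> cl q"
    then obtain x where "x \<in> J" "y = x + q" by (auto simp: cl_alt)
    then show "y \<in> cl p" using J_add[OF _ J_uminus[OF *], of x] by (auto simp: cl_alt intro!: exI[of _ "x + (q - p)"])
  qed
qed

lemma carrier_Q: "carrier Q = cl ` FC G"
  by (auto simp: FactRing_def A_RCOSETS_def RCOSETS_def cl_def a_r_coset_def)

lemma cl_hom: "cl \<in> ring_hom R Q"
  using J.rcos_ring_hom by (simp add: cl_def[abs_def])

lemma cl_closed: "p \<in> FC G \<Longrightarrow> cl p \<in> carrier Q" by (simp add: carrier_Q)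
lemma cl_add: "p \<in> FC G \<Longrightarrow> q \<in> FC G \<Longrightarrow> cl p \<oplus>\<^bsub>Q\<^esub> cl q = cl (p + q)"
  using ring_hom_add[OF cl_hom, of p q] by simp
lemma cl_mult: "p \<in> FC G \<Longrightarrow> q \<in> FC G \<Longrightarrow> cl p \<otimes>\<^bsub>Q\<^esub> cl q = cl (p * q)"
  using ring_hom_mult[OF cl_hom, of p q] by simp
lemma cl_zero: "\<zero>\<^bsub>Q\<^esub> = cl 0" by (auto simp: FactRing_def cl_alt)

lemma cl_sum: "finite A \<Longrightarrow> (\<And>i. i \<in> A \<Longrightarrow> f i \<in> FC G) \<Longrightarrow> (\<Oplus>\<^bsub>Q\<^esub>i\<in>A. cl (f i)) = cl (\<Sum>i\<in>A. f i)"
proof (induction A rule: finite_induct)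
  case empty
  then show ?case by (simp add: cl_zero)
next
  case (insert x A)
  have "(\<Oplus>\<^bsub>Q\<^esub>i\<in>insert x A. cl (f i)) = cl (f x) \<oplus>\<^bsub>Q\<^esub> (\<Oplus>\<^bsub>Q\<^esub>i\<in>A. cl (f i))"
    by (rule Q.finsum_insert) (use insert in \<open>auto intro: cl_closed\<close>)
  then show ?case using insert by (simp add: cl_add FC_sum)
qed

lemma cl_uminus: "p \<in> FC G \<Longrightarrow> \<ominus>\<^bsub>Q\<^esub> cl p = cl (- p)"
  by (rule Q.minus_equality) (auto simp: cl_add FC_uminus cl_zero intro: cl_closed)

lemma cl_pow: "p \<in> FC G \<Longrightarrow> [(k::int)] \<cdot>\<^bsub>Q\<^esub> cl p = cl (of_int k * p)"
proof -
  assume p: "p \<in> FC G"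
  have n: "[(m::nat)] \<cdot>\<^bsub>Q\<^esub> cl p = cl (of_nat m * p)" for m
  proof (induction m)
    case 0
    then show ?case by (simp add: add_pow_def cl_zero)
  next
    case (Suc m)
    have "of_nat m * p \<in> FC G" using FC_mult[OF FC_of_int[of "int m"] p] by simp
    then show ?case using Suc p Q.add.nat_pow_Suc[of m "cl p"] by (simp add: cl_add distrib_right add.commute)
  qed
  show ?thesis
  proof (cases "k \<ge> 0")
    case True
    then show ?thesis using n[of "nat k"] add_pow_int_ge[OF True, of Q "cl p"] by simp
  next
    case False
    then have "of_nat (nat (- k)) * p \<in> FC G" using FC_mult[OF FC_of_int[of "- k"] p] by simp
    then show ?thesis using False n[of "nat (- k)"] add_pow_int_lt[of k Q "cl p"] by (simp add: cl_uminus)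
  qed
qed

text \<open>Congruence of representatives, so that the algebra takes place in the free ring with its
  ordinary operations.\<close>

definition eqv :: "('g word \<Rightarrow>\<^sub>0 int) \<Rightarrow> ('g word \<Rightarrow>\<^sub>0 int) \<Rightarrow> bool" where
  "eqv p q \<longleftrightarrow> p - q \<in> J"

lemma eqv_refl [simp]: "eqv p p" by (simp add: eqv_def J_zero)
lemma eqv_sym: "eqv p q \<Longrightarrow> eqv q p" using J_uminus[of "p - q"] by (simp add: eqv_def)
lemma eqv_trans [trans]: "eqv p q \<Longrightarrow> eqv q r \<Longrightarrow> eqv p r"
  using J_add[of "p - q" "q - r"] by (simp add: eqv_def)
lemma eqv_add: "eqv p q \<Longrightarrow> eqv p' q' \<Longrightarrow> eqv (p + p') (q + q')"
  using J_add[of "p - q" "p' - q'"] by (simp add: eqv_def algebra_simps)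
lemma eqv_mult_l: "eqv p q \<Longrightarrow> r \<in> FC G \<Longrightarrow> eqv (r * p) (r * q)"
  using J_mult_l[of "p - q" r] by (simp add: eqv_def algebra_simps)
lemma eqv_mult_r: "eqv p q \<Longrightarrow> r \<in> FC G \<Longrightarrow> eqv (p * r) (q * r)"
  using J_mult_r[of "p - q" r] by (simp add: eqv_def algebra_simps)
lemma eqv_sum: "(\<And>i. i \<in> A \<Longrightarrow> eqv (f i) (g i)) \<Longrightarrow> eqv (\<Sum>i\<in>A. f i) (\<Sum>i\<in>A. g i)"
  by (induction A rule: infinite_finite_induct) (auto intro: eqv_add)
lemma eqv_rel: "p - q \<in> S \<Longrightarrow> eqv p q" by (simp add: eqv_def rel_in)
lemma eqv_cl: "eqv p q \<longleftrightarrow> cl p = cl q" by (simp add: eqv_def cl_eq)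

end

section \<open>The nilHecke algebra\<close>

context affine_C begin

definition G0 :: "gen set" where "G0 = {GA i | i. i \<le> n}"
definition G1 :: "gen set" where "G1 = G0 \<union> {GS p | p. p \<in> sym_alg n}"

definition aw :: "nat list \<Rightarrow> gen word \<Rightarrow>\<^sub>0 int" where "aw u = word_monom (map GA u)"
definition sc :: "spoly \<Rightarrow> gen word \<Rightarrow>\<^sub>0 int" where "sc p = word_monom [GS p]"

lemma GA_G0 [simp]: "GA i \<in> G0 \<longleftrightarrow> i \<le> n" by (auto simp: G0_def)
lemma GA_G1 [simp]: "GA i \<in> G1 \<longleftrightarrow> i \<le> n" by (auto simp: G1_def)
lemma GS_G1 [simp]: "GS p \<in> G1 \<longleftrightarrow> p \<in> sym_alg n" by (auto simp: G1_def G0_def)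
lemma G0_G1: "G0 \<subseteq> G1" by (auto simp: G1_def)

lemma aw_FC0 [simp]: "u \<in> Wd \<Longrightarrow> aw u \<in> FC G0" by (auto simp: aw_def)
lemma aw_FC1 [simp]: "u \<in> Wd \<Longrightarrow> aw u \<in> FC G1" by (auto simp: aw_def)
lemma sc_FC1 [simp]: "p \<in> sym_alg n \<Longrightarrow> sc p \<in> FC G1" by (auto simp: sc_def)
lemma aw_append: "aw (u @ v) = aw u * aw v" by (simp add: aw_def word_monom_append)
lemma aw_Cons: "aw (i # u) = aw [i] * aw u" using aw_append[of "[i]" u] by simp
lemma aw_Nil [simp]: "aw [] = 1" by (simp add: aw_def word_monom_Nil)

lemma linear_poly_in: "linear_poly n l \<in> sym_alg n"
proof -
  have "(\<Sum>j\<in>K. of_int (l j) * xvar j) \<in> polys_in {1..n}" if "finite K" "K \<subseteq> {1..n}" for K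
    using that
  proof (induction K)
    case empty
    then show ?case using polys_in.const[of 0] by simp
  next
    case (insert j K)
    then show ?case
      by (auto intro!: polys_in.add polys_in_mult xvar_in polys_in.const)
  qed
  then show ?thesis unfolding sym_alg_eq linear_poly_eq by blast
qed

lemma nilCoxeter_rels_FC: "nilCoxeter_rels n \<subseteq> FC G0"
proof
  fix p assume "p \<in> nilCoxeter_rels n"
  then consider i where "p = aw [i, i]" "i \<le> n" | u v where "p = aw u - aw v" "(u, v) \<in> braid_rels n"
    by (auto simp: nilCoxeter_rels_def aw_def)
  then show "p \<in> FC G0"
  proof cases
    case 1
    then show ?thesis by simp
  next
    case 2
    show ?thesis unfolding 2(1) using braid_rels_Wd[OF 2(2)] by (intro FC_diff aw_FC0) simp_all
  qed
qed

lemma nilHecke_rels_cases: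
  assumes "x \<in> nilHecke_rels n"
  obtains "x \<in> nilCoxeter_rels n"
  | p q where "x = sc p + sc q - sc (p + q)" "p \<in> sym_alg n" "q \<in> sym_alg n"
  | p q where "x = sc p * sc q - sc (p * q)" "p \<in> sym_alg n" "q \<in> sym_alg n"
  | "x = sc 1 - 1"
  | i l where "x = aw [i] * sc (linear_poly n l)
      - (sc (linear_poly n (reflect n i l)) * aw [i] + of_int (pairing n i l))" "i \<le> n" "l \<in> weights n"
proof -
  have 1: "word_monom [a, b] = word_monom [a] * word_monom [b]" for a b :: gen
    using word_monom_append[of "[a]" "[b]"] by simp
  show ?thesis
    using assms that unfolding nilHecke_rels_def by (auto simp: sc_def aw_def 1)
qed

lemma sym_alg_intros: "p \<in> sym_alg n \<Longrightarrow> q \<in> sym_alg n \<Longrightarrow> p + q \<in> sym_alg n"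
  "p \<in> sym_alg n \<Longrightarrow> q \<in> sym_alg n \<Longrightarrow> p * q \<in> sym_alg n" "of_int c \<in> sym_alg n"
  "0 \<in> sym_alg n" "1 \<in> sym_alg n"
  unfolding sym_alg_eq using polys_in.const[of 0] polys_in.const[of 1]
  by (auto intro: polys_in.intros polys_in_mult)

lemma nilHecke_rels_FC: "nilHecke_rels n \<subseteq> FC G1"
proof
  fix x assume "x \<in> nilHecke_rels n"
  then show "x \<in> FC G1"
  proof (cases rule: nilHecke_rels_cases)
    case 1
    then show ?thesis using nilCoxeter_rels_FC FC_mono[OF G0_G1] by blast
  qed (auto intro!: FC_diff FC_add FC_mult sc_FC1 sym_alg_intros linear_poly_in)
qed

sublocale C: free_quot G0 "nilCoxeter_rels n" by (rule free_quot.intro, rule nilCoxeter_rels_FC)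
sublocale H: free_quot G1 "nilHecke_rels n" by (rule free_quot.intro, rule nilHecke_rels_FC)

lemma nilCoxeter_Q: "nilCoxeter_free n = C.R" "nilCoxeter_ideal n = C.J" "nilCoxeter n = C.Q"
  unfolding nilCoxeter_free_def nilCoxeter_ideal_def nilCoxeter_def C.J_def G0_def[symmetric] by (rule HOL.refl)+

lemma nilHecke_Q: "nilHecke_free n = H.R" "nilHecke_ideal n = H.J" "nilHecke n = H.Q"
  unfolding nilHecke_free_def nilHecke_ideal_def nilHecke_def H.J_def G1_def[unfolded G0_def, symmetric]
  by (rule HOL.refl)+

section \<open>Evaluation in the representation\<close>

primrec gev :: "gen \<Rightarrow> endo" where
  "gev (GA i) = opA i"
| "gev (GS p) = opS p"

definition ev :: "(gen word \<Rightarrow>\<^sub>0 int) \<Rightarrow> endo" where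
  "ev = pm_ev (\<lambda>w. prod_list (map gev (letters w)))"

lemma ev_add: "ev (p + q) = ev p + ev q" by (simp add: ev_def pm_ev_add)
lemma ev_uminus: "ev (- p) = - ev p" by (simp add: ev_def pm_ev_uminus)
lemma ev_diff: "ev (p - q) = ev p - ev q" by (simp add: ev_def pm_ev_diff)
lemma ev_zero [simp]: "ev 0 = 0" by (simp add: ev_def)
lemma ev_sum: "ev (\<Sum>i\<in>I. f i) = (\<Sum>i\<in>I. ev (f i))" by (simp add: ev_def pm_ev_sum)
lemma ev_mult: "ev (p * q) = ev p * ev q"
  unfolding ev_def by (rule pm_ev_mult) (simp add: plus_word_def)
lemma ev_of_int [simp]: "ev (of_int c) = of_int c"
  unfolding ev_def by (rule pm_ev_of_int) (simp add: zero_word_def)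
lemma ev_one [simp]: "ev 1 = 1" using ev_of_int[of 1] by simp
lemma ev_word_monom: "ev (word_monom gs) = prod_list (map gev gs)"
  by (simp add: ev_def word_monom_def)
lemma ev_aw [simp]: "ev (aw u) = opW u"
  by (simp add: aw_def ev_word_monom opW_def o_def)
lemma ev_sc [simp]: "ev (sc p) = opS p"
  by (simp add: sc_def ev_word_monom)

lemma ddiff_linear: "i \<le> n \<Longrightarrow> ddiff n i (linear_poly n l) = of_int (pairing n i l)"
  by (rule ddiff_unique) (simp_all add: linear_poly_reflect)

lemma ev_nilCoxeter_rels: "x \<in> nilCoxeter_rels n \<Longrightarrow> ev x = 0"
proof -
  assume "x \<in> nilCoxeter_rels n"
  then consider i where "x = aw [i, i]" "i \<le> n" | u v where "x = aw u - aw v" "(u, v) \<in> braid_rels n"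
    by (auto simp: nilCoxeter_rels_def aw_def)
  then show ?thesis
    by cases (simp_all add: ev_diff opW_Cons opA_sq opW_braid)
qed

text \<open>The kernel of the evaluation is an ideal that contains the relations; so the operators
  define a representation of the nilHecke algebra.\<close>

lemma ev_H: "x \<in> H.J \<Longrightarrow> ev x = 0"
proof -
  let ?K = "{p \<in> FC G1. ev p = 0}"
  have "ideal ?K H.R"
    by (rule ideal_free_ringI) (auto simp: ev_add ev_mult ev_uminus intro: FC_add FC_mult FC_uminus)
  moreover have "nilHecke_rels n \<subseteq> ?K"
  proof
    fix x assume x: "x \<in> nilHecke_rels n"
    then have "ev x = 0"
    proof (cases rule: nilHecke_rels_cases)
      case (5 i l)
      then show ?thesis
        using opA_opS[of i "linear_poly n l"] ddiff_linear[of i l] linear_poly_reflect(1)[of i n l]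
        by (simp add: ev_diff ev_add ev_mult opW_Cons)
    qed (simp_all add: ev_nilCoxeter_rels ev_diff ev_add ev_mult opS_add opS_mult)
    then show "x \<in> ?K" using x nilHecke_rels_FC by auto
  qed
  ultimately have "H.J \<subseteq> ?K" by (rule H.J_minimal)
  then show "x \<in> H.J \<Longrightarrow> ev x = 0" by blast
qed

text \<open>Makes \<open>incl\<close> well defined: all representatives of a nilCoxeter class lie in
  one nilHecke class.\<close>

lemma C_J_subset: "C.J \<subseteq> H.J"
proof -
  have "ideal (H.J \<inter> FC G0) C.R"
    by (rule ideal_free_ringI)
      (auto simp: H.J_zero intro: H.J_add H.J_uminus H.J_mult_l H.J_mult_r FC_add FC_mult FC_uminus FC_mono[OF G0_G1])
  moreover have "nilCoxeter_rels n \<subseteq> H.J \<inter> FC G0"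
  proof -
    have "nilCoxeter_rels n \<subseteq> nilHecke_rels n" unfolding nilHecke_rels_def by blast
    then show ?thesis using nilCoxeter_rels_FC H.rel_in by blast
  qed
  ultimately show ?thesis using C.J_minimal by blast
qed

lemma C_eqv_H: "C.eqv p q \<Longrightarrow> H.eqv p q"
  using C_J_subset by (auto simp: C.eqv_def H.eqv_def)

lemma ev_eqv: "H.eqv p q \<Longrightarrow> ev p = ev q"
  using ev_H[of "p - q"] by (simp add: H.eqv_def ev_diff)

lemma aw_beq: "beq u v \<Longrightarrow> C.eqv (aw u) (aw v)"
proof (induction rule: beq.induct)
  case (rel u v x y)
  have "aw u - aw v \<in> nilCoxeter_rels n" using rel(1) by (auto simp: nilCoxeter_rels_def aw_def)
  then show ?case using rel unfolding aw_append
    by (intro C.eqv_mult_l C.eqv_mult_r C.eqv_rel) auto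
qed (auto intro: C.eqv_sym C.eqv_trans)

text \<open>Read from the right, the first letter that destroys reducedness is a left descent of the
  reduced word behind it. Braid moves bring the same letter to the front of that word, and a square
  appears.\<close>

lemma aw_not_red: "u \<in> Wd \<Longrightarrow> \<not> red u \<Longrightarrow> C.eqv (aw u) 0"
proof (induction u rule: list.induct)
  case (Cons i u)
  then have i: "i \<le> n" and u: "u \<in> Wd" by auto
  show ?case
  proof (cases "red u")
    case False
    then show ?thesis using C.eqv_mult_l[of "aw u" 0 "aw [i]"] Cons.IH[OF u] i
      by (simp add: aw_Cons[of i u])
  next
    case True
    then have "desc (pa (rev u)) i" using Cons.prems red_Cons_iff[OF True i] by simp
    then obtain w where w: "red (i # w)" "pa (i # w) = pa u" using desc_exchange[OF True i] by metis
    have "C.eqv (aw (i # u)) (aw [i] * aw (i # w))"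
      using aw_beq[OF red_beq[OF True w(1) w(2)[symmetric]]] i by (subst aw_Cons) (auto intro: C.eqv_mult_l)
    also have "aw [i] * aw (i # w) = aw [i, i] * aw w"
      by (simp add: aw_Cons[of i w] aw_Cons[of i "[i]"] mult.assoc)
    also have "C.eqv (aw [i, i] * aw w) (0 * aw w)"
      by (intro C.eqv_mult_r C.eqv_rel)
        (use i red_Wd[OF red_Cons[OF w(1)]] in \<open>auto simp: nilCoxeter_rels_def aw_def\<close>)
    finally show ?thesis by simp
  qed
qed auto

text \<open>Here \<open>h\<close> is the permutation of the inverse element, whence the reversal.
  The choice coincides with the one made in \<open>nilA\<close> (\<open>rw_hof\<close>).\<close>

definition rw :: "(state \<Rightarrow> state) \<Rightarrow> nat list" where
  "rw h = (SOME u. red u \<and> pa (rev u) = h)"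

lemma GG_red: "h \<in> GG \<Longrightarrow> \<exists>u. red u \<and> pa (rev u) = h"
proof -
  assume "h \<in> GG"
  then obtain x where x: "x \<in> Wd" "h = pa x" by (auto simp: GG_def)
  have rx: "rev x \<in> Wd" using x by auto
  then obtain w where w: "red w" "pa w = pa (rev x)" using ex_red by blast
  then have "pa (rev w) = pa (rev (rev x))" using pa_rev_eq[OF red_Wd[OF w(1)] rx] by simp
  then show ?thesis using w x by auto
qed

lemma rw: "h \<in> GG \<Longrightarrow> red (rw h)" "h \<in> GG \<Longrightarrow> pa (rev (rw h)) = h"
  using someI_ex[OF GG_red[of h]] by (auto simp: rw_def)

lemma rw_Wd: "h \<in> GG \<Longrightarrow> rw h \<in> Wd" by (simp add: rw red_Wd)

lemma red_GG: "u \<in> Wd \<Longrightarrow> pa (rev u) \<in> GG" by (auto simp: GG_def)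

lemma aw_rw: "red u \<Longrightarrow> C.eqv (aw u) (aw (rw (pa (rev u))))"
proof -
  assume u: "red u"
  have g: "pa (rev u) \<in> GG" by (rule red_GG[OF red_Wd[OF u]])
  have "pa (rw (pa (rev u))) = pa u"
    using pa_rev_eq[OF rw_Wd[OF g] red_Wd[OF u]] rw(2)[OF g] by simp
  then show ?thesis using aw_beq[OF red_beq[OF u rw(1)[OF g]]] by simp
qed

definition hof :: "nat list set \<Rightarrow> state \<Rightarrow> state" where
  "hof w = pa (rev (SOME u. u \<in> reduced_words w))"

definition cof :: "(state \<Rightarrow> state) \<Rightarrow> nat list set" where "cof h = cls (rw h)"

lemma hof_cls: "u \<in> Wd \<Longrightarrow> hof (cls u) = pa (rev u)"
proof -
  assume u: "u \<in> Wd"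
  obtain v where v: "red v" "pa v = pa u" using ex_red[OF u] by blast
  have c: "cls u = cls v" using cls_inject[OF u red_Wd[OF v(1)]] v by simp
  have "(SOME w. w \<in> reduced_words (cls u)) \<in> reduced_words (cls v)"
    unfolding c by (rule someI[of _ v]) (use v reduced_words_cls in auto)
  then have *: "red (SOME w. w \<in> reduced_words (cls u))" "pa (SOME w. w \<in> reduced_words (cls u)) = pa v"
    unfolding reduced_words_cls[OF v(1)] by auto
  then show ?thesis unfolding hof_def using pa_rev_eq[OF red_Wd[OF *(1)] u] v by simp
qed

lemma hof_GG: "w \<in> carrier CG \<Longrightarrow> hof w \<in> GG"
  by (erule carrier_E) (use hof_cls red_GG in auto)

lemma hof_inj: "w \<in> carrier CG \<Longrightarrow> w' \<in> carrier CG \<Longrightarrow> hof w = hof w' \<Longrightarrow> w = w'"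
  by (metis carrier_E cls_inject hof_cls pa_rev_eq)

lemma cof_carrier: "h \<in> GG \<Longrightarrow> cof h \<in> carrier CG"
  unfolding cof_def by (rule cls_carrier) (rule rw_Wd)

lemma hof_cof: "h \<in> GG \<Longrightarrow> hof (cof h) = h"
  unfolding cof_def by (simp add: hof_cls rw_Wd rw)

lemma cof_hof: "w \<in> carrier CG \<Longrightarrow> cof (hof w) = w"
  by (rule hof_inj) (simp_all add: hof_cof cof_carrier hof_GG)

lemma rw_hof: "w \<in> carrier CG \<Longrightarrow> rw (hof w) = (SOME u. u \<in> reduced_words w)"
proof -
  assume "w \<in> carrier CG"
  then obtain v where v: "red v" "w = cls v" using ex_red_cls by blast
  have "red u \<and> pa (rev u) = hof w \<longleftrightarrow> u \<in> reduced_words w" for u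
    unfolding v(2) reduced_words_cls[OF v(1)] hof_cls[OF red_Wd[OF v(1)]] mem_Collect_eq
    using pa_rev_eq[OF _ red_Wd[OF v(1)]] red_Wd by blast
  then show ?thesis by (simp add: rw_def)
qed

lemma nilA_eq: "w \<in> carrier CG \<Longrightarrow> nilA n w = C.cl (aw (rw (hof w)))"
  by (simp add: nilA_def rw_hof aw_def C.cl_def nilCoxeter_Q)

lemma incl_cl: "p \<in> FC G0 \<Longrightarrow> incl n (C.cl p) = H.cl p"
proof -
  assume p: "p \<in> FC G0"
  have "H.cl x = H.cl p" if "x \<in> C.cl p" for x
    using that C_J_subset by (auto simp: C.cl_alt H.cl_eq)
  moreover have "p \<in> C.cl p" using C.J_zero by (auto simp: C.cl_alt)
  ultimately show ?thesis unfolding incl_def nilHecke_Q H.cl_def[symmetric] by blast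
qed

text \<open>The coefficients of an element in the basis, read off from its action on the unit vector.\<close>

definition vec :: "(gen word \<Rightarrow>\<^sub>0 int) \<Rightarrow> modl" where "vec p = app (ev p) (bas id)"

definition good :: "modl \<Rightarrow> bool" where
  "good x \<longleftrightarrow> Poly_Mapping.keys x \<subseteq> GG \<and> (\<forall>h. Poly_Mapping.lookup x h \<in> sym_alg n)"

text \<open>Writes a vector back as a combination of the chosen \<open>A_w\<close> with coefficients
  on the left; by \<open>expand_vec\<close> this recovers an element from its vector modulo the
  relations.\<close>

definition expand :: "modl \<Rightarrow> gen word \<Rightarrow>\<^sub>0 int" where
  "expand x = (\<Sum>h\<in>Poly_Mapping.keys x. sc (Poly_Mapping.lookup x h) * aw (rw h))"

lemma sc_add: "p \<in> sym_alg n \<Longrightarrow> q \<in> sym_alg n \<Longrightarrow> H.eqv (sc p + sc q) (sc (p + q))"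
  by (rule H.eqv_rel) (auto simp: nilHecke_rels_def sc_def)

lemma sc_mult: "p \<in> sym_alg n \<Longrightarrow> q \<in> sym_alg n \<Longrightarrow> H.eqv (sc p * sc q) (sc (p * q))"
  by (rule H.eqv_rel) (auto simp: nilHecke_rels_def sc_def word_monom_append[symmetric])

lemma sc_one: "H.eqv (sc 1) 1"
  by (rule H.eqv_rel) (auto simp: nilHecke_rels_def sc_def)

lemma sc_zero: "H.eqv (sc 0) 0"
proof -
  have "H.eqv (sc 0 + sc 0 + - sc 0) (sc 0 + - sc 0)"
    using H.eqv_add[OF sc_add[of 0 0] H.eqv_refl[of "- sc 0"]] sym_alg_intros by simp
  then show ?thesis by simp
qed

text \<open>The relations identify only the polynomial 1 with the unit. Additivity extends this to
  the integers, the negative ones through \<open>sc 0\<close>.\<close>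

lemma sc_of_int: "H.eqv (sc (of_int c)) (of_int c)"
proof -
  have n: "H.eqv (sc (of_nat k)) (of_nat k)" for k
  proof (induction k)
    case 0
    then show ?case using sc_zero by simp
  next
    case (Suc k)
    have "H.eqv (sc (1 + of_nat k)) (sc 1 + sc (of_nat k))"
      using sc_add[of 1 "of_nat k"] sym_alg_intros(5) sym_alg_intros(3)[of "int k"] H.eqv_sym by simp
    then show ?case using H.eqv_trans H.eqv_add[OF sc_one Suc] by simp
  qed
  show ?thesis
  proof (cases "c \<ge> 0")
    case True
    then show ?thesis using n[of "nat c"] by simp
  next
    case False
    have "H.eqv (sc (of_int c) + sc (of_int (- c))) (sc (of_int c + of_int (- c)))"
      by (intro sc_add sym_alg_intros)
    also have "of_int c + of_int (- c) = (0 :: spoly)" by simp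
    also note sc_zero
    finally have "H.eqv (sc (of_int c) + sc (of_int (- c))) 0" .
    moreover have "H.eqv (sc (of_int (- c))) (of_int (- c))" using n[of "nat (- c)"] False by simp
    ultimately have "sc (of_int c) + sc (of_int (- c)) - 0 - (sc (of_int (- c)) - of_int (- c)) \<in> H.J"
      using H.J_add H.J_uminus unfolding H.eqv_def by (metis (no_types) diff_conv_add_uminus)
    then show ?thesis by (simp add: H.eqv_def)
  qed
qed

text \<open>The presentation states the commutation for weights; the twisted Leibniz rule carries it
  to products and thus to all of \<open>Sym(P)\<close>.\<close>

lemma aw_sc:
  assumes "f \<in> sym_alg n" "i \<le> n"
  shows "H.eqv (aw [i] * sc f) (sc (srefl n i f) * aw [i] + sc (ddiff n i f))"
  using assms(1) unfolding sym_alg_eq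
proof (induction rule: polys_in.induct)
  case (const c)
  have "H.eqv (aw [i] * sc (of_int c)) (aw [i] * of_int c)"
    by (rule H.eqv_mult_l[OF sc_of_int]) (simp add: assms)
  also have "aw [i] * of_int c = of_int c * aw [i] + 0"
    by (simp add: mult_of_int_commute)
  also have "H.eqv \<dots> (sc (of_int c) * aw [i] + sc 0)"
    by (intro H.eqv_add H.eqv_mult_r H.eqv_sym[OF sc_of_int] H.eqv_sym[OF sc_zero]) (simp add: assms)
  finally show ?case using assms by simp
next
  case (add p q)
  note s = add(1,2)[folded sym_alg_eq]
  have s': "srefl n i p \<in> sym_alg n" "srefl n i q \<in> sym_alg n" "ddiff n i p \<in> sym_alg n" "ddiff n i q \<in> sym_alg n"
    using s srefl_in ddiff_in assms by (simp_all add: sym_alg_eq)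
  have "H.eqv (aw [i] * sc (p + q)) (aw [i] * (sc p + sc q))"
    by (intro H.eqv_mult_l H.eqv_sym[OF sc_add] s) (simp add: assms)
  also have "aw [i] * (sc p + sc q) = aw [i] * sc p + aw [i] * sc q" by (rule distrib_left)
  also have "H.eqv \<dots> ((sc (srefl n i p) * aw [i] + sc (ddiff n i p)) + (sc (srefl n i q) * aw [i] + sc (ddiff n i q)))"
    by (rule H.eqv_add[OF add(3,4)])
  also have "\<dots> = (sc (srefl n i p) + sc (srefl n i q)) * aw [i] + (sc (ddiff n i p) + sc (ddiff n i q))"
    by (simp add: algebra_simps)
  also have "H.eqv \<dots> (sc (srefl n i p + srefl n i q) * aw [i] + sc (ddiff n i p + ddiff n i q))"
    by (intro H.eqv_add H.eqv_mult_r sc_add s') (simp add: assms)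
  finally show ?case using assms by (simp add: srefl_add ddiff_add)
next
  case (var p j)
  note s = var(1)[folded sym_alg_eq]
  have s': "srefl n i p \<in> sym_alg n" "ddiff n i p \<in> sym_alg n"
    using s srefl_in ddiff_in assms by (simp_all add: sym_alg_eq)
  let ?l = "\<lambda>k. if k = j then 1 else 0 :: int"
  have lx: "linear_poly n ?l = xvar j"
  proof -
    have "linear_poly n ?l = (\<Sum>k=1..n. if k = j then xvar j else 0)"
      unfolding linear_poly_eq by (rule sum.cong) auto
    then show ?thesis using var(2) by simp
  qed
  have x: "xvar j \<in> sym_alg n" and x': "srefl n i (xvar j) \<in> sym_alg n"
    unfolding sym_alg_eq using srefl_in[OF xvar_in[OF var(2)]] xvar_in[OF var(2)] by blast+
  define c where "c = pairing n i ?l"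
  have dx: "ddiff n i (xvar j) = of_int c" using ddiff_linear[OF assms(2), of ?l] lx c_def by simp
  have rx: "H.eqv (aw [i] * sc (xvar j)) (sc (srefl n i (xvar j)) * aw [i] + of_int c)"
  proof (rule H.eqv_rel)
    have "?l \<in> weights n" using var(2) by (auto simp: weights_def)
    then have "word_monom [GA i, GS (linear_poly n ?l)]
        - (word_monom [GS (linear_poly n (reflect n i ?l)), GA i] + of_int (pairing n i ?l)) \<in> nilHecke_rels n"
      using assms(2) unfolding nilHecke_rels_def by blast
    then show "aw [i] * sc (xvar j) - (sc (srefl n i (xvar j)) * aw [i] + of_int c) \<in> nilHecke_rels n"
      unfolding linear_poly_reflect(1)[OF assms(2)] lx c_def[symmetric]
      by (simp add: aw_def sc_def word_monom_append[symmetric])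
  qed
  have a: "aw [i] \<in> FC G1" using assms by simp
  have "H.eqv (aw [i] * sc (xvar j * p)) (aw [i] * (sc (xvar j) * sc p))"
    by (intro H.eqv_mult_l H.eqv_sym[OF sc_mult] s x a)
  also have "\<dots> = (aw [i] * sc (xvar j)) * sc p" by (simp add: mult.assoc)
  also have "H.eqv \<dots> ((sc (srefl n i (xvar j)) * aw [i] + of_int c) * sc p)"
    by (intro H.eqv_mult_r rx) (simp add: s)
  also have "\<dots> = sc (srefl n i (xvar j)) * (aw [i] * sc p) + of_int c * sc p"
    by (simp add: algebra_simps)
  also have "H.eqv \<dots> (sc (srefl n i (xvar j)) * (sc (srefl n i p) * aw [i] + sc (ddiff n i p)) + sc (of_int c) * sc p)"
    by (intro H.eqv_add H.eqv_mult_l H.eqv_mult_r var(3) H.eqv_sym[OF sc_of_int]) (simp_all add: s x')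
  also have "\<dots> = (sc (srefl n i (xvar j)) * sc (srefl n i p)) * aw [i]
      + (sc (of_int c) * sc p + sc (srefl n i (xvar j)) * sc (ddiff n i p))"
    by (simp add: algebra_simps)
  also have "H.eqv \<dots> (sc (srefl n i (xvar j) * srefl n i p) * aw [i]
      + (sc (of_int c * p) + sc (srefl n i (xvar j) * ddiff n i p)))"
    by (intro H.eqv_add H.eqv_mult_r sc_mult s s' x' a sym_alg_intros)
  also have "H.eqv \<dots> (sc (srefl n i (xvar j) * srefl n i p) * aw [i]
      + sc (of_int c * p + srefl n i (xvar j) * ddiff n i p))"
    by (intro H.eqv_add H.eqv_refl sc_add s s' x' sym_alg_intros)
  finally show ?case using assms by (simp add: srefl_mult ddiff_mult dx)
qed

lemma keys_subset_sum_eq: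
  assumes "finite K" "Poly_Mapping.keys x \<subseteq> K" "\<And>h. f h 0 = 0"
  shows "(\<Sum>h\<in>K. f h (Poly_Mapping.lookup x h)) = (\<Sum>h\<in>Poly_Mapping.keys x. f h (Poly_Mapping.lookup x h))"
  by (rule sum.mono_neutral_right) (use assms in \<open>auto simp: in_keys_iff\<close>)

lemma good_lookup: "good x \<Longrightarrow> Poly_Mapping.lookup x h \<in> sym_alg n" by (simp add: good_def)

lemma good_add: "good x \<Longrightarrow> good y \<Longrightarrow> good (x + y)"
  using keys_add[of x y] by (auto simp: good_def lookup_add sym_alg_intros)

lemma good_single: "h \<in> GG \<Longrightarrow> f \<in> sym_alg n \<Longrightarrow> good (Poly_Mapping.single h f)"
  using sym_alg_intros(4) by (auto simp: good_def lookup_single when_def)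

lemma good_zero [simp]: "good 0" using sym_alg_intros(4) by (simp add: good_def)

lemma good_induct [consumes 1, case_names zero add single]:
  assumes "good x" "P 0" "\<And>x y. good x \<Longrightarrow> good y \<Longrightarrow> P x \<Longrightarrow> P y \<Longrightarrow> P (x + y)"
    "\<And>h f. h \<in> GG \<Longrightarrow> f \<in> sym_alg n \<Longrightarrow> P (Poly_Mapping.single h f)"
  shows "P x"
proof -
  let ?s = "\<lambda>K. \<Sum>h\<in>K. Poly_Mapping.single h (Poly_Mapping.lookup x h)"
  have "P (?s K) \<and> good (?s K)" if "finite K" "K \<subseteq> Poly_Mapping.keys x" for K
    using that
  proof (induction K)
    case (insert h K)
    have h: "h \<in> GG" "Poly_Mapping.lookup x h \<in> sym_alg n"
      using assms(1) insert by (auto simp: good_def)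
    show ?case using insert assms(3)[OF good_single[OF h]] assms(4)[OF h] good_add[OF good_single[OF h]]
      by simp
  qed (use assms(2) in auto)
  then have "P (?s (Poly_Mapping.keys x))" by simp
  then show ?thesis using poly_mapping_decomp[of x] by simp
qed

lemma expand_superset:
  assumes "finite K" "Poly_Mapping.keys x \<subseteq> K" "K \<subseteq> GG"
  shows "H.eqv (\<Sum>h\<in>K. sc (Poly_Mapping.lookup x h) * aw (rw h)) (expand x)"
proof -
  let ?f = "\<lambda>h. sc (Poly_Mapping.lookup x h) * aw (rw h)"
  have "(\<Sum>h\<in>K. ?f h) = (\<Sum>h\<in>K - Poly_Mapping.keys x. ?f h) + expand x"
    unfolding expand_def by (rule sum.subset_diff) (use assms in auto)
  also have "H.eqv \<dots> ((\<Sum>h\<in>K - Poly_Mapping.keys x. 0 * aw (rw h)) + expand x)"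
  proof (intro H.eqv_add H.eqv_refl H.eqv_sum)
    fix h assume h: "h \<in> K - Poly_Mapping.keys x"
    have "H.eqv (sc 0 * aw (rw h)) (0 * aw (rw h))"
      by (rule H.eqv_mult_r[OF sc_zero]) (use h assms in \<open>auto intro!: aw_FC1 rw_Wd\<close>)
    then show "H.eqv (?f h) (0 * aw (rw h))" using h by (simp add: in_keys_iff)
  qed
  finally show ?thesis by simp
qed

lemma expand_add:
  assumes "good x" "good y"
  shows "H.eqv (expand x + expand y) (expand (x + y))"
proof -
  let ?K = "Poly_Mapping.keys x \<union> Poly_Mapping.keys y"
  have K: "finite ?K" "?K \<subseteq> GG" using assms by (auto simp: good_def)
  have "H.eqv (expand x + expand y) ((\<Sum>h\<in>?K. sc (Poly_Mapping.lookup x h) * aw (rw h)) + (\<Sum>h\<in>?K. sc (Poly_Mapping.lookup y h) * aw (rw h)))"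
    by (intro H.eqv_add H.eqv_sym[OF expand_superset]) (use K in auto)
  also have "\<dots> = (\<Sum>h\<in>?K. (sc (Poly_Mapping.lookup x h) + sc (Poly_Mapping.lookup y h)) * aw (rw h))"
    by (simp add: sum.distrib distrib_right)
  also have "H.eqv \<dots> (\<Sum>h\<in>?K. sc (Poly_Mapping.lookup x h + Poly_Mapping.lookup y h) * aw (rw h))"
    by (intro H.eqv_sum H.eqv_mult_r sc_add good_lookup assms aw_FC1 rw_Wd) (use K in auto)
  also have "\<dots> = (\<Sum>h\<in>?K. sc (Poly_Mapping.lookup (x + y) h) * aw (rw h))" by (simp add: lookup_add)
  also have "H.eqv \<dots> (expand (x + y))"
    by (rule expand_superset) (use K keys_add[of x y] in auto)
  finally show ?thesis .
qed

lemma expand_single: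
  assumes "h \<in> GG"
  shows "H.eqv (sc f * aw (rw h)) (expand (Poly_Mapping.single h f))"
  using expand_superset[of "{h}" "Poly_Mapping.single h f"] assms by simp

lemma asc_red:
  assumes "h \<in> GG" "i \<le> n"
  shows "h (xe i) \<prec> h (ye i) \<longleftrightarrow> red (i # rw h)"
proof -
  have r: "rev (rw h) \<in> Wd" using rw_Wd[OF assms(1)] by auto
  show ?thesis
    using asc_iff[OF r assms(2)] red_Cons_iff[OF rw(1)[OF assms(1)] assms(2)] rw(2)[OF assms(1)] by simp
qed

lemma GG_act: "h \<in> GG \<Longrightarrow> i \<le> n \<Longrightarrow> h \<circ> act i \<in> GG"
proof -
  assume "h \<in> GG" "i \<le> n"
  then obtain x where "x \<in> Wd" "h = pa x" by (auto simp: GG_def)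
  then have "x @ [i] \<in> Wd" "h \<circ> act i = pa (x @ [i])" using \<open>i \<le> n\<close> by (auto simp: pa_append)
  then show ?thesis unfolding GG_def by blast
qed

lemma aw_act:
  assumes "h \<in> GG" "i \<le> n"
  shows "C.eqv (aw [i] * aw (rw h)) (if h (xe i) \<prec> h (ye i) then aw (rw (h \<circ> act i)) else 0)"
proof -
  have W: "i # rw h \<in> Wd" using rw_Wd[OF assms(1)] assms(2) by auto
  have e: "pa (rev (i # rw h)) = h \<circ> act i" using rw(2)[OF assms(1)] by (simp add: pa_append)
  have "C.eqv (aw (i # rw h)) (if red (i # rw h) then aw (rw (h \<circ> act i)) else 0)"
    using aw_rw[of "i # rw h"] aw_not_red[OF W] e by auto
  then show ?thesis unfolding asc_red[OF assms] aw_Cons[of i "rw h"] .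
qed

lemma opA_good:
  assumes "i \<le> n" "good x"
  shows "good (app (opA i) x) \<and> H.eqv (aw [i] * expand x) (expand (app (opA i) x))"
  using assms(2)
proof (induction rule: good_induct)
  case zero
  then show ?case by (simp add: expand_def)
next
  case (add x y)
  have "H.eqv (aw [i] * expand (x + y)) (aw [i] * (expand x + expand y))"
    by (intro H.eqv_mult_l H.eqv_sym[OF expand_add] add) (use assms in simp)
  also have "\<dots> = aw [i] * expand x + aw [i] * expand y" by (rule distrib_left)
  also have "H.eqv \<dots> (expand (app (opA i) x) + expand (app (opA i) y))"
    using add by (intro H.eqv_add) auto
  also have "H.eqv \<dots> (expand (app (opA i) x + app (opA i) y))"
    using add by (intro expand_add) auto
  finally show ?case using add good_add by simp
next
  case (single h f)
  have f: "srefl n i f \<in> sym_alg n" "ddiff n i f \<in> sym_alg n"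
    using single(2) srefl_in ddiff_in assms(1) by (simp_all add: sym_alg_eq)
  let ?y = "if h (xe i) \<prec> h (ye i) then Poly_Mapping.single (h \<circ> act i) (srefl n i f) else 0"
  have e: "app (opA i) (Poly_Mapping.single h f) = Poly_Mapping.single h (ddiff n i f) + ?y"
    using app_opA[OF assms(1)] single(1) by simp
  have g: "good ?y" "good (Poly_Mapping.single h (ddiff n i f))"
    using good_single[OF GG_act[OF single(1) assms(1)] f(1)] good_single[OF single(1) f(2)] by auto
  have W: "aw (rw h) \<in> FC G1" by (intro aw_FC1 rw_Wd single)
  have "H.eqv (aw [i] * expand (Poly_Mapping.single h f)) (aw [i] * (sc f * aw (rw h)))"
    by (intro H.eqv_mult_l H.eqv_sym[OF expand_single] single) (use assms in simp)
  also have "\<dots> = (aw [i] * sc f) * aw (rw h)" by (simp add: mult.assoc)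
  also have "H.eqv \<dots> ((sc (srefl n i f) * aw [i] + sc (ddiff n i f)) * aw (rw h))"
    by (intro H.eqv_mult_r aw_sc single assms W)
  also have "\<dots> = sc (ddiff n i f) * aw (rw h) + sc (srefl n i f) * (aw [i] * aw (rw h))"
    by (simp add: algebra_simps)
  also have "H.eqv \<dots> (expand (Poly_Mapping.single h (ddiff n i f))
      + sc (srefl n i f) * (if h (xe i) \<prec> h (ye i) then aw (rw (h \<circ> act i)) else 0))"
    by (intro H.eqv_add expand_single H.eqv_mult_l C_eqv_H aw_act single assms sc_FC1 f)
  also have "H.eqv \<dots> (expand (Poly_Mapping.single h (ddiff n i f)) + expand ?y)"
  proof (intro H.eqv_add H.eqv_refl)
    show "H.eqv (sc (srefl n i f) * (if h (xe i) \<prec> h (ye i) then aw (rw (h \<circ> act i)) else 0)) (expand ?y)"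
      using expand_single[OF GG_act[OF single(1) assms(1)], of "srefl n i f"] by (simp add: expand_def[of 0])
  qed
  also have "H.eqv \<dots> (expand (Poly_Mapping.single h (ddiff n i f) + ?y))"
    by (intro expand_add g)
  finally show ?case unfolding e using good_add[OF g(2,1)] by blast
qed

lemma opS_good:
  assumes "p \<in> sym_alg n" "good x"
  shows "good (app (opS p) x) \<and> H.eqv (sc p * expand x) (expand (app (opS p) x))"
  using assms(2)
proof (induction rule: good_induct)
  case zero
  then show ?case by (simp add: expand_def)
next
  case (add x y)
  have "H.eqv (sc p * expand (x + y)) (sc p * (expand x + expand y))"
    by (intro H.eqv_mult_l H.eqv_sym[OF expand_add] add) (use assms in simp)
  also have "\<dots> = sc p * expand x + sc p * expand y" by (rule distrib_left)
  also have "H.eqv \<dots> (expand (app (opS p) x) + expand (app (opS p) y))"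
    using add by (intro H.eqv_add) auto
  also have "H.eqv \<dots> (expand (app (opS p) x + app (opS p) y))"
    using add by (intro expand_add) auto
  finally show ?case using add good_add by simp
next
  case (single h f)
  have "H.eqv (sc p * expand (Poly_Mapping.single h f)) (sc p * (sc f * aw (rw h)))"
    by (intro H.eqv_mult_l H.eqv_sym[OF expand_single] single) (use assms in simp)
  also have "\<dots> = (sc p * sc f) * aw (rw h)" by (simp add: mult.assoc)
  also have "H.eqv \<dots> (sc (p * f) * aw (rw h))"
    by (intro H.eqv_mult_r sc_mult single assms aw_FC1 rw_Wd)
  also have "H.eqv \<dots> (expand (Poly_Mapping.single h (p * f)))" by (intro expand_single single)
  finally show ?case using good_single single assms sym_alg_intros(2) by simp
qed

lemma vec_mult: "vec (p * q) = app (ev p) (vec q)" by (simp add: vec_def ev_mult app_times)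
lemma vec_add: "vec (p + q) = vec p + vec q" by (simp add: vec_def ev_add app_plus)
lemma vec_zero [simp]: "vec 0 = 0" by (simp add: vec_def)
lemma vec_sum: "vec (\<Sum>i\<in>A. f i) = (\<Sum>i\<in>A. vec (f i))" by (simp add: vec_def ev_sum app_sum_l)

lemma id_GG: "id \<in> GG" unfolding GG_def by (rule image_eqI[of _ _ "[]"]) auto

lemma rw_id [simp]: "rw id = []"
proof -
  have "pa (rev (rw id)) = id" "red (rev (rw id))" using rw[OF id_GG] red_rev by auto
  then have "length (rev (rw id)) \<le> length ([] :: nat list)" unfolding red_def
    by (metis lists.Nil pa.simps(1))
  then show ?thesis by simp
qed

text \<open>The spanning half of the basis theorem: multiplying an expansion by a generator is the
  same as expanding the image of the vector under its operator (\<open>opA_good\<close>,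
  \<open>opS_good\<close>). The independence half is that \<open>vec\<close> respects the
  congruence.\<close>

theorem expand_vec:
  assumes "p \<in> FC G1"
  shows "good (vec p) \<and> H.eqv p (expand (vec p))"
  using assms
proof (induction rule: FC_induct)
  case zero
  then show ?case by (simp add: expand_def)
next
  case (add p q)
  have "H.eqv (p + q) (expand (vec p) + expand (vec q))" using add by (intro H.eqv_add) auto
  also have "H.eqv \<dots> (expand (vec p + vec q))" using add by (intro expand_add) auto
  finally show ?case using add good_add by (simp add: vec_add)
next
  case (monom gs c)
  have w: "good (vec (word_monom gs)) \<and> H.eqv (word_monom gs) (expand (vec (word_monom gs)))"
    using monom
  proof (induction gs)
    case Nil
    have "H.eqv 1 (sc 1 * aw (rw id))" using H.eqv_sym[OF sc_one] by simp
    also have "H.eqv \<dots> (expand (Poly_Mapping.single id 1))" by (rule expand_single[OF id_GG])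
    finally show ?case using good_single[OF id_GG sym_alg_intros(5)]
      by (simp add: word_monom_Nil vec_def bas_def)
  next
    case (Cons g gs)
    note IH = Cons.IH[OF order.trans[OF set_subset_Cons Cons.prems]]
    have m: "word_monom (g # gs) = word_monom [g] * word_monom gs"
      using word_monom_append[of "[g]" gs] by simp
    have 1: "H.eqv (word_monom (g # gs)) (word_monom [g] * expand (vec (word_monom gs)))"
      unfolding m using IH Cons.prems by (intro H.eqv_mult_l) auto
    have v: "vec (word_monom (g # gs)) = app (gev g) (vec (word_monom gs))"
      unfolding m vec_mult by (simp add: ev_word_monom)
    show ?case
    proof (cases g)
      case (GA i)
      then have "i \<le> n" using Cons.prems by simp
      then show ?thesis unfolding v using opA_good[of i "vec (word_monom gs)"] IH 1 GA H.eqv_trans[OF 1]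
        by (simp add: aw_def)
    next
      case (GS p)
      then have "p \<in> sym_alg n" using Cons.prems by simp
      then show ?thesis unfolding v using opS_good[of p "vec (word_monom gs)"] IH 1 GS H.eqv_trans[OF 1]
        by (simp add: sc_def)
    qed
  qed
  have m: "word_monom gs \<in> FC G1" using monom by simp
  have o: "of_int c \<in> sym_alg n" by (rule sym_alg_intros)
  have "H.eqv (of_int c * word_monom gs) (sc (of_int c) * word_monom gs)"
    by (intro H.eqv_mult_r H.eqv_sym[OF sc_of_int] m)
  also have "H.eqv \<dots> (sc (of_int c) * expand (vec (word_monom gs)))"
    using w o by (intro H.eqv_mult_l) auto
  also have "H.eqv \<dots> (expand (app (opS (of_int c)) (vec (word_monom gs))))"
    using opS_good[OF o] w by blast
  finally show ?case using opS_good[OF o, of "vec (word_monom gs)"] w by (simp add: vec_mult)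
qed

section \<open>Integer coefficients: the basis of the nilCoxeter algebra\<close>

definition good0 :: "modl \<Rightarrow> bool" where
  "good0 x \<longleftrightarrow> Poly_Mapping.keys x \<subseteq> GG \<and> (\<forall>h. \<exists>c. Poly_Mapping.lookup x h = of_int c)"

definition expand0 :: "modl \<Rightarrow> gen word \<Rightarrow>\<^sub>0 int" where
  "expand0 x = (\<Sum>h\<in>Poly_Mapping.keys x. of_int (eval0 (Poly_Mapping.lookup x h)) * aw (rw h))"

lemma good0_add: "good0 x \<Longrightarrow> good0 y \<Longrightarrow> good0 (x + y)"
proof -
  assume x: "good0 x" and y: "good0 y"
  have "\<exists>c. Poly_Mapping.lookup (x + y) h = of_int c" for h
  proof -
    obtain a b where "Poly_Mapping.lookup x h = of_int a" "Poly_Mapping.lookup y h = of_int b"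
      using x y unfolding good0_def by blast
    then show ?thesis by (intro exI[of _ "a + b"]) (simp add: lookup_add)
  qed
  then show ?thesis using keys_add[of x y] x y unfolding good0_def by blast
qed

lemma good0_single: "h \<in> GG \<Longrightarrow> good0 (Poly_Mapping.single h (of_int c))"
  unfolding good0_def lookup_single when_def by (auto intro: exI[of _ "0::int"])

lemma good0_zero [simp]: "good0 0" unfolding good0_def by (auto intro: exI[of _ "0::int"])

lemma expand0_superset:
  "finite K \<Longrightarrow> Poly_Mapping.keys x \<subseteq> K \<Longrightarrow> expand0 x = (\<Sum>h\<in>K. of_int (eval0 (Poly_Mapping.lookup x h)) * aw (rw h))"
  unfolding expand0_def by (rule keys_subset_sum_eq[symmetric]) auto

lemma expand0_add: "expand0 (x + y) = expand0 x + expand0 y"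
proof -
  let ?K = "Poly_Mapping.keys x \<union> Poly_Mapping.keys y"
  show ?thesis
    using expand0_superset[of ?K x] expand0_superset[of ?K y] expand0_superset[of ?K "x + y"] keys_add[of x y]
    by (simp add: lookup_add eval0_add distrib_right sum.distrib)
qed

lemma expand0_single: "expand0 (Poly_Mapping.single h f) = of_int (eval0 f) * aw (rw h)"
  by (cases "f = 0") (simp_all add: expand0_def)

lemma good0_induct [consumes 1, case_names zero add single]:
  assumes "good0 x" "P 0" "\<And>x y. good0 x \<Longrightarrow> good0 y \<Longrightarrow> P x \<Longrightarrow> P y \<Longrightarrow> P (x + y)"
    "\<And>h c. h \<in> GG \<Longrightarrow> P (Poly_Mapping.single h (of_int c))"
  shows "P x"
proof -
  let ?s = "\<lambda>K. \<Sum>h\<in>K. Poly_Mapping.single h (Poly_Mapping.lookup x h)"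
  have "P (?s K) \<and> good0 (?s K)" if "finite K" "K \<subseteq> Poly_Mapping.keys x" for K
    using that
  proof (induction K)
    case (insert h K)
    have h: "h \<in> GG" using assms(1) insert by (auto simp: good0_def)
    obtain c where c: "Poly_Mapping.lookup x h = of_int c" using assms(1) by (auto simp: good0_def)
    show ?case using insert assms(3)[OF good0_single[OF h]] assms(4)[OF h] good0_add[OF good0_single[OF h]] c
      by simp
  qed (use assms(2) in auto)
  then have "P (?s (Poly_Mapping.keys x))" by simp
  then show ?thesis using poly_mapping_decomp[of x] by simp
qed

lemma opA_good0:
  assumes "i \<le> n" "good0 x"
  shows "good0 (app (opA i) x) \<and> C.eqv (aw [i] * expand0 x) (expand0 (app (opA i) x))"
  using assms(2)
proof (induction rule: good0_induct)
  case zero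
  then show ?case by (simp add: expand0_def)
next
  case (add x y)
  then show ?case using good0_add C.eqv_add by (simp add: expand0_add distrib_left)
next
  case (single h c)
  have a: "app (opA i) (Poly_Mapping.single h (of_int c))
      = (if h (xe i) \<prec> h (ye i) then Poly_Mapping.single (h \<circ> act i) (of_int c) else 0)"
    using app_opA[OF assms(1)] single assms(1) by simp
  have "C.eqv (of_int c * (aw [i] * aw (rw h))) (of_int c * (if h (xe i) \<prec> h (ye i) then aw (rw (h \<circ> act i)) else 0))"
    by (intro C.eqv_mult_l aw_act single assms) simp
  also have "of_int c * (aw [i] * aw (rw h)) = aw [i] * expand0 (Poly_Mapping.single h (of_int c))"
    by (simp add: expand0_single) (metis mult.assoc mult_of_int_commute)
  finally show ?case unfolding a using good0_single[OF GG_act[OF single assms(1)]]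
    by (auto simp: expand0_single expand0_def[of 0])
qed

theorem expand0_vec:
  assumes "p \<in> FC G0"
  shows "good0 (vec p) \<and> C.eqv p (expand0 (vec p))"
  using assms
proof (induction rule: FC_induct)
  case zero
  then show ?case by (simp add: expand0_def)
next
  case (add p q)
  then show ?case using good0_add C.eqv_add by (simp add: vec_add expand0_add)
next
  case (monom gs c)
  have w: "good0 (vec (word_monom gs)) \<and> C.eqv (word_monom gs) (expand0 (vec (word_monom gs)))"
    using monom
  proof (induction gs)
    case Nil
    then show ?case using good0_single[OF id_GG, of 1] eval0_of_int[of 1]
      by (simp add: word_monom_Nil vec_def bas_def expand0_single)
  next
    case (Cons g gs)
    note IH = Cons.IH[OF order.trans[OF set_subset_Cons Cons.prems]]
    obtain i where g: "g = GA i" "i \<le> n" using Cons.prems by (auto simp: G0_def)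
    have m: "word_monom (g # gs) = word_monom [g] * word_monom gs"
      using word_monom_append[of "[g]" gs] by simp
    have 1: "C.eqv (word_monom (g # gs)) (word_monom [g] * expand0 (vec (word_monom gs)))"
      unfolding m using IH Cons.prems by (intro C.eqv_mult_l) auto
    have v: "vec (word_monom (g # gs)) = app (gev g) (vec (word_monom gs))"
      unfolding m vec_mult by (simp add: ev_word_monom)
    show ?case unfolding v using opA_good0[of i "vec (word_monom gs)"] IH 1 g C.eqv_trans[OF 1]
      by (simp add: aw_def)
  qed
  have l: "Poly_Mapping.lookup (vec (of_int c * word_monom gs)) h = of_int c * Poly_Mapping.lookup (vec (word_monom gs)) h" for h
    by (simp add: vec_mult lookup_of_int_endo)
  have k: "Poly_Mapping.keys (vec (of_int c * word_monom gs)) \<subseteq> Poly_Mapping.keys (vec (word_monom gs))"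
    by (auto simp: in_keys_iff l)
  have "expand0 (vec (of_int c * word_monom gs)) = of_int c * expand0 (vec (word_monom gs))"
    unfolding expand0_superset[OF finite_keys k]
    by (simp add: expand0_def l eval0_mult sum_distrib_left mult.assoc)
  moreover have "good0 (vec (of_int c * word_monom gs))"
  proof -
    have "\<exists>d. Poly_Mapping.lookup (vec (of_int c * word_monom gs)) h = of_int d" for h
    proof -
      obtain a where "Poly_Mapping.lookup (vec (word_monom gs)) h = of_int a"
        using w unfolding good0_def by blast
      then show ?thesis by (intro exI[of _ "c * a"]) (simp add: l)
    qed
    then show ?thesis using w k unfolding good0_def by blast
  qed
  moreover have "C.eqv (of_int c * word_monom gs) (of_int c * expand0 (vec (word_monom gs)))"
    using w by (intro C.eqv_mult_l) auto
  ultimately show ?case by simp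
qed

text \<open>Equal vectors have the same integral expansion, to which both elements are congruent.
  Conversely, nilCoxeter congruence implies nilHecke congruence, which the operators
  respect.\<close>

lemma C_cl_iff: "p \<in> FC G0 \<Longrightarrow> q \<in> FC G0 \<Longrightarrow> C.cl p = C.cl q \<longleftrightarrow> vec p = vec q"
proof -
  assume pq: "p \<in> FC G0" "q \<in> FC G0"
  have "vec p = vec q" if "C.eqv p q" using ev_eqv[OF C_eqv_H[OF that]] by (simp add: vec_def)
  moreover have "C.eqv p q" if "vec p = vec q"
    using expand0_vec[OF pq(1)] expand0_vec[OF pq(2)] that C.eqv_trans C.eqv_sym by metis
  ultimately show ?thesis unfolding C.eqv_cl[symmetric] by blast
qed

lemma vec_aw: "red u \<Longrightarrow> vec (aw u) = bas (pa (rev u))"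
  using opW_bas_id[of u] red_Wd[of u] by (simp add: vec_def)

lemma vec_aw_rw: "h \<in> GG \<Longrightarrow> vec (aw (rw h)) = bas h"
  by (simp add: vec_aw rw)

section \<open>The maps \<open>coords\<close> and \<open>phi0\<close> computed on
  representatives\<close>

lemma finite_carrier_keys:
  "finite {w \<in> carrier CG. hof w \<in> Poly_Mapping.keys x}"
  by (rule finite_subset[of _ "cof ` Poly_Mapping.keys x"]) (use cof_hof in \<open>force+\<close>)

lemma bij_keys: "Poly_Mapping.keys x \<subseteq> GG \<Longrightarrow> bij_betw hof {w \<in> carrier CG. hof w \<in> Poly_Mapping.keys x} (Poly_Mapping.keys x)"
proof (rule bij_betwI')
  fix h assume "Poly_Mapping.keys x \<subseteq> GG" "h \<in> Poly_Mapping.keys x"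
  then show "\<exists>w\<in>{w \<in> carrier CG. hof w \<in> Poly_Mapping.keys x}. h = hof w"
    by (intro bexI[of _ "cof h"]) (auto simp: hof_cof cof_carrier)
qed (auto dest: hof_inj)

lemma coords_term:
  assumes "range f \<subseteq> sym_alg n" "w \<in> carrier CG"
  shows "scalar n (f w) \<otimes>\<^bsub>nilHecke n\<^esub> incl n (nilA n w) = H.cl (sc (f w) * aw (rw (hof w)))"
    and "sc (f w) * aw (rw (hof w)) \<in> FC G1"
proof -
  have s: "sc (f w) \<in> FC G1" using assms(1) by (intro sc_FC1) blast
  have g: "rw (hof w) \<in> Wd" using rw_Wd[OF hof_GG[OF assms(2)]] .
  show "scalar n (f w) \<otimes>\<^bsub>nilHecke n\<^esub> incl n (nilA n w) = H.cl (sc (f w) * aw (rw (hof w)))"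
    unfolding nilA_eq[OF assms(2)] incl_cl[OF aw_FC0[OF g]]
    using H.cl_mult[OF s aw_FC1[OF g]] by (simp add: scalar_def nilHecke_Q sc_def H.cl_def)
  show "sc (f w) * aw (rw (hof w)) \<in> FC G1" by (intro FC_mult s aw_FC1 g)
qed

lemma coords_sum:
  assumes "range f \<subseteq> sym_alg n" "finite {w. f w \<noteq> 0}" "{w. f w \<noteq> 0} \<subseteq> carrier CG"
  shows "(\<Oplus>\<^bsub>nilHecke n\<^esub> w \<in> {w. f w \<noteq> 0}. scalar n (f w) \<otimes>\<^bsub>nilHecke n\<^esub> incl n (nilA n w))
    = H.cl (\<Sum>w\<in>{w. f w \<noteq> 0}. sc (f w) * aw (rw (hof w)))"
proof -
  have c: "w \<in> carrier CG" if "w \<in> {w. f w \<noteq> 0}" for w using assms(3) that by blast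
  have "(\<Oplus>\<^bsub>H.Q\<^esub> w \<in> {w. f w \<noteq> 0}. scalar n (f w) \<otimes>\<^bsub>nilHecke n\<^esub> incl n (nilA n w))
      = (\<Oplus>\<^bsub>H.Q\<^esub> w \<in> {w. f w \<noteq> 0}. H.cl (sc (f w) * aw (rw (hof w))))"
    by (rule H.Q.finsum_cong'[OF HOL.refl])
      (use coords_term[OF assms(1) c] H.cl_closed in \<open>simp_all add: Pi_def\<close>)
  also have "\<dots> = H.cl (\<Sum>w\<in>{w. f w \<noteq> 0}. sc (f w) * aw (rw (hof w)))"
    by (rule H.cl_sum[OF assms(2)]) (rule coords_term(2)[OF assms(1) c])
  finally show ?thesis by (simp add: nilHecke_Q)
qed

text \<open>The expansion of the vector solves the description. Any other solution, applied to the
  unit vector, has the same vector and hence the same coefficients.\<close>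

theorem coords_eq:
  assumes "p \<in> FC G1"
  shows "coords n (H.cl p) = (\<lambda>w. if w \<in> carrier CG then Poly_Mapping.lookup (vec p) (hof w) else 0)"
    (is "_ = ?f")
  unfolding coords_def
proof (rule the_equality)
  let ?A = "\<lambda>f. {w. f w \<noteq> (0::spoly)}"
  have gv: "good (vec p)" "H.eqv p (expand (vec p))" using expand_vec[OF assms] by auto
  have keys: "Poly_Mapping.keys (vec p) \<subseteq> GG" using gv(1) by (simp add: good_def)
  have A: "?A ?f = {w \<in> carrier CG. hof w \<in> Poly_Mapping.keys (vec p)}" by (auto simp: in_keys_iff)
  have r: "range ?f \<subseteq> sym_alg n" using good_lookup[OF gv(1)] sym_alg_intros(4) by auto
  have fin: "finite (?A ?f)" "?A ?f \<subseteq> carrier CG" unfolding A using finite_carrier_keys by auto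
  have "(\<Sum>w\<in>?A ?f. sc (?f w) * aw (rw (hof w)))
      = (\<Sum>w\<in>{w \<in> carrier CG. hof w \<in> Poly_Mapping.keys (vec p)}. sc (Poly_Mapping.lookup (vec p) (hof w)) * aw (rw (hof w)))"
    unfolding A by (rule sum.cong) auto
  also have "\<dots> = expand (vec p)"
    unfolding expand_def by (rule sum.reindex_bij_betw[OF bij_keys[OF keys], of "\<lambda>h. sc (Poly_Mapping.lookup (vec p) h) * aw (rw h)"])
  finally have "H.cl p = H.cl (\<Sum>w\<in>?A ?f. sc (?f w) * aw (rw (hof w)))"
    using gv(2) H.eqv_cl by simp
  then show "range ?f \<subseteq> sym_alg n \<and> finite (?A ?f) \<and> ?A ?f \<subseteq> carrier CG
    \<and> H.cl p = (\<Oplus>\<^bsub>nilHecke n\<^esub> w \<in> ?A ?f. scalar n (?f w) \<otimes>\<^bsub>nilHecke n\<^esub> incl n (nilA n w))"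
    using coords_sum[OF r fin] r fin by simp
next
  fix g :: "nat list set \<Rightarrow> spoly"
  let ?A = "\<lambda>f. {w. f w \<noteq> (0::spoly)}"
  assume g: "range g \<subseteq> sym_alg n \<and> finite (?A g) \<and> ?A g \<subseteq> carrier CG
    \<and> H.cl p = (\<Oplus>\<^bsub>nilHecke n\<^esub> w \<in> ?A g. scalar n (g w) \<otimes>\<^bsub>nilHecke n\<^esub> incl n (nilA n w))"
  then have "H.eqv p (\<Sum>w\<in>?A g. sc (g w) * aw (rw (hof w)))"
    using coords_sum[of g] by (simp add: H.eqv_cl)
  from ev_eqv[OF this] have "vec p = vec (\<Sum>w\<in>?A g. sc (g w) * aw (rw (hof w)))" by (simp only: vec_def)
  also have "\<dots> = (\<Sum>w\<in>?A g. Poly_Mapping.single (hof w) (g w))"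
    unfolding vec_sum by (rule sum.cong) (use g hof_GG vec_aw_rw in \<open>auto simp: vec_mult bas_def\<close>)
  finally have v: "vec p = (\<Sum>w\<in>?A g. Poly_Mapping.single (hof w) (g w))" .
  show "g = ?f"
  proof
    fix w
    show "g w = ?f w"
    proof (cases "w \<in> carrier CG")
      case True
      have "Poly_Mapping.lookup (vec p) (hof w) = (\<Sum>w'\<in>?A g. if w' = w then g w' else 0)"
        unfolding v lookup_sum
      proof (rule sum.cong[OF HOL.refl])
        fix w' assume "w' \<in> ?A g"
        then have "hof w' = hof w \<longleftrightarrow> w' = w" using g True hof_inj by blast
        then show "Poly_Mapping.lookup (Poly_Mapping.single (hof w') (g w')) (hof w) = (if w' = w then g w' else 0)"
          by (simp add: lookup_single when_def)
      qed
      then show ?thesis using g True by auto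
    qed (use g in auto)
  qed
qed

lemma FC_expand0: "Poly_Mapping.keys x \<subseteq> GG \<Longrightarrow> expand0 x \<in> FC G0"
  unfolding expand0_def by (intro FC_sum FC_mult FC_of_int aw_FC0 rw_Wd) auto

theorem phi0_eq:
  assumes "p \<in> FC G1"
  shows "phi0 n (H.cl p) = C.cl (expand0 (vec p))"
proof -
  let ?K = "{w \<in> carrier CG. hof w \<in> Poly_Mapping.keys (vec p)}"
  let ?g = "\<lambda>w. of_int (eval0 (Poly_Mapping.lookup (vec p) (hof w))) * aw (rw (hof w))"
  have A: "{w. coords n (H.cl p) w \<noteq> 0} = ?K" unfolding coords_eq[OF assms] by (auto simp: in_keys_iff)
  have gv: "good (vec p)" using expand_vec[OF assms] by auto
  then have keys: "Poly_Mapping.keys (vec p) \<subseteq> GG" by (simp add: good_def)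
  have W: "aw (rw (hof w)) \<in> FC G0" if "w \<in> carrier CG" for w
    using aw_FC0[OF rw_Wd[OF hof_GG[OF that]]] .
  have "phi0 n (H.cl p) = (\<Oplus>\<^bsub>C.Q\<^esub> w \<in> ?K. C.cl (?g w))"
    unfolding phi0_def A nilCoxeter_Q
    by (rule C.Q.finsum_cong'[OF HOL.refl])
      (use W in \<open>simp_all add: coords_eq[OF assms] nilA_eq C.cl_pow C.cl_closed FC_mult Pi_def\<close>)
  also have "\<dots> = C.cl (\<Sum>w\<in>?K. ?g w)"
    by (rule C.cl_sum) (use W finite_carrier_keys in \<open>auto intro!: FC_mult\<close>)
  also have "(\<Sum>w\<in>?K. ?g w) = expand0 (vec p)"
    unfolding expand0_def
    by (rule sum.reindex_bij_betw[OF bij_keys[OF keys], of "\<lambda>h. of_int (eval0 (Poly_Mapping.lookup (vec p) h)) * aw (rw h)"])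
  finally show ?thesis .
qed

lemma lookup_vec_expand0:
  assumes "Poly_Mapping.keys x \<subseteq> GG"
  shows "Poly_Mapping.lookup (vec (expand0 x)) h = of_int (eval0 (Poly_Mapping.lookup x h))"
proof -
  have "vec (expand0 x) = (\<Sum>k\<in>Poly_Mapping.keys x. app (of_int (eval0 (Poly_Mapping.lookup x k))) (bas k))"
    unfolding expand0_def vec_sum by (rule sum.cong) (use assms vec_aw_rw in \<open>auto simp: vec_mult\<close>)
  then have "Poly_Mapping.lookup (vec (expand0 x)) h
      = (\<Sum>k\<in>Poly_Mapping.keys x. if k = h then of_int (eval0 (Poly_Mapping.lookup x h)) else 0)"
  proof (elim ssubst)
    have "Poly_Mapping.lookup (app (of_int (eval0 (Poly_Mapping.lookup x k))) (bas k)) h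
        = (if k = h then of_int (eval0 (Poly_Mapping.lookup x h)) else 0)" for k
      by (simp add: lookup_of_int_endo bas_def lookup_single when_def)
    then show "Poly_Mapping.lookup (\<Sum>k\<in>Poly_Mapping.keys x. app (of_int (eval0 (Poly_Mapping.lookup x k))) (bas k)) h
        = (\<Sum>k\<in>Poly_Mapping.keys x. if k = h then of_int (eval0 (Poly_Mapping.lookup x h)) else 0)"
      by (simp only: lookup_sum)
  qed
  then show ?thesis by (simp add: in_keys_iff)
qed

text \<open>Turns the defining condition into one on operators: the coefficients of
  \<open>a s\<close> are those of the vector that \<open>a\<close> produces from \<open>s\<close>
  times the unit vector.\<close>

theorem fomin_stanley_iff:
  assumes "p \<in> FC G0"
  shows "C.cl p \<in> fomin_stanley n \<longleftrightarrow>
    (\<forall>s\<in>sym_alg n. \<forall>h. eval0 (Poly_Mapping.lookup (app (ev p) (Poly_Mapping.single id s)) h)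
       = eval0 s * eval0 (Poly_Mapping.lookup (vec p) h))"
proof -
  have p1: "p \<in> FC G1" using FC_mono[OF G0_G1 assms] .
  have g0: "good0 (vec p)" using expand0_vec[OF assms] by blast
  have "phi0 n (incl n (C.cl p) \<otimes>\<^bsub>nilHecke n\<^esub> scalar n s) = [eval0 s] \<cdot>\<^bsub>nilCoxeter n\<^esub> C.cl p
    \<longleftrightarrow> (\<forall>h. eval0 (Poly_Mapping.lookup (app (ev p) (Poly_Mapping.single id s)) h)
       = eval0 s * eval0 (Poly_Mapping.lookup (vec p) h))" if s: "s \<in> sym_alg n" for s
  proof -
    have sF: "sc s \<in> FC G1" using s by simp
    have psF: "p * sc s \<in> FC G1" by (intro FC_mult p1 sF)
    have keys: "Poly_Mapping.keys (vec (p * sc s)) \<subseteq> GG" using expand_vec[OF psF] by (simp add: good_def)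
    have v: "vec (p * sc s) = app (ev p) (Poly_Mapping.single id s)"
      by (simp add: vec_mult vec_def[of "sc s"] bas_def)
    have "incl n (C.cl p) \<otimes>\<^bsub>nilHecke n\<^esub> scalar n s = H.cl (p * sc s)"
      unfolding incl_cl[OF assms] using H.cl_mult[OF p1 sF] by (simp add: scalar_def nilHecke_Q sc_def H.cl_def)
    then have "phi0 n (incl n (C.cl p) \<otimes>\<^bsub>nilHecke n\<^esub> scalar n s) = C.cl (expand0 (vec (p * sc s)))"
      using phi0_eq[OF psF] by simp
    moreover have "[eval0 s] \<cdot>\<^bsub>nilCoxeter n\<^esub> C.cl p = C.cl (of_int (eval0 s) * p)"
      unfolding nilCoxeter_Q by (rule C.cl_pow[OF assms])
    moreover have "C.cl (expand0 (vec (p * sc s))) = C.cl (of_int (eval0 s) * p)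
        \<longleftrightarrow> vec (expand0 (vec (p * sc s))) = vec (of_int (eval0 s) * p)"
      by (rule C_cl_iff[OF FC_expand0[OF keys] FC_mult[OF FC_of_int assms]])
    moreover have "vec (expand0 (vec (p * sc s))) = vec (of_int (eval0 s) * p)
        \<longleftrightarrow> (\<forall>h. eval0 (Poly_Mapping.lookup (vec (p * sc s)) h) = eval0 s * eval0 (Poly_Mapping.lookup (vec p) h))"
    proof -
      have "Poly_Mapping.lookup (vec (of_int (eval0 s) * p)) h
          = of_int (eval0 s * eval0 (Poly_Mapping.lookup (vec p) h))" for h
      proof -
        obtain c where c: "Poly_Mapping.lookup (vec p) h = of_int c" using g0 by (auto simp: good0_def)
        show ?thesis by (simp add: vec_mult lookup_of_int_endo c)
      qed
      moreover have "x = y \<longleftrightarrow> (\<forall>h. Poly_Mapping.lookup x h = Poly_Mapping.lookup y h)" for x y :: modl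
        by (metis poly_mapping_eqI)
      ultimately show ?thesis by (simp only: lookup_vec_expand0[OF keys] of_int_eq_iff)
    qed
    ultimately show ?thesis by (simp add: v)
  qed
  moreover have "C.cl p \<in> carrier (nilCoxeter n)" unfolding nilCoxeter_Q by (rule C.cl_closed[OF assms])
  ultimately show ?thesis by (auto simp: fomin_stanley_def)
qed

end

section \<open>Membership in the affine Fomin-Stanley algebra\<close>

definition comm :: "'a::ring_1 \<Rightarrow> 'a \<Rightarrow> bool" where "comm x y \<longleftrightarrow> x * y = y * x"

lemma comm_sym: "comm x y \<Longrightarrow> comm y x" by (simp add: comm_def)
lemma comm_1 [simp]: "comm x 1" "comm x 0" by (simp_all add: comm_def)
lemma comm_2: "comm x y \<Longrightarrow> comm x (2 * y)"
  unfolding comm_def mult_2 by (simp add: algebra_simps)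
lemma comm_add: "comm x y \<Longrightarrow> comm x z \<Longrightarrow> comm x (y + z)" by (simp add: comm_def algebra_simps)
lemma comm_diff: "comm x y \<Longrightarrow> comm x z \<Longrightarrow> comm x (y - z)" by (simp add: comm_def algebra_simps)
lemma comm_mult: "comm x y \<Longrightarrow> comm x z \<Longrightarrow> comm x (y * z)"
  unfolding comm_def by (metis mult.assoc)

lemmas comm_intros = comm_1 comm_2 comm_add comm_diff comm_mult

context affine_C begin

lemma opA_comm: "i \<le> n \<Longrightarrow> j \<le> n \<Longrightarrow> i + 1 < j \<or> j + 1 < i \<Longrightarrow> comm (opA i) (opA j)"
  using opW_braid[of "[i, j]" "[j, i]"] by (auto simp: braid_rels_def opW_Cons comm_def)

lemma opA_braid: "1 \<le> i \<Longrightarrow> i + 2 \<le> n \<Longrightarrow> opA i * opA (i+1) * opA i = opA (i+1) * opA i * opA (i+1)"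
  using opW_braid[of "[i, i+1, i]" "[i+1, i, i+1]"] by (auto simp: braid_rels_def opW_Cons mult.assoc)

section \<open>Commuting the products with the coordinates\<close>

definition ep :: "nat \<Rightarrow> endo" where "ep r = opS (eps (int r))"

lemma opA_ep:
  assumes "1 \<le> i" "i < n"
  shows "opA i * ep i = ep (Suc i) * opA i + 1" "opA i * ep (Suc i) = ep i * opA i - 1"
  using opA_eps[of i "int i"] opA_eps[of i "int (Suc i)"] assms
  by (simp_all add: ep_def actr_def kap_def add.commute)

lemma opA_ep_n: "opA n * ep n = - ep n * opA n + 1"
proof -
  have "actr n (int n) = int n + 1" "kap n (int n) = 1" using n_ge_2 by (auto simp: actr_def kap_def)
  moreover have "eps (int n + 1) = - eps (int n)" using eps_rv[of "int n"] n_ge_2 by simp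
  ultimately show ?thesis using opA_eps[of n "int n"] n_ge_2 by (simp add: ep_def opS_uminus)
qed

lemma opA_ep_0: "opA 0 * ep 1 = - ep 1 * opA 0 - 1"
proof -
  have "actr 0 1 = 2 * int n" "kap 0 1 = - 1" using n_ge_2 by (auto simp: actr_def kap_def)
  moreover have "eps (2 * int n) = - eps 1" using eps_rv[of 1] n_ge_2 by simp
  ultimately show ?thesis using opA_eps[of 0 1] n_ge_2 by (simp add: ep_def opS_uminus)
qed

lemma opA_ep_comm: "i \<le> n \<Longrightarrow> 1 \<le> r \<Longrightarrow> r \<le> n \<Longrightarrow> r \<noteq> i \<Longrightarrow> r \<noteq> Suc i \<Longrightarrow> comm (opA i) (ep r)"
proof -
  assume a: "i \<le> n" "1 \<le> r" "r \<le> n" "r \<noteq> i" "r \<noteq> Suc i"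
  then have "actr i (int r) = int r" "kap i (int r) = 0" using n_ge_2 by (auto simp: actr_def kap_def)
  then show ?thesis using opA_eps[of i "int r"] a by (simp add: ep_def comm_def)
qed

text \<open>The value at 0 lies outside the pattern; it is the one that makes
  \<open>Qm_Lm_diag\<close> true for \<open>j = 1\<close>.\<close>

primrec Lm :: "nat \<Rightarrow> endo" where
  "Lm 0 = 1"
| "Lm (Suc m) = (if m = 0 then 1 + 2 * opA 0 else (1 + opA m) * Lm m * (1 + opA m))"

text \<open>The signed coefficient of \<open>\<epsilon>\<^sub>m\<close> in \<open>L\<^sub>m \<epsilon>\<^sub>j\<close>.\<close>

primrec Qm :: "nat \<Rightarrow> nat \<Rightarrow> endo" where
  "Qm 0 j = 0"
| "Qm (Suc m) j = (if m = 0 then 1 - 2 * opA 0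
     else if j = Suc m then Lm m + opA m * Qm m m * opA m
     else if j = m then opA m * Qm m m + Lm m * opA m
     else opA m * Qm m j * (1 + opA m))"

primrec hh :: "nat \<Rightarrow> endo" where
  "hh 0 = opA n"
| "hh (Suc k) = opA (n - Suc k) * hh k * opA (n - Suc k)"

definition hm :: "nat \<Rightarrow> endo" where "hm m = hh (n - m)"

lemma hm_n: "hm n = opA n" by (simp add: hm_def)
lemma hm_step: "m < n \<Longrightarrow> hm m = opA m * hm (Suc m) * opA m"
proof -
  assume "m < n"
  then have "n - m = Suc (n - Suc m)" "n - Suc (n - Suc m) = m" by auto
  then show ?thesis by (simp add: hm_def)
qed

lemma Lm_comm: "m \<le> n \<Longrightarrow> (\<And>i. i < m \<Longrightarrow> comm x (opA i)) \<Longrightarrow> comm x (Lm m)"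
  by (induction m) (auto intro!: comm_intros)

lemma Qm_comm: "m \<le> n \<Longrightarrow> (\<And>i. i < m \<Longrightarrow> comm x (opA i)) \<Longrightarrow> comm x (Qm m j)"
  by (induction m arbitrary: j) (auto intro!: comm_intros Lm_comm)

lemma hm_comm: "m \<le> n \<Longrightarrow> (\<And>i. m \<le> i \<Longrightarrow> i \<le> n \<Longrightarrow> comm x (opA i)) \<Longrightarrow> comm x (hm m)"
proof (induction m rule: inc_induct)
  case base
  then show ?case by (simp add: hm_n)
next
  case (step m)
  then show ?case by (auto simp: hm_step intro!: comm_mult)
qed

text \<open>Such operators contribute nothing after evaluation at 0 (\<open>vanish_II\<close>).
  Right multiplication preserves them, left multiplication only by operators that commute with the
  coordinates in question (\<open>II_left\<close>); hence the bound \<open>k\<close>.\<close>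

definition II :: "nat \<Rightarrow> endo \<Rightarrow> bool" where
  "II k X \<longleftrightarrow> (\<exists>Y. X = (\<Sum>i=1..k. ep i * Y i))"

lemma II_0 [simp]: "II k 0" unfolding II_def by (rule exI[of _ "\<lambda>_. 0"]) simp

lemma II_add: "II k X \<Longrightarrow> II k Y \<Longrightarrow> II k (X + Y)"
  unfolding II_def by (auto simp: sum.distrib[symmetric] distrib_left[symmetric])

lemma II_mult: "II k X \<Longrightarrow> II k (X * Z)"
  unfolding II_def by (auto simp: sum_distrib_right mult.assoc)

lemma II_ep: "1 \<le> i \<Longrightarrow> i \<le> k \<Longrightarrow> II k (ep i * Z)"
  unfolding II_def
  by (rule exI[of _ "\<lambda>r. if r = i then Z else 0"]) (simp add: if_distrib[of "\<lambda>z. _ * z"] cong: if_cong)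

lemma II_neg: "II k X \<Longrightarrow> II k (- X)" using II_mult[of k X "- 1"] by simp

lemma II_diff: "II k X \<Longrightarrow> II k Y \<Longrightarrow> II k (X - Y)" using II_add[of k X "- Y"] II_neg by simp

lemma II_mono: "II k X \<Longrightarrow> k \<le> l \<Longrightarrow> II l X"
proof -
  assume "II k X" "k \<le> l"
  then obtain Y where Y: "X = (\<Sum>i=1..k. ep i * Y i)" by (auto simp: II_def)
  have "II l (\<Sum>i\<in>A. ep i * Y i)" if "finite A" "A \<subseteq> {1..l}" for A
    using that by (induction A) (auto intro!: II_add II_ep)
  then show ?thesis using Y \<open>k \<le> l\<close> by simp
qed

lemma II_left: "II k X \<Longrightarrow> (\<And>i. 1 \<le> i \<Longrightarrow> i \<le> k \<Longrightarrow> comm a (ep i)) \<Longrightarrow> II k (a * X)"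
proof -
  assume "II k X" and c: "\<And>i. 1 \<le> i \<Longrightarrow> i \<le> k \<Longrightarrow> comm a (ep i)"
  then obtain Y where Y: "X = (\<Sum>i=1..k. ep i * Y i)" by (auto simp: II_def)
  have "a * X = (\<Sum>i=1..k. ep i * (a * Y i))"
    unfolding Y sum_distrib_left
    by (rule sum.cong) (use c in \<open>auto simp: comm_def mult.assoc[symmetric]\<close>)
  then show ?thesis unfolding II_def by (rule exI[of _ "\<lambda>i. a * Y i"])
qed

text \<open>Modulo multiples of \<open>\<epsilon>_1, ..., \<epsilon>_{m-1}\<close>, the product
  \<open>L_m \<epsilon>_j\<close> is \<open>\<epsilon>_m Q - Q\<close> with
  \<open>Q = Qm m j\<close>, and a further \<open>- L_m\<close> if \<open>j = m\<close>. The
  induction closes because \<open>L_m\<close> and the same \<open>Q\<close> also determine the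
  constant part, from which conjugation by \<open>1 + A_m\<close> produces the next
  \<open>Q\<close>.\<close>

lemma Lm_ep:
  assumes "1 \<le> m" "m \<le> n" "1 \<le> j" "j \<le> m"
  shows "II (m - 1) (Lm m * ep j - ep m * Qm m j + Qm m j + (if j = m then Lm m else 0))"
  using assms
proof (induction m arbitrary: j rule: nat_induct_at_least)
  case base
  have a: "opA 0 * ep (Suc 0) = - ep (Suc 0) * opA 0 - 1" using opA_ep_0 by simp
  from base show ?case by (simp add: algebra_simps mult_2 mult_2_right a)
next
  case (Suc m)
  let ?a = "opA m" and ?L = "Lm m" and ?E = "ep m" and ?F = "ep (Suc m)"
  have m: "1 \<le> m" "m < n" using Suc by auto
  note aE = opA_ep[OF m]
  have aE': "?a * (?E * X) = ?F * (?a * X) + X" "?a * (?F * X) = ?E * (?a * X) - X" for X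
    using aE by (simp_all add: mult.assoc[symmetric] left_diff_distrib distrib_right)
  have LF: "?L * ?F = ?F * ?L"
  proof -
    have "comm ?F ?L"
      by (rule Lm_comm) (use m in \<open>auto intro!: comm_sym[OF opA_ep_comm]\<close>)
    then show ?thesis by (simp only: comm_def)
  qed
  have LF': "?L * (?F * X) = ?F * (?L * X)" for X
    using LF by (simp add: mult.assoc[symmetric])
  have a_II: "II (m - 1) (?a * X)" if "II (m - 1) X" for X
    by (rule II_left[OF that]) (use m opA_ep_comm in auto)
  have S: "Lm (Suc m) = (1 + ?a) * ?L * (1 + ?a)" using m by simp
  consider "j = Suc m" | "j = m" | "j < m" using Suc.prems by linarith
  then show ?case
  proof cases
    case 1
    let ?Q = "Qm m m"
    define i where "i = ?L * ?E - ?E * ?Q + ?Q + ?L"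
    have i: "II (m - 1) i" using Suc.IH[of m] m by (simp add: i_def)
    have LE: "?L * ?E = ?E * ?Q - ?Q - ?L + i" by (simp add: i_def)
    have LE': "?L * (?E * X) = ?E * (?Q * X) - ?Q * X - ?L * X + i * X" for X
      by (simp only: mult.assoc[symmetric] LE distrib_right left_diff_distrib)
    have "Lm (Suc m) * ep j - ep (Suc m) * Qm (Suc m) j + Qm (Suc m) j + (if j = Suc m then Lm (Suc m) else 0)
        = ?E * (?a * ?L + ?Q * ?a) + (i * ?a + ?a * (i * ?a))"
      unfolding S using 1 m
      by (simp add: algebra_simps aE aE' LF LF' LE LE')
    moreover have "II m (?E * (?a * ?L + ?Q * ?a) + (i * ?a + ?a * (i * ?a)))"
      by (intro II_add II_ep II_mono[OF II_mult[OF i]] II_mono[OF a_II[OF II_mult[OF i]]]) (use m in auto)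
    ultimately show ?thesis by simp
  next
    case 2
    let ?Q = "Qm m m"
    define i where "i = ?L * ?E - ?E * ?Q + ?Q + ?L"
    have i: "II (m - 1) i" using Suc.IH[of m] m by (simp add: i_def)
    have LE: "?L * ?E = ?E * ?Q - ?Q - ?L + i" by (simp add: i_def)
    have LE': "?L * (?E * X) = ?E * (?Q * X) - ?Q * X - ?L * X + i * X" for X
      by (simp only: mult.assoc[symmetric] LE distrib_right left_diff_distrib)
    have "Lm (Suc m) * ep j - ep (Suc m) * Qm (Suc m) j + Qm (Suc m) j + (if j = Suc m then Lm (Suc m) else 0)
        = ?E * (?Q + ?a * (?L * ?a)) + (i + ?a * i)"
      unfolding S using 2 m
      by (simp add: algebra_simps aE aE' LF LF' LE LE')
    moreover have "II m (?E * (?Q + ?a * (?L * ?a)) + (i + ?a * i))"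
      by (intro II_add II_ep II_mono[OF i] II_mono[OF a_II[OF i]]) (use m in auto)
    ultimately show ?thesis by simp
  next
    case 3
    let ?Q = "Qm m j" and ?J = "ep j"
    define i where "i = ?L * ?J - ?E * ?Q + ?Q"
    have i: "II (m - 1) i" using Suc.IH[of j] m 3 Suc.prems by (simp add: i_def)
    have LE: "?L * ?J = ?E * ?Q - ?Q + i" by (simp add: i_def)
    have LE': "?L * (?J * X) = ?E * (?Q * X) - ?Q * X + i * X" for X
      by (simp only: mult.assoc[symmetric] LE distrib_right left_diff_distrib)
    have aJ: "?a * ?J = ?J * ?a" using opA_ep_comm[of m j] m 3 Suc.prems by (simp add: comm_def)
    have "Lm (Suc m) * ep j - ep (Suc m) * Qm (Suc m) j + Qm (Suc m) j + (if j = Suc m then Lm (Suc m) else 0)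
        = ?E * (?Q + ?Q * ?a) + ((i + i * ?a) + (?a * i + ?a * (i * ?a)))"
      unfolding S using 3 m
      by (simp add: algebra_simps aE aE' LF LF' LE LE' aJ)
    moreover have "II m (?E * (?Q + ?Q * ?a) + ((i + i * ?a) + (?a * i + ?a * (i * ?a))))"
      by (intro II_add II_ep II_mono[OF i] II_mono[OF a_II[OF i]] II_mono[OF II_mult[OF i]] II_mono[OF a_II[OF II_mult[OF i]]])
        (use m in auto)
    ultimately show ?thesis by simp
  qed
qed

text \<open>The transposition \<open>a\<^sub>m \<cdots> a\<^bsub>k-1\<^esub> \<cdots> a\<^sub>m\<close> is \<open>vt m k\<close>.\<close>

primrec vf :: "nat \<Rightarrow> nat \<Rightarrow> endo" where
  "vf 0 m = opA m"
| "vf (Suc d) m = opA m * vf d (Suc m) * opA m"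

definition vt :: "nat \<Rightarrow> nat \<Rightarrow> endo" where "vt m k = vf (k - Suc m) m"

lemma vt_Suc: "vt m (Suc m) = opA m" by (simp add: vt_def)

lemma vt_left: "Suc m < k \<Longrightarrow> vt m k = opA m * vt (Suc m) k * opA m"
proof -
  assume "Suc m < k"
  then have "k - Suc m = Suc (k - Suc (Suc m))" by simp
  then show ?thesis by (simp add: vt_def)
qed

text \<open>A transposition has a palindrome that rises to its greatest letter and one that falls to
  its least letter; braid relations turn one into the other.\<close>

lemma vt_right:
  assumes "1 \<le> m" "m < k" "k < n"
  shows "vt m (Suc k) = opA k * vt m k * opA k"
  using assms
proof (induction "k - m" arbitrary: m)
  case (Suc d)
  show ?case
  proof (cases "k = Suc m")
    case True
    then have "vt m (Suc k) = opA m * opA (Suc m) * opA m"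
      using vt_left[of m "Suc k"] by (simp add: vt_Suc)
    also have "\<dots> = opA (Suc m) * opA m * opA (Suc m)"
      using opA_braid[of m] Suc.prems True by simp
    finally show ?thesis using True by (simp add: vt_Suc)
  next
    case False
    have "vt (Suc m) (Suc k) = opA k * vt (Suc m) k * opA k"
      by (rule Suc.hyps(1)) (use Suc.hyps(2) Suc.prems False in auto)
    moreover have "comm (opA m) (opA k)" by (rule opA_comm) (use Suc.prems False in auto)
    ultimately show ?thesis
      using vt_left[of m "Suc k"] vt_left[of m k] Suc.prems False
      by (simp add: comm_def mult.assoc) (metis mult.assoc)
  qed
qed simp

text \<open>The sum of the words obtained from \<open>h_m\<close> by one deletion. Deleting the
  letter \<open>k - 1\<close> on the right leaves \<open>vt m k * hm k\<close>, on the left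
  \<open>hm k * vt m k\<close>; deleting \<open>n\<close> leaves a square unless
  \<open>m = n\<close>, where it leaves 1.\<close>

definition xm :: "nat \<Rightarrow> endo" where
  "xm m = (if m = n then 1 else \<Sum>k=Suc m..n. vt m k * hm k + hm k * vt m k)"

lemma opA_hm: "i + 1 < k \<Longrightarrow> k \<le> n \<Longrightarrow> comm (opA i) (hm k)"
  by (rule hm_comm) (auto intro: opA_comm)

lemma Lm_hm: "m < k \<Longrightarrow> k \<le> n \<Longrightarrow> comm (Lm m) (hm k)"
  by (rule comm_sym, rule Lm_comm) (auto intro!: comm_sym[OF opA_hm])

lemma Qm_hm: "m < k \<Longrightarrow> k \<le> n \<Longrightarrow> comm (Qm m j) (hm k)"
  by (rule comm_sym, rule Qm_comm) (auto intro!: comm_sym[OF opA_hm])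

lemma Lm_opA: "m < i \<Longrightarrow> i \<le> n \<Longrightarrow> comm (Lm m) (opA i)"
  by (rule comm_sym, rule Lm_comm) (auto intro!: opA_comm)

lemma Qm_opA: "m < i \<Longrightarrow> i \<le> n \<Longrightarrow> comm (Qm m j) (opA i)"
  by (rule comm_sym, rule Qm_comm) (auto intro!: opA_comm)

lemma xm_step:
  assumes "1 \<le> m" "m < n"
  shows "xm m = opA m * hm (Suc m) + hm (Suc m) * opA m + opA m * xm (Suc m) * opA m"
proof -
  have "opA m * xm (Suc m) * opA m = (\<Sum>k=Suc (Suc m)..n. vt m k * hm k + hm k * vt m k)"
  proof (cases "Suc m = n")
    case True
    then show ?thesis using assms opA_sq[of m] by (simp add: xm_def)
  next
    case False
    have "opA m * (vt (Suc m) k * hm k + hm k * vt (Suc m) k) * opA m = vt m k * hm k + hm k * vt m k"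
      if "k \<in> {Suc (Suc m)..n}" for k
    proof -
      have "opA m * hm k = hm k * opA m" using opA_hm[of m k] that by (simp add: comm_def)
      then show ?thesis using vt_left[of m k] that
        by (simp add: distrib_left distrib_right mult.assoc) (metis mult.assoc)
    qed
    then show ?thesis using False by (simp add: xm_def sum_distrib_left sum_distrib_right)
  qed
  moreover have "xm m = (vt m (Suc m) * hm (Suc m) + hm (Suc m) * vt m (Suc m))
      + (\<Sum>k=Suc (Suc m)..n. vt m k * hm k + hm k * vt m k)"
    using assms by (simp add: xm_def sum.atLeast_Suc_atMost)
  ultimately show ?thesis by (simp add: vt_Suc)
qed

lemma hm_ep_less: "1 \<le> j \<Longrightarrow> j < m \<Longrightarrow> m \<le> n \<Longrightarrow> comm (hm m) (ep j)"
  by (rule comm_sym, rule hm_comm) (auto intro!: comm_sym[OF opA_ep_comm])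

text \<open>The word of \<open>h_m\<close> changes the sign of the \<open>m\<close>-th coordinate.
  On its way \<open>\<epsilon>_m\<close> meets every letter with coroot value 1, so all deletions
  enter with the sign plus.\<close>

lemma hm_ep:
  assumes "1 \<le> m" "m \<le> n"
  shows "hm m * ep m = - ep m * hm m + xm m"
  using assms(2,1)
proof (induction m rule: inc_induct)
  case base
  then show ?case using opA_ep_n by (simp add: hm_n xm_def)
next
  case (step m)
  let ?a = "opA m" and ?h = "hm (Suc m)" and ?E = "ep m" and ?F = "ep (Suc m)"
  have m: "1 \<le> m" "m < n" using step by auto
  note aE = opA_ep[OF m]
  have aE': "?a * (?E * X) = ?F * (?a * X) + X" "?a * (?F * X) = ?E * (?a * X) - X" for X
    using aE by (simp_all add: mult.assoc[symmetric] left_diff_distrib distrib_right)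
  have hF: "?h * ?F = - ?F * ?h + xm (Suc m)" using step by simp
  have hF': "?h * (?F * X) = - ?F * (?h * X) + xm (Suc m) * X" for X
    using hF by (simp add: mult.assoc[symmetric] left_diff_distrib distrib_right)
  show ?case unfolding hm_step[OF m(2)] xm_step[OF m]
    by (simp add: algebra_simps aE aE' hF hF')
qed

text \<open>The coordinate \<open>\<epsilon>_j\<close> meets the letter \<open>j - 1\<close> twice,
  with the coroot values -1 and 1. The letters below \<open>j - 1\<close> commute with
  \<open>h_j\<close>; so deleting the right occurrence leaves \<open>vt m j * hm j\<close>, and
  deleting the left one leaves \<open>hm j * vt m j\<close>.\<close>

lemma hm_ep_greater:
  assumes "1 \<le> m" "m < j" "j \<le> n"
  shows "hm m * ep j = ep j * hm m + (hm j * vt m j - vt m j * hm j)"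
  using assms
proof (induction "j - m" arbitrary: m)
  case (Suc d)
  let ?a = "opA m" and ?h = "hm (Suc m)" and ?E = "ep m" and ?J = "ep j"
  have m: "1 \<le> m" "m < n" using Suc by auto
  note aE = opA_ep[OF m]
  show ?case
  proof (cases "j = Suc m")
    case True
    have hE: "?h * ?E = ?E * ?h" using hm_ep_less[of m "Suc m"] m by (simp add: comm_def)
    have hE': "?h * (?E * X) = ?E * (?h * X)" for X using hE by (simp add: mult.assoc[symmetric])
    have aE': "?a * (?E * X) = ep (Suc m) * (?a * X) + X" for X
      using aE by (simp_all add: mult.assoc[symmetric] left_diff_distrib distrib_right)
    show ?thesis unfolding hm_step[OF m(2)] True vt_Suc
      by (simp add: algebra_simps aE aE' hE hE')
  next
    case False
    have IH: "?h * ?J = ?J * ?h + (hm j * vt (Suc m) j - vt (Suc m) j * hm j)"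
      by (rule Suc.hyps(1)) (use Suc.hyps(2) Suc.prems False in auto)
    have IH': "?h * (?J * X) = ?J * (?h * X) + (hm j * (vt (Suc m) j * X) - vt (Suc m) j * (hm j * X))" for X
      by (simp only: mult.assoc[symmetric] IH distrib_right left_diff_distrib)
    have aJ: "?a * ?J = ?J * ?a" using opA_ep_comm[of m j] Suc.prems False by (simp add: comm_def)
    have aJ': "?a * (?J * X) = ?J * (?a * X)" for X using aJ by (simp add: mult.assoc[symmetric])
    have ah: "hm j * ?a = ?a * hm j" using opA_hm[of m j] Suc.prems False by (simp add: comm_def)
    have ah': "hm j * (?a * X) = ?a * (hm j * X)" for X using ah by (simp add: mult.assoc[symmetric])
    have v: "vt m j = ?a * vt (Suc m) j * ?a" using vt_left Suc.prems False by simp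
    show ?thesis unfolding hm_step[OF m(2)] v
      by (simp add: algebra_simps aJ aJ' ah ah' IH IH')
  qed
qed simp

section \<open>The telescoping sum\<close>

definition M2 :: endo where
  "M2 = Lm n + (\<Sum>m=1..n. hm m * Lm m + Lm m * hm m)"

primrec cm :: "nat \<Rightarrow> nat \<Rightarrow> endo \<Rightarrow> endo" where
  "cm 0 m Q = Q"
| "cm (Suc d) m Q = opA (m + d) * cm d m Q * opA (m + d)"

text \<open>What the summands with index at least \<open>m\<close> leave behind. The conjugates of
  \<open>Q\<close> come from the recursion \<open>Qm (m + 1) j = A_m Q (1 + A_m)\<close> for
  \<open>j < m\<close>.\<close>

definition Rs :: "nat \<Rightarrow> endo \<Rightarrow> endo" where
  "Rs m Q = (\<Sum>k=m..n. hm k * cm (k - m) m Q + cm (k - m) m Q * hm k)"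

lemma cm_shift: "cm d (Suc m) (opA m * Q * opA m) = cm (Suc d) m Q"
  by (induction d) simp_all

lemma cm_add: "cm d m (P + Q) = cm d m P + cm d m Q"
  by (induction d) (simp_all add: distrib_left distrib_right)

lemma cm_vt:
  assumes "1 \<le> m" "m + d < n" "\<And>i. m < i \<Longrightarrow> i \<le> n \<Longrightarrow> comm Q (opA i)"
  shows "cm d (Suc m) (opA m * Q) = vt m (Suc m + d) * Q \<and> cm d (Suc m) (Q * opA m) = Q * vt m (Suc m + d)"
  using assms(2)
proof (induction d)
  case 0
  then show ?case by (simp add: vt_Suc)
next
  case (Suc d)
  let ?k = "Suc m + d"
  have c: "Q * opA ?k = opA ?k * Q" using assms(3)[of ?k] Suc.prems by (simp add: comm_def)
  have c': "Q * (opA ?k * X) = opA ?k * (Q * X)" for X using c by (simp add: mult.assoc[symmetric])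
  have v: "vt m (Suc ?k) = opA ?k * vt m ?k * opA ?k"
    by (rule vt_right) (use assms Suc.prems in auto)
  show ?case using Suc c c' v by (simp add: mult.assoc)
qed

lemma cm_vt_left:
  assumes "1 \<le> m" "m + d < n" "\<And>i. m < i \<Longrightarrow> i \<le> n \<Longrightarrow> comm Q (opA i)"
  shows "cm d (Suc m) (opA m * Q) = vt m (Suc m + d) * Q" "cm d (Suc m) (Q * opA m) = Q * vt m (Suc m + d)"
  using cm_vt[OF assms] by auto

text \<open>In \<open>A_m Q (1 + A_m)\<close> the one-sided term produces the transpositions
  \<open>vt m k\<close>, whose sum against the \<open>h_k\<close> is \<open>xm m * Q\<close>; the
  two-sided term continues the conjugation.\<close>

lemma Rs_step:
  assumes "1 \<le> j" "j < m" "m < n"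
  shows "xm m * Qm m j - (hm m * Qm m j + Qm m j * hm m) - Rs (Suc m) (Qm (Suc m) j) = - Rs m (Qm m j)"
proof -
  let ?Q = "Qm m j"
  have c: "cm (k - Suc m) (Suc m) (Qm (Suc m) j) = vt m k * ?Q + cm (k - m) m ?Q" if "k \<in> {Suc m..n}" for k
  proof -
    have "Qm (Suc m) j = opA m * ?Q + opA m * ?Q * opA m" using assms by (simp add: algebra_simps)
    moreover have "cm (k - Suc m) (Suc m) (opA m * ?Q) = vt m (Suc m + (k - Suc m)) * ?Q"
      by (rule cm_vt_left(1)) (use assms that Qm_opA in auto)
    moreover have "Suc (k - Suc m) = k - m" using that by auto
    ultimately show ?thesis using that cm_shift[of "k - Suc m" m ?Q] by (simp add: cm_add)
  qed
  have "Rs (Suc m) (Qm (Suc m) j) = (\<Sum>k=Suc m..n. (vt m k * hm k + hm k * vt m k) * ?Q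
      + (hm k * cm (k - m) m ?Q + cm (k - m) m ?Q * hm k))"
    unfolding Rs_def
  proof (rule sum.cong[OF HOL.refl])
    fix k assume k: "k \<in> {Suc m..n}"
    have "?Q * hm k = hm k * ?Q" using Qm_hm[of m k j] k by (simp add: comm_def)
    then show "hm k * cm (k - Suc m) (Suc m) (Qm (Suc m) j) + cm (k - Suc m) (Suc m) (Qm (Suc m) j) * hm k
        = (vt m k * hm k + hm k * vt m k) * ?Q + (hm k * cm (k - m) m ?Q + cm (k - m) m ?Q * hm k)"
      unfolding c[OF k] by (simp add: algebra_simps)
  qed
  also have "\<dots> = xm m * ?Q + (\<Sum>k=Suc m..n. hm k * cm (k - m) m ?Q + cm (k - m) m ?Q * hm k)"
  proof -
    have "xm m * ?Q = (\<Sum>k=Suc m..n. (vt m k * hm k + hm k * vt m k) * ?Q)"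
      using assms by (simp add: xm_def sum_distrib_right)
    then show ?thesis by (simp only: sum.distrib[of "\<lambda>k. (vt m k * hm k + hm k * vt m k) * ?Q"])
  qed
  finally show ?thesis using assms by (simp add: Rs_def sum.atLeast_Suc_atMost algebra_simps)
qed

text \<open>The telescope starts at \<open>n\<close>, where \<open>xm n = 1\<close>, so that the
  first summand cancels the constant part \<open>- Qm n j\<close> of
  \<open>L_n \<epsilon>_j\<close>.\<close>

lemma Rs_sum:
  assumes "1 \<le> j" "j < m" "m \<le> n"
  shows "(\<Sum>k=m..n. xm k * Qm k j - (hm k * Qm k j + Qm k j * hm k)) - Qm n j = - Rs m (Qm m j)"
  using assms(3,2)
proof (induction m rule: inc_induct)
  case base
  then show ?case by (simp add: Rs_def xm_def)
next
  case (step m)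
  let ?f = "\<lambda>k. xm k * Qm k j - (hm k * Qm k j + Qm k j * hm k)"
  have A: "(\<Sum>k=m..n. ?f k) = ?f m + (\<Sum>k=Suc m..n. ?f k)"
    using step by (simp add: sum.atLeast_Suc_atMost)
  have B: "(\<Sum>k=Suc m..n. ?f k) - Qm n j = - Rs (Suc m) (Qm (Suc m) j)"
    using step by simp
  have "(\<Sum>k=m..n. ?f k) - Qm n j = ?f m + ((\<Sum>k=Suc m..n. ?f k) - Qm n j)"
    by (simp only: A add_diff_eq)
  also have "\<dots> = ?f m - Rs (Suc m) (Qm (Suc m) j)"
    by (subst B) (simp only: diff_conv_add_uminus)
  also have "\<dots> = - Rs m (Qm m j)"
    by (rule Rs_step[OF assms(1) step.prems step.hyps(2)])
  finally show ?case .
qed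

text \<open>At its lower end the recursion takes the exceptional form
  \<open>Qm (j + 1) j = A_j Q + L_j A_j\<close>, and the remainder turns into terms of the summand
  \<open>m = j\<close>.\<close>

lemma Rs_diag:
  assumes "1 \<le> j" "j < n"
  shows "Rs (Suc j) (Qm (Suc j) j) = xm j * Qm j j + Lm j * xm j"
proof -
  let ?N = "Qm j j" and ?L = "Lm j"
  have c: "cm (k - Suc j) (Suc j) (Qm (Suc j) j) = vt j k * ?N + ?L * vt j k" if "k \<in> {Suc j..n}" for k
  proof -
    have "Qm (Suc j) j = opA j * ?N + ?L * opA j" using assms by simp
    moreover have "cm (k - Suc j) (Suc j) (opA j * ?N) = vt j (Suc j + (k - Suc j)) * ?N"
      by (rule cm_vt_left(1)) (use assms that Qm_opA in auto)
    moreover have "cm (k - Suc j) (Suc j) (?L * opA j) = ?L * vt j (Suc j + (k - Suc j))"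
      by (rule cm_vt_left(2)) (use assms that Lm_opA in auto)
    ultimately show ?thesis using that by (simp add: cm_add)
  qed
  have "Rs (Suc j) (Qm (Suc j) j) = (\<Sum>k=Suc j..n. (vt j k * hm k + hm k * vt j k) * ?N
      + ?L * (vt j k * hm k + hm k * vt j k))"
    unfolding Rs_def
  proof (rule sum.cong[OF HOL.refl])
    fix k assume k: "k \<in> {Suc j..n}"
    have 1: "?N * hm k = hm k * ?N" using Qm_hm[of j k j] k by (simp add: comm_def)
    have 2: "hm k * ?L = ?L * hm k" using Lm_hm[of j k] k by (simp add: comm_def)
    have 2: "hm k * (?L * X) = ?L * (hm k * X)" for X using 2 by (simp add: mult.assoc[symmetric])
    show "hm k * cm (k - Suc j) (Suc j) (Qm (Suc j) j) + cm (k - Suc j) (Suc j) (Qm (Suc j) j) * hm k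
        = (vt j k * hm k + hm k * vt j k) * ?N + ?L * (vt j k * hm k + hm k * vt j k)"
      unfolding c[OF k] using 1 2 by (simp add: algebra_simps)
  qed
  also have "\<dots> = (\<Sum>k=Suc j..n. (vt j k * hm k + hm k * vt j k) * ?N)
      + (\<Sum>k=Suc j..n. ?L * (vt j k * hm k + hm k * vt j k))"
    by (rule sum.distrib)
  also have "\<dots> = (\<Sum>k=Suc j..n. vt j k * hm k + hm k * vt j k) * ?N
      + ?L * (\<Sum>k=Suc j..n. vt j k * hm k + hm k * vt j k)"
    by (simp only: sum_distrib_left sum_distrib_right)
  finally show ?thesis using assms by (simp only: xm_def) simp
qed

text \<open>Expresses the operator whose commutator with \<open>h_j\<close> occurs in the summand
  \<open>m = j\<close> by the transpositions that occur for \<open>m < j\<close>. The extra term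
  \<open>2 L_{j-1}\<close> commutes with \<open>h_j\<close>.\<close>

lemma Qm_Lm_diag:
  assumes "1 \<le> j" "j \<le> n"
  shows "Qm j j + Lm j = 2 * Lm (j - 1) + (\<Sum>m=1..<j. Lm m * vt m j + vt m j * Lm m)"
  using assms
proof (induction j rule: nat_induct_at_least)
  case base
  then show ?case by simp
next
  case (Suc j)
  let ?a = "opA j"
  have j: "1 \<le> j" "j < n" using Suc by auto
  have IH: "Qm j j + Lm j = 2 * Lm (j - 1) + (\<Sum>m=1..<j. Lm m * vt m j + vt m j * Lm m)" using Suc by simp
  \<comment> \<open>The letters of \<open>L_{j-1}\<close> are less than \<open>j - 1\<close>, so
    both factors \<open>A_j\<close> come together.\<close>
  have z: "?a * Lm (j - 1) * ?a = 0"
    using Lm_opA[of "j - 1" j] j opA_sq[of j] by (simp add: comm_def mult.assoc) (metis mult.assoc mult_zero_right)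
  have "?a * (Lm m * vt m j + vt m j * Lm m) * ?a = Lm m * vt m (Suc j) + vt m (Suc j) * Lm m"
    if "m \<in> {1..<j}" for m
  proof -
    have c: "?a * Lm m = Lm m * ?a" using Lm_opA[of m j] that j by (simp add: comm_def)
    have c': "?a * (Lm m * X) = Lm m * (?a * X)" for X using c by (simp add: mult.assoc[symmetric])
    have "vt m (Suc j) = ?a * vt m j * ?a" by (rule vt_right) (use that j in auto)
    then show ?thesis using c c' by (simp add: algebra_simps)
  qed
  then have s: "?a * (\<Sum>m=1..<j. Lm m * vt m j + vt m j * Lm m) * ?a
      = (\<Sum>m=1..<j. Lm m * vt m (Suc j) + vt m (Suc j) * Lm m)"
    by (simp add: sum_distrib_left sum_distrib_right)
  have "Qm (Suc j) (Suc j) + Lm (Suc j) = 2 * Lm j + (?a * Lm j + Lm j * ?a) + ?a * (Qm j j + Lm j) * ?a"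
    using j by (simp add: algebra_simps mult_2)
  also have "?a * (Qm j j + Lm j) * ?a = (\<Sum>m=1..<j. Lm m * vt m (Suc j) + vt m (Suc j) * Lm m)"
    unfolding IH s[symmetric] using z by (simp add: algebra_simps mult_2)
  finally show ?case using j by (simp add: vt_Suc algebra_simps)
qed

text \<open>The operators \<open>t0\<close> and \<open>t m\<close> are the constant parts of the
  summands of \<open>M \<epsilon>_j\<close>. They cancel in two groups: in \<open>A\<close> the
  terms with \<open>xm\<close> against the summands \<open>m > j\<close> and \<open>t0\<close>, in
  \<open>B\<close> the commutators with \<open>h_j\<close> against the summands
  \<open>m < j\<close>.\<close>

theorem M2_ep:
  assumes "1 \<le> j" "j \<le> n"
  shows "II n (M2 * ep j)"
proof -
  define t where "t m = (if j < m then xm m * Qm m j - (hm m * Qm m j + Qm m j * hm m)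
    else if m = j then xm j * Qm j j + Lm j * xm j + ((Qm j j + Lm j) * hm j - hm j * (Qm j j + Lm j))
    else Lm m * (hm j * vt m j - vt m j * hm j) + (hm j * vt m j - vt m j * hm j) * Lm m)" for m
  define t0 where "t0 = - Qm n j - (if j = n then Lm n else 0)"
  have 0: "II n (Lm n * ep j - t0)"
  proof -
    have "Lm n * ep j - t0 = (Lm n * ep j - ep n * Qm n j + Qm n j + (if j = n then Lm n else 0)) + ep n * Qm n j"
      by (simp add: t0_def)
    moreover have "II n \<dots>"
      by (intro II_add II_ep II_mono[OF Lm_ep]) (use assms n_ge_2 in auto)
    ultimately show ?thesis by (simp only:)
  qed
  have 1: "II n ((hm m * Lm m + Lm m * hm m) * ep j - t m)" if m: "m \<in> {1..n}" for m
  proof -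
    let ?h = "hm m" and ?L = "Lm m" and ?E = "ep m" and ?J = "ep j"
    have hE: "?h * ?E = - ?E * ?h + xm m" using hm_ep m by simp
    have hE': "?h * (?E * X) = - ?E * (?h * X) + xm m * X" for X
      by (simp only: mult.assoc[symmetric] hE distrib_right left_diff_distrib)
    have h_II: "II (m - 1) (?h * X)" if "II (m - 1) X" for X
      by (rule II_left[OF that]) (use m hm_ep_less in auto)
    consider "j < m" | "j = m" | "m < j" by linarith
    then show ?thesis
    proof cases
      case 1
      let ?Q = "Qm m j"
      define i where "i = ?L * ?J - ?E * ?Q + ?Q"
      have i: "II (m - 1) i" using Lm_ep[of m j] m 1 assms by (simp add: i_def)
      have LJ: "?L * ?J = ?E * ?Q - ?Q + i" by (simp add: i_def)
      have LJ': "?L * (?J * X) = ?E * (?Q * X) - ?Q * X + i * X" for X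
        by (simp only: mult.assoc[symmetric] LJ distrib_right left_diff_distrib)
      have hJ: "?h * ?J = ?J * ?h" using hm_ep_less[of j m] 1 m assms by (simp add: comm_def)
      have "(?h * ?L + ?L * ?h) * ?J - t m = ?E * (?Q * ?h - ?h * ?Q) + (?h * i + i * ?h)"
        using 1 by (simp add: t_def algebra_simps hJ LJ LJ' hE hE')
      moreover have "II n \<dots>"
        by (intro II_add II_ep II_mono[OF h_II[OF i]] II_mono[OF II_mult[OF i]]) (use m in auto)
      ultimately show ?thesis by simp
    next
      case 2
      let ?Q = "Qm m m"
      define i where "i = ?L * ?E - ?E * ?Q + ?Q + ?L"
      have i: "II (m - 1) i" using Lm_ep[of m m] m by (simp add: i_def)
      have LE: "?L * ?E = ?E * ?Q - ?Q - ?L + i" by (simp add: i_def)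
      have LE': "?L * (?E * X) = ?E * (?Q * X) - ?Q * X - ?L * X + i * X" for X
        by (simp only: mult.assoc[symmetric] LE distrib_right left_diff_distrib)
      have "(?h * ?L + ?L * ?h) * ?J - t m = ?E * (- (?h * ?Q) - ?Q * ?h) + (?h * i - i * ?h)"
        using 2 by (simp add: t_def algebra_simps LE LE' hE hE')
      moreover have "II n \<dots>"
        by (intro II_add II_diff II_ep II_mono[OF h_II[OF i]] II_mono[OF II_mult[OF i]]) (use m in auto)
      ultimately show ?thesis by simp
    next
      case 3
      have LJ: "?L * ?J = ?J * ?L"
      proof -
        have "comm ?J ?L"
          by (rule Lm_comm) (use m 3 assms in \<open>auto intro!: comm_sym[OF opA_ep_comm]\<close>)
        then show ?thesis by (simp only: comm_def)
      qed
      have LJ': "?L * (?J * X) = ?J * (?L * X)" for X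
        using LJ by (simp add: mult.assoc[symmetric])
      have hJ: "?h * ?J = ?J * ?h + (hm j * vt m j - vt m j * hm j)"
        using hm_ep_greater[of m j] m 3 assms by simp
      have hJ': "?h * (?J * X) = ?J * (?h * X) + (hm j * (vt m j * X) - vt m j * (hm j * X))" for X
        by (simp only: mult.assoc[symmetric] hJ distrib_right left_diff_distrib)
      have "(?h * ?L + ?L * ?h) * ?J - t m = ?J * (?h * ?L + ?L * ?h)"
        using 3 by (simp add: t_def algebra_simps LJ LJ' hJ hJ')
      moreover have "II n \<dots>" by (intro II_ep) (use assms in auto)
      ultimately show ?thesis by simp
    qed
  qed
  have sum0: "t0 + (\<Sum>m=1..n. t m) = 0"
  proof -
    have S: "(\<Sum>m=1..n. t m) = (\<Sum>m=1..<j. t m) + (t j + (\<Sum>m=Suc j..n. t m))"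
    proof -
      have "{1..n} = {1..<j} \<union> {j..n}" using assms by auto
      moreover have "(\<Sum>m\<in>{1..<j} \<union> {j..n}. t m) = (\<Sum>m=1..<j. t m) + (\<Sum>m=j..n. t m)"
        by (rule sum.union_disjoint) auto
      moreover have "(\<Sum>m=j..n. t m) = t j + (\<Sum>m=Suc j..n. t m)"
        using assms by (simp add: sum.atLeast_Suc_atMost)
      ultimately show ?thesis by simp
    qed
    have A: "t0 + (xm j * Qm j j + Lm j * xm j) + (\<Sum>m=Suc j..n. t m) = 0"
    proof (cases "j = n")
      case True
      then show ?thesis by (simp add: t0_def xm_def)
    next
      case False
      have "(\<Sum>m=Suc j..n. t m) = (\<Sum>k=Suc j..n. xm k * Qm k j - (hm k * Qm k j + Qm k j * hm k))"
        by (rule sum.cong) (auto simp: t_def)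
      moreover have "(\<Sum>k=Suc j..n. xm k * Qm k j - (hm k * Qm k j + Qm k j * hm k)) - Qm n j
          = - (xm j * Qm j j + Lm j * xm j)"
        using Rs_sum[of j "Suc j"] Rs_diag[of j] False assms by simp
      ultimately show ?thesis using False by (simp add: t0_def algebra_simps)
    qed
    have B: "(\<Sum>m=1..<j. t m) + ((Qm j j + Lm j) * hm j - hm j * (Qm j j + Lm j)) = 0"
    proof -
      have c: "Lm (j - 1) * hm j = hm j * Lm (j - 1)"
        using Lm_hm[of "j - 1" j] assms by (simp add: comm_def)
      have "(\<Sum>m=1..<j. t m) = (\<Sum>m=1..<j. hm j * (Lm m * vt m j + vt m j * Lm m) - (Lm m * vt m j + vt m j * Lm m) * hm j)"
      proof (rule sum.cong[OF HOL.refl])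
        fix m assume m: "m \<in> {1..<j}"
        have c: "hm j * Lm m = Lm m * hm j" using Lm_hm[of m j] m assms by (simp add: comm_def)
        have c': "hm j * (Lm m * X) = Lm m * (hm j * X)" for X using c by (simp add: mult.assoc[symmetric])
        show "t m = hm j * (Lm m * vt m j + vt m j * Lm m) - (Lm m * vt m j + vt m j * Lm m) * hm j"
          using m by (simp add: t_def algebra_simps c c')
      qed
      also have "\<dots> = hm j * (\<Sum>m=1..<j. Lm m * vt m j + vt m j * Lm m) - (\<Sum>m=1..<j. Lm m * vt m j + vt m j * Lm m) * hm j"
        by (simp add: sum_subtractf sum_distrib_left sum_distrib_right)
      finally show ?thesis
        unfolding Qm_Lm_diag[OF assms] using c by (simp add: algebra_simps mult_2)
    qed
    have T: "t j = (xm j * Qm j j + Lm j * xm j) + ((Qm j j + Lm j) * hm j - hm j * (Qm j j + Lm j))"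
      by (simp add: t_def)
    have "t0 + (\<Sum>m=1..n. t m) = (t0 + (xm j * Qm j j + Lm j * xm j) + (\<Sum>m=Suc j..n. t m))
        + ((\<Sum>m=1..<j. t m) + ((Qm j j + Lm j) * hm j - hm j * (Qm j j + Lm j)))"
      unfolding S T by (simp only: add_ac)
    also have "\<dots> = 0" unfolding A B by simp
    finally show ?thesis .
  qed
  have "M2 * ep j = (Lm n * ep j - t0) + (\<Sum>m=1..n. (hm m * Lm m + Lm m * hm m) * ep j - t m) + (t0 + (\<Sum>m=1..n. t m))"
    by (simp add: M2_def distrib_right sum_distrib_right sum_subtractf)
  moreover have "II n (\<Sum>m\<in>A. (hm m * Lm m + Lm m * hm m) * ep j - t m)" if "finite A" "A \<subseteq> {1..n}" for A
    using that by (induction A) (auto intro!: II_add 1)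
  ultimately show ?thesis unfolding sum0 using 0 by (simp add: II_add)
qed

section \<open>Membership tested on the coordinates\<close>

definition vanish :: "modl \<Rightarrow> bool" where
  "vanish x \<longleftrightarrow> (\<forall>h. eval0 (Poly_Mapping.lookup x h) = 0)"

lemma vanish_sum: "(\<And>i. i \<in> A \<Longrightarrow> vanish (f i)) \<Longrightarrow> vanish (\<Sum>i\<in>A. f i)"
  by (simp add: vanish_def lookup_sum eval0_sum)

lemma vanish_opS: "eval0 f = 0 \<Longrightarrow> vanish (app (opS f) x)"
  by (simp add: vanish_def lookup_opS eval0_mult)

lemma eval0_eps [simp]: "eval0 (eps r) = 0"
  using eval0_uminus by (auto simp: eps_def eps0_def eval0_add diff_conv_add_uminus simp del: add_uminus_conv_diff)

lemma vanish_II: "II k X \<Longrightarrow> vanish (app X y)"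
  by (auto simp: II_def app_sum_l app_times ep_def intro!: vanish_sum vanish_opS)

text \<open>Coefficients stand on the left, so if all of them vanish at 0, this persists under any
  multiplication on the right.\<close>

lemma ev_vanish:
  assumes "x \<in> FC G1" "vanish (vec x)"
  shows "vanish (app (ev x) y)"
proof -
  have "ev x = ev (expand (vec x))" using ev_eqv expand_vec[OF assms(1)] by blast
  then have "app (ev x) y = (\<Sum>h\<in>Poly_Mapping.keys (vec x). app (opS (Poly_Mapping.lookup (vec x) h)) (app (opW (rw h)) y))"
    by (simp add: expand_def ev_sum ev_mult app_sum_l app_times)
  then show ?thesis using assms(2) by (simp add: vanish_def[of "vec x"] vanish_sum vanish_opS)
qed

text \<open>By induction on \<open>s\<close>. For \<open>s = x_j q\<close> the coefficients of
  \<open>p x_j\<close> vanish at 0, since \<open>x_j\<close> is a sum of coordinates, and by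
  \<open>ev_vanish\<close> they still do so after multiplication by \<open>q\<close>.\<close>

theorem fomin_stanley_criterion:
  assumes "p \<in> FC G0" and v: "\<And>j. 1 \<le> j \<Longrightarrow> j \<le> n \<Longrightarrow> vanish (app (ev p) (app (ep j) (bas id)))"
  shows "C.cl p \<in> fomin_stanley n"
  unfolding fomin_stanley_iff[OF assms(1)]
proof (intro ballI allI)
  have p1: "p \<in> FC G1" using FC_mono[OF G0_G1 assms(1)] .
  fix s h assume "s \<in> sym_alg n"
  then have "s \<in> polys_in {1..n}" by (simp only: sym_alg_eq)
  then show "eval0 (Poly_Mapping.lookup (app (ev p) (Poly_Mapping.single id s)) h)
      = eval0 s * eval0 (Poly_Mapping.lookup (vec p) h)"
  proof (induction arbitrary: h)
    case (const c)
    have "app (ev p) (Poly_Mapping.single id (of_int c)) = app (ev p * of_int c) (bas id)"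
      using app_opS[of "of_int c" id 1] by (simp add: app_times bas_def)
    also have "\<dots> = app (of_int c * ev p) (bas id)" by (simp only: mult_of_int_commute)
    finally have "app (ev p) (Poly_Mapping.single id (of_int c)) = app (of_int c) (vec p)"
      by (simp add: app_times vec_def)
    then show ?case by (simp add: lookup_of_int_endo eval0_mult id_def)
  next
    case (add p q)
    then show ?case by (simp add: single_add lookup_add eval0_add distrib_right)
  next
    case (var q j)
    then have j: "1 \<le> j" "j \<le> n" by auto
    have x: "xvar j \<in> sym_alg n" unfolding sym_alg_eq by (rule xvar_in[OF var(2)])
    have "vec (p * sc (xvar j)) = (\<Sum>r=1..j. app (ev p) (app (ep r) (bas id)))"
      unfolding vec_mult vec_def[of "sc (xvar j)"]
      by (simp add: xvar_eps[OF j] opS_sum app_sum_l app_sum ep_def)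
    then have "vanish (vec (p * sc (xvar j)))" using v j by (auto intro!: vanish_sum)
    then have "vanish (app (ev (p * sc (xvar j))) (Poly_Mapping.single id q))"
      by (intro ev_vanish FC_mult p1 sc_FC1 x)
    then show ?case by (simp add: ev_mult app_times vanish_def eval0_mult id_def)
  qed
qed

lemma fomin_stanley_vanish:
  assumes "p \<in> FC G0" "C.cl p \<in> fomin_stanley n" "1 \<le> j" "j \<le> n"
  shows "vanish (app (ev p) (app (ep j) (bas id)))"
proof -
  have "eps (int j) \<in> sym_alg n" unfolding sym_alg_eq by (rule eps_in) (use assms in auto)
  then show ?thesis using assms fomin_stanley_iff[OF assms(1)] by (simp add: vanish_def ep_def bas_def)
qed

section \<open>Uniqueness of the Schubert classes\<close>

text \<open>The coefficient of \<open>A\<^sub>v\<close> in \<open>\<phi>\<^sub>0(A\<^sub>u \<epsilon>\<^sub>j)\<close>.\<close>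

definition D :: "nat list \<Rightarrow> nat \<Rightarrow> (state \<Rightarrow> state) \<Rightarrow> int" where
  "D u j v = (\<Sum>i<length u. kap (u ! i) (res (drop (Suc i) u) (int j))
     * (if red (take i u @ drop (Suc i) u) \<and> pa (rev (take i u @ drop (Suc i) u)) = v then 1 else 0))"

lemma del_Wd: "u \<in> Wd \<Longrightarrow> take i u @ drop (Suc i) u \<in> Wd"
  by (auto dest: in_set_takeD in_set_dropD)

lemma D_eq:
  assumes "u \<in> Wd" "1 \<le> j" "j \<le> n"
  shows "eval0 (Poly_Mapping.lookup (app (opW u) (app (ep j) (bas id))) v) = D u j v"
proof -
  have r: "1 \<le> int j \<and> int j \<le> 2 * int n" using assms by auto
  have "app (opW u) (app (ep j) (bas id)) = app (opS (eps (res u (int j)))) (app (opW u) (bas id))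
      + (\<Sum>i<length u. app (of_int (kap (u ! i) (res (drop (Suc i) u) (int j)))) (app (opW (take i u @ drop (Suc i) u)) (bas id)))"
    using opW_eps[OF assms(1) r] by (simp add: ep_def app_times[symmetric] app_plus app_sum_l)
  moreover have "eval0 (Poly_Mapping.lookup (app (of_int k) (app (opW (take i u @ drop (Suc i) u)) (bas id))) v)
      = k * (if red (take i u @ drop (Suc i) u) \<and> pa (rev (take i u @ drop (Suc i) u)) = v then 1 else 0)" for k i
    unfolding lookup_of_int_endo eval0_mult opW_bas_id[OF del_Wd[OF assms(1)]]
    using eval0_of_int[of 1] by (auto simp: bas_def lookup_single when_def)
  ultimately show ?thesis
    by (simp add: lookup_add eval0_add lookup_sum eval0_sum lookup_opS eval0_mult D_def)
qed

lemma D_cong: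
  assumes "red u" "red u'" "pa u = pa u'" "1 \<le> j" "j \<le> n"
  shows "D u j v = D u' j v"
proof -
  have "opW u = opW u'"
    using ev_eqv[OF C_eqv_H[OF aw_beq[OF red_beq[OF assms(1-3)]]]] by simp
  then show ?thesis using D_eq[of u j v] D_eq[of u' j v] assms red_Wd by metis
qed

section \<open>Minimal coset representatives\<close>

abbreviation Fd :: "nat list set" where "Fd \<equiv> lists {1..n}"

lemma Fd_Wd: "x \<in> Fd \<Longrightarrow> x \<in> Wd" by auto

text \<open>Reducing a word creates no letters: braid moves preserve the letters and cancellation
  removes some. So the elements of the parabolic subgroup have reduced words in the positive
  letters.\<close>

lemma ex_red_subset: "u \<in> Wd \<Longrightarrow> \<exists>v. red v \<and> pa v = pa u \<and> set v \<subseteq> set u"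
proof (induction u rule: list.induct)
  case Nil
  show ?case by (rule exI[of _ "[]"]) simp
next
  case (Cons i u)
  then obtain v where v: "red v" "pa v = pa u" "set v \<subseteq> set u" by auto
  have i: "i \<le> n" using Cons by auto
  show ?case
  proof (cases "desc (pa (rev v)) i")
    case False
    then have "red (i # v)" using red_Cons_iff v i by blast
    then show ?thesis using v by (intro exI[of _ "i # v"]) auto
  next
    case True
    then obtain w where w: "red (i # w)" "pa (i # w) = pa v" using desc_exchange[OF v(1) i] by metis
    have "set w \<subseteq> set v" using beq_props[OF red_beq[OF w(1) v(1) w(2)]] by auto
    moreover have "pa w = pa (i # u)"
    proof -
      have "pa (i # u) = act i \<circ> pa (i # w)" using w(2) v(2) by simp
      also have "\<dots> = pa w" using i by (simp add: fun_eq_iff)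
      finally show ?thesis by simp
    qed
    ultimately show ?thesis using red_Cons[OF w(1)] v(3) by (intro exI[of _ w]) auto
  qed
qed

definition minrep :: "nat list \<Rightarrow> bool" where
  "minrep u \<longleftrightarrow> u \<in> Wd \<and> (\<forall>x\<in>Fd. \<forall>w\<in>Wd. pa w = pa (u @ x) \<longrightarrow> length u \<le> length w)"

lemma minrep_red: "minrep u \<Longrightarrow> red u"
  unfolding minrep_def red_def by (metis append_Nil2 lists.Nil)

lemma exchange_right:
  assumes "red u" "i \<le> n" "\<not> red (u @ [i])"
  obtains j where "j < length u" "pa (u @ [i]) = pa (take j u @ drop (Suc j) u)"
proof -
  have "red (rev u)" using assms red_rev by blast
  moreover have "\<not> red (i # rev u)" using assms(3) red_rev[of "u @ [i]"] by simp
  ultimately have "desc (pa (rev (rev u))) i" using red_Cons_iff assms(2) by blast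
  then obtain j where j: "j < length (rev u)" "pa (i # rev u) = pa (take j (rev u) @ drop (Suc j) (rev u))"
    using exchange[of "rev u" i] assms red_Wd by (metis rev_Wd)
  have W: "i # rev u \<in> Wd" "take j (rev u) @ drop (Suc j) (rev u) \<in> Wd"
    using red_Wd[OF assms(1)] assms(2) del_Wd[of "rev u" j] by auto
  have "pa (rev (i # rev u)) = pa (rev (take j (rev u) @ drop (Suc j) (rev u)))"
    using pa_rev_eq[OF W] j(2) by simp
  moreover have "rev (take j (rev u) @ drop (Suc j) (rev u)) = take (length u - Suc j) u @ drop (Suc (length u - Suc j)) u"
    using j(1) by (simp add: rev_take rev_drop Suc_diff_Suc)
  ultimately show ?thesis using that[of "length u - Suc j"] j(1) by simp
qed

text \<open>If a further letter destroyed reducedness, the exchange condition would delete a letter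
  of \<open>u\<close>, which gives a shorter word in the coset, or one of \<open>x\<close>, which
  contradicts that \<open>x\<close> with the new letter is reduced.\<close>

lemma minrep_append:
  assumes "minrep u" "red x" "x \<in> Fd"
  shows "red (u @ x)"
  using assms(2,3)
proof (induction x rule: rev_induct)
  case Nil
  then show ?case using minrep_red assms(1) by simp
next
  case (snoc i x)
  have x: "red x" "x \<in> Fd" "i \<le> n" "i \<in> {1..n}" using snoc.prems red_append2 by auto
  have ux: "red (u @ x)" using snoc.IH x by blast
  have uW: "u \<in> Wd" "x \<in> Wd" using red_Wd[OF ux] by auto
  show ?case
  proof (rule ccontr)
    assume "\<not> red (u @ x @ [i])"
    then obtain j where j: "j < length (u @ x)" "pa ((u @ x) @ [i]) = pa (take j (u @ x) @ drop (Suc j) (u @ x))"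
      using exchange_right[OF ux x(3)] by auto
    show False
    proof (cases "j < length u")
      case True
      let ?u = "take j u @ drop (Suc j) u"
      have "pa ?u s = pa (u @ x @ [i] @ rev x) s" for s
        using fun_cong[OF j(2), of "pa (rev x) s"] True uW by (simp add: pa_append pa_rev_r)
      then have "pa ?u = pa (u @ (x @ [i] @ rev x))" by auto
      moreover have "x @ [i] @ rev x \<in> Fd" using x by auto
      moreover have "?u \<in> Wd" by (rule del_Wd[OF uW(1)])
      ultimately have "length u \<le> length ?u" using assms(1) unfolding minrep_def by blast
      then show False using True by simp
    next
      case False
      define k where "k = j - length u"
      let ?x = "take k x @ drop (Suc k) x"
      have k: "k < length x" using False j(1) by (auto simp: k_def)
      have "take j (u @ x) @ drop (Suc j) (u @ x) = u @ ?x" using False by (simp add: k_def Suc_diff_le)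
      then have "pa u (pa (x @ [i]) s) = pa u (pa ?x s)" for s
        using fun_cong[OF j(2), of s] by (simp add: pa_append)
      then have "pa (x @ [i]) = pa ?x" using pa_inj[OF uW(1)] by auto
      moreover have "?x \<in> Wd" by (rule del_Wd[OF uW(2)])
      ultimately have "length (x @ [i]) \<le> length ?x" using snoc.prems(1) unfolding red_def by metis
      then show False using k by simp
    qed
  qed
qed

lemma minrep_ex:
  assumes "w \<in> Wd"
  shows "\<exists>u x. minrep u \<and> red x \<and> x \<in> Fd \<and> pa (u @ x) = pa w"
proof -
  let ?P = "\<lambda>u. u \<in> Wd \<and> (\<exists>x\<in>Fd. pa u = pa (w @ x))"
  have "?P w" using assms by (intro conjI bexI[of _ "[]"]) auto
  then obtain u where u: "?P u" "\<And>u'. ?P u' \<Longrightarrow> length u \<le> length u'"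
    using ex_has_least_nat[of ?P w length] by blast
  then obtain x where x: "x \<in> Fd" "pa u = pa (w @ x)" by blast
  have "minrep u"
    unfolding minrep_def
  proof (intro conjI ballI impI)
    fix y v assume y: "y \<in> Fd" "v \<in> Wd" "pa v = pa (u @ y)"
    have "x @ y \<in> Fd" "pa v = pa (w @ (x @ y))" using x y by (auto simp: pa_append o_assoc)
    then show "length u \<le> length v" using u(2)[of v] y(2) by blast
  qed (use u in blast)
  moreover obtain y where y: "red y" "pa y = pa (rev x)" "set y \<subseteq> set (rev x)"
    using ex_red_subset[of "rev x"] Fd_Wd[OF x(1)] by auto
  moreover have "y \<in> Fd" using y x by auto
  moreover have "pa (u @ y) s = pa w s" for s
    using fun_cong[OF x(2), of "pa (rev x) s"] fun_cong[OF y(2), of s] Fd_Wd[OF x(1)]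
    by (simp add: pa_append pa_rev_r)
  then have "pa (u @ y) = pa w" by blast
  ultimately show ?thesis by blast
qed

lemma act_invalid: "\<not> valid s \<Longrightarrow> i \<le> n \<Longrightarrow> act i s = s"
  using n_ge_2 by (auto simp: act_defs valid_def prod_eq_iff)

lemma pa_invalid: "\<not> valid s \<Longrightarrow> u \<in> Wd \<Longrightarrow> pa u s = s"
  by (induction u) (auto simp: act_invalid)

lemma pa_Fd: "x \<in> Fd \<Longrightarrow> pa x (q, r) = (q, res x r)"
  by (induction x) (auto simp: act_def)

text \<open>Words in positive letters keep the blocks and commute with \<open>rv\<close>, so the
  images of \<open>1, ..., n\<close> determine the whole permutation.\<close>

lemma Fd_id:
  assumes "red x" "x \<in> Fd" "\<And>r. 1 \<le> r \<Longrightarrow> r \<le> n \<Longrightarrow> res x (int r) = int r"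
  shows "x = []"
proof -
  have W: "x \<in> Wd" by (rule Fd_Wd[OF assms(2)])
  have "pa x (q, r) = (q, r)" for q r
  proof (cases "valid (q, r)")
    case True
    have 1: "pa x (q', r') = (q', r')" if "1 \<le> r'" "r' \<le> int n" for q' r'
      using assms(3)[of "nat r'"] that pa_Fd[OF assms(2)] by simp
    show ?thesis
    proof (cases "r \<le> int n")
      case True
      then show ?thesis using 1 \<open>valid (q, r)\<close> by (simp add: valid_def)
    next
      case False
      have "pa x (rv (rv (q, r))) = rv (pa x (rv (q, r)))" by (rule pa_rv[OF W])
      then show ?thesis using 1[of "2 * int n + 1 - r" "- q"] False \<open>valid (q, r)\<close> by (simp add: rv_def valid_def)
    qed
  qed (use pa_invalid W in simp)
  then have "pa x = pa []" by auto
  then have "length x \<le> length ([] :: nat list)" using assms(1) unfolding red_def by (metis lists.Nil)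
  then show ?thesis by simp
qed

text \<open>The letter of the edge between the positions \<open>t - 1\<close> and \<open>t\<close>.\<close>

definition lab :: "int \<Rightarrow> nat" where
  "lab t = (if t \<le> int n + 1 then nat (t - 1) else nat (2 * int n + 1 - t))"

lemma lab:
  assumes "2 \<le> t" "t \<le> 2 * int n"
  shows "1 \<le> lab t" "lab t \<le> n" "actr (lab t) (t - 1) = t" "actr (lab t) t = t - 1" "kap (lab t) (t - 1) = 1"
proof -
  have "2 * t \<noteq> 2 * int n + 1" by presburger
  then show "1 \<le> lab t" "lab t \<le> n" "actr (lab t) (t - 1) = t" "actr (lab t) t = t - 1" "kap (lab t) (t - 1) = 1"
    using assms by (auto simp: lab_def actr_def kap_def)
qed

lemma desc_lab:
  assumes "u \<in> Wd" "2 \<le> t" "t \<le> 2 * int n"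
  shows "desc (pa u) (lab t) \<longleftrightarrow> pa u (0, t) \<prec> pa u (0, t - 1)"
proof (cases "t \<le> int n + 1")
  case True
  then have "xe (lab t) = (0, t - 1)" "ye (lab t) = (0, t)" using assms by (auto simp: lab_def xe_def ye_def)
  then show ?thesis by (simp add: desc_def)
next
  case False
  then have "rv (xe (lab t)) = (0, t)" "rv (ye (lab t)) = (0, t - 1)" using assms by (auto simp: lab_def xe_def ye_def rv_def)
  then have "pa u (0, t) = rv (pa u (xe (lab t)))" "pa u (0, t - 1) = rv (pa u (ye (lab t)))"
    using pa_rv[OF assms(1)] by metis+
  then show ?thesis by (simp add: desc_def)
qed

text \<open>A nonzero coroot value means that the letter belongs to the edge from \<open>r\<close>
  to \<open>r + 1\<close>, with sign plus, or to the edge from \<open>r - 1\<close> to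
  \<open>r\<close>, with sign minus.\<close>

lemma kap_cases:
  assumes "1 \<le> i" "i \<le> n" "kap i r \<noteq> 0" "1 \<le> r" "r \<le> 2 * int n"
  obtains "kap i r = 1" "i = lab (r + 1)" "2 \<le> r + 1" "r + 1 \<le> 2 * int n" | "kap i r = - 1" "i = lab r" "2 \<le> r" "r \<le> 2 * int n"
proof -
  have par: "2 * int i + 1 \<noteq> 2 * int n" "2 * int i \<noteq> 2 * int n + 1" by presburger+
  consider "r = int i" | "r = 2 * int n - int i" | "r = int i + 1" | "r = 2 * int n - int i + 1"
    using assms by (auto simp: kap_def split: if_splits)
  then show ?thesis
  proof cases
    case 1
    then have "kap i r = 1" "i = lab (r + 1)" "2 \<le> r + 1" "r + 1 \<le> 2 * int n"
      using assms n_ge_2 by (auto simp: kap_def lab_def)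
    then show ?thesis by (rule that(1))
  next
    case 2
    then have "kap i r = 1" "i = lab (r + 1)" "2 \<le> r + 1" "r + 1 \<le> 2 * int n"
      using assms n_ge_2 by (auto simp: kap_def lab_def)
    then show ?thesis by (rule that(1))
  next
    case 3
    then have "kap i r = - 1" "i = lab r" "2 \<le> r" "r \<le> 2 * int n"
      using assms n_ge_2 par by (auto simp: kap_def lab_def split: if_splits)
    then show ?thesis by (rule that(2))
  next
    case 4
    then have "kap i r = - 1" "i = lab r" "2 \<le> r" "r \<le> 2 * int n"
      using assms n_ge_2 par by (auto simp: kap_def lab_def split: if_splits)
    then show ?thesis by (rule that(2))
  qed
qed

lemma res_append: "res (u @ v) r = res u (res v r)" by (simp add: res_def)

lemma res_rev: "u \<in> Wd \<Longrightarrow> res (rev u) (res u r) = r" "u \<in> Wd \<Longrightarrow> res u (res (rev u) r) = r"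
  using snd_pa[of "rev u" "pa u (0, r)"] snd_pa[of u "(0, r)"] pa_rev_l[of u "(0, r)"]
    snd_pa[of u "pa (rev u) (0, r)"] snd_pa[of "rev u" "(0, r)"] pa_rev_r[of u "(0, r)"] by auto

text \<open>In a reduced word the part to the left of a letter cannot invert the edge of that
  letter.\<close>

lemma asc_right:
  assumes "red (p @ k # q)" "p \<in> Fd" "k = lab t" "2 \<le> t" "t \<le> 2 * int n"
  shows "res p (t - 1) < res p t"
proof -
  have W: "p \<in> Wd" by (rule Fd_Wd[OF assms(2)])
  have k: "k \<le> n" using lab assms by auto
  have "red (p @ [k])" using red_append2[of "p @ [k]" q] assms(1) by simp
  then have "red (k # rev p)" using red_rev[of "p @ [k]"] by simp
  then have "\<not> desc (pa (rev (rev p))) k" using red_Cons_iff[OF red_Cons k] by blast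
  then have "\<not> pa p (0, t) \<prec> pa p (0, t - 1)" using desc_lab[OF W assms(4,5)] assms(3) by simp
  moreover have "pa p (0, t) \<noteq> pa p (0, t - 1)" using pa_inj[OF W] by simp
  ultimately show ?thesis using slt_linear[of "pa p (0, t)" "pa p (0, t - 1)"] pa_Fd[OF assms(2)] by (auto simp: slt_def)
qed

lemma asc_left:
  assumes "red (p @ k # q)" "q \<in> Fd" "k = lab t" "2 \<le> t" "t \<le> 2 * int n"
  shows "res (rev q) (t - 1) < res (rev q) t"
proof (rule asc_right)
  show "red (rev q @ k # rev p)" using assms(1) red_rev[of "p @ k # q"] by simp
qed (use assms in auto)

lemma D_append:
  assumes "u \<in> Wd"
  shows "D (u @ y) j v = (\<Sum>i<length u. kap (u ! i) (res (drop (Suc i) u @ y) (int j))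
      * (if red (take i u @ drop (Suc i) u @ y) \<and> pa (rev (take i u @ drop (Suc i) u @ y)) = v then 1 else 0))
    + (\<Sum>i<length y. kap (y ! i) (res (drop (Suc i) y) (int j))
      * (if red (u @ take i y @ drop (Suc i) y) \<and> pa (rev (u @ take i y @ drop (Suc i) y)) = v then 1 else 0))"
proof -
  have s: "(\<Sum>i<a + b. f i) = (\<Sum>i<a. f i) + (\<Sum>i<b. f (a + i))" for a b and f :: "nat \<Rightarrow> int"
    by (induction b) (simp_all add: add.assoc)
  show ?thesis
    unfolding D_def length_append s
    by (intro arg_cong2[of _ _ _ _ "(+)"] sum.cong) (auto simp: nth_append)
qed

section \<open>The extremal coefficient\<close>

context
  fixes u0 ys y' :: "nat list" and j :: nat and t :: int
  assumes u0: "minrep u0" and j: "1 \<le> j" "j \<le> n"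
    and t: "int j < t" "t \<le> 2 * int n"
    and ys: "ys = lab t # y'" "red ys" "ys \<in> Fd"
    and yst: "res ys (int j) = t"
begin

lemma y'_facts: "y' \<in> Fd" "y' \<in> Wd" "ys \<in> Wd" "red y'" "res y' (int j) = t - 1"
proof -
  show "y' \<in> Fd" using ys by auto
  then show W: "y' \<in> Wd" by (rule Fd_Wd)
  show "ys \<in> Wd" by (rule Fd_Wd[OF ys(3)])
  show "red y'" using ys red_Cons by blast
  have "actr (lab t) (actr (lab t) (res y' (int j))) = res y' (int j)"
    using lab[of t] t j act_act[of "lab t" "(0, res y' (int j))"] by (simp add: act_def)
  then show "res y' (int j) = t - 1" using yst ys(1) lab(4)[of t] t j by simp
qed

text \<open>Deleting a letter of \<open>u\<close> would leave a word in the coset of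
  \<open>u0\<close> that is shorter than \<open>u0\<close>. So the deleted letter lies in
  \<open>x\<close>, and such a deletion does not leave the coset.\<close>

lemma D_other:
  assumes "minrep u" "red x" "x \<in> Fd" "length u \<le> length u0"
    "D (u @ x) j (pa (rev (u0 @ y'))) \<noteq> 0"
  shows "\<exists>y. red y \<and> y \<in> Fd \<and> pa (u @ x) = pa (u0 @ y)"
proof -
  let ?v = "pa (rev (u0 @ y'))"
  have W: "u \<in> Wd" "x \<in> Wd" "u0 \<in> Wd" using assms u0 Fd_Wd[of x] by (auto simp: minrep_def)
  have uy: "u0 @ y' \<in> Wd" using W y'_facts by auto
  have key: "pa w = pa (u0 @ y' @ rev z)" if "w \<in> Wd" "z \<in> Wd" "pa (rev (w @ z)) = ?v" for w z
  proof -
    have wz: "w @ z \<in> Wd" using that by auto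
    have "pa (w @ z) = pa (u0 @ y')" using pa_rev_eq[OF wz uy] that(3) by simp
    from fun_cong[OF this] have "pa w (pa z (pa (rev z) s)) = pa u0 (pa y' (pa (rev z) s))" for s
      by (simp add: pa_append)
    then have "pa w s = pa (u0 @ y' @ rev z) s" for s using that(2) by (simp add: pa_append pa_rev_r)
    then show ?thesis by blast
  qed
  have 1: "\<not> pa (rev (take i u @ drop (Suc i) u @ x)) = ?v" if "i < length u" for i
  proof
    assume "pa (rev (take i u @ drop (Suc i) u @ x)) = ?v"
    then have "pa (take i u @ drop (Suc i) u) = pa (u0 @ (y' @ rev x))"
      using key[of "take i u @ drop (Suc i) u" x] del_Wd[OF W(1), of i] W(2) by simp
    moreover have "y' @ rev x \<in> Fd" using y'_facts assms by auto
    ultimately have "length u0 \<le> length (take i u @ drop (Suc i) u)"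
      using u0 del_Wd[OF W(1), of i] unfolding minrep_def by blast
    then show False using that assms(4) by simp
  qed
  have "\<exists>i<length x. pa (rev (u @ take i x @ drop (Suc i) x)) = ?v"
  proof (rule ccontr)
    assume "\<not> ?thesis"
    then have "D (u @ x) j ?v = 0" unfolding D_append[OF W(1)] using 1 by simp
    then show False using assms(5) by simp
  qed
  then obtain i where i: "pa (rev (u @ take i x @ drop (Suc i) x)) = ?v" by blast
  let ?x = "take i x @ drop (Suc i) x"
  have xF: "?x \<in> Fd" using assms(3) by (auto dest: in_set_takeD in_set_dropD)
  have "pa u = pa (u0 @ y' @ rev ?x)" using key[OF W(1) Fd_Wd[OF xF]] i by simp
  then have e: "pa (u @ x) = pa (u0 @ (y' @ rev ?x @ x))" by (simp add: pa_append o_assoc)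
  have F: "y' @ rev ?x @ x \<in> Fd" using xF y'_facts assms by auto
  then obtain y where "red y" "pa y = pa (y' @ rev ?x @ x)" "set y \<subseteq> set (y' @ rev ?x @ x)"
    using ex_red_subset[OF Fd_Wd[OF F]] by blast
  moreover from this have "y \<in> Fd" "pa (u @ x) = pa (u0 @ y)" using F e by (auto simp: pa_append)
  ultimately show ?thesis by blast
qed

text \<open>Factor \<open>y = p k q\<close> at the deleted letter; then \<open>p q\<close>
  represents \<open>y'\<close>, and \<open>p\<close> sends \<open>r\<close>, the image of
  \<open>j\<close> under \<open>q\<close>, to \<open>t - 1\<close>. The sign of the coroot value at
  \<open>r\<close> decides.\<close>

lemma D_terms:
  assumes y: "red y" "y \<in> Fd" "\<And>z. 1 \<le> z \<Longrightarrow> z < int j \<Longrightarrow> res y z = z" "res y (int j) \<le> t"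
    and i: "i < length y" "pa (rev (u0 @ take i y @ drop (Suc i) y)) = pa (rev (u0 @ y'))"
    "kap (y ! i) (res (drop (Suc i) y) (int j)) \<noteq> 0"
  shows "kap (y ! i) (res (drop (Suc i) y) (int j)) = 1 \<and> pa y = pa ys"
proof -
  define p k q where "p = take i y" and "k = y ! i" and "q = drop (Suc i) y"
  have ypq: "y = p @ k # q" using i(1) by (simp add: p_def k_def q_def id_take_nth_drop)
  have F: "p \<in> Fd" "q \<in> Fd" "k \<in> {1..n}" using y(2) unfolding ypq by auto
  have W: "p \<in> Wd" "q \<in> Wd" "u0 \<in> Wd" "p @ q \<in> Wd" "k \<le> n" "1 \<le> k"
    using F u0 Fd_Wd by (auto simp: minrep_def)
  have uy: "u0 @ y' \<in> Wd" "u0 @ p @ q \<in> Wd" using W y'_facts by auto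
  have "pa (u0 @ p @ q) = pa (u0 @ y')"
    using pa_rev_eq[OF uy(2,1)] i(2) by (simp add: p_def q_def)
  from fun_cong[OF this] have "pa u0 (pa (p @ q) s) = pa u0 (pa y' s)" for s by (simp add: pa_append)
  then have pq: "pa (p @ q) = pa y'" using pa_inj[OF W(3)] by auto
  define r where "r = res q (int j)"
  have r: "1 \<le> r" "r \<le> 2 * int n" using res_valid[OF W(2), of "int j"] j by (auto simp: r_def)
  have pr: "res p r = t - 1"
  proof -
    have "pa (p @ q) (0, int j) = pa y' (0, int j)" by (simp only: pq)
    then have "res (p @ q) (int j) = res y' (int j)"
      using pa_Fd[of "p @ q"] pa_Fd[of y'] F y'_facts(1) by simp
    then show ?thesis using y'_facts by (simp add: res_append r_def)
  qed
  have kr: "kap k r \<noteq> 0" using i(3) by (simp add: k_def q_def r_def)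
  show ?thesis
    using W(6,5) kr r
  proof (cases rule: kap_cases)
    case 1
    \<comment> \<open>The image of \<open>r + 1\<close> under \<open>p\<close> is
      \<open>y(j)\<close>. It is greater than \<open>t - 1\<close> and at most \<open>t\<close>,
      hence \<open>t\<close>. So \<open>p\<close> carries the edge of \<open>k\<close> to the edge
      of \<open>lab t\<close>, and \<open>p k q\<close> is \<open>lab t\<close> times
      \<open>y'\<close>.\<close>
    have a: "res p r < res p (r + 1)" using asc_right[of p k q "r + 1"] y(1) F 1 unfolding ypq by simp
    have yj: "res y (int j) = res p (r + 1)"
      unfolding ypq using 1 lab(3)[of "r + 1"] by (simp add: res_append r_def[symmetric])
    have pr1: "res p (r + 1) = t" using a yj pr y(4) by simp
    have "act (lab t) (pa p s) = pa p (act k s)" for s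
    proof (rule reflection_unique[OF W(1,5)])
      show "lab t \<le> n" using lab[of t] t j by simp
      have "act k (0, r) = (0, r + 1)" using 1 lab(3)[of "r + 1"] W(6) by (simp add: act_def)
      moreover have "act (lab t) (0, t - 1) = (0, t)" using lab[of t] t j by (simp add: act_def)
      ultimately show "act k (0, r) \<noteq> (0, r)" "pa p (act k (0, r)) = act (lab t) (pa p (0, r))"
        using pa_Fd[OF F(1)] pr pr1 by simp_all
    qed
    then have "pa p (act k (pa q s)) = act (lab t) (pa (p @ q) s)" for s by (simp add: pa_append)
    then have "pa y = pa ys" unfolding ypq ys(1) pq by (simp add: pa_append fun_eq_iff)
    then show ?thesis using 1(1) by (simp add: k_def q_def r_def)
  next
    case 2
    \<comment> \<open>The letter would move \<open>r\<close> down. The point \<open>z\<close> that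
      \<open>q\<close> sends to \<open>r - 1\<close> is less than \<open>j\<close>, so
      \<open>y\<close> fixes it, although \<open>y\<close> sends it to
      \<open>t - 1 \<ge> j\<close>.\<close>
    define z where "z = res (rev q) (r - 1)"
    have "z < res (rev q) r" unfolding z_def
      using asc_left[of p k q r] y(1) F 2 unfolding ypq by simp
    then have zj: "z < int j" using res_rev(1)[OF W(2)] by (simp add: r_def)
    have rq: "rev q \<in> Wd" using W by auto
    have z1: "1 \<le> z" using res_valid[OF rq, of "r - 1"] 2 by (simp add: z_def)
    have "res y z = res p (actr k (r - 1))"
      unfolding ypq z_def using res_rev(2)[OF W(2)] by (simp add: res_append)
    also have "actr k (r - 1) = r" using 2 lab(3)[of r] by simp
    finally have "res y z = t - 1" using pr by simp
    then show ?thesis using y(3)[OF z1 zj] zj t by simp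
  qed
qed

lemma D_fin:
  assumes y: "red y" "y \<in> Fd" "\<And>z. 1 \<le> z \<Longrightarrow> z < int j \<Longrightarrow> res y z = z" "res y (int j) \<le> t"
    and D: "D (u0 @ y) j (pa (rev (u0 @ y'))) \<noteq> 0"
  shows "pa y = pa ys"
proof (rule ccontr)
  assume n: "pa y \<noteq> pa ys"
  let ?v = "pa (rev (u0 @ y'))"
  have W: "u0 \<in> Wd" "y \<in> Wd" using u0 Fd_Wd[OF y(2)] by (auto simp: minrep_def)
  have uy: "u0 @ y' \<in> Wd" using W y'_facts by auto
  have 1: "\<not> pa (rev (take i u0 @ drop (Suc i) u0 @ y)) = ?v" if "i < length u0" for i
  proof
    assume a: "pa (rev (take i u0 @ drop (Suc i) u0 @ y)) = ?v"
    let ?u = "take i u0 @ drop (Suc i) u0"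
    have uW: "?u \<in> Wd" by (rule del_Wd[OF W(1)])
    have "?u @ y \<in> Wd" using uW W(2) by auto
    then have "pa (?u @ y) = pa (u0 @ y')" using pa_rev_eq[OF _ uy, of "?u @ y"] a by simp
    from fun_cong[OF this] have "pa ?u (pa y (pa (rev y) s)) = pa u0 (pa y' (pa (rev y) s))" for s
      by (simp add: pa_append)
    then have "pa ?u s = pa (u0 @ (y' @ rev y)) s" for s using W(2) by (simp add: pa_append pa_rev_r)
    then have "pa ?u = pa (u0 @ (y' @ rev y))" by blast
    moreover have "y' @ rev y \<in> Fd" using y'_facts y by auto
    ultimately have "length u0 \<le> length ?u" using u0 uW unfolding minrep_def by blast
    then show False using that by simp
  qed
  have 2: "kap (y ! i) (res (drop (Suc i) y) (int j)) = 0 \<or> pa (rev (u0 @ take i y @ drop (Suc i) y)) \<noteq> ?v"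
    if "i < length y" for i
    using D_terms[OF y that] n by blast
  have "D (u0 @ y) j ?v = 0 + 0"
    unfolding D_append[OF W(1)]
  proof (intro arg_cong2[of _ _ _ _ "(+)"] sum.neutral ballI)
    fix i assume "i \<in> {..<length u0}"
    then show "kap (u0 ! i) (res (drop (Suc i) u0 @ y) (int j))
      * (if red (take i u0 @ drop (Suc i) u0 @ y) \<and> pa (rev (take i u0 @ drop (Suc i) u0 @ y)) = ?v then 1 else 0) = 0"
      using 1[of i] by simp
  next
    fix i assume "i \<in> {..<length y}"
    then have "i < length y" by simp
    from 2[OF this] show "kap (y ! i) (res (drop (Suc i) y) (int j))
      * (if red (u0 @ take i y @ drop (Suc i) y) \<and> pa (rev (u0 @ take i y @ drop (Suc i) y)) = ?v then 1 else 0) = 0"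
      by (auto simp del: rev_append)
  qed
  then show False using D by simp
qed

text \<open>By \<open>D_terms\<close> no contribution is negative, and the deletion of the first
  letter of \<open>ys\<close> contributes the coroot value 1 at \<open>t - 1\<close>.\<close>

lemma D_pos:
  assumes ysm: "\<And>z. 1 \<le> z \<Longrightarrow> z < int j \<Longrightarrow> res ys z = z"
  shows "D (u0 @ ys) j (pa (rev (u0 @ y'))) > 0"
proof -
  let ?v = "pa (rev (u0 @ y'))"
  let ?f = "\<lambda>i. kap (ys ! i) (res (drop (Suc i) ys) (int j))
      * (if red (u0 @ take i ys @ drop (Suc i) ys) \<and> pa (rev (u0 @ take i ys @ drop (Suc i) ys)) = ?v then 1 else 0)"
  have W: "u0 \<in> Wd" using u0 by (auto simp: minrep_def)
  have uy: "u0 @ y' \<in> Wd" using W y'_facts by auto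
  have 1: "\<not> pa (rev (take i u0 @ drop (Suc i) u0 @ ys)) = ?v" if "i < length u0" for i
  proof
    assume a: "pa (rev (take i u0 @ drop (Suc i) u0 @ ys)) = ?v"
    let ?u = "take i u0 @ drop (Suc i) u0"
    have uW: "?u \<in> Wd" by (rule del_Wd[OF W(1)])
    have "?u @ ys \<in> Wd" using uW y'_facts(3) by auto
    then have "pa (?u @ ys) = pa (u0 @ y')" using pa_rev_eq[OF _ uy, of "?u @ ys"] a by simp
    from fun_cong[OF this] have "pa ?u (pa ys (pa (rev ys) s)) = pa u0 (pa y' (pa (rev ys) s))" for s
      by (simp add: pa_append)
    then have "pa ?u s = pa (u0 @ (y' @ rev ys)) s" for s using y'_facts(3) by (simp add: pa_append pa_rev_r)
    then have "pa ?u = pa (u0 @ (y' @ rev ys))" by blast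
    moreover have "y' @ rev ys \<in> Fd" using y'_facts ys by auto
    ultimately have "length u0 \<le> length ?u" using u0 uW unfolding minrep_def by blast
    then show False using that by simp
  qed
  have nn: "?f i \<ge> 0" if "i < length ys" for i
    using D_terms[OF ys(2,3) ysm _ that] yst by fastforce
  have "length ys > 0" using ys by simp
  moreover have "?f 0 = 1"
    using ys(1) y'_facts lab(5)[of t] t j minrep_append[OF u0 y'_facts(4,1)] by simp
  ultimately have "(\<Sum>i<length ys. ?f i) \<ge> 1"
    using member_le_sum[of 0 "{..<length ys}" ?f] nn by simp
  then show ?thesis unfolding D_append[OF W] using 1 by simp
qed

end

theorem fomin_stanley_unique:
  assumes p: "p \<in> FC G0" "C.cl p \<in> fomin_stanley n"
    and ng: "\<And>h. h \<in> Poly_Mapping.keys (vec p) \<Longrightarrow> cof h \<notin> grassmannian n"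
  shows "vec p = 0"
proof (rule ccontr)
  assume ne: "vec p \<noteq> 0"
  define K where "K = Poly_Mapping.keys (vec p)"
  define c where "c h = eval0 (Poly_Mapping.lookup (vec p) h)" for h
  have g: "good0 (vec p)" and ex: "C.eqv p (expand0 (vec p))" using expand0_vec[OF p(1)] by auto
  have fin: "finite K" and KG: "K \<subseteq> GG" using g by (auto simp: K_def good0_def)
  have c0: "c h \<noteq> 0" if "h \<in> K" for h
  proof -
    obtain a where "Poly_Mapping.lookup (vec p) h = of_int a" using g by (auto simp: good0_def)
    then show ?thesis using that by (auto simp: K_def c_def in_keys_iff)
  qed
  have "\<forall>h\<in>K. \<exists>ux. minrep (fst ux) \<and> red (snd ux) \<and> snd ux \<in> Fd \<and> pa (fst ux @ snd ux) = pa (rw h)"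
  proof
    fix h assume "h \<in> K"
    then obtain u x where "minrep u \<and> red x \<and> x \<in> Fd \<and> pa (u @ x) = pa (rw h)"
      using minrep_ex[OF rw_Wd[of h]] KG by blast
    then show "\<exists>ux. minrep (fst ux) \<and> red (snd ux) \<and> snd ux \<in> Fd \<and> pa (fst ux @ snd ux) = pa (rw h)"
      by (intro exI[of _ "(u, x)"]) simp
  qed
  from bchoice[OF this] obtain f where
    f: "\<forall>h\<in>K. minrep (fst (f h)) \<and> red (snd (f h)) \<and> snd (f h) \<in> Fd \<and> pa (fst (f h) @ snd (f h)) = pa (rw h)"
    by blast
  define U X where "U h = fst (f h)" and "X h = snd (f h)" for h
  have U: "minrep (U h)" and X: "red (X h)" "X h \<in> Fd" and UX: "pa (U h @ X h) = pa (rw h)" if "h \<in> K" for h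
    using f that by (auto simp: U_def X_def)
  have UW: "U h @ X h \<in> Wd" if "h \<in> K" for h using red_Wd[OF minrep_append[OF U X]] that by blast
  have UXh: "pa (rev (U h @ X h)) = h" if h: "h \<in> K" for h
  proof -
    have hG: "h \<in> GG" using h KG by blast
    show ?thesis using pa_rev_eq[OF UW[OF h] rw_Wd[OF hG]] UX[OF h] rw(2)[OF hG] by simp
  qed
  have "K \<noteq> {}" using ne by (simp add: K_def)
  then have "Max ((\<lambda>h. length (U h)) ` K) \<in> (\<lambda>h. length (U h)) ` K" using fin by (intro Max_in) auto
  then obtain h1 where h1: "h1 \<in> K" "Max ((\<lambda>h. length (U h)) ` K) = length (U h1)" by blast
  have h1m: "length (U h) \<le> length (U h1)" if "h \<in> K" for h
    using h1(2) Max_ge[of "(\<lambda>h. length (U h)) ` K" "length (U h)"] fin that by auto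
  define u0 where "u0 = U h1"
  have u0: "minrep u0" using U h1 by (simp add: u0_def)
  have u0W: "u0 \<in> Wd" using u0 by (simp add: minrep_def)
  define Y where "Y = {y. red y \<and> y \<in> Fd \<and> pa (rev (u0 @ y)) \<in> K}"
  have Y1: "X h1 \<in> Y" unfolding Y_def using X[OF h1(1)] UXh[OF h1(1)] h1(1) by (simp add: u0_def del: rev_append)
  \<comment> \<open>A term of the coset with trivial parabolic part would be Grassmannian.\<close>
  have Yne: "y \<noteq> []" if y: "y \<in> Y" for y
  proof
    assume "y = []"
    then have k: "pa (rev u0) \<in> K" using y by (simp add: Y_def)
    have kG: "pa (rev u0) \<in> GG" using k KG by blast
    have "pa (rw (pa (rev u0))) = pa u0"
      using pa_rev_eq[OF rw_Wd[OF kG] u0W] rw(2)[OF kG] by simp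
    then have "cof (pa (rev u0)) = cls u0"
      unfolding cof_def using cls_inject[OF rw_Wd[OF kG] u0W] by simp
    moreover have "cls u0 \<in> grassmannian n"
      unfolding grassmannian_cls[OF u0W]
    proof
      fix x assume x: "x \<in> Fd"
      have ux: "u0 @ x \<in> Wd" using u0W Fd_Wd[OF x] by auto
      obtain w where w: "red w" "pa w = pa (u0 @ x)" using ex_red[OF ux] by blast
      have "cls (u0 @ x) = cls w" using cls_inject[OF ux red_Wd[OF w(1)]] w(2) by simp
      moreover have "length u0 \<le> length w" using u0 x red_Wd[OF w(1)] w(2) unfolding minrep_def by blast
      ultimately show "len (cls u0) \<le> len (cls (u0 @ x))" using len_cls[OF w(1)] len_cls[OF minrep_red[OF u0]] by simp
    qed
    moreover have "cof (pa (rev u0)) \<notin> grassmannian n" using ng k unfolding K_def by blast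
    ultimately show False by simp
  qed
  have YW: "y \<in> Wd" "y \<in> Fd" "red y" if "y \<in> Y" for y using that Fd_Wd[of y] by (auto simp: Y_def)
  have "\<exists>r. 1 \<le> r \<and> r \<le> n \<and> (\<exists>y\<in>Y. res y (int r) \<noteq> int r)"
    using Fd_id[of "X h1"] YW[OF Y1] Yne[OF Y1] Y1 by blast
  then have "\<exists>j. (1 \<le> j \<and> j \<le> n \<and> (\<exists>y\<in>Y. res y (int j) \<noteq> int j))
      \<and> (\<forall>r<j. \<not> (1 \<le> r \<and> r \<le> n \<and> (\<exists>y\<in>Y. res y (int r) \<noteq> int r)))"
    by (rule exists_least_iff[THEN iffD1])
  then obtain j y1 where j: "1 \<le> j" "j \<le> n" and y1: "y1 \<in> Y" "res y1 (int j) \<noteq> int j"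
    and jm: "\<forall>r<j. \<not> (1 \<le> r \<and> r \<le> n \<and> (\<exists>y\<in>Y. res y (int r) \<noteq> int r))" by blast
  have fix_: "res y z = z" if "y \<in> Y" "1 \<le> z" "z < int j" for y z
  proof -
    have "nat z < j" "1 \<le> nat z" "nat z \<le> n" using that j by auto
    then have "res y (int (nat z)) = int (nat z)" using jm that(1) by blast
    then show ?thesis using that by simp
  qed
  have vj: "1 \<le> res y (int j) \<and> res y (int j) \<le> 2 * int n" if "y \<in> Y" for y
    using res_valid[OF YW(1)[OF that], of "int j"] j by auto
  define t where "t = Max ((\<lambda>y. res y (int j)) ` Y)"
  have finY: "finite ((\<lambda>y. res y (int j)) ` Y)"
    by (rule finite_subset[of _ "{1..2 * int n}"]) (use vj in auto)
  have tm: "res y (int j) \<le> t" if "y \<in> Y" for y unfolding t_def using finY that by (intro Max_ge) auto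
  have "t \<in> (\<lambda>y. res y (int j)) ` Y" unfolding t_def using finY y1 by (intro Max_in) auto
  then obtain y2 where y2: "y2 \<in> Y" "res y2 (int j) = t" by blast
  \<comment> \<open>All points below \<open>j\<close> are fixed by \<open>y1\<close>, so injectivity
    forbids \<open>j\<close> to move down.\<close>
  have "\<not> res y1 (int j) < int j"
  proof
    assume l: "res y1 (int j) < int j"
    have "res y1 (res y1 (int j)) = res y1 (int j)" by (rule fix_[OF y1(1) _ l]) (use vj y1 in blast)
    then have "res y1 (int j) = int j" using res_rev(1)[OF YW(1)[OF y1(1)]] by metis
    then show False using y1(2) by simp
  qed
  then have t: "int j < t" "t \<le> 2 * int n" using tm[OF y1(1)] y1(2) vj[OF y2(1)] y2(2) by auto
  have t2: "2 \<le> t" using t j by simp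
  have ry: "rev y2 \<in> Wd" "rev y2 \<in> Fd" using YW[OF y2(1)] by auto
  define z where "z = res (rev y2) (t - 1)"
  have z1: "1 \<le> z" using res_valid[OF ry(1), of "t - 1"] t t2 by (simp add: z_def)
  have yz: "res y2 z = t - 1" using res_rev(2)[OF YW(1)[OF y2(1)]] by (simp add: z_def)
  \<comment> \<open>Here \<open>z\<close> is the preimage of \<open>t - 1\<close>. The points below
    \<open>j\<close> are fixed and \<open>t - 1 \<ge> j\<close>, while \<open>j\<close> itself goes
    to \<open>t\<close>. So the inverse of \<open>y2\<close> inverts the edge at \<open>t\<close>,
    and \<open>lab t\<close> is a left descent of \<open>y2\<close>.\<close>
  have "int j < z"
    using fix_[OF y2(1) z1] yz y2(2) t by (cases z "int j" rule: linorder_cases) auto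
  moreover have "res (rev y2) t = int j" using res_rev(1)[OF YW(1)[OF y2(1)], of "int j"] y2(2) by simp
  ultimately have "pa (rev y2) (0, t) \<prec> pa (rev y2) (0, t - 1)"
    using pa_Fd[OF ry(2)] by (simp add: z_def slt_def)
  then have "desc (pa (rev y2)) (lab t)" using desc_lab[OF ry(1) t2 t(2)] by blast
  then obtain y' where y': "red (lab t # y')" "pa (lab t # y') = pa y2"
    using desc_exchange[OF YW(3)[OF y2(1)] lab(2)[OF t2 t(2)]] by metis
  define ys where "ys = lab t # y'"
  have ys: "red ys" "pa ys = pa y2" using y' by (simp_all only: ys_def)
  have ysF: "ys \<in> Fd"
    using beq_props[OF red_beq[OF ys(1) YW(3)[OF y2(1)] ys(2)]] YW(2)[OF y2(1)] by auto
  have rys: "res ys r = res y2 r" for r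
    using pa_Fd[OF ysF, of 0 r] pa_Fd[OF YW(2)[OF y2(1)], of 0 r] fun_cong[OF ys(2), of "(0, r)"] by simp
  have yst: "res ys (int j) = t" using rys y2 by simp
  note ctx = u0 j(1) j(2) t(1) t(2) ys_def ys(1) ysF yst
  let ?v = "pa (rev (u0 @ y'))"
  let ?hs = "pa (rev (u0 @ ys))"
  have u0y: "u0 @ y \<in> Wd" if "y \<in> Fd" for y using u0W Fd_Wd[OF that] by auto
  have hsK: "?hs \<in> K"
  proof -
    have "pa (u0 @ ys) = pa (u0 @ y2)" using ys by (simp add: pa_append)
    then have "?hs = pa (rev (u0 @ y2))" using pa_rev_eq[OF u0y[OF ysF] u0y[OF YW(2)[OF y2(1)]]] by blast
    then show ?thesis using y2(1) by (simp add: Y_def del: rev_append)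
  qed
  have Dp: "D (rw ?hs) j ?v > 0"
  proof -
    have hG: "?hs \<in> GG" using hsK KG by blast
    have "pa (rw ?hs) = pa (u0 @ ys)" using pa_rev_eq[OF rw_Wd[OF hG] u0y[OF ysF]] rw(2)[OF hG] by blast
    then have "D (rw ?hs) j ?v = D (u0 @ ys) j ?v"
      by (rule D_cong[OF rw(1)[OF hG] minrep_append[OF u0 ys(1) ysF] _ j])
    also have "\<dots> > 0"
      by (rule D_pos[OF ctx]) (use rys fix_[OF y2(1)] in auto)
    finally show ?thesis .
  qed
  have D0: "D (rw h) j ?v = 0" if h: "h \<in> K" "h \<noteq> ?hs" for h
  proof (rule ccontr)
    assume a: "D (rw h) j ?v \<noteq> 0"
    have hG: "h \<in> GG" using h KG by blast
    have rUX: "red (U h @ X h)" by (rule minrep_append[OF U[OF h(1)] X[OF h(1)]])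
    have "D (rw h) j ?v = D (U h @ X h) j ?v"
      by (rule D_cong[OF rw(1)[OF hG] rUX UX[OF h(1), symmetric] j])
    with a have b: "D (U h @ X h) j ?v \<noteq> 0" by simp
    obtain y where y: "red y" "y \<in> Fd" "pa (U h @ X h) = pa (u0 @ y)"
      using D_other[OF ctx U[OF h(1)] X[OF h(1)] _ b] h1m[OF h(1)] unfolding u0_def by blast
    have "pa (rev (u0 @ y)) = h"
      using pa_rev_eq[OF UW[OF h(1)] u0y[OF y(2)]] y(3) UXh[OF h(1)] by simp
    then have yY: "y \<in> Y" using y h by (simp add: Y_def del: rev_append)
    have "D (U h @ X h) j ?v = D (u0 @ y) j ?v"
      by (rule D_cong[OF rUX minrep_append[OF u0 y(1,2)] y(3) j])
    with b have "D (u0 @ y) j ?v \<noteq> 0" by simp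
    then have "pa y = pa ys" using D_fin[OF ctx y(1,2) fix_[OF yY] tm[OF yY]] by blast
    then have "pa (u0 @ y) = pa (u0 @ ys)" by (simp add: pa_append)
    then have "pa (rev (u0 @ y)) = ?hs" using pa_rev_eq[OF u0y[OF y(2)] u0y[OF ysF]] by blast
    then show False using \<open>pa (rev (u0 @ y)) = h\<close> h(2) by simp
  qed
  have "ev p = ev (expand0 (vec p))" by (rule ev_eqv[OF C_eqv_H[OF ex]])
  also have "\<dots> = (\<Sum>h\<in>K. of_int (c h) * opW (rw h))"
    unfolding expand0_def K_def c_def by (simp add: ev_sum ev_mult)
  finally have "app (ev p) (app (ep j) (bas id)) = (\<Sum>h\<in>K. app (of_int (c h)) (app (opW (rw h)) (app (ep j) (bas id))))"
    by (simp add: app_sum_l app_times)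
  then have "eval0 (Poly_Mapping.lookup (app (ev p) (app (ep j) (bas id))) ?v) = (\<Sum>h\<in>K. c h * D (rw h) j ?v)"
    using D_eq[OF rw_Wd j] KG
    by (simp add: lookup_sum eval0_sum lookup_of_int_endo eval0_mult subset_iff)
  also have "\<dots> = c ?hs * D (rw ?hs) j ?v"
    by (subst sum.remove[OF fin hsK]) (use D0 in simp)
  finally have "c ?hs * D (rw ?hs) j ?v = 0" using fomin_stanley_vanish[OF p j] unfolding vanish_def by (simp del: rev_append)
  then show False using c0[OF hsK] Dp by simp
qed

section \<open>Normal forms of the subwords\<close>

text \<open>The normal forms of the subwords of \<open>[m - 1, \<dots>, 1, 0, 1, \<dots>, m - 1]\<close>: the letter \<open>m\<close> on
  the right of a word without \<open>m - 1\<close> is moved to the left.\<close>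

primrec LL :: "nat \<Rightarrow> nat list set" where
  "LL 0 = {[]}"
| "LL (Suc m) = (if m = 0 then {[], [0]} else LL m \<union> (#) m ` LL m
     \<union> (\<lambda>u. u @ [m]) ` {u \<in> LL m. m - 1 \<in> set u} \<union> (\<lambda>u. m # u @ [m]) ` {u \<in> LL m. m - 1 \<in> set u})"

definition hw :: "nat \<Rightarrow> nat list" where "hw m = [m..<n] @ [n] @ rev [m..<n]"

definition LL' :: "nat \<Rightarrow> nat list set" where "LL' m = {u \<in> LL m. m - 1 \<in> set u}"
definition BB :: "nat \<Rightarrow> nat list set" where "BB m = (\<lambda>u. hw m @ u) ` LL m"
text \<open>Only the words with the letter \<open>m - 1\<close> are taken: the others commute with
  \<open>hw m\<close>, and their products are already in \<open>BB m\<close>.\<close>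

definition DD :: "nat \<Rightarrow> nat list set" where "DD m = (\<lambda>u. u @ hw m) ` LL' m"
definition CC :: "nat list set" where "CC = LL n \<union> (\<Union>m\<in>{1..n}. BB m \<union> DD m)"

lemma LL_Suc: "1 \<le> m \<Longrightarrow> LL (Suc m) = LL m \<union> (#) m ` LL m \<union> (\<lambda>u. u @ [m]) ` LL' m \<union> (\<lambda>u. m # u @ [m]) ` LL' m"
  by (simp add: LL'_def)

lemma LL'_LL: "u \<in> LL' m \<Longrightarrow> u \<in> LL m" by (simp add: LL'_def)

lemma LL_set: "u \<in> LL m \<Longrightarrow> set u \<subseteq> {..<m}"
proof (induction m arbitrary: u)
  case (Suc m)
  show ?case
  proof (cases "m = 0")
    case True
    then show ?thesis using Suc.prems by auto
  next
    case False
    then have "u \<in> LL (Suc m) \<Longrightarrow> \<exists>v\<in>LL m. set u \<subseteq> insert m (set v)" by auto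
    then obtain v where "v \<in> LL m" "set u \<subseteq> insert m (set v)" using Suc.prems by blast
    then show ?thesis using Suc.IH[of v] by auto
  qed
qed simp

lemma LL_finite: "finite (LL m)" by (induction m) auto

lemma LL_Wd: "u \<in> LL m \<Longrightarrow> m \<le> n \<Longrightarrow> u \<in> Wd" using LL_set[of u m] by auto

lemma LL_mono: "1 \<le> k \<Longrightarrow> k \<le> m \<Longrightarrow> LL k \<subseteq> LL m"
proof (induction m)
  case (Suc m)
  then show ?case by (cases "k = Suc m") (auto simp: LL_Suc)
qed simp

lemma hw_n: "hw n = [n]" by (simp add: hw_def)

lemma hw_step: "m < n \<Longrightarrow> hw m = m # hw (Suc m) @ [m]" by (simp add: hw_def upt_conv_Cons)

lemma hw_set: "m \<le> n \<Longrightarrow> set (hw m) = {m..n}" by (auto simp: hw_def)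

lemma hw_Wd: "m \<le> n \<Longrightarrow> hw m \<in> Wd" using hw_set[of m] by auto

lemma opW_hw: "m \<le> n \<Longrightarrow> opW (hw m) = hm m"
proof (induction rule: inc_induct)
  case (step m)
  then show ?case by (simp add: hw_step hm_step opW_append opW_Cons mult.assoc)
qed (simp_all add: hw_n hm_n opW_Cons)

text \<open>The states \<open>\<plusminus>1, \<dots>, \<plusminus>k\<close>, on which the letters below \<open>k\<close> act by signed permutations.\<close>

definition Sg :: "nat \<Rightarrow> state \<Rightarrow> bool" where
  "Sg k s \<longleftrightarrow> fst s = 0 \<and> 1 \<le> snd s \<and> snd s \<le> int k \<or> fst s = - 1 \<and> 2 * int n + 1 - int k \<le> snd s \<and> snd s \<le> 2 * int n"

lemma Sg_pos: "1 \<le> m \<Longrightarrow> m \<le> k \<Longrightarrow> Sg k (0, int m)" by (simp add: Sg_def)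

lemma Sg_rv: "Sg n s \<Longrightarrow> \<not> Sg n (rv s)" by (auto simp: Sg_def rv_def)

lemma act_Sg: "i < k \<Longrightarrow> k \<le> n \<Longrightarrow> Sg k s \<Longrightarrow> Sg k (act i s)"
  using n_int by (auto simp: Sg_def act_defs)

lemma pa_Sg: "set u \<subseteq> {..<k} \<Longrightarrow> k \<le> n \<Longrightarrow> Sg k s \<Longrightarrow> Sg k (pa u s)"
  by (induction u) (auto simp: act_Sg)

lemma act_fix: "i + 1 < r \<Longrightarrow> r \<le> n \<Longrightarrow> act i (0, int r) = (0, int r)"
  by (auto simp: act_defs)

lemma pa_fix: "set u \<subseteq> {..<m} \<Longrightarrow> m < r \<Longrightarrow> r \<le> n \<Longrightarrow> pa u (0, int r) = (0, int r)"
  by (induction u) (auto simp: act_fix)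

lemma act_up: "1 \<le> m \<Longrightarrow> m < n \<Longrightarrow> act m (0, int m) = (0, int m + 1)"
  and act_down: "1 \<le> m \<Longrightarrow> m < n \<Longrightarrow> act m (0, int m + 1) = (0, int m)"
  by (auto simp: act_defs)

lemma act_eq: "i \<le> n \<Longrightarrow> act i s = t \<longleftrightarrow> s = act i t"
  using act_act by metis

lemma pa_cancel_l: "u \<in> Wd \<Longrightarrow> pa (u @ v) = pa (u @ w) \<Longrightarrow> pa v = pa w"
proof
  fix s assume u: "u \<in> Wd" and e: "pa (u @ v) = pa (u @ w)"
  from fun_cong[OF e, of s] show "pa v s = pa w s" using pa_inj[OF u] by (simp add: pa_append)
qed

lemma pa_cancel_r: "u \<in> Wd \<Longrightarrow> pa (v @ u) = pa (w @ u) \<Longrightarrow> pa v = pa w"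
proof
  fix s assume u: "u \<in> Wd" and e: "pa (v @ u) = pa (w @ u)"
  from fun_cong[OF e, of "pa (rev u) s"] show "pa v s = pa w s" using pa_rev_r[OF u] by (simp add: pa_append)
qed

text \<open>Makes the occurrence of \<open>m - 1\<close> visible in the permutation, so that the
  kinds of words in \<open>LL (m + 1)\<close> can be told apart.\<close>

lemma LL_token:
  assumes "u \<in> LL m" "1 \<le> m" "m \<le> n" "m - 1 \<in> set u"
  shows "pa u (0, int m) \<noteq> (0, int m)"
  using assms
proof (induction m arbitrary: u)
  case (Suc m)
  show ?case
  proof (cases "m = 0")
    case True
    then show ?thesis using Suc.prems n_int by (auto simp: act_defs)
  next
    case False
    then have m: "1 \<le> m" "m < n" using Suc.prems by auto
    have nm: "m \<notin> set v" if "v \<in> LL m" for v using LL_set[OF that] by auto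
    consider v where "v \<in> LL m" "u = m # v" | v where "v \<in> LL' m" "u = v @ [m]" | v where "v \<in> LL' m" "u = m # v @ [m]"
      using Suc.prems nm unfolding LL_Suc[OF m(1)] by auto
    then show ?thesis
    proof cases
      case 1
      have "pa v (0, int (Suc m)) = (0, int (Suc m))"
        by (rule pa_fix[OF LL_set[OF 1(1)]]) (use m in auto)
      then show ?thesis using act_down[OF m] by (simp add: 1 add.commute)
    next
      case 2
      have "Sg m (pa v (0, int m))"
        by (rule pa_Sg[OF LL_set[OF LL'_LL[OF 2(1)]]]) (use m Sg_pos in auto)
      then have "pa v (0, int m) \<noteq> (0, int (Suc m))" by (auto simp: Sg_def)
      then show ?thesis using act_down[OF m] by (simp add: 2 add.commute pa_append)
    next
      case 3
      have "pa v (0, int m) \<noteq> (0, int m)"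
        using Suc.IH[OF LL'_LL[OF 3(1)] m(1)] m 3(1) by (simp add: LL'_def)
      then have "act m (pa v (0, int m)) \<noteq> (0, int m + 1)"
        using act_eq[of m "pa v (0, int m)"] act_down[OF m] m by simp
      then show ?thesis using act_down[OF m] by (simp add: 3 add.commute pa_append)
    qed
  qed
qed simp

lemma rev_token: "u \<in> Wd \<Longrightarrow> pa u s \<noteq> s \<Longrightarrow> pa (rev u) s \<noteq> s"
  using pa_rev_r[of u s] by metis

text \<open>The image of \<open>m + 1\<close> distinguishes words without \<open>m\<close>, with
  \<open>m\<close> on the left only, and with \<open>m\<close> on the right; its image under the
  inverse separates the last two kinds.\<close>

lemma LL_Suc_cases:
  assumes "u \<in> LL (Suc m)" "1 \<le> m" "m < n"
  shows "u \<in> LL m \<and> pa u (0, int m + 1) = (0, int m + 1)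
    \<or> (\<exists>v. u = m # v \<and> v \<in> LL m \<and> pa u (0, int m + 1) = (0, int m))
    \<or> (\<exists>v. u = v @ [m] \<and> v \<in> LL m \<and> pa u (0, int m + 1) \<notin> {(0, int m), (0, int m + 1)}
        \<and> pa (rev u) (0, int m + 1) = (0, int m))
    \<or> (\<exists>v. u = m # v @ [m] \<and> v \<in> LL m \<and> pa u (0, int m + 1) \<notin> {(0, int m), (0, int m + 1)}
        \<and> pa (rev u) (0, int m + 1) \<noteq> (0, int m))"
proof -
  have W: "v \<in> Wd" if "v \<in> LL m" for v by (rule LL_Wd[OF that]) (use assms in simp)
  have fx: "pa v (0, int m + 1) = (0, int m + 1)" "pa (rev v) (0, int m + 1) = (0, int m + 1)" if "v \<in> LL m" for v
    using pa_fix[OF LL_set[OF that], of "Suc m"] pa_fix[of "rev v" m "Suc m"] LL_set[OF that] assms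
    by (simp_all add: add.commute)
  have ad: "act m (0, int m + 1) = (0, int m)" by (rule act_down[OF assms(2,3)])
  have tk: "pa v (0, int m) \<noteq> (0, int m)" "pa (rev v) (0, int m) \<noteq> (0, int m)" if "v \<in> LL' m" for v
  proof -
    show "pa v (0, int m) \<noteq> (0, int m)"
      using LL_token[of v m] that assms by (simp add: LL'_def)
    then show "pa (rev v) (0, int m) \<noteq> (0, int m)" by (rule rev_token[OF W[OF LL'_LL[OF that]]])
  qed
  have sg: "Sg m (pa v (0, int m))" "Sg m (pa (rev v) (0, int m))" if "v \<in> LL m" for v
    using pa_Sg[of v m] pa_Sg[of "rev v" m] LL_set[OF that] Sg_pos[of m m] assms by auto
  have ng: "act m x \<noteq> (0, int m)" if "Sg m x" for x
  proof
    assume "act m x = (0, int m)"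
    then have "x = (0, int m + 1)" using act_eq[of m x] act_up[OF assms(2,3)] assms(3) by simp
    then show False using that by (simp add: Sg_def)
  qed
  have ng': "act m x \<noteq> (0, int m + 1)" if "x \<noteq> (0, int m)" for x
    using that act_eq[of m x] ad assms by simp
  have nS: "x \<noteq> (0, int m + 1)" if "Sg m x" for x using that by (auto simp: Sg_def)
  consider "u \<in> LL m" | v where "v \<in> LL m" "u = m # v" | v where "v \<in> LL' m" "u = v @ [m]" | v where "v \<in> LL' m" "u = m # v @ [m]"
    using assms(1) unfolding LL_Suc[OF assms(2)] by auto
  then show ?thesis
  proof cases
    case 1
    then show ?thesis using fx by blast
  next
    case 2
    then show ?thesis using fx(1)[OF 2(1)] ad by simp
  next
    case 3
    then show ?thesis
      using fx(2)[OF LL'_LL[OF 3(1)]] ad tk[OF 3(1)] nS[OF sg(1)[OF LL'_LL[OF 3(1)]]] LL'_LL[OF 3(1)]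
      by (simp add: pa_append)
  next
    case 4
    then show ?thesis
      using ad ng'[OF tk(1)[OF 4(1)]] ng[OF sg(1)[OF LL'_LL[OF 4(1)]]] ng[OF sg(2)[OF LL'_LL[OF 4(1)]]] LL'_LL[OF 4(1)]
      by (simp add: pa_append)
  qed
qed

lemma LL_inj: "u \<in> LL m \<Longrightarrow> v \<in> LL m \<Longrightarrow> m \<le> n \<Longrightarrow> pa u = pa v \<Longrightarrow> u = v"
proof (induction m arbitrary: u v)
  case (Suc m)
  show ?case
  proof (cases "m = 0")
    case True
    have "act 0 (0, 1) \<noteq> id (0, 1)" using n_int by (simp add: act_defs)
    then have "act 0 \<noteq> id" "id \<noteq> act 0" by metis+
    then show ?thesis using Suc.prems True by auto
  next
    case False
    then have m: "1 \<le> m" "m < n" "m \<le> n" using Suc.prems by auto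
    have W: "u \<in> Wd" "v \<in> Wd" using Suc.prems LL_Wd by blast+
    have mW: "[m] \<in> Wd" using m by simp
    note e = fun_cong[OF Suc.prems(4), of "(0, int m + 1)"]
    have e': "pa (rev u) (0, int m + 1) = pa (rev v) (0, int m + 1)"
      using pa_rev_eq[OF W] Suc.prems(4) by simp
    have IH: "x = y" if "x \<in> LL m" "y \<in> LL m" "pa x = pa y" for x y
      by (rule Suc.IH[OF that(1,2) m(3) that(3)])
    have l: "pa x = pa y" if "pa (m # x) = pa (m # y)" for x y
      using pa_cancel_l[OF mW, of x y] that by simp
    have r: "pa x = pa y" if "pa (x @ [m]) = pa (y @ [m])" for x y
      by (rule pa_cancel_r[OF mW that])
    have IHs: "\<And>x y. x \<in> LL m \<Longrightarrow> y \<in> LL m \<Longrightarrow> pa x = pa y \<Longrightarrow> x = y"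
      "\<And>x y. x \<in> LL m \<Longrightarrow> y \<in> LL m \<Longrightarrow> pa (m # x) = pa (m # y) \<Longrightarrow> x = y"
      "\<And>x y. x \<in> LL m \<Longrightarrow> y \<in> LL m \<Longrightarrow> pa (x @ [m]) = pa (y @ [m]) \<Longrightarrow> x = y"
      "\<And>x y. x \<in> LL m \<Longrightarrow> y \<in> LL m \<Longrightarrow> pa (m # x @ [m]) = pa (m # y @ [m]) \<Longrightarrow> x = y"
      using IH l r by blast+
    show ?thesis
      using LL_Suc_cases[OF Suc.prems(1) m(1,2)] LL_Suc_cases[OF Suc.prems(2) m(1,2)]
      unfolding e e'
      by (elim disjE conjE exE) (use IHs Suc.prems(4) in \<open>((simp; fail) | blast)+\<close>)
  qed
qed simp

lemma hw_fst: "1 \<le> m \<Longrightarrow> m \<le> n \<Longrightarrow> fst (pa (hw m) s) = fst s"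
proof -
  assume "1 \<le> m" "m \<le> n"
  then have "hw m \<in> Fd" using hw_set[of m] by auto
  then show ?thesis using pa_Fd[of "hw m" "fst s" "snd s"] by simp
qed

lemma hw_m:
  assumes "1 \<le> m" "m \<le> n"
  shows "pa (hw m) (0, int m) = rv (0, int m)"
  using assms(2,1)
proof (induction rule: inc_induct)
  case (step m)
  then have "act m (rv (0, int m + 1)) = rv (0, int m)"
    using act_rv[of m "(0, int m + 1)"] act_down by simp
  then show ?case using step act_up[of m] by (simp add: hw_step pa_append add.commute)
qed (auto simp: hw_n rv_def act_defs)

lemma hw_fix:
  assumes "1 \<le> m" "m \<le> n" "1 \<le> r" "r \<le> int n" "r \<noteq> int m"
  shows "pa (hw m) (0, r) = (0, r)"
  using assms(2,1,3-)
proof (induction arbitrary: r rule: inc_induct)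
  case (step m)
  note IH = step.IH
  show ?case
  proof (cases "r = int m + 1")
    case True
    then have "act m (0, r) = (0, int m)" "pa (hw (Suc m)) (0, int m) = (0, int m)" "act m (0, int m) = (0, r)"
      using step.hyps step.prems act_down[of m] act_up[of m] IH[of "int m"] by auto
    then show ?thesis using step.hyps by (simp add: hw_step pa_append)
  next
    case False
    then have "act m (0, r) = (0, r)" "pa (hw (Suc m)) (0, r) = (0, r)"
      using step.hyps step.prems IH[of r] by (auto simp: act_defs)
    then show ?thesis using step.hyps by (simp add: hw_step pa_append)
  qed
qed (auto simp: hw_n act_defs)

text \<open>Since \<open>hw m\<close> keeps the blocks, \<open>x\<close> and \<open>y\<close> both
  lie in block 0, where \<open>hw m\<close> fixes every point of \<open>1, ..., n\<close> except
  \<open>m\<close>.\<close>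

lemma hw_out:
  assumes "1 \<le> m" "m \<le> n" "Sg n x" "pa (hw m) x = rv y" "Sg n y"
  shows "x = (0, int m) \<and> y = (0, int m)"
proof -
  have f: "fst x = - fst y" using hw_fst[OF assms(1,2), of x] assms(4) by (simp add: rv_def)
  then have "fst x = 0" using assms by (auto simp: Sg_def)
  then obtain r where x: "x = (0, r)" "1 \<le> r" "r \<le> int n" using assms(3) by (cases x) (auto simp: Sg_def)
  have "r = int m"
  proof (rule ccontr)
    assume "r \<noteq> int m"
    then have "rv y = x" using hw_fix[OF assms(1,2) x(2,3)] assms(4) x by simp
    then show False using Sg_rv[OF assms(5)] assms(3) by simp
  qed
  moreover from this have "rv y = rv (0, int m)" using assms(4) hw_m[OF assms(1,2)] x by simp
  then have "y = (0, int m)" using rv_rv by metis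
  ultimately show ?thesis using x by simp
qed

lemma LL_Sg: "u \<in> LL m \<Longrightarrow> m \<le> n \<Longrightarrow> Sg n s \<Longrightarrow> Sg n (pa u s)"
  by (rule pa_Sg) (use LL_set in fastforce)+

lemma LL_rev_Sg: "u \<in> LL m \<Longrightarrow> m \<le> n \<Longrightarrow> Sg n s \<Longrightarrow> Sg n (pa (rev u) s)"
  by (rule pa_Sg) (use LL_set in fastforce)+

context
  fixes m m' :: nat
  assumes m: "1 \<le> m" "m \<le> n" and m': "1 \<le> m'" "m' \<le> n"
begin

lemma SgN: "Sg n (0, int m)" "Sg n (0, int m')" using m m' Sg_pos by auto

lemma LL_BB: "u \<in> LL n \<Longrightarrow> v \<in> LL m \<Longrightarrow> pa u \<noteq> pa (hw m @ v)"
proof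
  assume u: "u \<in> LL n" and v: "v \<in> LL m" and e: "pa u = pa (hw m @ v)"
  let ?s = "pa (rev v) (0, int m)"
  have "pa u ?s = rv (0, int m)"
    using fun_cong[OF e, of ?s] pa_rev_r[OF LL_Wd[OF v m(2)]] hw_m[OF m] by (simp add: pa_append)
  moreover have "Sg n (pa u ?s)" using LL_Sg[OF u order.refl LL_rev_Sg[OF v m(2) SgN(1)]] .
  ultimately show False using Sg_rv[OF SgN(1)] by simp
qed

lemma LL_DD: "u \<in> LL n \<Longrightarrow> v \<in> LL m \<Longrightarrow> pa u \<noteq> pa (v @ hw m)"
proof
  assume u: "u \<in> LL n" and v: "v \<in> LL m" and e: "pa u = pa (v @ hw m)"
  have "pa u (0, int m) = rv (pa v (0, int m))"
    using fun_cong[OF e, of "(0, int m)"] hw_m[OF m] pa_rv[OF LL_Wd[OF v m(2)]] by (simp add: pa_append)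
  moreover have "Sg n (pa u (0, int m))" using LL_Sg[OF u order.refl SgN(1)] .
  moreover have "\<not> Sg n (rv (pa v (0, int m)))" by (rule Sg_rv[OF LL_Sg[OF v m(2) SgN(1)]])
  ultimately show False by simp
qed

lemma BB_BB: "u \<in> LL m \<Longrightarrow> v \<in> LL m' \<Longrightarrow> pa (hw m @ u) = pa (hw m' @ v) \<Longrightarrow> m = m' \<and> u = v"
proof -
  assume u: "u \<in> LL m" and v: "v \<in> LL m'" and e: "pa (hw m @ u) = pa (hw m' @ v)"
  let ?s = "pa (rev u) (0, int m)"
  have "pa (hw m') (pa v ?s) = rv (0, int m)"
    using fun_cong[OF e, of ?s] pa_rev_r[OF LL_Wd[OF u m(2)]] hw_m[OF m] by (simp add: pa_append)
  moreover have "Sg n (pa v ?s)" by (rule LL_Sg[OF v m'(2) LL_rev_Sg[OF u m(2) SgN(1)]])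
  ultimately have "m = m'" using hw_out[OF m' _ _ SgN(1)] by auto
  then show ?thesis using LL_inj[OF u _ m(2), of v] v pa_cancel_l[OF hw_Wd[OF m(2)], of u v] e by simp
qed

lemma DD_DD: "u \<in> LL m \<Longrightarrow> v \<in> LL m' \<Longrightarrow> pa (u @ hw m) = pa (v @ hw m') \<Longrightarrow> m = m' \<and> u = v"
proof -
  assume u: "u \<in> LL m" and v: "v \<in> LL m'" and e: "pa (u @ hw m) = pa (v @ hw m')"
  have e1: "rv (pa u (0, int m)) = pa v (pa (hw m') (0, int m))"
    using fun_cong[OF e, of "(0, int m)"] hw_m[OF m] pa_rv[OF LL_Wd[OF u m(2)]] by (simp add: pa_append)
  have "m = m'"
  proof (rule ccontr)
    assume "m \<noteq> m'"
    then have "rv (pa u (0, int m)) = pa v (0, int m)" using e1 hw_fix[OF m', of "int m"] m by simp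
    then show False using Sg_rv[OF LL_Sg[OF u m(2) SgN(1)]] LL_Sg[OF v m'(2) SgN(1)] by simp
  qed
  then show ?thesis using LL_inj[OF u _ m(2), of v] v pa_cancel_r[OF hw_Wd[OF m(2)], of u v] e by simp
qed

lemma BB_DD: "u \<in> LL m \<Longrightarrow> v \<in> LL' m' \<Longrightarrow> pa (hw m @ u) \<noteq> pa (v @ hw m')"
proof
  assume u: "u \<in> LL m" and v': "v \<in> LL' m'" and e: "pa (hw m @ u) = pa (v @ hw m')"
  note v = LL'_LL[OF v']
  have "pa (hw m) (pa u (0, int m')) = rv (pa v (0, int m'))"
    using fun_cong[OF e, of "(0, int m')"] hw_m[OF m'] pa_rv[OF LL_Wd[OF v m'(2)]] by (simp add: pa_append)
  from hw_out[OF m LL_Sg[OF u m(2) SgN(2)] this LL_Sg[OF v m'(2) SgN(2)]]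
  have a: "pa u (0, int m') = (0, int m)" "pa v (0, int m') = (0, int m)" by auto
  have "pa v (0, int m') \<noteq> (0, int m')" using LL_token[OF v m'] v' by (simp add: LL'_def)
  moreover have "Sg m' (pa v (0, int m'))" by (rule pa_Sg[OF LL_set[OF v] m'(2) Sg_pos]) (use m' in auto)
  ultimately have "m < m'" using a by (auto simp: Sg_def)
  then have "pa u (0, int m') = (0, int m')" using pa_fix[OF LL_set[OF u]] m' by blast
  then show False using a \<open>m < m'\<close> by simp
qed

end

lemma CC_cases:
  assumes "c \<in> CC"
  obtains (LL) "c \<in> LL n" | (BB) m u where "1 \<le> m" "m \<le> n" "u \<in> LL m" "c = hw m @ u"
  | (DD) m u where "1 \<le> m" "m \<le> n" "u \<in> LL' m" "c = u @ hw m"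
  using assms by (auto simp: CC_def BB_def DD_def)

text \<open>Words of \<open>LL m\<close> preserve the set \<open>Sg n\<close>, while
  \<open>hw m\<close> expels \<open>m\<close> from it. Whether this happens, for which
  \<open>m\<close>, and on which side can be read from the permutation; then \<open>LL_inj\<close>
  decides.\<close>

lemma CC_inj:
  assumes "c \<in> CC" "d \<in> CC" "pa c = pa d"
  shows "c = d"
  using assms(1)
proof (cases rule: CC_cases)
  case LL
  note c = this
  from assms(2) show ?thesis
  proof (cases rule: CC_cases)
    case LL then show ?thesis using LL_inj[OF c LL order.refl] assms(3) by blast
  next
    case BB then show ?thesis using LL_BB[OF BB(1,2) BB(1,2) c BB(3)] assms(3) by simp
  next
    case DD then show ?thesis using LL_DD[OF DD(1,2) DD(1,2) c LL'_LL[OF DD(3)]] assms(3) by simp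
  qed
next
  case (BB m u)
  note c = this
  from assms(2) show ?thesis
  proof (cases rule: CC_cases)
    case LL then show ?thesis using LL_BB[OF c(1,2) c(1,2) LL c(3)] assms(3) c(4) by simp
  next
    case (BB m' u') then show ?thesis using BB_BB[OF c(1,2) BB(1,2) c(3) BB(3)] assms(3) c(4) by simp
  next
    case DD then show ?thesis using BB_DD[OF c(1,2) DD(1,2) c(3) DD(3)] assms(3) c(4) by simp
  qed
next
  case (DD m u)
  note c = this
  from assms(2) show ?thesis
  proof (cases rule: CC_cases)
    case LL then show ?thesis using LL_DD[OF c(1,2) c(1,2) LL LL'_LL[OF c(3)]] assms(3) c(4) by simp
  next
    case BB then show ?thesis using BB_DD[OF BB(1,2) c(1,2) BB(3) c(3)] assms(3) c(4) by simp
  next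
    case (DD m' u') then show ?thesis using DD_DD[OF c(1,2) DD(1,2) LL'_LL[OF c(3)] LL'_LL[OF DD(3)]] assms(3) c(4) by simp
  qed
qed

lemma CC_Wd: "c \<in> CC \<Longrightarrow> c \<in> Wd"
  by (erule CC_cases) (use LL_Wd LL'_LL hw_Wd in auto)

lemma CC_finite: "finite CC"
  by (auto simp: CC_def BB_def DD_def LL'_def LL_finite)

text \<open>The number of left ends of the components; on the support of an element it equals
  \<open>num_components\<close> (\<open>num_components_eq\<close>).\<close>

definition wt :: "nat set \<Rightarrow> nat" where "wt S = card {i \<in> S. i = 0 \<or> i - 1 \<notin> S}"

lemma wt_insert:
  assumes "S \<subseteq> {..<m}" "1 \<le> m"
  shows "wt (insert m S) = wt S + (if m - 1 \<in> S then 0 else 1)"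
proof -
  have "finite S" "m \<notin> S" using assms(1) finite_subset by auto
  moreover have "{i \<in> insert m S. i = 0 \<or> i - 1 \<notin> insert m S}
      = (if m - 1 \<in> S then {i \<in> S. i = 0 \<or> i - 1 \<notin> S} else insert m {i \<in> S. i = 0 \<or> i - 1 \<notin> S})"
    using assms by (auto simp: subset_iff)
  ultimately show ?thesis using assms by (auto simp: wt_def)
qed

lemma wt_hw:
  assumes "S \<subseteq> {..<m}" "1 \<le> m" "m \<le> n"
  shows "wt ({m..n} \<union> S) = wt S + (if m - 1 \<in> S then 0 else 1)"
proof -
  have "finite S" "m \<notin> S" using assms(1) finite_subset by auto
  moreover have "{i \<in> {m..n} \<union> S. i = 0 \<or> i - 1 \<notin> {m..n} \<union> S}
      = (if m - 1 \<in> S then {i \<in> S. i = 0 \<or> i - 1 \<notin> S} else insert m {i \<in> S. i = 0 \<or> i - 1 \<notin> S})"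
  proof -
    have "i - 1 \<in> {m..n} \<or> i = m" if "i \<in> {m..n}" for i using that by auto
    moreover have "i - 1 \<notin> {m..n}" if "i \<in> S" for i using that assms by (auto simp: subset_iff)
    ultimately show ?thesis using assms by (auto simp: subset_iff)
  qed
  ultimately show ?thesis using assms by (auto simp: wt_def)
qed

lemma opW_comm: "(\<And>i. i \<in> set u \<Longrightarrow> comm x (opA i)) \<Longrightarrow> comm x (opW u)"
  by (induction u) (auto simp: opW_Cons intro!: comm_intros)

abbreviation cw :: "nat list \<Rightarrow> endo" where "cw u \<equiv> 2 ^ wt (set u) * opW u"

lemma LL_sum_Suc:
  fixes f :: "nat list \<Rightarrow> endo"
  assumes "1 \<le> m"
  shows "(\<Sum>u\<in>LL (Suc m). f u) = (\<Sum>u\<in>LL m. f u) + (\<Sum>u\<in>LL m. f (m # u))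
    + (\<Sum>u\<in>LL' m. f (u @ [m])) + (\<Sum>u\<in>LL' m. f (m # u @ [m]))"
proof -
  have nm: "m \<notin> set u" if "u \<in> LL m" for u using LL_set[OF that] by auto
  have L: "u \<in> LL m" "u \<noteq> []" if "u \<in> LL' m" for u
    using that by (auto simp: LL'_def)
  have ne: "m # u @ [m] \<noteq> v @ [m]" if "v \<in> LL' m" for u v
    using nm[OF L(1)[OF that]] by (cases v) auto
  have ne': "m # u \<noteq> v @ [m]" if "v \<in> LL' m" for u v
    using nm[OF L(1)[OF that]] L(2)[OF that] by (cases v) auto
  have nl: "m # u \<notin> LL m" "u @ [m] \<notin> LL m" for u
    using nm[of "m # u"] nm[of "u @ [m]"] by auto
  then have ni: "m # u @ [m] \<notin> (#) m ` LL m" for u by auto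
  have fin: "finite (LL m)" "finite (LL' m)" by (simp_all add: LL'_def LL_finite)
  have d: "(LL m \<union> (#) m ` LL m \<union> (\<lambda>u. u @ [m]) ` LL' m) \<inter> (\<lambda>u. m # u @ [m]) ` LL' m = {}"
  proof -
    have "x \<notin> (\<lambda>u. m # u @ [m]) ` LL' m" if "x \<in> LL m \<union> (#) m ` LL m \<union> (\<lambda>u. u @ [m]) ` LL' m" for x
      using that ne nl ni by blast
    then show ?thesis by blast
  qed
  have d': "(LL m \<union> (#) m ` LL m) \<inter> (\<lambda>u. u @ [m]) ` LL' m = {}" "LL m \<inter> (#) m ` LL m = {}"
  proof -
    have "x \<notin> (\<lambda>u. u @ [m]) ` LL' m" if "x \<in> LL m \<union> (#) m ` LL m" for x
    proof
      assume "x \<in> (\<lambda>u. u @ [m]) ` LL' m"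
      then obtain v where v: "v \<in> LL' m" "x = v @ [m]" by (rule imageE)
      from \<open>x \<in> LL m \<union> (#) m ` LL m\<close> show False
      proof
        assume "x \<in> LL m"
        then show False using nl(2) v(2) by simp
      next
        assume "x \<in> (#) m ` LL m"
        then obtain u where "x = m # u" by (rule imageE)
        then show False using ne'[OF v(1), of u] v(2) by simp
      qed
    qed
    then show "(LL m \<union> (#) m ` LL m) \<inter> (\<lambda>u. u @ [m]) ` LL' m = {}" by blast
    show "LL m \<inter> (#) m ` LL m = {}" using nl(1) by blast
  qed
  note d = d d'
  have 1: "(\<Sum>u\<in>LL (Suc m). f u) = (\<Sum>u\<in>LL m \<union> (#) m ` LL m \<union> (\<lambda>u. u @ [m]) ` LL' m. f u)
      + (\<Sum>u\<in>(\<lambda>u. m # u @ [m]) ` LL' m. f u)"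
    unfolding LL_Suc[OF assms] by (intro sum.union_disjoint d finite_UnI finite_imageI fin)
  have 2: "(\<Sum>u\<in>LL m \<union> (#) m ` LL m \<union> (\<lambda>u. u @ [m]) ` LL' m. f u)
      = (\<Sum>u\<in>LL m \<union> (#) m ` LL m. f u) + (\<Sum>u\<in>(\<lambda>u. u @ [m]) ` LL' m. f u)"
    by (intro sum.union_disjoint d finite_UnI finite_imageI fin)
  have 3: "(\<Sum>u\<in>LL m \<union> (#) m ` LL m. f u) = (\<Sum>u\<in>LL m. f u) + (\<Sum>u\<in>(#) m ` LL m. f u)"
    by (intro sum.union_disjoint d finite_UnI finite_imageI fin)
  show ?thesis unfolding 1 2 3 by (simp add: sum.reindex inj_on_def o_def)
qed

lemma sum_LL':
  fixes f :: "nat list \<Rightarrow> endo"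
  shows "(\<Sum>u\<in>LL' m. f u) = (\<Sum>u\<in>LL m. if m - 1 \<in> set u then f u else 0)"
proof -
  have "(\<Sum>u\<in>LL m. if m - 1 \<in> set u then f u else 0) = (\<Sum>u\<in>LL' m. if m - 1 \<in> set u then f u else 0)"
    by (rule sum.mono_neutral_right) (auto simp: LL'_def LL_finite)
  also have "\<dots> = (\<Sum>u\<in>LL' m. f u)" by (rule sum.cong) (auto simp: LL'_def)
  finally show ?thesis by simp
qed

lemma two_comm: "x * (2 ^ k * y) = 2 ^ k * (x * (y :: endo))"
proof -
  have "comm x (2 ^ k)" by (induction k) (simp_all add: comm_def mult_2 distrib_left distrib_right)
  then show ?thesis by (simp add: comm_def mult.assoc[symmetric])
qed

text \<open>Multiply by \<open>1 + A_m\<close> on both sides. If \<open>m - 1\<close> occurs in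
  \<open>u\<close>, all four words are normal forms. Otherwise \<open>A_m\<close> commutes with
  \<open>u\<close>: the two one-sided words coincide and give the factor 2 of a new component, and
  the two-sided word contains a square.\<close>

lemma Lm_sum: "1 \<le> m \<Longrightarrow> m \<le> n \<Longrightarrow> Lm m = (\<Sum>u\<in>LL m. cw u)"
proof (induction m)
  case (Suc m)
  show ?case
  proof (cases "m = 0")
    case True
    have "{i. i = 0} = {0::nat}" by auto
    then show ?thesis using True by (simp add: wt_def opW_Cons cong: conj_cong)
  next
    case False
    then have m: "1 \<le> m" "m \<le> n" using Suc.prems by auto
    let ?a = "opA m"
    have sq: "?a * ?a = 0" using opA_sq m by simp
    have "Lm (Suc m) = (1 + ?a) * (\<Sum>u\<in>LL m. cw u) * (1 + ?a)" using Suc.IH[OF m] m by simp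
    also have "\<dots> = (\<Sum>u\<in>LL m. cw u + 2 ^ wt (set u) * (?a * opW u) + 2 ^ wt (set u) * (opW u * ?a)
        + 2 ^ wt (set u) * (?a * opW u * ?a))"
      by (simp add: sum_distrib_left sum_distrib_right distrib_left distrib_right mult.assoc two_comm add.assoc sum.distrib)
    also have "\<dots> = (\<Sum>u\<in>LL m. cw u + cw (m # u) + (if m - 1 \<in> set u then cw (u @ [m]) else 0)
        + (if m - 1 \<in> set u then cw (m # u @ [m]) else 0))"
    proof (rule sum.cong)
      fix u assume u: "u \<in> LL m"
      have w: "wt (insert m (set u)) = wt (set u) + (if m - 1 \<in> set u then 0 else 1)"
        by (rule wt_insert[OF LL_set[OF u] m(1)])
      show "cw u + 2 ^ wt (set u) * (?a * opW u) + 2 ^ wt (set u) * (opW u * ?a) + 2 ^ wt (set u) * (?a * opW u * ?a)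
        = cw u + cw (m # u) + (if m - 1 \<in> set u then cw (u @ [m]) else 0) + (if m - 1 \<in> set u then cw (m # u @ [m]) else 0)"
      proof (cases "m - 1 \<in> set u")
        case True
        then show ?thesis by (simp add: w opW_append opW_Cons mult.assoc)
      next
        case nin: False
        have "comm ?a (opW u)"
        proof (rule opW_comm, rule opA_comm)
          fix i assume i: "i \<in> set u"
          then have "i < m" "i \<noteq> m - 1" using LL_set[OF u] nin by auto
          then show "m + 1 < i \<or> i + 1 < m" by simp
        qed (use m LL_set[OF u] in auto)
        then have c: "opW u * ?a = ?a * opW u" by (simp add: comm_def)
        have "?a * opW u * ?a = ?a * ?a * opW u" by (simp only: mult.assoc c)
        then have z: "?a * opW u * ?a = 0" using sq by simp
        show ?thesis using nin by (simp add: w z c opW_Cons mult_2 distrib_right)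
      qed
    qed simp
    also have "\<dots> = (\<Sum>u\<in>LL (Suc m). cw u)"
      unfolding LL_sum_Suc[OF m(1)] sum_LL' by (simp only: sum.distrib)
    finally show ?thesis .
  qed
qed simp

text \<open>As in \<open>Lm_sum\<close>: if \<open>m - 1\<close> does not occur in \<open>u\<close>,
  both orders of \<open>hw m\<close> and \<open>u\<close> give the same operator, and the resulting
  2 is the factor of the new component \<open>{m..n}\<close>.\<close>

theorem M2_sum: "M2 = (\<Sum>u\<in>CC. cw u)"
proof -
  have 1: "hm m * Lm m + Lm m * hm m = (\<Sum>u\<in>BB m \<union> DD m. cw u)" if m: "m \<in> {1..n}" for m
  proof -
    have m': "1 \<le> m" "m \<le> n" using m by auto
    have fin: "finite (BB m)" "finite (DD m)" by (simp_all add: BB_def DD_def LL'_def LL_finite)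
    have "BB m \<inter> DD m = {}" using BB_DD[OF m' m'] by (fastforce simp: BB_def DD_def)
    then have "(\<Sum>u\<in>BB m \<union> DD m. cw u) = (\<Sum>u\<in>BB m. cw u) + (\<Sum>u\<in>DD m. cw u)"
      by (intro sum.union_disjoint fin)
    also have "\<dots> = (\<Sum>u\<in>LL m. cw (hw m @ u) + (if m - 1 \<in> set u then cw (u @ hw m) else 0))"
      unfolding BB_def DD_def by (simp add: sum.reindex inj_on_def sum_LL' sum.distrib cong: if_cong)
    also have "\<dots> = (\<Sum>u\<in>LL m. 2 ^ wt (set u) * (hm m * opW u) + 2 ^ wt (set u) * (opW u * hm m))"
    proof (rule sum.cong)
      fix u assume u: "u \<in> LL m"
      have w: "wt ({m..n} \<union> set u) = wt (set u) + (if m - 1 \<in> set u then 0 else 1)"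
        "wt (set u \<union> {m..n}) = wt (set u) + (if m - 1 \<in> set u then 0 else 1)"
        using wt_hw[OF LL_set[OF u] m'] by (simp_all only: Un_commute)
      show "cw (hw m @ u) + (if m - 1 \<in> set u then cw (u @ hw m) else 0)
          = 2 ^ wt (set u) * (hm m * opW u) + 2 ^ wt (set u) * (opW u * hm m)"
      proof (cases "m - 1 \<in> set u")
        case True
        then show ?thesis by (simp add: w hw_set m' opW_append opW_hw)
      next
        case False
        have "comm (hm m) (opW u)"
        proof (rule opW_comm, rule comm_sym, rule opA_hm)
          fix i assume i: "i \<in> set u"
          then have "i < m" "i \<noteq> m - 1" using LL_set[OF u] False by auto
          then show "i + 1 < m" by simp
        qed (use m' in auto)
        then have "opW u * hm m = hm m * opW u" by (simp add: comm_def)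
        then show ?thesis using False
          by (simp add: w hw_set m' opW_append opW_hw mult_2 distrib_right)
      qed
    qed simp
    also have "\<dots> = hm m * Lm m + Lm m * hm m"
      unfolding Lm_sum[OF m'] by (simp add: sum.distrib sum_distrib_left sum_distrib_right two_comm mult.assoc)
    finally show ?thesis by simp
  qed
  have fin: "finite (BB m \<union> DD m)" for m by (simp add: BB_def DD_def LL'_def LL_finite)
  have d: "(BB m \<union> DD m) \<inter> (BB m' \<union> DD m') = {}" if "m \<in> {1..n}" "m' \<in> {1..n}" "m \<noteq> m'" for m m'
  proof -
    have m: "1 \<le> m" "m \<le> n" "1 \<le> m'" "m' \<le> n" using that by auto
    have "hw m @ u \<noteq> hw m' @ v" if "u \<in> LL m" "v \<in> LL m'" for u v
      using BB_BB[OF m that] \<open>m \<noteq> m'\<close> by metis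
    moreover have "u @ hw m \<noteq> v @ hw m'" if "u \<in> LL' m" "v \<in> LL' m'" for u v
      using DD_DD[OF m LL'_LL[OF that(1)] LL'_LL[OF that(2)]] \<open>m \<noteq> m'\<close> by metis
    moreover have "hw m @ u \<noteq> v @ hw m'" if "u \<in> LL m" "v \<in> LL' m'" for u v
      using BB_DD[OF m that] by metis
    moreover have "hw m' @ u \<noteq> v @ hw m" if "u \<in> LL m'" "v \<in> LL' m" for u v
      using BB_DD[OF m(3,4) m(1,2) that] by metis
    ultimately have "x \<noteq> y" if "x \<in> BB m \<union> DD m" "y \<in> BB m' \<union> DD m'" for x y
      using that unfolding BB_def DD_def Un_iff image_iff by metis
    then show ?thesis by blast
  qed
  have "LL n \<inter> (\<Union>m\<in>{1..n}. BB m \<union> DD m) = {}"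
  proof -
    have "x \<noteq> y" if "x \<in> LL n" "y \<in> BB m \<union> DD m" "m \<in> {1..n}" for x y m
    proof -
      have m: "1 \<le> m" "m \<le> n" using that by auto
      show ?thesis using that(1,2) LL_BB[OF m m] LL_DD[OF m m _ LL'_LL] unfolding BB_def DD_def by blast
    qed
    then show ?thesis by blast
  qed
  then have "(\<Sum>u\<in>CC. cw u) = (\<Sum>u\<in>LL n. cw u) + (\<Sum>u\<in>(\<Union>m\<in>{1..n}. BB m \<union> DD m). cw u)"
    unfolding CC_def by (intro sum.union_disjoint LL_finite finite_UN_I fin) auto
  also have "(\<Sum>u\<in>(\<Union>m\<in>{1..n}. BB m \<union> DD m). cw u) = (\<Sum>m\<in>{1..n}. \<Sum>u\<in>BB m \<union> DD m. cw u)"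
    by (rule sum.UNION_disjoint) (use fin d in auto)
  also have "(\<Sum>u\<in>LL n. cw u) = Lm n" using Lm_sum[of n] n_ge_2 by simp
  finally show ?thesis unfolding M2_def using 1 by simp
qed

end

lemma subseq_rev_mono: "subseq u v \<Longrightarrow> subseq (rev u) (rev v)"
  by (induction rule: list_emb.induct) (auto intro: list_emb_append_mono)

lemma subseq_append_mono: "subseq u v \<Longrightarrow> subseq u' v' \<Longrightarrow> subseq (u @ u') (v @ v')"
  by (rule list_emb_append_mono)

lemma subseq_set_subset: "subseq u v \<Longrightarrow> set u \<subseteq> set v"
  by (auto dest: list_emb_set)

lemma subseq_single_iff: "subseq u [a] \<longleftrightarrow> u = [] \<or> u = [a]"
  by (auto simp: in_set_subseqs[symmetric] simp del: in_set_subseqs)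

lemma upt_split: "i \<le> j \<Longrightarrow> j \<le> k \<Longrightarrow> [i..<k] = [i..<j] @ [j..<k]"
  using upt_add_eq_append[of i j "k - j"] by simp

context affine_C begin

section \<open>Subwords\<close>

text \<open>Compares words, reduced or not, by the group elements of their reduced subwords. Words
  can thus be rewritten before the letters of a subword are known.\<close>

definition wle :: "nat list \<Rightarrow> nat list \<Rightarrow> bool" where
  "wle w w' \<longleftrightarrow> (\<forall>u. red u \<and> subseq u w \<longrightarrow> (\<exists>v. red v \<and> subseq v w' \<and> pa v = pa u))"

lemma wle_trans [trans]: "wle u v \<Longrightarrow> wle v w \<Longrightarrow> wle u w"
  unfolding wle_def by metis

lemma wle_subseq: "subseq u v \<Longrightarrow> wle u v"
  unfolding wle_def using subseq_order.trans by blast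

lemma wle_cong:
  assumes "wle w w'"
  shows "wle (x @ w @ y) (x @ w' @ y)"
  unfolding wle_def
proof (intro allI impI)
  fix u assume u: "red u \<and> subseq u (x @ w @ y)"
  then obtain u1 u2 u3 where u': "u = u1 @ u2 @ u3" "subseq u1 x" "subseq u2 w" "subseq u3 y"
    unfolding subseq_append_iff by blast
  have "red u2" using u u'(1) red_append red_append2 by metis
  then obtain v where v: "red v" "subseq v w'" "pa v = pa u2" using assms u'(3) unfolding wle_def by blast
  have "length v = length u2" by (rule red_length_eq[OF v(1) \<open>red u2\<close> v(3)])
  moreover have "u1 @ v @ u3 \<in> Wd" using red_Wd[OF v(1)] red_Wd[of u] u u'(1) by auto
  ultimately have "red (u1 @ v @ u3)"
    using red_pa_eq[of u "u1 @ v @ u3"] u u'(1) v(3) by (simp add: pa_append)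
  then show "\<exists>v. red v \<and> subseq v (x @ w' @ y) \<and> pa v = pa u"
    using u' v by (intro exI[of _ "u1 @ v @ u3"]) (simp add: pa_append subseq_append_mono)
qed

lemma wle_append: "wle w w' \<Longrightarrow> wle (w @ y) (w' @ y)" "wle w w' \<Longrightarrow> wle (x @ w) (x @ w')"
  using wle_cong[of w w' "[]" y] wle_cong[of w w' x "[]"] by simp_all

lemma not_red_square: "i \<le> n \<Longrightarrow> \<not> red [i, i]"
proof
  assume i: "i \<le> n" and r: "red [i, i]"
  have "pa [] = pa [i, i]" using i by (simp add: act_act_comp)
  then have "length [i, i] \<le> length ([] :: nat list)" using r unfolding red_def by blast
  then show False by simp
qed

lemma wle_square: "i \<le> n \<Longrightarrow> wle [i, i] [i]"
  unfolding wle_def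
proof (intro allI impI)
  fix u assume i: "i \<le> n" and u: "red u \<and> subseq u [i, i]"
  then have "u \<in> {[], [i], [i, i]}" by (auto simp: in_set_subseqs[symmetric] simp del: in_set_subseqs)
  then show "\<exists>v. red v \<and> subseq v [i] \<and> pa v = pa u"
    using u not_red_square[OF i] by (intro exI[of _ u]) auto
qed

text \<open>Of the reduced subwords only the full word is not literally a subword of the other side,
  and there the braid relation helps.\<close>

lemma wle_braid:
  assumes "1 \<le> i" "i + 2 \<le> n"
  shows "wle [i, i + 1, i] [i + 1, i, i + 1]"
  unfolding wle_def
proof (intro allI impI)
  fix u assume u: "red u \<and> subseq u [i, i + 1, i]"
  then have c: "u \<in> {[], [i], [i + 1], [i, i + 1], [i + 1, i], [i, i], [i, i + 1, i]}"
    by (auto simp: in_set_subseqs[symmetric] simp del: in_set_subseqs)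
  show "\<exists>v. red v \<and> subseq v [i + 1, i, i + 1] \<and> pa v = pa u"
  proof (cases "u = [i, i + 1, i]")
    case True
    have e: "pa [i + 1, i, i + 1] = pa u" unfolding True using act_braid3[OF assms] by (simp add: fun_eq_iff)
    have "red [i + 1, i, i + 1]" by (rule red_pa_eq[OF _ _ e]) (use u True assms in auto)
    then show ?thesis using e by blast
  next
    case False
    then show ?thesis using u c not_red_square[of i] assms by (intro exI[of _ u]) auto
  qed
qed

definition far :: "nat list \<Rightarrow> nat list \<Rightarrow> bool" where
  "far u v \<longleftrightarrow> (\<forall>i\<in>set u. \<forall>j\<in>set v. i + 1 < j \<or> j + 1 < i)"

lemma far_subset: "far u v \<Longrightarrow> set u' \<subseteq> set u \<Longrightarrow> set v' \<subseteq> set v \<Longrightarrow> far u' v'"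
  unfolding far_def by blast

lemma pa_far: "far u v \<Longrightarrow> u \<in> Wd \<Longrightarrow> v \<in> Wd \<Longrightarrow> pa (u @ v) = pa (v @ u)"
proof (induction u)
  case (Cons i u)
  have i: "i \<le> n" using Cons.prems by auto
  have c: "act i (pa v s) = pa v (act i s)" for s
    using Cons.prems(1,3)
  proof (induction v)
    case (Cons j v)
    have "act i (act j t) = act j (act i t)" for t
      using Cons.prems i act_commute[of i j t] act_commute[of j i t] by (auto simp: far_def)
    then show ?case using Cons by (auto simp: far_def)
  qed simp
  have "pa (u @ v) = pa (v @ u)" using Cons by (auto simp: far_def)
  from fun_cong[OF this] show ?case by (simp add: fun_eq_iff pa_append c)
qed simp

lemma wle_far:
  assumes "far u v" "u \<in> Wd" "v \<in> Wd"
  shows "wle (u @ v) (v @ u)"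
  unfolding wle_def
proof (intro allI impI)
  fix w assume w: "red w \<and> subseq w (u @ v)"
  then obtain a b where ab: "w = a @ b" "subseq a u" "subseq b v" unfolding subseq_append_iff by blast
  have "set a \<subseteq> set u" "set b \<subseteq> set v" using ab(2,3) by (auto dest: list_emb_set)
  moreover from this have W: "a \<in> Wd" "b \<in> Wd" using assms by auto
  ultimately have e: "pa (b @ a) = pa w" using pa_far[OF far_subset[OF assms(1)]] ab(1) by metis
  have "red (b @ a)" by (rule red_pa_eq[OF _ _ e]) (use w ab W in auto)
  then show "\<exists>x. red x \<and> subseq x (v @ u) \<and> pa x = pa w" using e ab subseq_append_mono by blast
qed

text \<open>The letter \<open>i\<close> commutes with the run down to \<open>i + 2\<close>, the
  braid relation turns \<open>i, i + 1, i\<close> into \<open>i + 1, i, i + 1\<close>, and the last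
  \<open>i + 1\<close> commutes with the rest of the run.\<close>

lemma wle_shift:
  assumes "1 \<le> m" "m \<le> i" "i + 2 \<le> k" "k \<le> n"
  shows "wle (i # rev [m..<k]) (rev [m..<k] @ [i + 1])"
proof -
  have "[m..<k] = [m..<i] @ [i..<k]" using upt_split[of m i k] assms by simp
  also have "[i..<k] = i # (i + 1) # [i + 2..<k]" using assms by (simp add: upt_conv_Cons)
  finally have s: "rev [m..<k] = rev [i + 2..<k] @ [i + 1, i] @ rev [m..<i]" by simp
  have "wle ([i] @ rev [i + 2..<k]) (rev [i + 2..<k] @ [i])"
    by (rule wle_far) (use assms in \<open>auto simp: far_def\<close>)
  from wle_append(1)[OF this] have "wle (i # rev [m..<k]) (rev [i + 2..<k] @ [i, i + 1, i] @ rev [m..<i])"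
    unfolding s by (simp only: append_assoc append_Cons append_Nil)
  also have "wle (rev [i + 2..<k] @ [i, i + 1, i] @ rev [m..<i]) (rev [i + 2..<k] @ [i + 1, i, i + 1] @ rev [m..<i])"
    by (rule wle_cong, rule wle_braid) (use assms in auto)
  also have "wle (rev [i + 2..<k] @ [i + 1, i, i + 1] @ rev [m..<i]) (rev [m..<k] @ [i + 1])"
  proof -
    have "wle ([i + 1] @ rev [m..<i]) (rev [m..<i] @ [i + 1])"
      by (rule wle_far) (use assms in \<open>auto simp: far_def\<close>)
    from wle_append(2)[OF this, of "rev [i + 2..<k] @ [i + 1, i]"] show ?thesis
      unfolding s by (simp only: append_assoc append_Cons append_Nil)
  qed
  finally show ?thesis .
qed

lemma wle_shifts:
  assumes "1 \<le> m" "m \<le> j" "j < k" "k \<le> n"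
  shows "wle ([j..<k - 1] @ rev [m..<k]) (rev [m..<k] @ [j + 1..<k])"
proof -
  have "j \<le> k - 1" using assms by simp
  then show ?thesis using assms(2)
  proof (induction rule: inc_induct)
    case base
    then show ?case using assms by (simp add: wle_subseq)
  next
    case (step j)
    then have "wle (j # [Suc j..<k - 1] @ rev [m..<k]) (j # rev [m..<k] @ [Suc j + 1..<k])"
      using wle_append(2)[of _ _ "[j]"] by simp
    also have "wle (j # rev [m..<k] @ [Suc j + 1..<k]) (rev [m..<k] @ (j + 1) # [Suc j + 1..<k])"
      using wle_append(1)[OF wle_shift[of m j k]] step assms by simp
    finally show ?case using step.hyps by (simp add: upt_conv_Cons)
  qed
qed

definition lamw :: "nat \<Rightarrow> nat list" where "lamw m = rev [0..<m] @ [1..<m]"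

lemma lamw_Suc: "1 \<le> m \<Longrightarrow> lamw (Suc m) = m # lamw m @ [m]" by (simp add: lamw_def)

lemma lamw_1: "lamw (Suc 0) = [0]" by (simp add: lamw_def)

lemma lamw_Wd: "m \<le> n \<Longrightarrow> lamw m \<in> Wd" by (auto simp: lamw_def)

lemma lamw_set: "set (lamw m) \<subseteq> {..<m}" by (auto simp: lamw_def)

lemma rev_lamw: "rev (lamw m) = lamw m"
proof (cases m)
  case (Suc k)
  then show ?thesis using upt_conv_Cons[of 0 m] by (simp add: lamw_def)
qed (simp add: lamw_def)

text \<open>An ascending run in front of the descending one is pushed through it, raised by one, and
  then past \<open>lamw m\<close>. There it fits into the ascending half of
  \<open>lamw k\<close>.\<close>

lemma wle_lamw:
  assumes "1 \<le> m" "m < k" "k \<le> n"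
  shows "wle ([m..<k - 1] @ rev [m..<k] @ lamw m) (lamw k)"
proof -
  have "wle ([m..<k - 1] @ rev [m..<k] @ lamw m) (rev [m..<k] @ [m + 1..<k] @ lamw m)"
    using wle_append(1)[OF wle_shifts[of m m k], of "lamw m"] assms by simp
  also have "wle (rev [m..<k] @ [m + 1..<k] @ lamw m) (rev [m..<k] @ lamw m @ [m + 1..<k])"
  proof (rule wle_append(2), rule wle_far)
    show "far [m + 1..<k] (lamw m)" using lamw_set[of m] by (fastforce simp: far_def)
    show "lamw m \<in> Wd" by (rule lamw_Wd) (use assms in simp)
  qed (use assms in auto)
  also have "wle (rev [m..<k] @ lamw m @ [m + 1..<k]) (lamw k)"
  proof -
    have "[0..<k] = [0..<m] @ [m..<k]" "[1..<k] = [1..<m] @ m # [m + 1..<k]"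
      using upt_split[of 0 m k] upt_split[of 1 m k] upt_conv_Cons[of m k] assms by simp_all
    then have "lamw k = (rev [m..<k] @ lamw m) @ m # [m + 1..<k]" by (simp add: lamw_def)
    then show ?thesis using subseq_append_mono[of "rev [m..<k] @ lamw m" "rev [m..<k] @ lamw m" "[m + 1..<k]" "m # [m + 1..<k]"]
      by (intro wle_subseq) auto
  qed
  finally show ?thesis .
qed

section \<open>Normal forms of reduced subwords\<close>

definition inP :: "nat list \<Rightarrow> nat \<Rightarrow> bool" where
  "inP w k \<longleftrightarrow> (\<exists>v\<in>LL k. pa v = pa w \<and> length v = length w)"

lemma far_LL: "v \<in> LL m \<Longrightarrow> m - 1 \<notin> set v \<Longrightarrow> set u \<subseteq> {m..} \<Longrightarrow> far v u"
proof -
  assume v: "v \<in> LL m" "m - 1 \<notin> set v" and u: "set u \<subseteq> {m..}"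
  have "i + 1 < j" if "i \<in> set v" "j \<in> set u" for i j
  proof -
    have "i < m" "i \<noteq> m - 1" "m \<le> j" using that v LL_set[OF v(1)] u by auto
    then show ?thesis by simp
  qed
  then show ?thesis by (auto simp: far_def)
qed

text \<open>The subwords that are not in normal form have \<open>m\<close> on the right and no
  \<open>m - 1\<close>. Then \<open>m\<close> commutes to the left, where a second \<open>m\<close>
  would contradict reducedness.\<close>

lemma lamw_inP: "1 \<le> m \<Longrightarrow> m \<le> n \<Longrightarrow> red u \<Longrightarrow> subseq u (lamw m) \<Longrightarrow> inP u m"
proof (induction m arbitrary: u)
  case (Suc m)
  show ?case
  proof (cases "m = 0")
    case True
    then have "u \<in> LL (Suc m)" using Suc.prems by (simp add: lamw_1 subseq_single_iff)
    then show ?thesis unfolding inP_def by blast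
  next
    case False
    then have m: "1 \<le> m" "m \<le> n" using Suc.prems by auto
    have "subseq u ([m] @ lamw m @ [m])" using Suc.prems(4) lamw_Suc[OF m(1)] by simp
    then obtain a b c where u: "u = a @ b @ c" "subseq a [m]" "subseq b (lamw m)" "subseq c [m]"
      unfolding subseq_append_iff by blast
    have ac: "a = [] \<or> a = [m]" "c = [] \<or> c = [m]" using u by (simp_all add: subseq_single_iff)
    have "red b" using Suc.prems(3) u(1) red_append red_append2 by metis
    then obtain v where v: "v \<in> LL m" "pa v = pa b" "length v = length b"
      using Suc.IH[OF m _ u(3)] unfolding inP_def by blast
    have avc: "pa (a @ v @ c) = pa u" "length (a @ v @ c) = length u" using u v by (simp_all add: pa_append)
    have vW: "v \<in> Wd" by (rule LL_Wd[OF v(1) m(2)])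
    show ?thesis
    proof (cases "c = [] \<or> m - 1 \<in> set v")
      case True
      then have "a @ v @ c \<in> LL (Suc m)" using ac v unfolding LL_Suc[OF m(1)] LL'_def by auto
      then show ?thesis using avc unfolding inP_def by blast
    next
      case False
      then have c: "c = [m]" using ac by simp
      have e: "pa (v @ [m]) = pa (m # v)"
        using pa_far[OF far_LL[of v m "[m]"] vW] v False m by simp
      show ?thesis
      proof (cases "a = []")
        case True
        have "m # v \<in> LL (Suc m)" using v unfolding LL_Suc[OF m(1)] by auto
        then show ?thesis using avc e True c unfolding inP_def by (metis append_Nil length_append_singleton length_Cons)
      next
        case False
        then have a: "a = [m]" using ac by simp
        have "pa u = pa v" using avc(1) e m unfolding a c by (simp add: o_assoc[symmetric]) (simp add: fun_eq_iff)
        then have "length u \<le> length v" using Suc.prems(3) vW unfolding red_def by metis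
        then show ?thesis using avc(2) a by simp
      qed
    qed
  qed
qed simp

lemma wle_inP:
  assumes "1 \<le> k" "k \<le> n" "red w" "subseq w x" "wle x (lamw k)"
  shows "inP w k"
proof -
  obtain v where v: "red v" "subseq v (lamw k)" "pa v = pa w" using assms unfolding wle_def by blast
  show ?thesis using lamw_inP[OF assms(1,2) v(1,2)] v(3) red_length_eq[OF v(1) assms(3) v(3)] by (simp add: inP_def)
qed

definition nf :: "nat list \<Rightarrow> bool" where
  "nf u \<longleftrightarrow> (\<exists>c\<in>CC. pa c = pa u \<and> length c = length u)"

lemma nf_cong: "nf u \<Longrightarrow> pa u = pa v \<Longrightarrow> length u = length v \<Longrightarrow> nf v" by (simp add: nf_def)

lemma nf_B:
  assumes "1 \<le> k" "k \<le> n" "inP w k"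
  shows "nf (hw k @ w)"
proof -
  obtain v where v: "v \<in> LL k" "pa v = pa w" "length v = length w" using assms(3) by (auto simp: inP_def)
  have "hw k @ v \<in> CC" using v(1) assms by (auto simp: CC_def BB_def)
  then show ?thesis using v unfolding nf_def by (intro bexI[of _ "hw k @ v"]) (simp_all add: pa_append)
qed

lemma nf_D:
  assumes "1 \<le> k" "k \<le> n" "inP w k"
  shows "nf (w @ hw k)"
proof -
  obtain v where v: "v \<in> LL k" "pa v = pa w" "length v = length w" using assms(3) by (auto simp: inP_def)
  show ?thesis
  proof (cases "k - 1 \<in> set v")
    case True
    then have "v @ hw k \<in> CC" using v(1) assms by (auto simp: CC_def DD_def LL'_def)
    then show ?thesis using v unfolding nf_def by (intro bexI[of _ "v @ hw k"]) (simp_all add: pa_append)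
  next
    case False
    have "far v (hw k)" by (rule far_LL[OF v(1) False]) (use hw_set[OF assms(2)] in auto)
    from pa_far[OF this LL_Wd[OF v(1) assms(2)] hw_Wd[OF assms(2)]]
    have "pa (hw k @ w) = pa (w @ hw k)" using v(2) by (simp add: pa_append)
    then show ?thesis using nf_cong[OF nf_B[OF assms]] by simp
  qed
qed

lemma nf_LL: "inP w n \<Longrightarrow> nf w" by (auto simp: nf_def inP_def CC_def)

text \<open>If \<open>k\<close> occurs on both sides of \<open>hw (k + 1)\<close>, it is absorbed
  into \<open>hw k\<close>. If it is missing on one side, the letters on that side commute with
  \<open>hw (k + 1)\<close> and move across it, and what is left fits into
  \<open>lamw (k + 1)\<close> by \<open>wle_lamw\<close>.\<close>

lemma nf_main:
  assumes "m \<le> k" "1 \<le> m" "k \<le> n" "subseq S [m..<k]" "subseq T (rev [m..<k])" "subseq l (lamw m)" "red (S @ hw k @ T @ l)"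
  shows "nf (S @ hw k @ T @ l)"
  using assms(1,3-)
proof (induction arbitrary: S T l rule: dec_induct)
  case base
  then have "S = []" "T = []" by simp_all
  moreover have "red l" using base red_append by metis
  ultimately show ?case using nf_B[OF assms(2) base(1) lamw_inP[OF assms(2) base(1) _ base(4)]] by simp
next
  case (step k)
  have k: "1 \<le> Suc k" "m < Suc k" "k < n" "k \<le> n" using step assms(2) by auto
  note kn = \<open>Suc k \<le> n\<close>
  have "subseq S ([m..<k] @ [k])" "subseq T ([k] @ rev [m..<k])" using step.prems step.hyps by auto
  then obtain S1 S2 T1 T2 where ST: "S = S1 @ S2" "subseq S1 [m..<k]" "subseq S2 [k]"
      "T = T2 @ T1" "subseq T2 [k]" "subseq T1 (rev [m..<k])"
    unfolding subseq_append_iff by blast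
  have sets: "set S1 \<subseteq> {m..<k}" "set T1 \<subseteq> {m..<k}" "set l \<subseteq> {..<m}"
    using subseq_set_subset[OF ST(2)] subseq_set_subset[OF ST(6)] subseq_set_subset[OF step.prems(4)] lamw_set[of m]
    by (auto simp: subset_iff)
  have W: "S @ hw (Suc k) @ T @ l \<in> Wd" by (rule red_Wd[OF step.prems(5)])
  consider "S2 = [k]" "T2 = [k]" | "S2 = []" | "S2 = [k]" "T2 = []"
    using ST(3,5) by (auto simp: subseq_single_iff)
  then show ?case
  proof cases
    case 1
    have e: "S @ hw (Suc k) @ T @ l = S1 @ hw k @ T1 @ l" using ST 1 hw_step[OF k(3)] by simp
    show ?thesis unfolding e by (rule step.IH[OF k(4) ST(2,6) step.prems(4) step.prems(5)[unfolded e]])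
  next
    case 2
    have "far S1 (hw (Suc k))" using sets(1) hw_set[OF kn] by (auto simp: far_def subset_iff)
    moreover have "S1 \<in> Wd" using W ST by simp
    ultimately have "pa (S1 @ hw (Suc k)) = pa (hw (Suc k) @ S1)" by (rule pa_far) (rule hw_Wd[OF kn])
    then have e: "pa (hw (Suc k) @ S @ T @ l) = pa (S @ hw (Suc k) @ T @ l)"
      using ST(1) 2 by (simp add: pa_append o_assoc)
    have r: "red (hw (Suc k) @ S @ T @ l)" by (rule red_pa_eq[OF step.prems(5) _ e]) (use W in auto)
    have "subseq (S @ T @ l) ([m..<Suc k - 1] @ rev [m..<Suc k] @ lamw m)"
      unfolding diff_Suc_1 using ST(2) 2 by (intro subseq_append_mono step.prems) (simp add: ST(1))
    then have "inP (S @ T @ l) (Suc k)"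
      by (rule wle_inP[OF k(1) kn red_append[OF r] _ wle_lamw[OF assms(2) k(2) kn]])
    from nf_B[OF k(1) kn this] show ?thesis by (rule nf_cong[OF _ e]) simp
  next
    case 3
    have "set (T @ l) \<subseteq> {..<k}" using sets(2,3) ST(4) 3 step.hyps by (auto simp: subset_iff)
    then have "far (T @ l) (hw (Suc k))" using hw_set[OF kn] by (auto simp: far_def subset_iff)
    moreover have "T @ l \<in> Wd" using W by simp
    ultimately have "pa ((T @ l) @ hw (Suc k)) = pa (hw (Suc k) @ T @ l)" by (rule pa_far) (rule hw_Wd[OF kn])
    then have e: "pa ((S @ T @ l) @ hw (Suc k)) = pa (S @ hw (Suc k) @ T @ l)"
      by (simp add: pa_append o_assoc)
    have r: "red ((S @ T @ l) @ hw (Suc k))" by (rule red_pa_eq[OF step.prems(5) _ e]) (use W in auto)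
    have "subseq (S @ T @ l) ([m..<Suc k] @ rev [m..<k] @ lamw m)"
      using ST(6) 3 by (intro subseq_append_mono step.prems) (simp add: ST(4))
    then have "subseq (S @ T @ l) ([m..<Suc k - 1] @ rev [m..<Suc k] @ lamw m)"
      using step.hyps by simp
    then have "inP (S @ T @ l) (Suc k)"
      by (rule wle_inP[OF k(1) kn red_append2[OF r] _ wle_lamw[OF assms(2) k(2) kn]])
    from nf_D[OF k(1) kn this] show ?thesis by (rule nf_cong[OF _ e]) simp
  qed
qed

lemma nf_rotation:
  assumes "1 \<le> m" "m \<le> n" "red u" "subseq u (hw m @ lamw m)"
  shows "nf u"
proof -
  have "subseq u ([m..<n] @ [n] @ rev [m..<n] @ lamw m)" using assms(4) by (simp add: hw_def)
  then obtain S N T l where u: "u = S @ N @ T @ l" "subseq S [m..<n]" "subseq N [n]" "subseq T (rev [m..<n])" "subseq l (lamw m)"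
    unfolding subseq_append_iff by blast
  show ?thesis
  proof (cases "N = [n]")
    case True
    then show ?thesis using nf_main[OF assms(2,1) order.refl u(2,4,5)] assms(3) u(1) by (simp add: hw_n)
  next
    case False
    then have N: "N = []" using u(3) by (simp add: subseq_single_iff)
    have sub: "subseq u ([m..<n] @ rev [m..<n] @ lamw m)"
      unfolding u(1) N using u(2,4,5) by (simp add: subseq_append_mono)
    have n1: "1 \<le> n" using n_ge_2 by simp
    have "inP u n"
    proof (cases "m = n")
      case True
      then show ?thesis using lamw_inP[OF n1 order.refl assms(3)] sub by simp
    next
      case False
      then have m: "m < n" using assms by simp
      have n: "[m..<n] = [m..<n - 1] @ [n - 1]" using m upt_Suc_append[of m "n - 1"] by simp
      \<comment> \<open>Without \<open>n\<close> the two letters \<open>n - 1\<close> at the centre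
        are adjacent, and a reduced subword uses at most one of them.\<close>
      have "wle ([m..<n - 1] @ [n - 1, n - 1] @ rev [m..<n - 1] @ lamw m) ([m..<n - 1] @ [n - 1] @ rev [m..<n - 1] @ lamw m)"
        by (rule wle_cong, rule wle_square) simp
      then have "wle ([m..<n] @ rev [m..<n] @ lamw m) ([m..<n - 1] @ rev [m..<n] @ lamw m)"
        unfolding n by simp
      also have "wle ([m..<n - 1] @ rev [m..<n] @ lamw m) (lamw n)" by (rule wle_lamw[OF assms(1) m order.refl])
      finally show ?thesis by (rule wle_inP[OF n1 order.refl assms(3) sub])
    qed
    then show ?thesis by (rule nf_LL)
  qed
qed

lemma LL_subseq: "1 \<le> m \<Longrightarrow> v \<in> LL m \<Longrightarrow> subseq v (lamw m)"
proof (induction m arbitrary: v)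
  case (Suc m)
  show ?case
  proof (cases "m = 0")
    case True
    then show ?thesis using Suc.prems by (auto simp: lamw_1)
  next
    case False
    then have m: "1 \<le> m" by simp
    have a: "subseq (a @ u @ c) (lamw (Suc m))" if "u \<in> LL m" "a \<in> {[], [m]}" "c \<in> {[], [m]}" for a u c
    proof -
      have "subseq (a @ u @ c) ([m] @ lamw m @ [m])"
        by (intro subseq_append_mono Suc.IH m that(1)) (use that in auto)
      then show ?thesis using lamw_Suc[OF m] by simp
    qed
    show ?thesis using Suc.prems(2) a[of _ "[]" "[]"] a[of _ "[m]" "[]"] a[of _ "[]" "[m]"] a[of _ "[m]" "[m]"]
      unfolding LL_Suc[OF m] LL'_def by auto
  qed
qed simp

lemma rev_hw: "rev (hw m) = hw m" by (simp add: hw_def)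

lemma rev_inP:
  assumes "1 \<le> m" "m \<le> n" "v \<in> LL m" "red v"
  shows "inP (rev v) m"
proof (rule lamw_inP[OF assms(1,2)])
  show "red (rev v)" using assms(4) red_rev by blast
  show "subseq (rev v) (lamw m)" using subseq_rev_mono[OF LL_subseq[OF assms(1,3)]] rev_lamw by simp
qed

lemma nf_rev:
  assumes "nf u" "red u"
  shows "nf (rev u)"
proof -
  obtain c where c: "c \<in> CC" "pa c = pa u" "length c = length u" using assms(1) by (auto simp: nf_def)
  have rc: "red c" by (rule red_pa_eq[OF assms(2) CC_Wd[OF c(1)] c(2,3)])
  from c(1) have "nf (rev c)"
  proof (cases rule: CC_cases)
    case LL
    then show ?thesis using rev_inP[OF _ order.refl LL rc] n_ge_2 nf_LL by simp
  next
    case (BB m v)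
    then have "red v" using rc red_append by blast
    then show ?thesis using nf_D[OF BB(1,2) rev_inP[OF BB(1-3)]] by (simp add: BB rev_hw)
  next
    case (DD m v)
    then have "red v" using rc red_append2 by blast
    then show ?thesis using nf_B[OF DD(1,2) rev_inP[OF DD(1,2) LL'_LL[OF DD(3)]]] by (simp add: DD rev_hw)
  qed
  moreover have "pa (rev c) = pa (rev u)" using pa_rev_eq[OF CC_Wd[OF c(1)] red_Wd[OF assms(2)]] c(2) by simp
  ultimately show ?thesis using nf_cong[of "rev c" "rev u"] c(3) by simp
qed

text \<open>The cyclic word is composed of a palindrome around \<open>n\<close> and one around 0. A
  cut in the ascending run puts \<open>hw m\<close> first, a cut in the descending run puts
  \<open>lamw m\<close> first.\<close>

lemma rotations:
  "(\<exists>k. w = rotate k ([1..<n + 1] @ rev [0..<n])) \<longleftrightarrow> (\<exists>m. 1 \<le> m \<and> m \<le> n \<and> (w = hw m @ lamw m \<or> w = lamw m @ hw m))"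
proof -
  let ?W = "[1..<n + 1] @ rev [0..<n]"
  have a: "drop k ?W @ take k ?W = hw (k + 1) @ lamw (k + 1)" if "k < n" for k
  proof -
    have "[0..<n] = [0..<k + 1] @ [k + 1..<n]" using upt_split[of 0 "k + 1" n] that by simp
    then show ?thesis using that by (simp add: hw_def lamw_def del: upt_Suc) (simp add: upt_Suc_append)
  qed
  have b: "drop (n + p) ?W @ take (n + p) ?W = lamw (n - p) @ hw (n - p)" if "p < n" for p
  proof -
    have "[1..<n] = [1..<n - p] @ [n - p..<n]" using upt_split[of 1 "n - p" n] that by simp
    then show ?thesis using that
      by (simp add: hw_def lamw_def drop_rev take_rev del: upt_Suc) (simp add: upt_Suc_append)
  qed
  have l: "length ?W = 2 * n" by simp
  show ?thesis
  proof
    assume "\<exists>k. w = rotate k ?W"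
    then obtain k where k: "w = drop (k mod (2 * n)) ?W @ take (k mod (2 * n)) ?W"
      unfolding rotate_drop_take l by blast
    have "k mod (2 * n) < 2 * n" using n_ge_2 by simp
    then consider "k mod (2 * n) < n" | p where "k mod (2 * n) = n + p" "p < n"
      by (metis add_less_cancel_left le_add_diff_inverse mult_2 not_le)
    then show "\<exists>m. 1 \<le> m \<and> m \<le> n \<and> (w = hw m @ lamw m \<or> w = lamw m @ hw m)"
    proof cases
      case 1
      then show ?thesis using a[OF 1] k by (intro exI[of _ "k mod (2 * n) + 1"]) simp
    next
      case 2
      then show ?thesis using b[OF 2(2)] k by (intro exI[of _ "n - p"]) simp
    qed
  next
    assume "\<exists>m. 1 \<le> m \<and> m \<le> n \<and> (w = hw m @ lamw m \<or> w = lamw m @ hw m)"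
    then obtain m where m: "1 \<le> m" "m \<le> n" "w = hw m @ lamw m \<or> w = lamw m @ hw m" by blast
    from m(3) show "\<exists>k. w = rotate k ?W"
    proof
      assume "w = hw m @ lamw m"
      then show ?thesis using a[of "m - 1"] m(1,2) unfolding rotate_drop_take l
        by (intro exI[of _ "m - 1"]) simp
    next
      assume "w = lamw m @ hw m"
      then show ?thesis using b[of "n - m"] m(1,2) unfolding rotate_drop_take l
        by (intro exI[of _ "n + (n - m)"]) simp
    qed
  qed
qed

lemma CC_subseq:
  assumes "c \<in> CC"
  shows "\<exists>m. 1 \<le> m \<and> m \<le> n \<and> (subseq c (hw m @ lamw m) \<or> subseq c (lamw m @ hw m))"
  using assms
proof (cases rule: CC_cases)
  case LL
  have "subseq c (hw n @ lamw n)" using LL_subseq[OF _ LL] n_ge_2 by (simp add: list_emb_append2)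
  then show ?thesis using n_ge_2 by (intro exI[of _ n]) simp
next
  case (BB m u)
  then show ?thesis using LL_subseq[OF BB(1,3)] by (intro exI[of _ m]) (simp add: subseq_append_mono)
next
  case (DD m u)
  then show ?thesis using LL_subseq[OF DD(1) LL'_LL[OF DD(3)]] by (intro exI[of _ m]) (simp add: subseq_append_mono)
qed

text \<open>Both palindromes are invariant under reversal, so the rotations that begin with
  \<open>lamw m\<close> are reduced to those that begin with \<open>hw m\<close> by passing to
  inverses.\<close>

theorem Z_set_eq: "Z_set n = cls ` {c \<in> CC. red c}"
proof (intro equalityI subsetI)
  fix w assume w: "w \<in> Z_set n"
  then obtain u k where wu: "w \<in> carrier CG" "u \<in> reduced_words w" "subseq u (rotate k ([1..<n + 1] @ rev [0..<n]))"
    by (auto simp: Z_set_def)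
  obtain v where v: "red v" "w = cls v" using ex_red_cls[OF wu(1)] by blast
  have u: "red u" "pa u = pa v" using wu(2) unfolding v(2) reduced_words_cls[OF v(1)] by auto
  obtain m where m: "1 \<le> m" "m \<le> n" "subseq u (hw m @ lamw m) \<or> subseq u (lamw m @ hw m)"
    using wu(3) rotations by metis
  from m(3) have "nf u"
  proof
    assume "subseq u (lamw m @ hw m)"
    then have "subseq (rev u) (hw m @ lamw m)" using subseq_rev_mono[of u "lamw m @ hw m"] by (simp add: rev_hw rev_lamw)
    then have "nf (rev u)" using nf_rotation[OF m(1,2)] u(1) red_rev by blast
    then show ?thesis using nf_rev[of "rev u"] u(1) red_rev[of u] by simp
  qed (rule nf_rotation[OF m(1,2) u(1)])
  then obtain c where c: "c \<in> CC" "pa c = pa u" "length c = length u" by (auto simp: nf_def)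
  have "red c" by (rule red_pa_eq[OF u(1) CC_Wd[OF c(1)] c(2,3)])
  moreover have "w = cls c" using v u c cls_inject[OF CC_Wd[OF c(1)] red_Wd[OF v(1)]] by simp
  ultimately show "w \<in> cls ` {c \<in> CC. red c}" using c by blast
next
  fix w assume "w \<in> cls ` {c \<in> CC. red c}"
  then obtain c where c: "w = cls c" "c \<in> CC" "red c" by blast
  have "c \<in> reduced_words w" unfolding c(1) reduced_words_cls[OF c(3)] using c(3) by simp
  moreover have "\<exists>k. subseq c (rotate k ([1..<n + 1] @ rev [0..<n]))" using CC_subseq[OF c(2)] rotations by metis
  ultimately show "w \<in> Z_set n" using cls_carrier[OF CC_Wd[OF c(2)]] c(1) unfolding Z_set_def by blast
qed

end

text \<open>A maximal interval is determined by its minimum, and the minima are the elements without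
  a predecessor in the set.\<close>

lemma num_components_eq:
  assumes "finite S" "Supp w = S"
  shows "num_components w = card {i \<in> S. i = 0 \<or> i - 1 \<notin> S}"
proof -
  let ?I = "intervals_in S"
  let ?M = "{I \<in> ?I. \<forall>J \<in> ?I. I \<subseteq> J \<longrightarrow> J = I}"
  let ?F = "{i \<in> S. i = 0 \<or> i - 1 \<notin> S}"
  have ex: "\<exists>a b. a \<le> b \<and> I = {a..b} \<and> Min I = a" if "I \<in> ?I" for I
  proof -
    obtain a b where ab: "I = {a..b}" "I \<noteq> {}" using \<open>I \<in> ?I\<close> by (auto simp: intervals_in_def)
    then have "a \<le> b" by auto
    moreover from this have "Min I = a" unfolding ab(1) by (intro Min_eqI) auto
    ultimately show ?thesis using ab by blast
  qed
  have int: "{a..b} \<in> ?I" if "a \<le> b" "{a..b} \<subseteq> S" for a b using that by (auto simp: intervals_in_def)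
  have "bij_betw Min ?M ?F"
    unfolding bij_betw_def
  proof
    show "inj_on Min ?M"
    proof (rule inj_onI)
      fix I J assume IJ: "I \<in> ?M" "J \<in> ?M" "Min I = Min J"
      obtain a b where I: "I = {a..b}" "Min I = a" using ex[of I] IJ by blast
      obtain c d where J: "J = {c..d}" "Min J = c" using ex[of J] IJ by blast
      have "I \<subseteq> J \<or> J \<subseteq> I" using I J IJ(3) by auto
      then show "I = J" using IJ by blast
    qed
    show "Min ` ?M = ?F"
    proof (intro equalityI subsetI)
      fix x assume "x \<in> Min ` ?M"
      then obtain I where I: "I \<in> ?M" "x = Min I" by blast
      have "I \<in> ?I" using I(1) by blast
      from ex[OF this] obtain b where ab: "x \<le> b" "I = {x..b}" using I(2) by metis
      have sub: "{x..b} \<subseteq> S" using \<open>I \<in> ?I\<close> ab(2) by (simp add: intervals_in_def)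
      moreover have "x - 1 \<notin> S" if "x \<noteq> 0"
      proof
        assume "x - 1 \<in> S"
        moreover have "{x - 1..b} \<subseteq> insert (x - 1) {x..b}" by auto
        ultimately have "{x - 1..b} \<in> ?I" using sub ab(1) by (intro int) auto
        moreover have "I \<subseteq> {x - 1..b}" using ab(2) by auto
        ultimately have "{x - 1..b} = I" using I(1) by blast
        then show False using ab \<open>x \<noteq> 0\<close> atLeastatMost_subset_iff[of "x - 1" b x b] by auto
      qed
      ultimately show "x \<in> ?F" using ab(1) by auto
    next
      fix i assume i: "i \<in> ?F"
      define B where "B = {b. i \<le> b \<and> {i..b} \<subseteq> S}"
      have finB: "finite B" by (rule finite_subset[OF _ assms(1)]) (auto simp: B_def)
      have "i \<in> B" using i by (auto simp: B_def)
      then have mB: "Max B \<in> B" using finB Max_in by blast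
      then have I: "i \<le> Max B" "{i..Max B} \<subseteq> S" by (auto simp: B_def)
      have "J = {i..Max B}" if J: "J \<in> ?I" "{i..Max B} \<subseteq> J" for J
      proof -
        obtain c d where cd: "c \<le> d" "J = {c..d}" using ex[OF J(1)] by blast
        have JS: "{c..d} \<subseteq> S" using J(1) cd by (simp add: intervals_in_def)
        have c: "c \<le> i" "Max B \<le> d" using J(2) cd I(1) by auto
        have "c = i"
        proof (rule ccontr)
          assume "c \<noteq> i"
          then have "i \<noteq> 0" "i - 1 \<in> {c..d}" using c I(1) by auto
          then show False using i JS by auto
        qed
        then have "d \<in> B" using JS cd by (simp add: B_def)
        then have "d \<le> Max B" using finB by simp
        then show ?thesis using c cd \<open>c = i\<close> by simp
      qed
      then have M: "{i..Max B} \<in> ?M" using int[OF I] by blast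
      have "i = Min {i..Max B}" using I(1) by (intro Min_eqI[symmetric]) auto
      then show "i \<in> Min ` ?M" by (rule image_eqI[OF _ M])
    qed
  qed
  then have "card ?M = card ?F" by (rule bij_betw_same_card)
  then show ?thesis unfolding num_components_def assms(2) .
qed

context affine_C begin

section \<open>The words of the Schubert row\<close>

definition rhow :: "nat \<Rightarrow> nat list" where
  "rhow r = (if r \<le> n then rev [0..<r] else [2 * n + 1 - r..<n + 1] @ rev [0..<n])"

lemma rho_rhow: "rho n r = cls (rhow r)" by (simp add: rho_def rhow_def)

text \<open>A left descent would give a reduced word beginning with \<open>i\<close>, but all
  reduced words of an element have the same letters.\<close>

lemma red_new_letter:
  assumes "red u" "i \<notin> set u" "i \<le> n"
  shows "red (i # u)"
proof (rule ccontr)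
  assume "\<not> red (i # u)"
  then have "desc (pa (rev u)) i" using red_Cons_iff[OF assms(1,3)] by blast
  then obtain v where v: "red (i # v)" "pa (i # v) = pa u" using desc_exchange[OF assms(1,3)] by metis
  have "set (i # v) = set u" using beq_props[OF red_beq[OF v(1) assms(1) v(2)]] by blast
  then show False using assms(2) by auto
qed

lemma red_descending: "r \<le> n + 1 \<Longrightarrow> red (rev [0..<r])"
  by (induction r) (simp_all add: red_new_letter)

lemma pa_fix_low:
  assumes "1 \<le> k" "k < n" "\<And>i. i \<in> set u \<Longrightarrow> k < i \<and> i \<le> n"
  shows "pa u (0, int k) = (0, int k)"
  using assms(3)
proof (induction u)
  case (Cons i u)
  have "k < i" "i \<le> n" using Cons.prems by auto
  then have "act i (0, int k) = (0, int k)" using assms(1,2) by (auto simp: act_defs)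
  then show ?case using Cons by simp
qed simp

lemma pa_rise: "j \<le> n \<Longrightarrow> 1 \<le> j \<Longrightarrow> pa (rev [j..<n + 1]) (0, int j) = (0, int n + 1)"
proof (induction rule: inc_induct)
  case base
  then show ?case by (simp add: act_defs)
next
  case (step j)
  then show ?case using act_up[of j] by (simp add: upt_conv_Cons[of j] pa_append add.commute del: upt_Suc)
qed

lemma pa_to_neg: "1 \<le> j \<Longrightarrow> j \<le> n \<Longrightarrow> pa [0..<j] (0, int j) = (- 1, 2 * int n)"
proof (induction j)
  case (Suc j)
  show ?case
  proof (cases "j = 0")
    case True
    then show ?thesis using n_int by (simp add: act_defs)
  next
    case False
    then show ?thesis using Suc act_down[of j] by (simp add: pa_append add.commute)
  qed
qed simp

text \<open>Letters are put in front, downwards from \<open>n\<close>. The inverse of the word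
  reached so far keeps \<open>k\<close> in block 0 and sends \<open>k + 1\<close> to the integer
  \<open>2n + 1\<close> in block 1, so \<open>k\<close> is no left descent.\<close>

lemma red_ascending_descending: "k \<le> n \<Longrightarrow> 1 \<le> k \<Longrightarrow> red ([k..<n + 1] @ rev [0..<n])"
proof (induction rule: inc_induct)
  case base
  then show ?case using red_descending[of "n + 1"] by simp
next
  case (step k)
  let ?x = "[Suc k..<n + 1] @ rev [0..<n]"
  have k: "1 \<le> k" "k < n" using step by auto
  have up: "[0..<n] = [0..<k] @ k # [Suc k..<n]" using k upt_split[of 0 k n] upt_conv_Cons[of k n] by simp
  have "pa (rev [Suc k..<n + 1]) (0, int k) = (0, int k)" "pa [Suc k..<n] (0, int k) = (0, int k)"
    by (rule pa_fix_low[OF k]; auto)+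
  moreover have "pa [0..<k] (0, int k + 1) = (0, int k + 1)"
    using pa_fix[of "[0..<k]" k "Suc k"] k by (auto simp: add.commute atLeast0LessThan)
  ultimately have x: "pa (rev ?x) (0, int k) = (0, int k + 1)"
    using act_up[OF k] unfolding up by (simp add: pa_append)
  have W: "[0..<n] \<in> Wd" by auto
  have r: "rv (0, int n) = (0, int n + 1)" by (simp add: rv_def)
  have "pa [0..<n] (0, int n + 1) = rv (pa [0..<n] (0, int n))"
    using pa_rv[OF W, of "(0, int n)"] r by simp
  also have "\<dots> = (1, 1)" using pa_to_neg[of n] n_ge_2 by (simp add: rv_def)
  finally have "pa [0..<n] (0, int n + 1) = (1, 1)" .
  then have y: "pa (rev ?x) (0, int k + 1) = (1, 1)"
    using pa_rise[of "Suc k"] k by (simp add: pa_append add.commute del: upt_Suc)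
  have "xe k = (0, int k)" "ye k = (0, int k + 1)" using k by (auto simp: xe_def ye_def)
  then have "\<not> desc (pa (rev ?x)) k" using x y by (simp add: desc_def slt_def del: rev_append upt_Suc)
  moreover have "red ?x" using step by simp
  ultimately have "red (k # ?x)" using red_Cons_iff[of ?x k] k by auto
  then show ?case using k by (simp add: upt_conv_Cons[of k] del: upt_Suc)
qed

lemma red_rhow: "r \<le> 2 * n \<Longrightarrow> red (rhow r)"
  using red_descending[of r] red_ascending_descending[of "2 * n + 1 - r"] by (auto simp: rhow_def simp del: upt_Suc)

lemma length_rhow: "r \<le> 2 * n \<Longrightarrow> length (rhow r) = r" by (auto simp: rhow_def)

lemma hw_descending: "m \<le> n \<Longrightarrow> hw m @ rev [0..<m] = [m..<n + 1] @ rev [0..<n]"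
  using upt_split[of 0 m n] by (simp add: hw_def)

lemma descending_LL: "rev [0..<m] \<in> LL m"
proof (induction m)
  case (Suc m)
  then show ?case by (cases "m = 0") auto
qed simp

lemma rhow_CC: "1 \<le> r \<Longrightarrow> r \<le> 2 * n \<Longrightarrow> rhow r \<in> CC"
proof (cases "r \<le> n")
  case True
  assume "1 \<le> r"
  then show ?thesis using True LL_mono[of r n] descending_LL[of r] by (auto simp: rhow_def CC_def)
next
  case False
  assume r: "1 \<le> r" "r \<le> 2 * n"
  let ?m = "2 * n + 1 - r"
  have "rhow r = hw ?m @ rev [0..<?m]" using False r hw_descending[of ?m] by (simp add: rhow_def)
  then have "rhow r \<in> BB ?m" using descending_LL[of ?m] unfolding BB_def by (metis imageI)
  moreover have "?m \<in> {1..n}" using False r by auto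
  ultimately show ?thesis unfolding CC_def by blast
qed

lemma wt_rhow: "1 \<le> r \<Longrightarrow> r \<le> 2 * n \<Longrightarrow> wt (set (rhow r)) = 1"
proof -
  assume r: "1 \<le> r" "r \<le> 2 * n"
  have "{i. i < k \<and> (i = 0 \<or> \<not> i - 1 < k)} = {0}" if "1 \<le> k" for k :: nat using that by auto
  then have w: "wt {0..<k} = 1" if "1 \<le> k" for k using that by (simp add: wt_def)
  show ?thesis
  proof (cases "r \<le> n")
    case True
    then show ?thesis using w r by (simp add: rhow_def)
  next
    case False
    then have "set (rhow r) = {0..<n + 1}" using r by (auto simp: rhow_def)
    then show ?thesis using w[of "n + 1"] by simp
  qed
qed

definition nG :: "nat list \<Rightarrow> bool" where
  "nG u \<longleftrightarrow> (\<exists>x i. 1 \<le> i \<and> red (x @ [i]) \<and> pa (x @ [i]) = pa u)"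

lemma nG_cls:
  assumes "nG u" "u \<in> Wd"
  shows "cls u \<notin> grassmannian n"
proof -
  obtain x i where x: "1 \<le> i" "red (x @ [i])" "pa (x @ [i]) = pa u" using assms(1) by (auto simp: nG_def)
  then have "cls u = cls (x @ [i])" using cls_inject[OF assms(2) red_Wd[OF x(2)]] by simp
  then show ?thesis using not_grassmannian[OF x(2,1)] by simp
qed

lemma nG_last: "red u \<Longrightarrow> red (x @ [i]) \<or> length (x @ [i]) = length u \<and> x @ [i] \<in> Wd \<Longrightarrow> pa (x @ [i]) = pa u \<Longrightarrow> 1 \<le> i \<Longrightarrow> nG u"
  unfolding nG_def using red_pa_eq[of u "x @ [i]"] by blast

lemma nG_append:
  assumes "nG v" "red (w @ v)"
  shows "nG (w @ v)"
proof -
  obtain x i where x: "1 \<le> i" "red (x @ [i])" "pa (x @ [i]) = pa v" using assms(1) by (auto simp: nG_def)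
  have l: "length (x @ [i]) = length v" by (rule red_length_eq[OF x(2) red_append[OF assms(2)] x(3)])
  have W: "w @ x @ [i] \<in> Wd" using red_Wd[OF assms(2)] red_Wd[OF x(2)] by auto
  show ?thesis
    by (rule nG_last[OF assms(2), of "w @ x" i]) (use l W x in \<open>simp_all add: pa_append\<close>)
qed

text \<open>A normal form with \<open>m\<close> on the right ends in a positive letter. One with
  \<open>m\<close> on the left only inherits such an ending from the rest, or its rest is a
  descending word; unless that word starts with \<open>m - 1\<close>, the letter \<open>m\<close>
  commutes to the end.\<close>

lemma LL_nG: "1 \<le> m \<Longrightarrow> m \<le> n \<Longrightarrow> u \<in> LL m \<Longrightarrow> red u \<Longrightarrow> (\<exists>j\<le>m. u = rev [0..<j]) \<or> nG u"
proof (induction m arbitrary: u)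
  case (Suc m)
  show ?case
  proof (cases "m = 0")
    case True
    then have "u = rev [0..<0] \<or> u = rev [0..<1]" using Suc.prems by auto
    then show ?thesis by (metis One_nat_def Suc.prems(1) le0)
  next
    case False
    then have m: "1 \<le> m" "m \<le> n" using Suc.prems by auto
    consider "u \<in> LL m" | v where "v \<in> LL m" "u = m # v" | v where "v \<in> LL' m" "u = v @ [m]" | v where "v \<in> LL' m" "u = (m # v) @ [m]"
      using Suc.prems(3) unfolding LL_Suc[OF m(1)] by auto
    then show ?thesis
    proof cases
      case 1
      then show ?thesis using Suc.IH[OF m _ Suc.prems(4)] le_SucI by blast
    next
      case 2
      have rv: "red v" using Suc.prems(4) 2 red_Cons by blast
      from Suc.IH[OF m 2(1) rv] show ?thesis
      proof
        assume "\<exists>j\<le>m. v = rev [0..<j]"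
        then obtain j where j: "j \<le> m" "v = rev [0..<j]" by blast
        show ?thesis
        proof (cases "j = m")
          case True
          then have "u = rev [0..<Suc m]" using j 2 by simp
          then show ?thesis by blast
        next
          case False
          then have "m - 1 \<notin> set v" using j m by auto
          then have "pa (v @ [m]) = pa u"
            using pa_far[OF far_LL[OF 2(1)], of "[m]"] red_Wd[OF rv] m 2(2) by simp
          then show ?thesis using nG_last[OF Suc.prems(4), of v m] red_Wd[OF Suc.prems(4)] m 2(2) by simp
        qed
      next
        assume "nG v"
        then show ?thesis using nG_append[of v "[m]"] Suc.prems(4) 2 by simp
      qed
    next
      case 3
      then show ?thesis using nG_last[OF Suc.prems(4), of v m] Suc.prems(4) m by simp
    next
      case 4
      then show ?thesis using nG_last[OF Suc.prems(4), of "m # v" m] Suc.prems(4) m by simp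
    qed
  qed
qed simp

text \<open>If \<open>u\<close> in \<open>hw m @ u\<close> is a descending word without
  \<open>m - 1\<close>, it commutes with the palindrome, whose last letter \<open>m\<close> then
  comes to the end.\<close>

lemma CC_nG:
  assumes "c \<in> CC" "red c"
  shows "c = rhow (length c) \<or> nG c"
  using assms(1)
proof (cases rule: CC_cases)
  case LL
  then have "(\<exists>j\<le>n. c = rev [0..<j]) \<or> nG c" using LL_nG[OF _ order.refl] assms(2) n_ge_2 by auto
  then show ?thesis by (auto simp: rhow_def)
next
  case (BB m u)
  have ru: "red u" using assms(2) red_append unfolding BB(4) by blast
  from LL_nG[OF BB(1-3) ru] show ?thesis
  proof
    assume "\<exists>j\<le>m. u = rev [0..<j]"
    then obtain j where j: "j \<le> m" "u = rev [0..<j]" by blast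
    show ?thesis
    proof (cases "j = m")
      case True
      have "c = [m..<n + 1] @ rev [0..<n]" using BB(4) j(2) True hw_descending[OF BB(2)] by simp
      then show ?thesis using BB(1,2) by (auto simp: rhow_def simp del: upt_Suc)
    next
      case False
      then have nin: "m - 1 \<notin> set u" using j BB(1) by auto
      have "far u (hw m)" by (rule far_LL[OF BB(3) nin]) (use hw_set[OF BB(2)] in auto)
      from pa_far[OF this red_Wd[OF ru] hw_Wd[OF BB(2)]]
      have e: "pa (u @ hw m) = pa c" unfolding BB(4) .
      have "hw m \<noteq> [] \<and> last (hw m) = m" using BB(2) by (cases "m = n") (auto simp: hw_n hw_step)
      then obtain y where y: "hw m = y @ [m]" by (metis append_butlast_last_id)
      show ?thesis using nG_last[OF assms(2), of "u @ y" m] e red_Wd[OF assms(2)] BB(1) unfolding y BB(4) by auto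
    qed
  next
    assume "nG u"
    then show ?thesis using nG_append[of u "hw m"] assms(2) BB(4) by simp
  qed
next
  case (DD m u)
  have "hw m \<noteq> [] \<and> last (hw m) = m" using DD(2) by (cases "m = n") (auto simp: hw_n hw_step)
  then obtain y where y: "hw m = y @ [m]" by (metis append_butlast_last_id)
  then show ?thesis using nG_last[OF assms(2), of "u @ y" m] DD assms(2) by simp
qed

section \<open>The Schubert row\<close>

definition lin :: "nat list set set \<Rightarrow> (nat list set \<Rightarrow> int) \<Rightarrow> gen word \<Rightarrow>\<^sub>0 int" where
  "lin U k = (\<Sum>u\<in>U. of_int (k u) * aw (rw (hof u)))"

lemma aw_hof_FC: "u \<in> carrier CG \<Longrightarrow> aw (rw (hof u)) \<in> FC G0"
  by (rule aw_FC0[OF rw_Wd[OF hof_GG]])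

lemma lin_FC: "U \<subseteq> carrier CG \<Longrightarrow> lin U k \<in> FC G0"
  unfolding lin_def by (intro FC_sum FC_mult FC_of_int aw_hof_FC) auto

lemma lin_finsum:
  assumes "finite U" "U \<subseteq> carrier CG"
  shows "(\<Oplus>\<^bsub>nilCoxeter n\<^esub> u \<in> U. [k u] \<cdot>\<^bsub>nilCoxeter n\<^esub> nilA n u) = C.cl (lin U k)"
proof -
  have W: "aw (rw (hof u)) \<in> FC G0" if "u \<in> U" for u using aw_hof_FC assms(2) that by blast
  have "(\<Oplus>\<^bsub>nilCoxeter n\<^esub> u \<in> U. [k u] \<cdot>\<^bsub>nilCoxeter n\<^esub> nilA n u)
      = (\<Oplus>\<^bsub>C.Q\<^esub> u \<in> U. C.cl (of_int (k u) * aw (rw (hof u))))"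
    unfolding nilCoxeter_Q
    by (rule C.Q.finsum_cong'[OF HOL.refl])
      (use W assms(2) in \<open>auto simp: nilA_eq C.cl_pow Pi_def intro!: C.cl_closed FC_mult\<close>)
  also have "\<dots> = C.cl (lin U k)"
    unfolding lin_def by (rule C.cl_sum[OF assms(1)]) (use W in \<open>auto intro!: FC_mult\<close>)
  finally show ?thesis .
qed

lemma vec_lin: "U \<subseteq> carrier CG \<Longrightarrow> vec (lin U k) = (\<Sum>u\<in>U. app (of_int (k u)) (bas (hof u)))"
  unfolding lin_def vec_sum by (rule sum.cong) (auto simp: vec_mult vec_aw_rw hof_GG)

lemma keys_vec_lin: "U \<subseteq> carrier CG \<Longrightarrow> Poly_Mapping.keys (vec (lin U k)) \<subseteq> hof ` U"
proof
  fix h assume U: "U \<subseteq> carrier CG" and h: "h \<in> Poly_Mapping.keys (vec (lin U k))"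
  show "h \<in> hof ` U"
  proof (rule ccontr)
    assume "h \<notin> hof ` U"
    then have "Poly_Mapping.lookup (vec (lin U k)) h = 0"
      unfolding vec_lin[OF U] lookup_sum
      by (intro sum.neutral) (auto simp: lookup_of_int_endo bas_def lookup_single when_def)
    then show False using h by (simp add: in_keys_iff)
  qed
qed

text \<open>The common term \<open>A_w\<close> cancels in the difference of two candidates, which
  thus lies in the algebra without Grassmannian terms and vanishes by
  \<open>fomin_stanley_unique\<close>.\<close>

lemma schubert_unique:
  assumes w: "w \<in> carrier CG"
    and a: "a \<in> fomin_stanley n" "b \<in> non_grassmannian_span n" "a = nilA n w \<oplus>\<^bsub>nilCoxeter n\<^esub> b"
    and a': "a' \<in> fomin_stanley n" "b' \<in> non_grassmannian_span n" "a' = nilA n w \<oplus>\<^bsub>nilCoxeter n\<^esub> b'"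
  shows "a = a'"
proof -
  obtain U k where U: "finite U" "U \<subseteq> carrier CG - grassmannian n" "b = C.cl (lin U k)"
    using a(2) lin_finsum by (auto simp: non_grassmannian_span_def) blast
  obtain U' k' where U': "finite U'" "U' \<subseteq> carrier CG - grassmannian n" "b' = C.cl (lin U' k')"
    using a'(2) lin_finsum by (auto simp: non_grassmannian_span_def) blast
  let ?x = "aw (rw (hof w))" and ?p = "lin U k" and ?p' = "lin U' k'"
  have xF: "?x \<in> FC G0" by (rule aw_hof_FC[OF w])
  have UC: "U \<subseteq> carrier CG" "U' \<subseteq> carrier CG" using U U' by auto
  have pF: "?p \<in> FC G0" "?p' \<in> FC G0" using lin_FC UC by auto
  have ap: "a = C.cl (?x + ?p)" "a' = C.cl (?x + ?p')"
    unfolding a(3) a'(3) U(3) U'(3) nilA_eq[OF w] nilCoxeter_Q using C.cl_add[OF xF] pF by auto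
  have sF: "?x + ?p \<in> FC G0" "?x + ?p' \<in> FC G0" "?p - ?p' \<in> FC G0"
    using xF pF FC_add FC_diff by blast+
  have "C.cl (?p - ?p') \<in> fomin_stanley n"
  proof (rule fomin_stanley_criterion[OF sF(3)])
    fix j assume j: "1 \<le> j" "j \<le> n"
    have "?p - ?p' = (?x + ?p) - (?x + ?p')" by simp
    then have "ev (?p - ?p') = ev (?x + ?p) - ev (?x + ?p')" by (simp only: ev_diff)
    then have "app (ev (?p - ?p')) y + app (ev (?x + ?p')) y = app (ev (?x + ?p)) y" for y
      by (simp add: app_plus[symmetric])
    then have "eval0 (Poly_Mapping.lookup (app (ev (?p - ?p')) y) h) + eval0 (Poly_Mapping.lookup (app (ev (?x + ?p')) y) h)
        = eval0 (Poly_Mapping.lookup (app (ev (?x + ?p)) y) h)" for y h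
      by (metis eval0_add lookup_add)
    then show "vanish (app (ev (?p - ?p')) (app (ep j) (bas id)))"
      using fomin_stanley_vanish[OF sF(1) _ j] fomin_stanley_vanish[OF sF(2) _ j] a(1) a'(1)
      unfolding ap vanish_def by (metis add.right_neutral)
  qed
  moreover have "cof h \<notin> grassmannian n" if h: "h \<in> Poly_Mapping.keys (vec (?p - ?p'))" for h
  proof -
    have "vec ?p = vec (?p - ?p') + vec ?p'" by (simp add: vec_add[symmetric])
    then have "Poly_Mapping.lookup (vec ?p) h = Poly_Mapping.lookup (vec (?p - ?p')) h + Poly_Mapping.lookup (vec ?p') h"
      by (metis lookup_add)
    then have "h \<in> Poly_Mapping.keys (vec ?p) \<or> h \<in> Poly_Mapping.keys (vec ?p')"
      using h by (auto simp: in_keys_iff)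
    then obtain u where "u \<in> U \<union> U'" "h = hof u" using keys_vec_lin[OF UC(1)] keys_vec_lin[OF UC(2)] by blast
    then show ?thesis using U(2) U'(2) cof_hof[of u] by auto
  qed
  ultimately have "vec (?p - ?p') = 0" by (rule fomin_stanley_unique[OF sF(3)])
  then have "vec ?p = vec ?p'" using vec_add[of "?p - ?p'" ?p'] by simp
  then show ?thesis unfolding ap using C_cl_iff[OF sF(1,2)] by (simp add: vec_add)
qed

definition CCr :: "nat \<Rightarrow> nat list set" where "CCr r = {c \<in> CC. red c \<and> length c = r}"

lemma CCr_finite: "finite (CCr r)" using CC_finite by (simp add: CCr_def)

lemma Z_len_eq: "Z_len n r = cls ` CCr r"
  unfolding Z_len_def Z_set_eq CCr_def by (auto simp: len_cls)

lemma cls_inj_CCr: "inj_on cls (CCr r)"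
proof (rule inj_onI)
  fix c d assume c: "c \<in> CCr r" and d: "d \<in> CCr r" and e: "cls c = cls d"
  have CC: "c \<in> CC" "d \<in> CC" using c d by (simp_all add: CCr_def)
  then have "pa c = pa d" using e cls_inject[OF CC_Wd CC_Wd] by blast
  then show "c = d" by (rule CC_inj[OF CC])
qed

lemma num_components_cls: "red c \<Longrightarrow> num_components (cls c) = wt (set c)"
  unfolding wt_def by (rule num_components_eq) (simp_all add: Supp_cls)

lemma D_zero:
  assumes "u \<in> Wd" "\<not> red u" "1 \<le> j" "j \<le> n"
  shows "D u j v = 0"
proof -
  have "opW u = 0" using ev_eqv[OF C_eqv_H[OF aw_not_red[OF assms(1,2)]]] by (simp add: ev_of_int[of 0, simplified])
  then show ?thesis using D_eq[OF assms(1,3,4), of v] lookup_of_int_endo[of 0] by (simp add: eval0_of_int[of 0, simplified])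
qed

lemma D_length:
  assumes "D u j v \<noteq> 0"
  shows "\<exists>y. red y \<and> pa (rev y) = v \<and> length u = Suc (length y)"
proof -
  obtain i where i: "i < length u" "red (take i u @ drop (Suc i) u)" "pa (rev (take i u @ drop (Suc i) u)) = v"
    using assms unfolding D_def by (auto elim!: sum.not_neutral_contains_not_neutral split: if_splits simp del: rev_append)
  then show ?thesis by (intro exI[of _ "take i u @ drop (Suc i) u"]) (simp del: rev_append)
qed

lemma wt_pos: "finite S \<Longrightarrow> S \<noteq> {} \<Longrightarrow> 1 \<le> wt S"
proof -
  assume S: "finite S" "S \<noteq> {}"
  have "Min S \<in> {i \<in> S. i = 0 \<or> i - 1 \<notin> S}"
  proof -
    have "Min S - 1 \<notin> S" if "Min S \<noteq> 0"
    proof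
      assume "Min S - 1 \<in> S"
      then have "Min S \<le> Min S - 1" using S by simp
      then show False using that by simp
    qed
    then show ?thesis using Min_in[OF S] by blast
  qed
  then have "card {i \<in> S. i = 0 \<or> i - 1 \<notin> S} > 0" using S(1) by (subst card_gt_0_iff) auto
  then show ?thesis by (simp add: wt_def)
qed

lemma CC_D_sum:
  assumes "1 \<le> j" "j \<le> n"
  shows "(\<Sum>u\<in>CC. 2 ^ wt (set u) * D u j v) = 0"
proof -
  have "vanish (app (M2 * ep j) (bas id))" by (rule vanish_II[OF M2_ep[OF assms]])
  moreover have "app (M2 * ep j) (bas id) = (\<Sum>u\<in>CC. app (of_int (2 ^ wt (set u))) (app (opW u) (app (ep j) (bas id))))"
    unfolding M2_sum by (simp add: sum_distrib_right app_sum_l app_times)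
  ultimately show ?thesis
    using D_eq[OF CC_Wd assms] by (simp add: vanish_def lookup_sum eval0_sum lookup_of_int_endo eval0_mult del: of_int_power)
qed

text \<open>Deletion lowers the length by one, so for a given \<open>v\<close> only the words of one
  length contribute and the relation for \<open>M\<close> splits into homogeneous parts. A nonempty
  word has weight at least 1, so the common factor 2 cancels in the integers.\<close>

lemma CCr_D_sum:
  assumes "1 \<le> j" "j \<le> n" "1 \<le> r"
  shows "(\<Sum>u\<in>CCr r. 2 ^ (wt (set u) - 1) * D u j v) = 0"
proof (cases "\<exists>y. red y \<and> pa (rev y) = v \<and> r = Suc (length y)")
  case True
  then obtain y where y: "red y" "pa (rev y) = v" "r = Suc (length y)" by blast
  have "D u j v = 0" if u: "u \<in> CC - CCr r" for u
  proof (rule ccontr)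
    assume nz: "D u j v \<noteq> 0"
    then have ru: "red u" using D_zero[OF CC_Wd _ assms(1,2)] u by blast
    obtain x where x: "red x" "pa (rev x) = v" "length u = Suc (length x)" using D_length[OF nz] by blast
    have "pa x = pa y" using pa_rev_eq[OF red_Wd[OF x(1)] red_Wd[OF y(1)]] x(2) y(2) by simp
    then have "length x = length y" by (rule red_length_eq[OF x(1) y(1)])
    then show False using u ru x(3) y(3) by (simp add: CCr_def)
  qed
  then have "(\<Sum>u\<in>CCr r. 2 ^ wt (set u) * D u j v) = 0"
    using sum.mono_neutral_right[OF CC_finite, of "CCr r" "\<lambda>u. 2 ^ wt (set u) * D u j v"] CC_D_sum[OF assms(1,2), of v]
    by (auto simp: CCr_def)
  moreover have "(\<Sum>u\<in>CCr r. 2 ^ wt (set u) * D u j v) = (\<Sum>u\<in>CCr r. 2 * (2 ^ (wt (set u) - 1) * D u j v))"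
  proof (rule sum.cong)
    fix u assume u: "u \<in> CCr r"
    then have "u \<noteq> []" using assms(3) by (auto simp: CCr_def)
    then have "1 \<le> wt (set u)" by (intro wt_pos) auto
    then have "(2 :: int) ^ wt (set u) = 2 * 2 ^ (wt (set u) - 1)" by (simp flip: power_Suc)
    then show "2 ^ wt (set u) * D u j v = 2 * (2 ^ (wt (set u) - 1) * D u j v)" by simp
  qed simp
  ultimately show ?thesis by (simp flip: sum_distrib_left)
next
  case False
  then have "D u j v = 0" if "u \<in> CCr r" for u using D_length[of u j v] that by (auto simp: CCr_def)
  then show ?thesis by simp
qed

theorem schubert_row_eq:
  assumes r: "1 \<le> r" "r \<le> 2 * n"
  shows "schubert_row n r = (\<Oplus>\<^bsub>nilCoxeter n\<^esub> w \<in> Z_len n r.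
      [((2 :: int) ^ (num_components w - 1))] \<cdot>\<^bsub>nilCoxeter n\<^esub> nilA n w)" (is "_ = ?A")
proof -
  let ?Z = "Z_len n r"
  let ?k = "\<lambda>w. (2 :: int) ^ (num_components w - 1)"
  let ?w = "rho n r"
  have rc: "red c" "c \<in> CC" "c \<in> Wd" if "c \<in> CCr r" for c using that CC_Wd by (auto simp: CCr_def)
  have Z: "finite ?Z" "?Z \<subseteq> carrier CG"
    using CCr_finite rc(3) cls_carrier by (auto simp: Z_len_eq)
  have A: "?A = C.cl (lin ?Z ?k)" by (rule lin_finsum[OF Z])
  have wZ: "?w \<in> ?Z"
    unfolding Z_len_eq rho_rhow using rhow_CC[OF r] red_rhow[OF r(2)] length_rhow[OF r(2)] by (auto simp: CCr_def)
  then have w: "?w \<in> carrier CG" using Z by blast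
  \<comment> \<open>The support of \<open>\<rho>_r\<close> is one interval, so its coefficient is 1,
    as the characterization of the Schubert class demands.\<close>
  have kw: "?k ?w = 1" unfolding rho_rhow num_components_cls[OF red_rhow[OF r(2)]] wt_rhow[OF r] by simp
  have fs: "?A \<in> fomin_stanley n"
    unfolding A
  proof (rule fomin_stanley_criterion[OF lin_FC[OF Z(2)]])
    fix j assume j: "1 \<le> j" "j \<le> n"
    have "opW (rw (hof (cls c))) = opW c" if "c \<in> CCr r" for c
    proof -
      have "C.eqv (aw c) (aw (rw (hof (cls c))))" using aw_rw[OF rc(1)[OF that]] hof_cls[OF rc(3)[OF that]] by simp
      from ev_eqv[OF C_eqv_H[OF this]] show ?thesis by simp
    qed
    then have "ev (lin ?Z ?k) = (\<Sum>c\<in>CCr r. of_int (2 ^ (wt (set c) - 1)) * opW c)"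
      unfolding lin_def Z_len_eq sum.reindex[OF cls_inj_CCr] ev_sum
      by (intro sum.cong) (auto simp: ev_mult num_components_cls rc(1) simp del: of_int_power)
    then have "app (ev (lin ?Z ?k)) (app (ep j) (bas id))
        = (\<Sum>c\<in>CCr r. app (of_int (2 ^ (wt (set c) - 1))) (app (opW c) (app (ep j) (bas id))))"
      by (simp add: app_sum_l app_times del: of_int_power)
    then have "eval0 (Poly_Mapping.lookup (app (ev (lin ?Z ?k)) (app (ep j) (bas id))) v) = 0" for v
      using D_eq[OF rc(3) j] CCr_D_sum[OF j r(1), of v]
      by (simp add: lookup_sum eval0_sum lookup_of_int_endo eval0_mult del: of_int_power)
    then show "vanish (app (ev (lin ?Z ?k)) (app (ep j) (bas id)))" by (simp add: vanish_def)
  qed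
  define b where "b = C.cl (lin (?Z - {?w}) ?k)"
  have Zw: "finite (?Z - {?w})" "?Z - {?w} \<subseteq> carrier CG" using Z by auto
  have "u \<notin> grassmannian n" if u: "u \<in> ?Z - {?w}" for u
  proof -
    obtain c where c: "c \<in> CCr r" "u = cls c" using u by (auto simp: Z_len_eq)
    have "c \<noteq> rhow (length c)" using c u by (auto simp: CCr_def rho_rhow)
    then have "nG c" using CC_nG[of c] rc[OF c(1)] by blast
    then show ?thesis using nG_cls rc(3)[OF c(1)] c(2) by blast
  qed
  then have "?Z - {?w} \<subseteq> carrier CG - grassmannian n" using Zw by blast
  then have b: "b \<in> non_grassmannian_span n"
    unfolding non_grassmannian_span_def b_def
    by (intro CollectI exI conjI) (rule lin_finsum[OF Zw, symmetric], rule Zw(1))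
  have "lin ?Z ?k = aw (rw (hof ?w)) + lin (?Z - {?w}) ?k"
    unfolding lin_def sum.remove[OF Z(1) wZ] kw by simp
  moreover have "nilA n ?w \<oplus>\<^bsub>nilCoxeter n\<^esub> b = C.cl (aw (rw (hof ?w)) + lin (?Z - {?w}) ?k)"
    unfolding b_def nilA_eq[OF w] nilCoxeter_Q by (rule C.cl_add[OF aw_hof_FC[OF w] lin_FC[OF Zw(2)]])
  ultimately have Ab: "?A = nilA n ?w \<oplus>\<^bsub>nilCoxeter n\<^esub> b" using A by simp
  show ?thesis
    unfolding schubert_row_def schubert_def
  proof (rule the_equality)
    show "?A \<in> fomin_stanley n \<and> (\<exists>b\<in>non_grassmannian_span n. ?A = nilA n ?w \<oplus>\<^bsub>nilCoxeter n\<^esub> b)"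
      using fs b Ab by blast
    fix a assume "a \<in> fomin_stanley n \<and> (\<exists>b\<in>non_grassmannian_span n. a = nilA n ?w \<oplus>\<^bsub>nilCoxeter n\<^esub> b)"
    then obtain b' where "a \<in> fomin_stanley n" "b' \<in> non_grassmannian_span n" "a = nilA n ?w \<oplus>\<^bsub>nilCoxeter n\<^esub> b'" by blast
    then show "a = ?A" by (rule schubert_unique[OF w _ _ _ fs b Ab])
  qed
qed

end

theorem theorem5p1:
  fixes n r :: nat
  assumes "2 \<le> n" and "1 \<le> r" and "r \<le> 2 * n"
  shows "schubert_row n r =
    (\<Oplus>\<^bsub>nilCoxeter n\<^esub> w \<in> Z_len n r.
       [((2 :: int) ^ (num_components w - 1))] \<cdot>\<^bsub>nilCoxeter n\<^esub> nilA n w)"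
proof -
  interpret affine_C n by (rule affine_C.intro) (rule assms(1))
  show ?thesis by (rule schubert_row_eq[OF assms(2,3)])
qed

end
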